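(* Let $R$ be an $A$-algebra and $x=x_1,\dots,x_n$ an $n$-tuple of elements of $R$, with associated ring extension $\mathcal A\subseteq\mathcal R$. Let $B\to E$ be an étale extension (ring homomorphism) of $A$-algebras, and let $f:R\to E$ be an $A$-algebra homomorphism. Assume that the elements $f(x_1),\dots,f(x_n)$ form a $B$-module basis of $E$. Then there is a unique $A$-algebra homomorphism $$\mathfrak n_{E/B}:\mathcal A\to B$$ such that $\mathcal R\otimes_{\mathcal A}B=E$ as quotients of $R\otimes_AB$. The homomorphism $\mathfrak n_{E/B}$ is determined by sending the polarized power sum $\mathfrak p(z)=\varphi_1(z)+\cdots+\varphi_n(z)$ to $\mathrm{Tr}_B(e\mapsto f(z)e)$, the trace of the $B$-linear multiplication map by $f(z)$ on $E$, for every $z\in R$.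
   Context: All rings are commutative with unit; $n\ge1$. $\mathrm T^n_AR=R\otimes_A\cdots\otimes_AR$ ($n$ factors), and $\varphi_p:R\to\mathrm T^n_AR$ is the co-projection on the $p$-th factor. The symmetric group $\mathfrak S_n$ permutes the factors; $\mathrm{TS}^n_AR=(\mathrm T^n_AR)^{\mathfrak S_n}$, and $\mathrm{TS}^{n-1,1}_AR=(\mathrm T^n_AR)^{\mathfrak S_{n-1}}$, where $\mathfrak S_{n-1}$ permutes the first $n-1$ factors. The alternating tensor is $\alpha(x)=\sum_{\sigma\in\mathfrak S_n}(-1)^{|\sigma|}x_{\sigma(1)}\otimes\cdots\otimes x_{\sigma(n)}\in\mathrm T^n_AR$; its square $\alpha^2(x)$ lies in $\mathrm{TS}^n_AR$. Set $\mathcal A=\mathrm{TS}^n_AR[\alpha^2(x)^{-1}]$ and $\mathcal R=\mathrm{TS}^{n-1,1}_AR[\alpha^2(x)^{-1}]$ (localization at the element $\alpha^2(x)$). $\mathcal R$ is an $R$-algebra via $\varphi_n:R\to\mathcal R$. For an $A$-algebra homomorphism $\mathcal A\to B$, $\mathcal R\otimes_{\mathcal A}B$ is an algebra over $R\otimes_AB$ via $\varphi_n$, and $E$ is an $R\otimes_AB$-algebra via $f$; the equality as quotients means that both are quotients of $R\otimes_AB$ with the same kernel. *)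

theory Defs
  imports "HOL-Algebra.Algebra" "HOL-Combinatorics.Permutations"
begin

text \<open>
  Rings are objects of the locale \<^locale>\<open>cring\<close> (the zero ring is allowed). An \<open>A\<close>-algebra is a
  commutative ring \<open>R\<close> together with its structure homomorphism \<open>i\<close> from \<open>A\<close> to \<open>R\<close>, that is,
  \<open>ring_hom_cring A R i\<close>.
\<close>

definition alg_hom ::
  "('a, 'k) ring_scheme \<Rightarrow> ('r, 'l) ring_scheme \<Rightarrow> ('a \<Rightarrow> 'r) \<Rightarrow> ('s, 'm) ring_scheme \<Rightarrow> ('a \<Rightarrow> 's)
    \<Rightarrow> ('r \<Rightarrow> 's) set"
  where "alg_hom A R i S j = {h \<in> ring_hom R S. \<forall>a \<in> carrier A. h (i a) = j a}"

definition alg_module :: "('r, 'k) ring_scheme \<Rightarrow> ('a \<Rightarrow> 'r) \<Rightarrow> ('a, 'r) module"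
  where "alg_module R i =
    \<lparr>carrier = carrier R, monoid.mult = (\<otimes>\<^bsub>R\<^esub>), one = \<one>\<^bsub>R\<^esub>, ring.zero = \<zero>\<^bsub>R\<^esub>, add = (\<oplus>\<^bsub>R\<^esub>),
     smult = (\<lambda>a r. i a \<otimes>\<^bsub>R\<^esub> r)\<rparr>"


section \<open>Free modules and monoid algebras\<close>

text \<open>
  The free \<open>A\<close>-module on a set \<open>Z\<close>: finitely supported functions, vanishing off \<open>Z\<close>. It carries
  no multiplication, so those two record fields are left unspecified.
\<close>

definition free_module :: "('a, 'k) ring_scheme \<Rightarrow> 'x set \<Rightarrow> ('a, 'x \<Rightarrow> 'a) module"
  where "free_module A Z =
    \<lparr>carrier = {u. (\<forall>y. u y \<in> carrier A) \<and> finite {y. u y \<noteq> \<zero>\<^bsub>A\<^esub>} \<and> (\<forall>y. y \<notin> Z \<longrightarrow> u y = \<zero>\<^bsub>A\<^esub>)},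
     monoid.mult = undefined, one = undefined,
     ring.zero = (\<lambda>y. \<zero>\<^bsub>A\<^esub>), add = (\<lambda>u v y. u y \<oplus>\<^bsub>A\<^esub> v y),
     smult = (\<lambda>a u y. a \<otimes>\<^bsub>A\<^esub> u y)\<rparr>"

definition basis_elt :: "('a, 'k) ring_scheme \<Rightarrow> 'x \<Rightarrow> 'x \<Rightarrow> 'a"
  where "basis_elt A x = (\<lambda>y. if y = x then \<one>\<^bsub>A\<^esub> else \<zero>\<^bsub>A\<^esub>)"

definition monoid_algebra :: "('a, 'k) ring_scheme \<Rightarrow> ('g, 'l) monoid_scheme \<Rightarrow> ('a, 'g \<Rightarrow> 'a) module"
  where "monoid_algebra A G = (free_module A (carrier G))
    \<lparr>monoid.mult := (\<lambda>u v h. \<Oplus>\<^bsub>A\<^esub>p \<in> {(g, g'). u g \<noteq> \<zero>\<^bsub>A\<^esub> \<and> v g' \<noteq> \<zero>\<^bsub>A\<^esub> \<and> g \<otimes>\<^bsub>G\<^esub> g' = h}.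
                              u (fst p) \<otimes>\<^bsub>A\<^esub> v (snd p)),
     one := basis_elt A \<one>\<^bsub>G\<^esub>\<rparr>"

definition generated_submodule ::
  "('a, 'k) ring_scheme \<Rightarrow> ('a, 'm, 'l) module_scheme \<Rightarrow> 'm set \<Rightarrow> 'm set"
  where "generated_submodule A M S = \<Inter>{N. submodule N A M \<and> S \<subseteq> N}"


section \<open>Binary tensor products\<close>

definition bilinear_relations ::
  "('a, 'k) ring_scheme \<Rightarrow> ('a, 'm) module \<Rightarrow> ('a, 'n) module \<Rightarrow> ('m \<times> 'n \<Rightarrow> 'a) set"
  where "bilinear_relations A M N =
    (let F = free_module A (carrier M \<times> carrier N); \<delta> = basis_elt A in
      {\<delta> (m \<oplus>\<^bsub>M\<^esub> m', y) \<ominus>\<^bsub>F\<^esub> (\<delta> (m, y) \<oplus>\<^bsub>F\<^esub> \<delta> (m', y)) | m m' y.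
         m \<in> carrier M \<and> m' \<in> carrier M \<and> y \<in> carrier N}
    \<union> {\<delta> (m, y \<oplus>\<^bsub>N\<^esub> y') \<ominus>\<^bsub>F\<^esub> (\<delta> (m, y) \<oplus>\<^bsub>F\<^esub> \<delta> (m, y')) | m y y'.
         m \<in> carrier M \<and> y \<in> carrier N \<and> y' \<in> carrier N}
    \<union> {\<delta> (a \<odot>\<^bsub>M\<^esub> m, y) \<ominus>\<^bsub>F\<^esub> a \<odot>\<^bsub>F\<^esub> \<delta> (m, y) | a m y.
         a \<in> carrier A \<and> m \<in> carrier M \<and> y \<in> carrier N}
    \<union> {\<delta> (m, a \<odot>\<^bsub>N\<^esub> y) \<ominus>\<^bsub>F\<^esub> a \<odot>\<^bsub>F\<^esub> \<delta> (m, y) | a m y.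
         a \<in> carrier A \<and> m \<in> carrier M \<and> y \<in> carrier N})"

text \<open>
  The tensor product of modules, as an abelian group. The library writes additive quotient groups
  multiplicatively.
\<close>

definition tensor_group ::
  "('a, 'k) ring_scheme \<Rightarrow> ('a, 'm) module \<Rightarrow> ('a, 'n) module \<Rightarrow> ('m \<times> 'n \<Rightarrow> 'a) set monoid"
  where "tensor_group A M N =
    (let F = free_module A (carrier M \<times> carrier N)
     in F A_Mod generated_submodule A F (bilinear_relations A M N))"

definition tensor_group_pure ::
  "('a, 'k) ring_scheme \<Rightarrow> ('a, 'm) module \<Rightarrow> ('a, 'n) module \<Rightarrow> 'm \<Rightarrow> 'n \<Rightarrow> ('m \<times> 'n \<Rightarrow> 'a) set"
  where "tensor_group_pure A M N m y =
    (let F = free_module A (carrier M \<times> carrier N)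
     in generated_submodule A F (bilinear_relations A M N) +>\<^bsub>F\<^esub> basis_elt A (m, y))"

text \<open>
  The tensor product of algebras. The monoid algebra of the product monoid is the free module on
  pairs with the product \<open>(m, y) (m', y') = (m m', y y')\<close>; the bilinear relations are stable under
  multiplication by pairs, so the ideal and the submodule which they generate agree.
\<close>

definition tensor_ideal ::
  "('a, 'k) ring_scheme \<Rightarrow> ('a, 'm) module \<Rightarrow> ('a, 'n) module \<Rightarrow> ('m \<times> 'n \<Rightarrow> 'a) set"
  where "tensor_ideal A M N = Idl\<^bsub>monoid_algebra A (M \<times>\<times> N)\<^esub> (bilinear_relations A M N)"

definition tensor_algebra ::
  "('a, 'k) ring_scheme \<Rightarrow> ('a, 'm) module \<Rightarrow> ('a, 'n) module \<Rightarrow> ('m \<times> 'n \<Rightarrow> 'a) set ring"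
  where "tensor_algebra A M N = monoid_algebra A (M \<times>\<times> N) Quot tensor_ideal A M N"

definition tensor_pure ::
  "('a, 'k) ring_scheme \<Rightarrow> ('a, 'm) module \<Rightarrow> ('a, 'n) module \<Rightarrow> 'm \<Rightarrow> 'n \<Rightarrow> ('m \<times> 'n \<Rightarrow> 'a) set"
  where "tensor_pure A M N m y =
    tensor_ideal A M N +>\<^bsub>monoid_algebra A (M \<times>\<times> N)\<^esub> basis_elt A (m, y)"

text \<open>
  The map from the tensor product to \<open>C\<close> sending \<open>m \<otimes> y\<close> to \<open>p m * q y\<close>, for homomorphisms \<open>p\<close>
  and \<open>q\<close> of \<open>A\<close>-algebras; the displayed sum takes the same value at all representatives of a coset.
\<close>

definition tensor_lift ::
  "('a, 'k) ring_scheme \<Rightarrow> ('a, 'm) module \<Rightarrow> ('a, 'n) module \<Rightarrow> ('c, 'l) ring_scheme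
    \<Rightarrow> ('m \<Rightarrow> 'c) \<Rightarrow> ('n \<Rightarrow> 'c) \<Rightarrow> ('m \<times> 'n \<Rightarrow> 'a) set \<Rightarrow> 'c"
  where "tensor_lift A M N C p q Z =
    the_elem ((\<lambda>u. \<Oplus>\<^bsub>C\<^esub>w \<in> {w. u w \<noteq> \<zero>\<^bsub>A\<^esub>}. p (u w \<odot>\<^bsub>M\<^esub> fst w) \<otimes>\<^bsub>C\<^esub> q (snd w)) ` Z)"


section \<open>Etale homomorphisms\<close>

text \<open>
  Etale means flat, of finite presentation, and with vanishing module of differentials.
\<close>

definition poly_algebra :: "('b, 'k) ring_scheme \<Rightarrow> nat \<Rightarrow> ('b, (nat \<Rightarrow> nat) \<Rightarrow> 'b) module"
  where "poly_algebra B m =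
    monoid_algebra B
      (product_group {..<m} (\<lambda>_. \<lparr>carrier = UNIV :: nat set, monoid.mult = (+), one = 0\<rparr>))"

definition finitely_presented ::
  "('b, 'k) ring_scheme \<Rightarrow> ('e, 'l) ring_scheme \<Rightarrow> ('b \<Rightarrow> 'e) \<Rightarrow> bool"
  where "finitely_presented B E g \<longleftrightarrow>
    (\<exists>m h S. h \<in> alg_hom B (poly_algebra B m)
                   (\<lambda>b. b \<odot>\<^bsub>poly_algebra B m\<^esub> \<one>\<^bsub>poly_algebra B m\<^esub>) E g
           \<and> h ` carrier (poly_algebra B m) = carrier E
           \<and> finite S \<and> S \<subseteq> carrier (poly_algebra B m)
           \<and> a_kernel (poly_algebra B m) E h = Idl\<^bsub>poly_algebra B m\<^esub> S)"

definition linear_maps :: "('b, 'k) ring_scheme \<Rightarrow> ('b, 'm) module \<Rightarrow> ('b, 'n) module \<Rightarrow> ('m \<Rightarrow> 'n) set"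
  where "linear_maps B M N =
    {u \<in> carrier M \<rightarrow> carrier N.
       (\<forall>x \<in> carrier M. \<forall>y \<in> carrier M. u (x \<oplus>\<^bsub>M\<^esub> y) = u x \<oplus>\<^bsub>N\<^esub> u y)
     \<and> (\<forall>b \<in> carrier B. \<forall>x \<in> carrier M. u (b \<odot>\<^bsub>M\<^esub> x) = b \<odot>\<^bsub>N\<^esub> u x)}"

text \<open>
  \<open>K\<close> is flat if for every injective linear map \<open>u\<close> from \<open>M\<close> to \<open>N\<close> the map from \<open>M \<otimes> K\<close> to
  \<open>N \<otimes> K\<close> induced by \<open>u\<close> is injective; injectivity is spelled out on the elements
  \<open>m\<^sub>1 \<otimes> y\<^sub>1 + \<dots> + m\<^sub>k \<otimes> y\<^sub>k\<close> of \<open>M \<otimes> K\<close>. The type over which \<open>M\<close> and \<open>N\<close> range contains a copy of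
  every finitely generated \<open>B\<close>-module, as a quotient of some \<open>B\<^sup>k\<close>, and flatness can be tested on
  finitely generated modules.
\<close>

definition flat_module :: "('b, 'k) ring_scheme \<Rightarrow> ('b, 'e) module \<Rightarrow> bool"
  where "flat_module B K \<longleftrightarrow>
    (\<forall>(M :: ('b, (nat \<Rightarrow> 'b) set) module) (N :: ('b, (nat \<Rightarrow> 'b) set) module) u.
       module B M \<and> module B N \<and> u \<in> linear_maps B M N \<and> inj_on u (carrier M) \<longrightarrow>
       (\<forall>(k :: nat) m y. m \<in> {1..k} \<rightarrow> carrier M \<and> y \<in> {1..k} \<rightarrow> carrier K \<and>
          (\<Otimes>\<^bsub>tensor_group B N K\<^esub>i \<in> {1..k}. tensor_group_pure B N K (u (m i)) (y i))
            = \<one>\<^bsub>tensor_group B N K\<^esub> \<longrightarrow>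
          (\<Otimes>\<^bsub>tensor_group B M K\<^esub>i \<in> {1..k}. tensor_group_pure B M K (m i) (y i))
            = \<one>\<^bsub>tensor_group B M K\<^esub>))"

text \<open>
  The differentials of \<open>E\<close> over \<open>B\<close> are \<open>I/I\<^sup>2\<close>, for \<open>I\<close> the kernel of the multiplication map from
  \<open>E \<otimes> E\<close> to \<open>E\<close>.
\<close>

definition differentials ::
  "('b, 'k) ring_scheme \<Rightarrow> ('e, 'l) ring_scheme \<Rightarrow> ('b \<Rightarrow> 'e) \<Rightarrow> ('e \<times> 'e \<Rightarrow> 'b) set set monoid"
  where "differentials B E g =
    (let M = alg_module E g; S = tensor_algebra B M M;
         I = a_kernel S E (tensor_lift B M M E id id)
     in S\<lparr>carrier := I\<rparr> A_Mod (I \<cdot>\<^bsub>S\<^esub> I))"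

definition etale :: "('b, 'k) ring_scheme \<Rightarrow> ('e, 'l) ring_scheme \<Rightarrow> ('b \<Rightarrow> 'e) \<Rightarrow> bool"
  where "etale B E g \<longleftrightarrow>
    ring_hom_cring B E g \<and> flat_module B (alg_module E g) \<and> finitely_presented B E g \<and>
    carrier (differentials B E g) = {\<one>\<^bsub>differentials B E g\<^esub>}"


section \<open>Bases and traces\<close>

definition module_basis :: "('b, 'k) ring_scheme \<Rightarrow> ('b, 'm) module \<Rightarrow> nat \<Rightarrow> (nat \<Rightarrow> 'm) \<Rightarrow> bool"
  where "module_basis B M k e \<longleftrightarrow>
    e \<in> {1..k} \<rightarrow> carrier M \<and>
    (\<forall>y \<in> carrier M. \<exists>!c. c \<in> {1..k} \<rightarrow>\<^sub>E carrier B \<and> y = (\<Oplus>\<^bsub>M\<^esub>i \<in> {1..k}. c i \<odot>\<^bsub>M\<^esub> e i))"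

definition coordinates ::
  "('b, 'k) ring_scheme \<Rightarrow> ('b, 'm) module \<Rightarrow> nat \<Rightarrow> (nat \<Rightarrow> 'm) \<Rightarrow> 'm \<Rightarrow> nat \<Rightarrow> 'b"
  where "coordinates B M k e y =
    (THE c. c \<in> {1..k} \<rightarrow>\<^sub>E carrier B \<and> y = (\<Oplus>\<^bsub>M\<^esub>i \<in> {1..k}. c i \<odot>\<^bsub>M\<^esub> e i))"

text \<open>
  The trace of an endomorphism \<open>u\<close> of a free module of finite rank: the sum of the diagonal entries
  of the matrix of \<open>u\<close> in a basis, which is independent of the basis.
\<close>

definition module_trace :: "('b, 'k) ring_scheme \<Rightarrow> ('b, 'm) module \<Rightarrow> ('m \<Rightarrow> 'm) \<Rightarrow> 'b"
  where "module_trace B M u =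
    (THE t. \<exists>k e. module_basis B M k e \<and> t = (\<Oplus>\<^bsub>B\<^esub>i \<in> {1..k}. coordinates B M k e (u (e i)) i))"


section \<open>Localization\<close>

definition fraction :: "('s, 'k) ring_scheme \<Rightarrow> 's set \<Rightarrow> 's \<Rightarrow> 's \<Rightarrow> ('s \<times> 's) set"
  where "fraction S D a s =
    {(b, t). b \<in> carrier S \<and> t \<in> D \<and> (\<exists>d \<in> D. d \<otimes>\<^bsub>S\<^esub> (a \<otimes>\<^bsub>S\<^esub> t \<ominus>\<^bsub>S\<^esub> b \<otimes>\<^bsub>S\<^esub> s) = \<zero>\<^bsub>S\<^esub>)}"

definition localization :: "('s, 'k) ring_scheme \<Rightarrow> 's set \<Rightarrow> ('s \<times> 's) set ring"
  where "localization S D =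
    \<lparr>carrier = {fraction S D a s | a s. a \<in> carrier S \<and> s \<in> D},
     monoid.mult = (\<lambda>Z Y. \<Union>(a, s) \<in> Z. \<Union>(b, t) \<in> Y. fraction S D (a \<otimes>\<^bsub>S\<^esub> b) (s \<otimes>\<^bsub>S\<^esub> t)),
     one = fraction S D \<one>\<^bsub>S\<^esub> \<one>\<^bsub>S\<^esub>,
     ring.zero = fraction S D \<zero>\<^bsub>S\<^esub> \<one>\<^bsub>S\<^esub>,
     add = (\<lambda>Z Y. \<Union>(a, s) \<in> Z. \<Union>(b, t) \<in> Y.
              fraction S D (a \<otimes>\<^bsub>S\<^esub> t \<oplus>\<^bsub>S\<^esub> b \<otimes>\<^bsub>S\<^esub> s) (s \<otimes>\<^bsub>S\<^esub> t))\<rparr>"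

definition element_powers :: "('s, 'k) ring_scheme \<Rightarrow> 's \<Rightarrow> 's set"
  where "element_powers S s = range (\<lambda>k :: nat. s [^]\<^bsub>S\<^esub> k)"


section \<open>Tensor powers and symmetric tensors\<close>

definition multilinear_relations ::
  "('a, 'k) ring_scheme \<Rightarrow> ('a, 'r) module \<Rightarrow> nat \<Rightarrow> ((nat \<Rightarrow> 'r) \<Rightarrow> 'a) set"
  where "multilinear_relations A M n =
    (let F = free_module A ({1..n} \<rightarrow>\<^sub>E carrier M); \<delta> = basis_elt A in
      {\<delta> (y(i := m \<oplus>\<^bsub>M\<^esub> m')) \<ominus>\<^bsub>F\<^esub> (\<delta> (y(i := m)) \<oplus>\<^bsub>F\<^esub> \<delta> (y(i := m'))) | y i m m'.
         y \<in> {1..n} \<rightarrow>\<^sub>E carrier M \<and> i \<in> {1..n} \<and> m \<in> carrier M \<and> m' \<in> carrier M}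
    \<union> {\<delta> (y(i := a \<odot>\<^bsub>M\<^esub> m)) \<ominus>\<^bsub>F\<^esub> a \<odot>\<^bsub>F\<^esub> \<delta> (y(i := m)) | y i a m.
         y \<in> {1..n} \<rightarrow>\<^sub>E carrier M \<and> i \<in> {1..n} \<and> a \<in> carrier A \<and> m \<in> carrier M})"

text \<open>Pure tensors \<open>y\<^sub>1 \<otimes> \<dots> \<otimes> y\<^sub>n\<close> are indexed by extensional functions \<open>y\<close> on \<open>{1..n}\<close>.\<close>

locale tensor_power =
  fixes A :: "('a, 'k) ring_scheme" and R :: "('r, 'l) ring_scheme" and iR :: "'a \<Rightarrow> 'r" and n :: nat
begin

definition tuple_algebra :: "('a, (nat \<Rightarrow> 'r) \<Rightarrow> 'a) module"
  where "tuple_algebra = monoid_algebra A (product_group {1..n} (\<lambda>_. R))"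

definition T_ideal :: "((nat \<Rightarrow> 'r) \<Rightarrow> 'a) set"
  where "T_ideal = Idl\<^bsub>tuple_algebra\<^esub> (multilinear_relations A (alg_module R iR) n)"

definition T :: "((nat \<Rightarrow> 'r) \<Rightarrow> 'a) set ring"
  where "T = tuple_algebra Quot T_ideal"

definition pure :: "(nat \<Rightarrow> 'r) \<Rightarrow> ((nat \<Rightarrow> 'r) \<Rightarrow> 'a) set"
  where "pure y = T_ideal +>\<^bsub>tuple_algebra\<^esub> basis_elt A (restrict y {1..n})"

definition T_map :: "'a \<Rightarrow> ((nat \<Rightarrow> 'r) \<Rightarrow> 'a) set"
  where "T_map a = T_ideal +>\<^bsub>tuple_algebra\<^esub> (a \<odot>\<^bsub>tuple_algebra\<^esub> \<one>\<^bsub>tuple_algebra\<^esub>)"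

definition \<phi> :: "nat \<Rightarrow> 'r \<Rightarrow> ((nat \<Rightarrow> 'r) \<Rightarrow> 'a) set"
  where "\<phi> p z = pure (\<lambda>i. if i = p then z else \<one>\<^bsub>R\<^esub>)"

text \<open>
  The action of a permutation \<open>\<sigma>\<close> on the free module on tuples sends \<open>y \<circ> \<sigma>\<close> to \<open>y\<close>; it preserves
  the multilinear relations, so the image of a coset is a coset.
\<close>

definition permute_factors :: "(nat \<Rightarrow> nat) \<Rightarrow> ((nat \<Rightarrow> 'r) \<Rightarrow> 'a) set \<Rightarrow> ((nat \<Rightarrow> 'r) \<Rightarrow> 'a) set"
  where "permute_factors \<sigma> Z = (\<lambda>u y. u (y \<circ> \<sigma>)) ` Z"

definition TS :: "((nat \<Rightarrow> 'r) \<Rightarrow> 'a) set ring"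
  where "TS = T\<lparr>carrier := {t \<in> carrier T. \<forall>\<sigma>. \<sigma> permutes {1..n} \<longrightarrow> permute_factors \<sigma> t = t}\<rparr>"

definition TS' :: "((nat \<Rightarrow> 'r) \<Rightarrow> 'a) set ring"
  where "TS' = T\<lparr>carrier := {t \<in> carrier T. \<forall>\<sigma>. \<sigma> permutes {1..n-1} \<longrightarrow> permute_factors \<sigma> t = t}\<rparr>"

definition \<pp> :: "'r \<Rightarrow> ((nat \<Rightarrow> 'r) \<Rightarrow> 'a) set"
  where "\<pp> z = (\<Oplus>\<^bsub>T\<^esub>p \<in> {1..n}. \<phi> p z)"

definition \<alpha> :: "(nat \<Rightarrow> 'r) \<Rightarrow> ((nat \<Rightarrow> 'r) \<Rightarrow> 'a) set"
  where "\<alpha> x = (\<Oplus>\<^bsub>T\<^esub>\<sigma> \<in> {\<sigma>. \<sigma> permutes {1..n}}. [sign \<sigma>] \<cdot>\<^bsub>T\<^esub> pure (x \<circ> \<sigma>))"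

definition denominators :: "(nat \<Rightarrow> 'r) \<Rightarrow> ((nat \<Rightarrow> 'r) \<Rightarrow> 'a) set set"
  where "denominators x = element_powers T (\<alpha> x \<otimes>\<^bsub>T\<^esub> \<alpha> x)"

definition \<A> :: "(nat \<Rightarrow> 'r) \<Rightarrow> (((nat \<Rightarrow> 'r) \<Rightarrow> 'a) set \<times> ((nat \<Rightarrow> 'r) \<Rightarrow> 'a) set) set ring"
  where "\<A> x = localization TS (denominators x)"

definition \<R> :: "(nat \<Rightarrow> 'r) \<Rightarrow> (((nat \<Rightarrow> 'r) \<Rightarrow> 'a) set \<times> ((nat \<Rightarrow> 'r) \<Rightarrow> 'a) set) set ring"
  where "\<R> x = localization TS' (denominators x)"

definition to_\<A> ::
  "(nat \<Rightarrow> 'r) \<Rightarrow> ((nat \<Rightarrow> 'r) \<Rightarrow> 'a) set \<Rightarrow> (((nat \<Rightarrow> 'r) \<Rightarrow> 'a) set \<times> ((nat \<Rightarrow> 'r) \<Rightarrow> 'a) set) set"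
  where "to_\<A> x t = fraction TS (denominators x) t \<one>\<^bsub>T\<^esub>"

definition to_\<R> ::
  "(nat \<Rightarrow> 'r) \<Rightarrow> ((nat \<Rightarrow> 'r) \<Rightarrow> 'a) set \<Rightarrow> (((nat \<Rightarrow> 'r) \<Rightarrow> 'a) set \<times> ((nat \<Rightarrow> 'r) \<Rightarrow> 'a) set) set"
  where "to_\<R> x t = fraction TS' (denominators x) t \<one>\<^bsub>T\<^esub>"

definition \<A>_map :: "(nat \<Rightarrow> 'r) \<Rightarrow> 'a \<Rightarrow> (((nat \<Rightarrow> 'r) \<Rightarrow> 'a) set \<times> ((nat \<Rightarrow> 'r) \<Rightarrow> 'a) set) set"
  where "\<A>_map x a = to_\<A> x (T_map a)"

text \<open>
  The extension of \<open>\<A>\<close> by \<open>\<R>\<close> sends \<open>a/s\<close> to \<open>a/s\<close>; a fraction is a class of pairs, and the class in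
  \<open>\<R>\<close> is larger than the one in \<open>\<A>\<close>.
\<close>

definition \<A>_to_\<R> ::
  "(nat \<Rightarrow> 'r) \<Rightarrow> (((nat \<Rightarrow> 'r) \<Rightarrow> 'a) set \<times> ((nat \<Rightarrow> 'r) \<Rightarrow> 'a) set) set
    \<Rightarrow> (((nat \<Rightarrow> 'r) \<Rightarrow> 'a) set \<times> ((nat \<Rightarrow> 'r) \<Rightarrow> 'a) set) set"
  where "\<A>_to_\<R> x Z = (\<Union>(a, s) \<in> Z. fraction TS' (denominators x) a s)"

end


section \<open>Quotients of a ring\<close>

definition equal_quotients ::
  "('s, 'k) ring_scheme \<Rightarrow> ('p, 'l) ring_scheme \<Rightarrow> ('s \<Rightarrow> 'p) \<Rightarrow> ('q, 'm) ring_scheme \<Rightarrow> ('s \<Rightarrow> 'q) \<Rightarrow> bool"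
  where "equal_quotients S P p Q q \<longleftrightarrow>
    p \<in> ring_hom S P \<and> p ` carrier S = carrier P \<and>
    q \<in> ring_hom S Q \<and> q ` carrier S = carrier Q \<and>
    a_kernel S P p = a_kernel S Q q"

text \<open>
  For a homomorphism \<open>h\<close> of \<open>A\<close>-algebras from \<open>\<A>\<close> to \<open>B\<close>: the ring \<open>\<R> \<otimes>\<^sub>\<A> B\<close> and the algebra
  \<open>E\<close> are the same quotient of \<open>R \<otimes>\<^sub>A B\<close>, the quotient maps being
  \<open>z \<otimes> b \<mapsto> \<phi>\<^sub>n(z) \<otimes> b\<close> and \<open>z \<otimes> b \<mapsto> f(z) g(b)\<close>.
\<close>

definition (in tensor_power) base_change_is where
  "base_change_is x B iB E g f h \<longleftrightarrow>
    (let M = alg_module R iR; N = alg_module B iB;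
         M' = alg_module (\<R> x) (\<A>_to_\<R> x); N' = alg_module B h;
         P = tensor_algebra (\<A> x) M' N'
     in equal_quotients (tensor_algebra A M N)
          P (tensor_lift A M N P
               (\<lambda>z. tensor_pure (\<A> x) M' N' (to_\<R> x (\<phi> n z)) \<one>\<^bsub>B\<^esub>)
               (\<lambda>b. tensor_pure (\<A> x) M' N' \<one>\<^bsub>\<R> x\<^esub> b))
          E (tensor_lift A M N E f g))"

end

theory Submission
  imports Defs
begin

text \<open>
  Let \<open>c\<^sub>p\<close> be the coordinate functions of the basis \<open>f(x\<^sub>i)\<close> of \<open>E\<close>. The multilinear map
  \<open>y\<^sub>1 \<otimes> \<dots> \<otimes> y\<^sub>n \<mapsto> \<Prod>\<^sub>p c\<^sub>p(f(y\<^sub>p))\<close> is a functional \<open>K\<close> on the tensor power with \<open>K(\<alpha>(x)) = 1\<close>, and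
  multiplicativity of determinants gives \<open>K(s \<alpha>(z)) = K(s \<alpha>(x)) K(\<alpha>(z))\<close>. A symmetric tensor
  \<open>t = \<Sum> y\<^sub>1 \<otimes> \<dots> \<otimes> y\<^sub>n\<close> satisfies \<open>t \<alpha>(x) = \<Sum> \<alpha>(x y)\<close>, so \<open>t \<mapsto> K(t \<alpha>(x))\<close> is a ring homomorphism
  on symmetric tensors. It sends the power sum \<open>\<pp>(z)\<close> to the trace of \<open>f(z)\<close> and \<open>\<alpha>\<^sup>2(x)\<close> to the
  discriminant of the trace form, which is invertible since \<open>E\<close> is unramified over \<open>B\<close>; this gives
  the homomorphism \<open>\<A> \<rightarrow> B\<close>.

  By Cramer's rule, \<open>\<alpha>\<^sup>2(x) t = \<Sum>\<^sub>i \<phi>\<^sub>n(x\<^sub>i) D\<^sub>i(t)\<close> with \<open>D\<^sub>i(t)\<close> symmetric, for every \<open>t\<close> invariant under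
  the permutations of the first \<open>n - 1\<close> factors. Hence the \<open>\<phi>\<^sub>n(x\<^sub>i)\<close> span \<open>\<R>\<close> over \<open>\<A>\<close>, and
  multiplication by \<open>\<phi>\<^sub>n(z)\<close> has trace \<open>\<pp>(z)\<close>, which forces every solution to send \<open>\<pp>(z)\<close> to the
  trace of \<open>f(z)\<close>. Their linear independence after base change is detected by the trace pairing. Finally
  \<open>\<alpha>\<^sup>2(x) t = \<Sum> det(\<pp>(x\<^sub>i x\<^sub>j y\<^sub>j))\<close> shows that the power sums determine the homomorphism.
\<close>

section \<open>Determinants over commutative rings\<close>

text \<open>Multiplicativity appears only on multiples of alternating tensors: applied to a pure
  tensor w times \<alpha>(z), \<open>K\<close> is a determinant with rows of p-th coordinates of
  f(w_p) f(z_i), and expanding f(z_i) in the basis f(x_j) splits off the coordinate matrix of z.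
  Multiplication by \<alpha>(x) thus replaces averaging; the price is the denominator \<alpha>(x)^2.
  Unramifiedness acts through a separability element of E \<otimes> E, whose contractions form a
  dual basis for the trace form. The two kernel inclusions differ in nature. The kernel of the map
  to E is contained in the other by Cramer's rule. The converse needs a functional on the base
  change; it comes from summing the conjugates of an element of \<open>TS'\<close> and applying
  \<open>c\<close>. Tensor products are literal quotients of monoid algebras, and a map out of them
  is the common value of a sum on a coset. Universal properties are therefore proved once, for
  algebras presented by additive and scalar relations.\<close>

context abelian_monoid
begin

lemma finsum_cong_on:
  assumes "\<And>i. i \<in> I \<Longrightarrow> f i = h i" "\<And>i. i \<in> I \<Longrightarrow> h i \<in> carrier G"
  shows "(\<Oplus>i\<in>I. f i) = (\<Oplus>i\<in>I. h i)"
  using assms by (intro finsum_cong') auto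

lemma finsum_fubini:
  assumes "finite I" "finite J" "\<And>i j. i \<in> I \<Longrightarrow> j \<in> J \<Longrightarrow> f i j \<in> carrier G"
  shows "(\<Oplus>i\<in>I. \<Oplus>j\<in>J. f i j) = (\<Oplus>j\<in>J. \<Oplus>i\<in>I. f i j)"
  using assms(1,3)
proof (induction I)
  case empty
  then show ?case by (simp add: finsum_zero)
next
  case (insert i I)
  have "(\<Oplus>i'\<in>insert i I. \<Oplus>j\<in>J. f i' j) = (\<Oplus>j\<in>J. f i j) \<oplus> (\<Oplus>j\<in>J. \<Oplus>i\<in>I. f i j)"
    using insert by (subst finsum_insert) (auto intro!: finsum_closed)
  also have "\<dots> = (\<Oplus>j\<in>J. f i j \<oplus> (\<Oplus>i\<in>I. f i j))"
    using insert by (intro finsum_addf[symmetric]) (auto intro!: finsum_closed)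
  also have "\<dots> = (\<Oplus>j\<in>J. \<Oplus>i'\<in>insert i I. f i' j)"
    using insert by (intro finsum_cong_on) (auto intro!: finsum_closed)
  finally show ?case .
qed

lemma finsum_reindex_bij:
  assumes "bij_betw h I J" "\<And>j. j \<in> J \<Longrightarrow> f j \<in> carrier G"
  shows "(\<Oplus>j\<in>J. f j) = (\<Oplus>i\<in>I. f (h i))"
  using finsum_reindex[of f h I] assms unfolding bij_betw_def by auto

lemma finsum_delta:
  assumes "finite I" "i \<in> I" "\<And>j. j \<in> I \<Longrightarrow> f j \<in> carrier G" "\<And>j. j \<in> I \<Longrightarrow> j \<noteq> i \<Longrightarrow> f j = \<zero>"
  shows "(\<Oplus>j\<in>I. f j) = f i"
proof -
  have "(\<Oplus>j\<in>I. f j) = (\<Oplus>j\<in>insert i (I - {i}). f j)"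
    using assms by (simp add: insert_absorb)
  also have "\<dots> = f i \<oplus> (\<Oplus>j\<in>I - {i}. f j)"
    using assms by (intro finsum_insert) auto
  also have "(\<Oplus>j\<in>I - {i}. f j) = \<zero>"
    using assms by (intro add.finprod_one_eqI) auto
  finally show ?thesis using assms by simp
qed

lemma finsum_split:
  assumes "finite I" "\<And>i. i \<in> I \<Longrightarrow> f i \<in> carrier G"
  shows "(\<Oplus>i\<in>I. f i) = (\<Oplus>i\<in>{i\<in>I. Q i}. f i) \<oplus> (\<Oplus>i\<in>{i\<in>I. \<not> Q i}. f i)"
proof -
  have "I = {i\<in>I. Q i} \<union> {i\<in>I. \<not> Q i}" by auto
  then have "(\<Oplus>i\<in>I. f i) = (\<Oplus>i\<in>{i\<in>I. Q i} \<union> {i\<in>I. \<not> Q i}. f i)" by simp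
  also have "\<dots> = (\<Oplus>i\<in>{i\<in>I. Q i}. f i) \<oplus> (\<Oplus>i\<in>{i\<in>I. \<not> Q i}. f i)"
    using assms by (intro finsum_Un_disjoint) auto
  finally show ?thesis .
qed

lemma finsum_partition:
  assumes "finite I" "finite J" "h \<in> I \<rightarrow> J" "\<And>i. i \<in> I \<Longrightarrow> f i \<in> carrier G"
  shows "(\<Oplus>i\<in>I. f i) = (\<Oplus>j\<in>J. \<Oplus>i\<in>{i\<in>I. h i = j}. f i)"
proof -
  have "I = (\<Union>j\<in>J. {i\<in>I. h i = j})" using assms(3) by auto
  then have "(\<Oplus>i\<in>I. f i) = (\<Oplus>i\<in>(\<Union>j\<in>J. {i\<in>I. h i = j}). f i)" by simp
  also have "\<dots> = (\<Oplus>j\<in>J. \<Oplus>i\<in>{i\<in>I. h i = j}. f i)"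
    using assms by (intro add.finprod_UN_disjoint) (auto simp: pairwise_def disjnt_def)
  finally show ?thesis .
qed

end

context comm_monoid
begin

lemma finprod_cong_on:
  assumes "\<And>i. i \<in> I \<Longrightarrow> f i = h i" "\<And>i. i \<in> I \<Longrightarrow> h i \<in> carrier G"
  shows "(\<Otimes>i\<in>I. f i) = (\<Otimes>i\<in>I. h i)"
  using assms by (intro finprod_cong') auto

lemma finprod_reindex_bij:
  assumes "bij_betw h I J" "\<And>j. j \<in> J \<Longrightarrow> f j \<in> carrier G"
  shows "(\<Otimes>j\<in>J. f j) = (\<Otimes>i\<in>I. f (h i))"
  using finprod_reindex[of f h I] assms unfolding bij_betw_def by auto

lemma finprod_remove:
  assumes "finite I" "i \<in> I" "\<And>j. j \<in> I \<Longrightarrow> f j \<in> carrier G"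
  shows "(\<Otimes>j\<in>I. f j) = f i \<otimes> (\<Otimes>j\<in>I - {i}. f j)"
proof -
  have "(\<Otimes>j\<in>I. f j) = (\<Otimes>j\<in>insert i (I - {i}). f j)"
    using assms by (simp add: insert_absorb)
  also have "\<dots> = f i \<otimes> (\<Otimes>j\<in>I - {i}. f j)"
    using assms by (intro finprod_insert) auto
  finally show ?thesis .
qed

end

context cring
begin

lemma finsum_lmult:
  assumes "finite I" "a \<in> carrier R" "\<And>i. i \<in> I \<Longrightarrow> f i \<in> carrier R"
  shows "a \<otimes> (\<Oplus>i\<in>I. f i) = (\<Oplus>i\<in>I. a \<otimes> f i)"
  using assms by (intro finsum_rdistr) auto

lemma finsum_rmult:
  assumes "finite I" "a \<in> carrier R" "\<And>i. i \<in> I \<Longrightarrow> f i \<in> carrier R"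
  shows "(\<Oplus>i\<in>I. f i) \<otimes> a = (\<Oplus>i\<in>I. f i \<otimes> a)"
  using assms by (intro finsum_ldistr) auto

lemma finprod_zero_factor:
  assumes "finite I" "i \<in> I" "f i = \<zero>" "\<And>j. j \<in> I \<Longrightarrow> f j \<in> carrier R"
  shows "(\<Otimes>j\<in>I. f j) = \<zero>"
  using finprod_remove[of I i f] assms by (simp add: Pi_def)

text \<open>Induction on I: extensional choice functions on \<open>insert i I\<close> correspond to
  pairs of a value at i and a choice function on I, via \<open>\<kappa>(i := j)\<close>.
  Extensionality keeps the index set finite and the correspondence bijective.\<close>

lemma finprod_finsum:
  assumes "finite I" "finite J" "\<And>i j. i \<in> I \<Longrightarrow> j \<in> J \<Longrightarrow> f i j \<in> carrier R"
  shows "(\<Otimes>i\<in>I. \<Oplus>j\<in>J. f i j) = (\<Oplus>\<kappa>\<in>I \<rightarrow>\<^sub>E J. \<Otimes>i\<in>I. f i (\<kappa> i))"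
  using assms(1,3)
proof (induction I)
  case empty
  then show ?case by simp
next
  case (insert i I)
  have inj: "inj_on (\<lambda>(j, \<kappa>). \<kappa>(i := j)) (J \<times> (I \<rightarrow>\<^sub>E J))"
    using inj_combinator[of i I "\<lambda>_. J"] insert by simp
  have fin: "finite (I \<rightarrow>\<^sub>E J)" using insert assms by (simp add: finite_PiE)
  have "(\<Oplus>\<kappa>\<in>insert i I \<rightarrow>\<^sub>E J. \<Otimes>k\<in>insert i I. f k (\<kappa> k))
      = (\<Oplus>p\<in>J \<times> (I \<rightarrow>\<^sub>E J). \<Otimes>k\<in>insert i I. f k ((case p of (j, \<kappa>) \<Rightarrow> \<kappa>(i := j)) k))"
    unfolding PiE_insert_eq using insert inj
    by (intro finsum_reindex) (auto intro!: finprod_closed simp: PiE_def Pi_def split: if_splits)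
  also have "\<dots> = (\<Oplus>p\<in>J \<times> (I \<rightarrow>\<^sub>E J). f i (fst p) \<otimes> (\<Otimes>k\<in>I. f k (snd p k)))"
  proof (intro finsum_cong_on)
    fix p assume "p \<in> J \<times> (I \<rightarrow>\<^sub>E J)"
    then obtain j \<kappa> where p: "p = (j, \<kappa>)" "j \<in> J" "\<kappa> \<in> I \<rightarrow>\<^sub>E J" by auto
    have "(\<Otimes>k\<in>insert i I. f k ((\<kappa>(i := j)) k)) = f i j \<otimes> (\<Otimes>k\<in>I. f k ((\<kappa>(i := j)) k))"
      using insert p by (subst finprod_insert) (auto simp: Pi_def PiE_def)
    also have "(\<Otimes>k\<in>I. f k ((\<kappa>(i := j)) k)) = (\<Otimes>k\<in>I. f k (\<kappa> k))"
      using insert p by (intro finprod_cong_on) (auto simp: Pi_def PiE_def)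
    finally show "(\<Otimes>k\<in>insert i I. f k ((case p of (j, \<kappa>) \<Rightarrow> \<kappa>(i := j)) k))
        = f i (fst p) \<otimes> (\<Otimes>k\<in>I. f k (snd p k))" using p by simp
    show "f i (fst p) \<otimes> (\<Otimes>k\<in>I. f k (snd p k)) \<in> carrier R"
      using insert p by (auto intro!: finprod_closed simp: Pi_def PiE_def)
  qed
  also have "\<dots> = (\<Oplus>j\<in>J. \<Oplus>p\<in>{p \<in> J \<times> (I \<rightarrow>\<^sub>E J). fst p = j}. f i (fst p) \<otimes> (\<Otimes>k\<in>I. f k (snd p k)))"
    using insert assms fin
    by (intro finsum_partition) (auto intro!: finprod_closed m_closed simp: Pi_def PiE_def)
  also have "\<dots> = (\<Oplus>j\<in>J. \<Oplus>\<kappa>\<in>I \<rightarrow>\<^sub>E J. f i j \<otimes> (\<Otimes>k\<in>I. f k (\<kappa> k)))"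
  proof (intro finsum_cong_on)
    fix j assume j: "j \<in> J"
    have "bij_betw (Pair j) (I \<rightarrow>\<^sub>E J) {p \<in> J \<times> (I \<rightarrow>\<^sub>E J). fst p = j}"
      using j by (auto simp: bij_betw_def inj_on_def)
    then show "(\<Oplus>p\<in>{p \<in> J \<times> (I \<rightarrow>\<^sub>E J). fst p = j}. f i (fst p) \<otimes> (\<Otimes>k\<in>I. f k (snd p k)))
        = (\<Oplus>\<kappa>\<in>I \<rightarrow>\<^sub>E J. f i j \<otimes> (\<Otimes>k\<in>I. f k (\<kappa> k)))"
      using insert by (subst finsum_reindex_bij) (auto intro!: finprod_closed m_closed simp: Pi_def PiE_def)
    show "(\<Oplus>\<kappa>\<in>I \<rightarrow>\<^sub>E J. f i j \<otimes> (\<Otimes>k\<in>I. f k (\<kappa> k))) \<in> carrier R"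
      using insert j by (intro finsum_closed) (auto intro!: finprod_closed m_closed simp: Pi_def PiE_def)
  qed
  also have "\<dots> = (\<Oplus>j\<in>J. f i j \<otimes> (\<Oplus>\<kappa>\<in>I \<rightarrow>\<^sub>E J. \<Otimes>k\<in>I. f k (\<kappa> k)))"
    using insert fin
    by (intro finsum_cong_on finsum_lmult[symmetric])
       (auto intro!: finprod_closed m_closed finsum_closed simp: Pi_def PiE_def)
  also have "\<dots> = (\<Oplus>j\<in>J. f i j) \<otimes> (\<Oplus>\<kappa>\<in>I \<rightarrow>\<^sub>E J. \<Otimes>k\<in>I. f k (\<kappa> k))"
    using insert assms fin
    by (intro finsum_rmult[symmetric]) (auto intro!: finprod_closed m_closed finsum_closed simp: Pi_def PiE_def)
  also have "\<dots> = (\<Otimes>k\<in>insert i I. \<Oplus>j\<in>J. f k j)"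
    using insert by (subst finprod_insert) (auto intro!: finsum_closed)
  finally show ?case by simp
qed

section \<open>Signs of permutations and the Leibniz determinant\<close>

definition psgn :: "('i \<Rightarrow> 'i) \<Rightarrow> 'a"
  where "psgn \<pi> = [sign \<pi>] \<cdot> \<one>"

lemma psgn_cases: "psgn \<pi> = (if evenperm \<pi> then \<one> else \<ominus> \<one>)"
  unfolding psgn_def sign_def by (auto simp: add_pow_int_ge add_pow_int_lt)

lemma psgn_closed [simp, intro]: "psgn \<pi> \<in> carrier R"
  by (simp add: psgn_cases)

lemma psgn_mult: "a \<in> carrier R \<Longrightarrow> [sign \<pi>] \<cdot> a = psgn \<pi> \<otimes> a"
  unfolding psgn_def by (simp add: add_pow_ldistr_int)

lemma psgn_id [simp]: "psgn id = \<one>" "psgn (\<lambda>i. i) = \<one>"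
  using evenperm_id by (simp_all add: psgn_cases id_def)

lemma psgn_comp:
  assumes "finite I" "\<pi> permutes I" "\<tau> permutes I"
  shows "psgn (\<pi> \<circ> \<tau>) = psgn \<pi> \<otimes> psgn \<tau>"
  using evenperm_comp[of \<pi> \<tau>] assms permutation_permutes[of \<pi>] permutation_permutes[of \<tau>]
  by (auto simp: psgn_cases l_minus r_minus)

lemma psgn_square: "psgn \<pi> \<otimes> psgn \<pi> = \<one>"
  by (simp add: psgn_cases l_minus r_minus)

lemma psgn_inv:
  assumes "finite I" "\<pi> permutes I"
  shows "psgn (inv_into UNIV \<pi>) = psgn \<pi>"
  using evenperm_inv[of \<pi>] assms permutation_permutes[of \<pi>] by (auto simp: psgn_cases)

text \<open>The index set is arbitrary and the entries matter only on I. The first index is the row;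
  in the tensor power the rows will be the factors and the columns the members of a tuple.\<close>

definition det :: "'i set \<Rightarrow> ('i \<Rightarrow> 'i \<Rightarrow> 'a) \<Rightarrow> 'a"
  where "det I M = (\<Oplus>\<pi>\<in>{\<pi>. \<pi> permutes I}. psgn \<pi> \<otimes> (\<Otimes>i\<in>I. M i (\<pi> i)))"

lemma perm_prod_closed:
  assumes "\<And>i j. i \<in> I \<Longrightarrow> j \<in> I \<Longrightarrow> M i j \<in> carrier R" "\<pi> permutes I"
  shows "(\<Otimes>i\<in>I. M i (\<pi> i)) \<in> carrier R"
  using assms permutes_in_image[OF assms(2)] by (intro finprod_closed) auto

lemma det_closed [intro]:
  assumes "\<And>i j. i \<in> I \<Longrightarrow> j \<in> I \<Longrightarrow> M i j \<in> carrier R"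
  shows "det I M \<in> carrier R"
  unfolding det_def using perm_prod_closed[of I M] assms by (intro finsum_closed) auto

lemma det_cong:
  assumes "\<And>i j. i \<in> I \<Longrightarrow> j \<in> I \<Longrightarrow> M i j = N i j" "\<And>i j. i \<in> I \<Longrightarrow> j \<in> I \<Longrightarrow> N i j \<in> carrier R"
  shows "det I M = det I N"
proof -
  have "(\<Otimes>i\<in>I. M i (\<pi> i)) = (\<Otimes>i\<in>I. N i (\<pi> i))" if "\<pi> permutes I" for \<pi>
    using assms permutes_in_image[OF that] by (intro finprod_cong_on) auto
  then show ?thesis
    unfolding det_def using perm_prod_closed[of I N] assms by (intro finsum_cong_on) auto
qed

text \<open>Replacing \<open>\<pi>\<close> by \<open>\<pi> \<circ> \<tau>\<close> in the sum
  produces the sign of \<open>\<tau>\<close>, and reindexing each product by \<open>\<tau>\<close>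
  restores the original terms.\<close>

lemma det_row_perm:
  assumes "finite I" "\<And>i j. i \<in> I \<Longrightarrow> j \<in> I \<Longrightarrow> M i j \<in> carrier R" "\<tau> permutes I"
  shows "det I (\<lambda>i. M (\<tau> i)) = psgn \<tau> \<otimes> det I M"
proof -
  have c: "(\<Otimes>i\<in>I. M (\<tau> i) (\<pi> i)) \<in> carrier R" if "\<pi> permutes I" for \<pi>
    using assms that permutes_in_image[OF assms(3)] permutes_in_image[OF that] by (intro finprod_closed) auto
  have bij: "bij_betw (\<lambda>\<pi>. \<pi> \<circ> \<tau>) {\<pi>. \<pi> permutes I} {\<pi>. \<pi> permutes I}"
    by (rule bij_betw_byWitness[where f' = "\<lambda>\<pi>. \<pi> \<circ> inv_into UNIV \<tau>"])
       (use assms(3) in \<open>auto simp: o_assoc[symmetric] permutes_inv_o intro: permutes_compose permutes_inv\<close>)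
  have "det I (\<lambda>i. M (\<tau> i))
      = (\<Oplus>\<pi>\<in>{\<pi>. \<pi> permutes I}. psgn (\<pi> \<circ> \<tau>) \<otimes> (\<Otimes>i\<in>I. M (\<tau> i) ((\<pi> \<circ> \<tau>) i)))"
    unfolding det_def using c by (subst finsum_reindex_bij[OF bij]) auto
  also have "\<dots> = (\<Oplus>\<pi>\<in>{\<pi>. \<pi> permutes I}. psgn \<tau> \<otimes> (psgn \<pi> \<otimes> (\<Otimes>i\<in>I. M i (\<pi> i))))"
  proof (intro finsum_cong_on)
    fix \<pi> assume "\<pi> \<in> {\<pi>. \<pi> permutes I}"
    then have s: "\<pi> permutes I" by simp
    have "(\<Otimes>i\<in>I. M i (\<pi> i)) = (\<Otimes>i\<in>I. M (\<tau> i) (\<pi> (\<tau> i)))"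
      using assms permutes_in_image[OF s] by (intro finprod_reindex_bij permutes_imp_bij) auto
    then show "psgn (\<pi> \<circ> \<tau>) \<otimes> (\<Otimes>i\<in>I. M (\<tau> i) ((\<pi> \<circ> \<tau>) i)) = psgn \<tau> \<otimes> (psgn \<pi> \<otimes> (\<Otimes>i\<in>I. M i (\<pi> i)))"
      using psgn_comp[OF assms(1) s assms(3)] perm_prod_closed[of I M, OF assms(2) s]
      by (simp add: m_assoc m_lcomm[of "psgn \<tau>"])
    show "psgn \<tau> \<otimes> (psgn \<pi> \<otimes> (\<Otimes>i\<in>I. M i (\<pi> i))) \<in> carrier R"
      using perm_prod_closed[of I M, OF assms(2) s] by simp
  qed
  also have "\<dots> = psgn \<tau> \<otimes> det I M"
    unfolding det_def using perm_prod_closed[of I M] assms finite_permutations[OF assms(1)]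
    by (intro finsum_lmult[symmetric]) auto
  finally show ?thesis .
qed

text \<open>Swapping the two rows would only give that twice the determinant vanishes, which is too
  weak where 2 is a zero divisor. Instead composition with the transposition pairs each even
  permutation with an odd one having the same product.\<close>

lemma det_equal_rows:
  assumes "finite I" "\<And>i j. i \<in> I \<Longrightarrow> j \<in> I \<Longrightarrow> M i j \<in> carrier R"
    and "p \<in> I" "q \<in> I" "p \<noteq> q" "\<And>j. j \<in> I \<Longrightarrow> M p j = M q j"
  shows "det I M = \<zero>"
proof -
  let ?t = "transpose p q"
  have t: "?t permutes I" using assms by (simp add: permutes_swap_id)
  let ?E = "{\<pi> \<in> {\<pi>. \<pi> permutes I}. evenperm \<pi>}" and ?O = "{\<pi> \<in> {\<pi>. \<pi> permutes I}. \<not> evenperm \<pi>}"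
  let ?f = "\<lambda>\<pi>. \<Otimes>i\<in>I. M i (\<pi> i)"
  have c: "\<pi> permutes I \<Longrightarrow> ?f \<pi> \<in> carrier R" for \<pi> using perm_prod_closed[of I M] assms by auto
  have pm: "\<pi> permutes I \<Longrightarrow> permutation \<pi>" for \<pi> using assms(1) permutation_permutes by blast
  have ev: "\<pi> permutes I \<Longrightarrow> evenperm (\<pi> \<circ> ?t) = (\<not> evenperm \<pi>)" for \<pi>
    using evenperm_comp[of \<pi> ?t] pm t assms(5) by (auto simp: evenperm_swap)
  have inv: "\<pi> \<circ> ?t \<circ> ?t = \<pi>" for \<pi> by (auto simp: fun_eq_iff)
  have bij: "bij_betw (\<lambda>\<pi>. \<pi> \<circ> ?t) ?E ?O"
    by (rule bij_betw_byWitness[where f' = "\<lambda>\<pi>. \<pi> \<circ> ?t"])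
       (use t ev inv in \<open>auto intro: permutes_compose\<close>)
  have same: "?f (\<pi> \<circ> ?t) = ?f \<pi>" if s: "\<pi> permutes I" for \<pi>
  proof -
    have "?f \<pi> = (\<Otimes>i\<in>I. M (?t i) (\<pi> (?t i)))"
      using assms permutes_in_image[OF s] t by (intro finprod_reindex_bij permutes_imp_bij) auto
    also have "\<dots> = (\<Otimes>i\<in>I. M i ((\<pi> \<circ> ?t) i))"
      using assms permutes_in_image[OF s] permutes_in_image[OF t]
      by (intro finprod_cong_on) (auto simp: transpose_def)
    finally show ?thesis by simp
  qed
  have "det I M = (\<Oplus>\<pi>\<in>?E. psgn \<pi> \<otimes> ?f \<pi>) \<oplus> (\<Oplus>\<pi>\<in>?O. psgn \<pi> \<otimes> ?f \<pi>)"
    unfolding det_def using c assms(1) by (intro finsum_split) (auto simp: finite_permutations)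
  also have "(\<Oplus>\<pi>\<in>?O. psgn \<pi> \<otimes> ?f \<pi>) = (\<Oplus>\<pi>\<in>?E. psgn (\<pi> \<circ> ?t) \<otimes> ?f (\<pi> \<circ> ?t))"
    using c by (intro finsum_reindex_bij[OF bij]) auto
  also have "\<dots> = (\<Oplus>\<pi>\<in>?E. (\<ominus> \<one>) \<otimes> ?f \<pi>)"
    using c ev same by (intro finsum_cong_on) (auto simp: psgn_cases)
  also have "(\<Oplus>\<pi>\<in>?E. psgn \<pi> \<otimes> ?f \<pi>) = (\<Oplus>\<pi>\<in>?E. ?f \<pi>)"
    using c by (intro finsum_cong_on) (auto simp: psgn_cases)
  also have "(\<Oplus>\<pi>\<in>?E. (\<ominus> \<one>) \<otimes> ?f \<pi>) = (\<ominus> \<one>) \<otimes> (\<Oplus>\<pi>\<in>?E. ?f \<pi>)"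
    using c assms(1) by (intro finsum_lmult[symmetric]) (auto simp: finite_permutations)
  also have "(\<Oplus>\<pi>\<in>?E. ?f \<pi>) \<oplus> (\<ominus> \<one>) \<otimes> (\<Oplus>\<pi>\<in>?E. ?f \<pi>) = \<zero>"
    using c by (subst l_minus) (auto intro!: finsum_closed simp: r_neg)
  finally show ?thesis .
qed

text \<open>Each row of the product matrix is a combination of rows of N, so multilinearity expands
  the determinant into a sum over all maps \<open>\<kappa>\<close> from I to I of a product of
  entries of M times the determinant of the selected rows of N.\<close>

lemma det_mult:
  assumes "finite I" and M: "\<And>i j. i \<in> I \<Longrightarrow> j \<in> I \<Longrightarrow> M i j \<in> carrier R"
    and N: "\<And>i j. i \<in> I \<Longrightarrow> j \<in> I \<Longrightarrow> N i j \<in> carrier R"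
  shows "det I (\<lambda>i j. \<Oplus>k\<in>I. M i k \<otimes> N k j) = det I M \<otimes> det I N"
proof -
  let ?S = "{\<pi>. \<pi> permutes I}" and ?F = "I \<rightarrow>\<^sub>E I"
  have fin: "finite ?S" "finite ?F" using assms(1) by (auto simp: finite_permutations finite_PiE)
  have cM: "(\<Otimes>i\<in>I. M i (\<kappa> i)) \<in> carrier R" if "\<kappa> \<in> I \<rightarrow> I" for \<kappa>
    using that M by (intro finprod_closed) auto
  have cN: "(\<Otimes>i\<in>I. N (\<kappa> i) (\<pi> i)) \<in> carrier R" if "\<kappa> \<in> I \<rightarrow> I" "\<pi> permutes I" for \<kappa> \<pi>
    using that N permutes_in_image[OF that(2)] by (intro finprod_closed) auto
  have cd: "det I (\<lambda>i. N (\<kappa> i)) \<in> carrier R" if "\<kappa> \<in> I \<rightarrow> I" for \<kappa>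
    using that N by (intro det_closed) auto
  have "det I (\<lambda>i j. \<Oplus>k\<in>I. M i k \<otimes> N k j)
      = (\<Oplus>\<pi>\<in>?S. \<Oplus>\<kappa>\<in>?F. (\<Otimes>i\<in>I. M i (\<kappa> i)) \<otimes> (psgn \<pi> \<otimes> (\<Otimes>i\<in>I. N (\<kappa> i) (\<pi> i))))"
    unfolding det_def
  proof (intro finsum_cong_on)
    fix \<pi> assume "\<pi> \<in> ?S"
    then have s: "\<pi> permutes I" by simp
    have "(\<Otimes>i\<in>I. \<Oplus>k\<in>I. M i k \<otimes> N k (\<pi> i)) = (\<Oplus>\<kappa>\<in>?F. \<Otimes>i\<in>I. M i (\<kappa> i) \<otimes> N (\<kappa> i) (\<pi> i))"
      using assms permutes_in_image[OF s] by (intro finprod_finsum) auto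
    also have "\<dots> = (\<Oplus>\<kappa>\<in>?F. (\<Otimes>i\<in>I. M i (\<kappa> i)) \<otimes> (\<Otimes>i\<in>I. N (\<kappa> i) (\<pi> i)))"
      using assms permutes_in_image[OF s] cM cN[OF _ s]
      by (intro finsum_cong_on finprod_multf) (auto simp: PiE_def Pi_def)
    finally have "psgn \<pi> \<otimes> (\<Otimes>i\<in>I. \<Oplus>k\<in>I. M i k \<otimes> N k (\<pi> i))
        = (\<Oplus>\<kappa>\<in>?F. psgn \<pi> \<otimes> ((\<Otimes>i\<in>I. M i (\<kappa> i)) \<otimes> (\<Otimes>i\<in>I. N (\<kappa> i) (\<pi> i))))"
      using fin cM cN[OF _ s] by (simp, subst finsum_lmult) (auto simp: PiE_def)
    also have "\<dots> = (\<Oplus>\<kappa>\<in>?F. (\<Otimes>i\<in>I. M i (\<kappa> i)) \<otimes> (psgn \<pi> \<otimes> (\<Otimes>i\<in>I. N (\<kappa> i) (\<pi> i))))"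
      using cM cN[OF _ s] by (intro finsum_cong_on m_lcomm) (auto simp: PiE_def)
    finally show "psgn \<pi> \<otimes> (\<Otimes>i\<in>I. \<Oplus>k\<in>I. M i k \<otimes> N k (\<pi> i))
        = (\<Oplus>\<kappa>\<in>?F. (\<Otimes>i\<in>I. M i (\<kappa> i)) \<otimes> (psgn \<pi> \<otimes> (\<Otimes>i\<in>I. N (\<kappa> i) (\<pi> i))))" .
    show "(\<Oplus>\<kappa>\<in>?F. (\<Otimes>i\<in>I. M i (\<kappa> i)) \<otimes> (psgn \<pi> \<otimes> (\<Otimes>i\<in>I. N (\<kappa> i) (\<pi> i)))) \<in> carrier R"
      using cM cN[OF _ s] by (intro finsum_closed) (auto simp: PiE_def)
  qed
  also have "\<dots> = (\<Oplus>\<kappa>\<in>?F. \<Oplus>\<pi>\<in>?S. (\<Otimes>i\<in>I. M i (\<kappa> i)) \<otimes> (psgn \<pi> \<otimes> (\<Otimes>i\<in>I. N (\<kappa> i) (\<pi> i))))"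
    using fin cM cN by (intro finsum_fubini) (auto simp: PiE_def)
  also have "\<dots> = (\<Oplus>\<kappa>\<in>?F. (\<Otimes>i\<in>I. M i (\<kappa> i)) \<otimes> det I (\<lambda>i. N (\<kappa> i)))"
    unfolding det_def using fin cM cN
    by (intro finsum_cong_on finsum_lmult[symmetric]) (auto simp: PiE_def)
  \<comment> \<open>A map that is not injective selects some row of N twice and contributes zero. An
    injective one is bijective since I is finite, hence is the restriction of a permutation.\<close>
  also have "\<dots> = (\<Oplus>\<kappa>\<in>(\<lambda>\<pi>. restrict \<pi> I) ` ?S. (\<Otimes>i\<in>I. M i (\<kappa> i)) \<otimes> det I (\<lambda>i. N (\<kappa> i)))"
  proof (rule add.finprod_mono_neutral_cong_right)
    show "finite ?F" by fact
    show "(\<lambda>\<pi>. restrict \<pi> I) ` ?S \<subseteq> ?F" by (auto simp: permutes_in_image)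
    show "(\<lambda>\<kappa>. (\<Otimes>i\<in>I. M i (\<kappa> i)) \<otimes> det I (\<lambda>i. N (\<kappa> i))) \<in> ?F \<rightarrow> carrier R"
      using cM cd by auto
    fix \<kappa> assume k: "\<kappa> \<in> ?F - (\<lambda>\<pi>. restrict \<pi> I) ` ?S"
    have "\<not> inj_on \<kappa> I"
    proof
      assume "inj_on \<kappa> I"
      moreover have "\<kappa> ` I \<subseteq> I" using k by (auto simp: PiE_def)
      ultimately have "bij_betw \<kappa> I I"
        using assms(1) by (simp add: bij_betw_def endo_inj_surj)
      then have "(\<lambda>i. if i \<in> I then \<kappa> i else i) permutes I"
        by (intro bij_imp_permutes) (auto cong: bij_betw_cong)
      moreover have "\<kappa> = restrict (\<lambda>i. if i \<in> I then \<kappa> i else i) I"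
        using k by (intro ext) (auto simp: PiE_def extensional_def)
      ultimately have "\<kappa> \<in> (\<lambda>\<pi>. restrict \<pi> I) ` ?S" by (intro image_eqI) auto
      then show False using k by simp
    qed
    then obtain p q where "p \<in> I" "q \<in> I" "p \<noteq> q" "\<kappa> p = \<kappa> q" by (auto simp: inj_on_def)
    moreover have "\<kappa> i \<in> I" if "i \<in> I" for i using k that by auto
    ultimately have "det I (\<lambda>i. N (\<kappa> i)) = \<zero>"
      using N assms(1) by (intro det_equal_rows[of I _ p q]) simp_all
    moreover have "(\<Otimes>i\<in>I. M i (\<kappa> i)) \<in> carrier R" using cM k by auto
    ultimately show "(\<Otimes>i\<in>I. M i (\<kappa> i)) \<otimes> det I (\<lambda>i. N (\<kappa> i)) = \<zero>" by simp
  qed auto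
  also have "\<dots> = (\<Oplus>\<pi>\<in>?S. (\<Otimes>i\<in>I. M i (restrict \<pi> I i)) \<otimes> det I (\<lambda>i. N (restrict \<pi> I i)))"
  proof (rule finsum_reindex)
    \<comment> \<open>Permutations of I are the identity off I, so they are determined by their
      restrictions.\<close>
    show "inj_on (\<lambda>\<pi>. restrict \<pi> I) ?S"
    proof (rule inj_onI)
      fix \<pi> \<tau> assume st: "\<pi> \<in> ?S" "\<tau> \<in> ?S" and e: "restrict \<pi> I = restrict \<tau> I"
      show "\<pi> = \<tau>"
      proof
        fix i show "\<pi> i = \<tau> i"
          using st fun_cong[OF e, of i] by (cases "i \<in> I") (auto simp: permutes_def)
      qed
    qed
    show "(\<lambda>\<kappa>. (\<Otimes>i\<in>I. M i (\<kappa> i)) \<otimes> det I (\<lambda>i. N (\<kappa> i))) \<in> (\<lambda>\<pi>. restrict \<pi> I) ` ?S \<rightarrow> carrier R"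
      using cM cd by (auto simp: permutes_in_image)
  qed
  also have "\<dots> = (\<Oplus>\<pi>\<in>?S. (psgn \<pi> \<otimes> (\<Otimes>i\<in>I. M i (\<pi> i))) \<otimes> det I N)"
  proof (intro finsum_cong_on)
    fix \<pi> assume "\<pi> \<in> ?S"
    then have s: "\<pi> permutes I" by simp
    have 1: "(\<Otimes>i\<in>I. M i (restrict \<pi> I i)) = (\<Otimes>i\<in>I. M i (\<pi> i))"
      using M permutes_in_image[OF s] by (intro finprod_cong_on) auto
    have 2: "det I (\<lambda>i. N (restrict \<pi> I i)) = det I (\<lambda>i. N (\<pi> i))"
      using N permutes_in_image[OF s] by (intro det_cong) auto
    show "(\<Otimes>i\<in>I. M i (restrict \<pi> I i)) \<otimes> det I (\<lambda>i. N (restrict \<pi> I i))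
        = (psgn \<pi> \<otimes> (\<Otimes>i\<in>I. M i (\<pi> i))) \<otimes> det I N"
      unfolding 1 2 using perm_prod_closed[of I M, OF M s] det_closed[of I N] N
        det_row_perm[of I N \<pi>] assms(1) s
      by (simp add: m_assoc m_lcomm)
    show "(psgn \<pi> \<otimes> (\<Otimes>i\<in>I. M i (\<pi> i))) \<otimes> det I N \<in> carrier R"
      using perm_prod_closed[of I M, OF M s] det_closed[of I N] N by simp
  qed
  also have "\<dots> = det I M \<otimes> det I N"
    unfolding det_def[of I M] using perm_prod_closed[of I M] M N fin det_closed[of I N]
    by (intro finsum_rmult[symmetric]) auto
  finally show ?thesis .
qed

text \<open>The hypothesis concerns permutations instead of off-diagonal entries so that it also
  covers the identity matrix with one row or one column replaced.\<close>

lemma det_diag: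
  fixes I :: "'i set"
  assumes "finite I" "\<And>i j. i \<in> I \<Longrightarrow> j \<in> I \<Longrightarrow> M i j \<in> carrier R"
    and "\<And>\<pi>. \<pi> permutes I \<Longrightarrow> \<pi> \<noteq> id \<Longrightarrow> \<exists>i\<in>I. M i (\<pi> i) = \<zero>"
  shows "det I M = (\<Otimes>i\<in>I. M i i)"
proof -
  have "det I M = psgn (id :: 'i \<Rightarrow> 'i) \<otimes> (\<Otimes>i\<in>I. M i (id i))"
    unfolding det_def
  proof (rule finsum_delta[where i = id])
    fix \<pi> assume s: "\<pi> \<in> {\<pi>. \<pi> permutes I}"
    show "psgn \<pi> \<otimes> (\<Otimes>i\<in>I. M i (\<pi> i)) \<in> carrier R"
      using s perm_prod_closed[of I M] assms by auto
    assume "\<pi> \<noteq> id"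
    then obtain i where "i \<in> I" "M i (\<pi> i) = \<zero>" using assms(3) s by auto
    then have "(\<Otimes>i\<in>I. M i (\<pi> i)) = \<zero>"
      using s assms permutes_in_image[of \<pi> I] by (intro finprod_zero_factor[of I i]) auto
    then show "psgn \<pi> \<otimes> (\<Otimes>i\<in>I. M i (\<pi> i)) = \<zero>" by simp
  qed (use assms in \<open>auto simp: finite_permutations permutes_id\<close>)
  then show ?thesis using assms(2) by (simp add: finprod_closed Pi_def)
qed

text \<open>A permutation that fixes every index other than q also fixes q by injectivity. Any
  permutation other than the identity therefore meets an off-diagonal zero in a row different from
  q.\<close>

lemma det_identity_except_row:
  assumes "finite I" "q \<in> I" "\<And>j. j \<in> I \<Longrightarrow> M q j \<in> carrier R"
    and "\<And>i j. i \<in> I \<Longrightarrow> j \<in> I \<Longrightarrow> i \<noteq> q \<Longrightarrow> M i j = (if i = j then \<one> else \<zero>)"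
  shows "det I M = M q q"
proof -
  have M: "M i j \<in> carrier R" if "i \<in> I" "j \<in> I" for i j
    using assms that by (cases "i = q") auto
  have "det I M = (\<Otimes>i\<in>I. M i i)"
  proof (rule det_diag[OF assms(1) M])
    fix \<pi> assume s: "\<pi> permutes I" "\<pi> \<noteq> id"
    have "\<exists>i\<in>I. i \<noteq> q \<and> \<pi> i \<noteq> i"
    proof (rule ccontr)
      assume "\<not> ?thesis"
      then have a: "\<pi> i = i" if "i \<noteq> q" for i using that s by (metis permutes_not_in)
      then have "\<pi> q = q" using s(1) by (metis permutes_inj injD)
      then show False using a s(2) by (metis eq_id_iff)
    qed
    then show "\<exists>i\<in>I. M i (\<pi> i) = \<zero>" using assms(4) permutes_in_image[OF s(1)] by metis
  qed
  also have "\<dots> = M q q \<otimes> (\<Otimes>i\<in>I - {q}. M i i)"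
    using assms M by (intro finprod_remove) auto
  also have "(\<Otimes>i\<in>I - {q}. M i i) = \<one>"
    using assms by (intro finprod_one_eqI) auto
  finally show ?thesis using assms by simp
qed

lemma det_identity:
  assumes "finite I"
  shows "det I (\<lambda>i j. if i = j then \<one> else \<zero>) = \<one>"
proof -
  have "det I (\<lambda>i j. if i = j then \<one> else \<zero>) = (\<Otimes>i\<in>I. if i = i then \<one> else \<zero>)"
  proof (rule det_diag[OF assms])
    fix \<pi> assume s: "\<pi> permutes I" "\<pi> \<noteq> id"
    then obtain i where "\<pi> i \<noteq> i" by (auto simp: fun_eq_iff)
    then show "\<exists>i\<in>I. (if i = \<pi> i then \<one> else \<zero>) = \<zero>" using s by (metis permutes_not_in)
  qed auto
  then show ?thesis by simp
qed

section \<open>Cofactors, Cramer's rule and the determinant trick\<close>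

text \<open>The signed minor, written as a sum over permutations of all of I with
  \<open>\<pi> p = q\<close>. In this form no smaller index set has to be renumbered and the sign is
  that of the permutation itself.\<close>

definition cofactor :: "'i set \<Rightarrow> ('i \<Rightarrow> 'i \<Rightarrow> 'a) \<Rightarrow> 'i \<Rightarrow> 'i \<Rightarrow> 'a"
  where "cofactor I M p q =
    (\<Oplus>\<pi>\<in>{\<pi> \<in> {\<pi>. \<pi> permutes I}. \<pi> p = q}. psgn \<pi> \<otimes> (\<Otimes>i\<in>I - {p}. M i (\<pi> i)))"

lemma cofactor_prod_closed:
  assumes "\<And>i j. i \<in> I \<Longrightarrow> j \<in> I \<Longrightarrow> M i j \<in> carrier R" "\<pi> permutes I"
  shows "(\<Otimes>i\<in>I - {p}. M i (\<pi> i)) \<in> carrier R"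
  using assms permutes_in_image[OF assms(2)] by (intro finprod_closed) auto

lemma cofactor_closed [intro]:
  assumes "\<And>i j. i \<in> I \<Longrightarrow> j \<in> I \<Longrightarrow> M i j \<in> carrier R"
  shows "cofactor I M p q \<in> carrier R"
  unfolding cofactor_def using cofactor_prod_closed[of I M] assms by (intro finsum_closed) auto

text \<open>A permutation with \<open>\<pi> p = q\<close> reaches column q from no other row, so the
  entries of row p and of column q do not occur.\<close>

lemma cofactor_cong:
  assumes "\<And>i j. i \<in> I \<Longrightarrow> j \<in> I \<Longrightarrow> i \<noteq> p \<Longrightarrow> j \<noteq> q \<Longrightarrow> M i j = N i j"
    and "\<And>i j. i \<in> I \<Longrightarrow> j \<in> I \<Longrightarrow> N i j \<in> carrier R"
  shows "cofactor I M p q = cofactor I N p q"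
proof -
  have "(\<Otimes>i\<in>I - {p}. M i (\<pi> i)) = (\<Otimes>i\<in>I - {p}. N i (\<pi> i))" if "\<pi> permutes I" "\<pi> p = q" for \<pi>
  proof (rule finprod_cong_on)
    fix i assume i: "i \<in> I - {p}"
    then have "\<pi> i \<noteq> q" using that by (metis DiffD2 injD insertI1 permutes_inj)
    then show "M i (\<pi> i) = N i (\<pi> i)" "N i (\<pi> i) \<in> carrier R"
      using assms i permutes_in_image[OF that(1)] by auto
  qed
  then show ?thesis
    unfolding cofactor_def using cofactor_prod_closed[of I N] assms by (intro finsum_cong_on) auto
qed

lemma laplace_aux:
  assumes "finite I" "\<And>i j. i \<in> I \<Longrightarrow> j \<in> I \<Longrightarrow> M i j \<in> carrier R" "p \<in> I" "q \<in> I"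
  shows "(\<Oplus>\<pi>\<in>{\<pi> \<in> {\<pi>. \<pi> permutes I}. \<pi> p = q}. psgn \<pi> \<otimes> (\<Otimes>i\<in>I. M i (\<pi> i)))
      = M p q \<otimes> cofactor I M p q"
proof -
  have c: "\<pi> permutes I \<Longrightarrow> (\<Otimes>i\<in>I - {p}. M i (\<pi> i)) \<in> carrier R" for \<pi>
    using cofactor_prod_closed[of I M] assms by auto
  have "(\<Oplus>\<pi>\<in>{\<pi> \<in> {\<pi>. \<pi> permutes I}. \<pi> p = q}. psgn \<pi> \<otimes> (\<Otimes>i\<in>I. M i (\<pi> i)))
      = (\<Oplus>\<pi>\<in>{\<pi> \<in> {\<pi>. \<pi> permutes I}. \<pi> p = q}. M p q \<otimes> (psgn \<pi> \<otimes> (\<Otimes>i\<in>I - {p}. M i (\<pi> i))))"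
  proof (intro finsum_cong_on)
    fix \<pi> assume "\<pi> \<in> {\<pi> \<in> {\<pi>. \<pi> permutes I}. \<pi> p = q}"
    then have s: "\<pi> permutes I" "\<pi> p = q" by auto
    have "(\<Otimes>i\<in>I. M i (\<pi> i)) = M p (\<pi> p) \<otimes> (\<Otimes>i\<in>I - {p}. M i (\<pi> i))"
      using assms permutes_in_image[OF s(1)] by (intro finprod_remove) auto
    then show "psgn \<pi> \<otimes> (\<Otimes>i\<in>I. M i (\<pi> i)) = M p q \<otimes> (psgn \<pi> \<otimes> (\<Otimes>i\<in>I - {p}. M i (\<pi> i)))"
      using s c assms by (simp add: m_lcomm)
    show "M p q \<otimes> (psgn \<pi> \<otimes> (\<Otimes>i\<in>I - {p}. M i (\<pi> i))) \<in> carrier R" using s c assms by simp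
  qed
  then show ?thesis
    unfolding cofactor_def using c assms finite_permutations[OF assms(1)]
    by (subst finsum_lmult) auto
qed

lemma laplace_row:
  assumes "finite I" "\<And>i j. i \<in> I \<Longrightarrow> j \<in> I \<Longrightarrow> M i j \<in> carrier R" "p \<in> I"
  shows "det I M = (\<Oplus>q\<in>I. M p q \<otimes> cofactor I M p q)"
proof -
  have "det I M = (\<Oplus>q\<in>I. \<Oplus>\<pi>\<in>{\<pi> \<in> {\<pi>. \<pi> permutes I}. \<pi> p = q}. psgn \<pi> \<otimes> (\<Otimes>i\<in>I. M i (\<pi> i)))"
    unfolding det_def using assms perm_prod_closed[of I M]
    by (intro finsum_partition) (auto simp: finite_permutations permutes_in_image)
  also have "\<dots> = (\<Oplus>q\<in>I. M p q \<otimes> cofactor I M p q)"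
    using assms cofactor_closed[of I M] by (intro finsum_cong_on laplace_aux) auto
  finally show ?thesis .
qed

text \<open>The permutations are sorted by the row that they send to q, which is the value of the
  inverse permutation at q; the fibres are those of the row expansion.\<close>

lemma laplace_col:
  assumes "finite I" "\<And>i j. i \<in> I \<Longrightarrow> j \<in> I \<Longrightarrow> M i j \<in> carrier R" "q \<in> I"
  shows "det I M = (\<Oplus>p\<in>I. M p q \<otimes> cofactor I M p q)"
proof -
  have e: "{\<pi> \<in> {\<pi>. \<pi> permutes I}. inv_into UNIV \<pi> q = p} = {\<pi> \<in> {\<pi>. \<pi> permutes I}. \<pi> p = q}" for p
    by (auto simp: permutes_inv_eq permutes_inverses)
  have "det I M = (\<Oplus>p\<in>I. \<Oplus>\<pi>\<in>{\<pi> \<in> {\<pi>. \<pi> permutes I}. inv_into UNIV \<pi> q = p}. psgn \<pi> \<otimes> (\<Otimes>i\<in>I. M i (\<pi> i)))"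
    unfolding det_def using assms perm_prod_closed[of I M]
    by (intro finsum_partition) (auto simp: finite_permutations permutes_in_image dest: permutes_inv)
  also have "\<dots> = (\<Oplus>p\<in>I. M p q \<otimes> cofactor I M p q)"
    unfolding e using assms cofactor_closed[of I M] by (intro finsum_cong_on laplace_aux) auto
  finally show ?thesis .
qed

text \<open>Expand along row p the matrix whose row p is replaced by row q. The cofactors along row
  p are unchanged, and for p different from q two rows coincide.\<close>

lemma adjugate_row:
  assumes "finite I" "\<And>i j. i \<in> I \<Longrightarrow> j \<in> I \<Longrightarrow> M i j \<in> carrier R" "p \<in> I" "q \<in> I"
  shows "(\<Oplus>i\<in>I. M q i \<otimes> cofactor I M p i) = (if p = q then det I M else \<zero>)"
proof -
  let ?N = "\<lambda>i. if i = p then M q else M i"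
  have "det I ?N = (\<Oplus>i\<in>I. ?N p i \<otimes> cofactor I ?N p i)"
    using assms by (intro laplace_row) auto
  also have "\<dots> = (\<Oplus>i\<in>I. M q i \<otimes> cofactor I M p i)"
  proof (intro finsum_cong_on)
    fix i assume i: "i \<in> I"
    have "cofactor I ?N p i = cofactor I M p i" using assms by (intro cofactor_cong) auto
    then show "?N p i \<otimes> cofactor I ?N p i = M q i \<otimes> cofactor I M p i" by simp
    show "M q i \<otimes> cofactor I M p i \<in> carrier R" using assms i cofactor_closed[of I M] by simp
  qed
  finally have e: "(\<Oplus>i\<in>I. M q i \<otimes> cofactor I M p i) = det I ?N" ..
  show ?thesis
  proof (cases "p = q")
    case True
    then have "det I ?N = det I M" using assms by (intro det_cong) auto
    then show ?thesis using e True by simp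
  next
    case False
    then have "det I ?N = \<zero>" using assms by (intro det_equal_rows[of I _ p q]) auto
    then show ?thesis using e False by simp
  qed
qed

lemma det_replace_col:
  assumes "finite I" "\<And>i j. i \<in> I \<Longrightarrow> j \<in> I \<Longrightarrow> M i j \<in> carrier R" "q \<in> I" "\<And>i. i \<in> I \<Longrightarrow> v i \<in> carrier R"
  shows "det I (\<lambda>i j. if j = q then v i else M i j) = (\<Oplus>p\<in>I. v p \<otimes> cofactor I M p q)"
proof -
  let ?N = "\<lambda>i j. if j = q then v i else M i j"
  have "det I ?N = (\<Oplus>p\<in>I. ?N p q \<otimes> cofactor I ?N p q)"
    using assms by (intro laplace_col) auto
  also have "\<dots> = (\<Oplus>p\<in>I. v p \<otimes> cofactor I M p q)"
  proof (intro finsum_cong_on)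
    fix p assume p: "p \<in> I"
    have "cofactor I ?N p q = cofactor I M p q" using assms by (intro cofactor_cong) auto
    then show "?N p q \<otimes> cofactor I ?N p q = v p \<otimes> cofactor I M p q" by simp
    show "v p \<otimes> cofactor I M p q \<in> carrier R" using assms p cofactor_closed[of I M] by simp
  qed
  finally show ?thesis .
qed

text \<open>Expanding the replaced columns in cofactors and exchanging the sums leaves the adjugate
  identity for row q. Nothing is divided by the determinant, so the formula is available in the
  tensor power before localization.\<close>

lemma cramer:
  assumes "finite I" and M: "\<And>i j. i \<in> I \<Longrightarrow> j \<in> I \<Longrightarrow> M i j \<in> carrier R"
    and "q \<in> I" and v: "\<And>i. i \<in> I \<Longrightarrow> v i \<in> carrier R"
  shows "det I M \<otimes> v q = (\<Oplus>k\<in>I. M q k \<otimes> det I (\<lambda>i j. if j = k then v i else M i j))"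
proof -
  have C: "cofactor I M i j \<in> carrier R" for i j using cofactor_closed M by auto
  have "(\<Oplus>k\<in>I. M q k \<otimes> det I (\<lambda>i j. if j = k then v i else M i j))
      = (\<Oplus>k\<in>I. \<Oplus>p\<in>I. v p \<otimes> (M q k \<otimes> cofactor I M p k))"
  proof (intro finsum_cong_on)
    fix k assume k: "k \<in> I"
    have "M q k \<otimes> det I (\<lambda>i j. if j = k then v i else M i j)
        = (\<Oplus>p\<in>I. M q k \<otimes> (v p \<otimes> cofactor I M p k))"
      using assms k C by (simp add: det_replace_col finsum_lmult)
    also have "\<dots> = (\<Oplus>p\<in>I. v p \<otimes> (M q k \<otimes> cofactor I M p k))"
      using assms k C by (intro finsum_cong_on m_lcomm) auto
    finally show "M q k \<otimes> det I (\<lambda>i j. if j = k then v i else M i j)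
        = (\<Oplus>p\<in>I. v p \<otimes> (M q k \<otimes> cofactor I M p k))" .
    show "(\<Oplus>p\<in>I. v p \<otimes> (M q k \<otimes> cofactor I M p k)) \<in> carrier R"
      using assms k C by (intro finsum_closed) auto
  qed
  also have "\<dots> = (\<Oplus>p\<in>I. \<Oplus>k\<in>I. v p \<otimes> (M q k \<otimes> cofactor I M p k))"
    using assms C by (intro finsum_fubini) auto
  also have "\<dots> = (\<Oplus>p\<in>I. v p \<otimes> (if p = q then det I M else \<zero>))"
  proof (intro finsum_cong_on)
    fix p assume p: "p \<in> I"
    have "(\<Oplus>k\<in>I. v p \<otimes> (M q k \<otimes> cofactor I M p k)) = v p \<otimes> (\<Oplus>k\<in>I. M q k \<otimes> cofactor I M p k)"
      using assms p C by (intro finsum_lmult[symmetric]) auto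
    then show "(\<Oplus>k\<in>I. v p \<otimes> (M q k \<otimes> cofactor I M p k)) = v p \<otimes> (if p = q then det I M else \<zero>)"
      using adjugate_row[of I M p q] assms p by simp
    show "v p \<otimes> (if p = q then det I M else \<zero>) \<in> carrier R" using p v det_closed[of I M] M by auto
  qed
  also have "\<dots> = v q \<otimes> (if q = q then det I M else \<zero>)"
    using assms det_closed[of I M] by (intro finsum_delta) auto
  also have "\<dots> = det I M \<otimes> v q" using assms det_closed[of I M] by (simp add: m_comm)
  finally show ?thesis ..
qed

text \<open>Let X be the identity matrix with column q replaced by v. Its determinant is v q,
  whereas column q of the product MX is Mv = 0. This serves both the Nakayama argument and the
  nondegeneracy of the trace form.\<close>

lemma det_annihilates_kernel:
  assumes "finite I" and M: "\<And>i j. i \<in> I \<Longrightarrow> j \<in> I \<Longrightarrow> M i j \<in> carrier R"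
    and v: "\<And>i. i \<in> I \<Longrightarrow> v i \<in> carrier R"
    and ker: "\<And>i. i \<in> I \<Longrightarrow> (\<Oplus>j\<in>I. M i j \<otimes> v j) = \<zero>" and "q \<in> I"
  shows "det I M \<otimes> v q = \<zero>"
proof -
  let ?X = "\<lambda>i j. if j = q then v i else if i = j then \<one> else \<zero>"
  have X: "?X i j \<in> carrier R" if "i \<in> I" "j \<in> I" for i j using that v by auto
  have "det I ?X = (\<Otimes>i\<in>I. ?X i i)"
  proof (rule det_diag[OF assms(1) X])
    fix \<pi> assume s: "\<pi> permutes I" "\<pi> \<noteq> id"
    \<comment> \<open>Otherwise q is fixed, and then by injectivity no other index is sent to q, so
      that all indices are fixed.\<close>
    have "\<exists>i\<in>I. \<pi> i \<noteq> q \<and> \<pi> i \<noteq> i"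
    proof (rule ccontr)
      assume n: "\<not> ?thesis"
      then have a: "\<pi> i = i" if "\<pi> i \<noteq> q" for i using that s by (metis permutes_not_in)
      have "\<pi> q = q" using a s(1) by (metis permutes_inj injD)
      then have "\<pi> i = i" for i using a s(1) by (metis permutes_inj injD)
      then show False using s(2) by (metis eq_id_iff)
    qed
    then obtain i where "i \<in> I" "\<pi> i \<noteq> q" "\<pi> i \<noteq> i" by auto
    then show "\<exists>i\<in>I. ?X i (\<pi> i) = \<zero>" by (intro bexI[of _ i]) auto
  qed auto
  also have "\<dots> = ?X q q \<otimes> (\<Otimes>i\<in>I - {q}. ?X i i)"
    using assms X by (intro finprod_remove) auto
  also have "(\<Otimes>i\<in>I - {q}. ?X i i) = \<one>" by (intro finprod_one_eqI) auto
  finally have dX: "det I ?X = v q" using assms by simp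
  have "det I M \<otimes> v q = det I (\<lambda>i j. \<Oplus>k\<in>I. M i k \<otimes> ?X k j)"
    using det_mult[OF assms(1) M X] dX by simp
  also have "\<dots> = (\<Oplus>p\<in>I. (\<Oplus>k\<in>I. M p k \<otimes> ?X k q) \<otimes> cofactor I (\<lambda>i j. \<Oplus>k\<in>I. M i k \<otimes> ?X k j) p q)"
    using assms X by (intro laplace_col) (auto intro!: finsum_closed)
  also have "\<dots> = (\<Oplus>p\<in>I. \<zero>)"
  proof (rule finsum_cong_on)
    fix p assume "p \<in> I"
    then have "(\<Oplus>k\<in>I. M p k \<otimes> ?X k q) = \<zero>" using ker by simp
    moreover have "cofactor I (\<lambda>i j. \<Oplus>k\<in>I. M i k \<otimes> ?X k j) p q \<in> carrier R"
      using M X by (intro cofactor_closed finsum_closed) auto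
    ultimately show "(\<Oplus>k\<in>I. M p k \<otimes> ?X k q) \<otimes> cofactor I (\<lambda>i j. \<Oplus>k\<in>I. M i k \<otimes> ?X k j) p q = \<zero>" by simp
  qed auto
  finally show ?thesis by (simp add: finsum_zero)
qed

text \<open>The left-hand side is the derivative of the determinant in the direction diag(d) M.
  After expansion in cofactors, summing over the columns first gives the expansion of det M along
  row p, weighted by d p. With d p = \<phi>_p(z) the factor becomes the power sum of z.\<close>

lemma det_diagonal_derivation:
  assumes "finite I" and M: "\<And>i j. i \<in> I \<Longrightarrow> j \<in> I \<Longrightarrow> M i j \<in> carrier R"
    and d: "\<And>i. i \<in> I \<Longrightarrow> d i \<in> carrier R"
  shows "(\<Oplus>k\<in>I. det I (\<lambda>i j. if j = k then d i \<otimes> M i j else M i j)) = (\<Oplus>i\<in>I. d i) \<otimes> det I M"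
proof -
  have C: "cofactor I M i j \<in> carrier R" for i j using cofactor_closed M by auto
  have "(\<Oplus>k\<in>I. det I (\<lambda>i j. if j = k then d i \<otimes> M i j else M i j))
      = (\<Oplus>k\<in>I. \<Oplus>p\<in>I. d p \<otimes> (M p k \<otimes> cofactor I M p k))"
  proof (intro finsum_cong_on)
    fix k assume k: "k \<in> I"
    have "det I (\<lambda>i j. if j = k then d i \<otimes> M i j else M i j) = det I (\<lambda>i j. if j = k then d i \<otimes> M i k else M i j)"
      using assms k by (intro det_cong) auto
    also have "\<dots> = (\<Oplus>p\<in>I. (d p \<otimes> M p k) \<otimes> cofactor I M p k)"
      using assms k by (intro det_replace_col) auto
    also have "\<dots> = (\<Oplus>p\<in>I. d p \<otimes> (M p k \<otimes> cofactor I M p k))"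
      using assms k C by (intro finsum_cong_on m_assoc) auto
    finally show "det I (\<lambda>i j. if j = k then d i \<otimes> M i j else M i j) = (\<Oplus>p\<in>I. d p \<otimes> (M p k \<otimes> cofactor I M p k))" .
    show "(\<Oplus>p\<in>I. d p \<otimes> (M p k \<otimes> cofactor I M p k)) \<in> carrier R"
      using assms k C by (intro finsum_closed) auto
  qed
  also have "\<dots> = (\<Oplus>p\<in>I. \<Oplus>k\<in>I. d p \<otimes> (M p k \<otimes> cofactor I M p k))"
    using assms C by (intro finsum_fubini) auto
  also have "\<dots> = (\<Oplus>p\<in>I. d p \<otimes> det I M)"
    using assms C det_closed[of I M]
    by (intro finsum_cong_on) (auto simp: finsum_lmult[symmetric] laplace_row[symmetric])
  also have "\<dots> = (\<Oplus>p\<in>I. d p) \<otimes> det I M"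
    using assms det_closed[of I M] by (intro finsum_rmult[symmetric]) auto
  finally show ?thesis .
qed

end

lemma (in ring_hom_cring) hom_psgn: "h (R.psgn \<pi>) = S.psgn \<pi>"
  by (simp add: R.psgn_cases S.psgn_cases)

lemma (in ring_hom_cring) hom_det:
  assumes "finite I" "\<And>i j. i \<in> I \<Longrightarrow> j \<in> I \<Longrightarrow> M i j \<in> carrier R"
  shows "h (R.det I M) = S.det I (\<lambda>i j. h (M i j))"
proof -
  have c: "\<pi> permutes I \<Longrightarrow> (\<Otimes>\<^bsub>R\<^esub>i\<in>I. M i (\<pi> i)) \<in> carrier R" for \<pi>
    using R.perm_prod_closed[of I M] assms by auto
  have "h (R.det I M) = (\<Oplus>\<^bsub>S\<^esub>\<pi>\<in>{\<pi>. \<pi> permutes I}. h (R.psgn \<pi> \<otimes>\<^bsub>R\<^esub> (\<Otimes>\<^bsub>R\<^esub>i\<in>I. M i (\<pi> i))))"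
    unfolding R.det_def using c by (subst hom_finsum) (auto simp: o_def)
  also have "\<dots> = S.det I (\<lambda>i j. h (M i j))"
    unfolding S.det_def
  proof (rule S.finsum_cong_on)
    fix \<pi> assume "\<pi> \<in> {\<pi>. \<pi> permutes I}"
    then have s: "\<pi> permutes I" by simp
    have "h (\<Otimes>\<^bsub>R\<^esub>i\<in>I. M i (\<pi> i)) = (\<Otimes>\<^bsub>S\<^esub>i\<in>I. h (M i (\<pi> i)))"
      using assms permutes_in_image[OF s] by (subst hom_finprod) (auto simp: o_def)
    then show "h (R.psgn \<pi> \<otimes>\<^bsub>R\<^esub> (\<Otimes>\<^bsub>R\<^esub>i\<in>I. M i (\<pi> i))) = S.psgn \<pi> \<otimes>\<^bsub>S\<^esub> (\<Otimes>\<^bsub>S\<^esub>i\<in>I. h (M i (\<pi> i)))"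
      using c s by (simp add: hom_psgn)
    show "S.psgn \<pi> \<otimes>\<^bsub>S\<^esub> (\<Otimes>\<^bsub>S\<^esub>i\<in>I. h (M i (\<pi> i))) \<in> carrier S"
      using assms permutes_in_image[OF s] by (intro S.m_closed S.finprod_closed) auto
  qed
  finally show ?thesis .
qed

lemma (in cring) det_transpose:
  assumes "finite I" "\<And>i j. i \<in> I \<Longrightarrow> j \<in> I \<Longrightarrow> M i j \<in> carrier R"
  shows "det I (\<lambda>i j. M j i) = det I M"
proof -
  have bij: "bij_betw (inv_into UNIV) {\<pi>. \<pi> permutes I} {\<pi>. \<pi> permutes I}"
    by (rule bij_betw_byWitness[where f' = "inv_into UNIV"])
       (auto intro: permutes_inv simp: permutes_inv_inv)
  have "det I M = (\<Oplus>\<pi>\<in>{\<pi>. \<pi> permutes I}. psgn (inv_into UNIV \<pi>) \<otimes> (\<Otimes>i\<in>I. M i (inv_into UNIV \<pi> i)))"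
    unfolding det_def using perm_prod_closed[of I M] assms by (intro finsum_reindex_bij[OF bij]) auto
  also have "\<dots> = det I (\<lambda>i j. M j i)"
    unfolding det_def
  proof (rule finsum_cong_on)
    fix \<pi> assume "\<pi> \<in> {\<pi>. \<pi> permutes I}"
    then have p: "\<pi> permutes I" by simp
    have "(\<Otimes>i\<in>I. M i (inv_into UNIV \<pi> i)) = (\<Otimes>i\<in>I. M (\<pi> i) (inv_into UNIV \<pi> (\<pi> i)))"
      using assms p permutes_in_image[OF permutes_inv[OF p]] by (intro finprod_reindex_bij permutes_imp_bij) auto
    also have "\<dots> = (\<Otimes>i\<in>I. M (\<pi> i) i)"
      using assms permutes_in_image[OF p] by (intro finprod_cong_on) (auto simp: permutes_inverses[OF p])
    finally show "psgn (inv_into UNIV \<pi>) \<otimes> (\<Otimes>i\<in>I. M i (inv_into UNIV \<pi> i)) = psgn \<pi> \<otimes> (\<Otimes>i\<in>I. M (\<pi> i) i)"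
      using psgn_inv[OF assms(1) p] by simp
    show "psgn \<pi> \<otimes> (\<Otimes>i\<in>I. M (\<pi> i) i) \<in> carrier R"
      using assms permutes_in_image[OF p] by (intro m_closed finprod_closed) auto
  qed
  finally show ?thesis ..
qed

section \<open>Monoid algebras and their presented quotients\<close>

locale comm_monoid_algebra = A: cring A + G: comm_monoid G
  for A :: "('a, 'k) ring_scheme" and G :: "('g, 'l) monoid_scheme"
begin

abbreviation F :: "('a, 'g \<Rightarrow> 'a) module" where "F \<equiv> monoid_algebra A G"

definition monomial :: "'a \<Rightarrow> 'g \<Rightarrow> 'g \<Rightarrow> 'a"
  where "monomial a g = (\<lambda>y. if y = g then a else \<zero>\<^bsub>A\<^esub>)"

definition supp :: "('g \<Rightarrow> 'a) \<Rightarrow> 'g set"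
  where "supp u = {g. u g \<noteq> \<zero>\<^bsub>A\<^esub>}"

lemma F_simps:
  "carrier F = {u. (\<forall>y. u y \<in> carrier A) \<and> finite (supp u) \<and> (\<forall>y. y \<notin> carrier G \<longrightarrow> u y = \<zero>\<^bsub>A\<^esub>)}"
  "\<zero>\<^bsub>F\<^esub> = (\<lambda>y. \<zero>\<^bsub>A\<^esub>)" "u \<oplus>\<^bsub>F\<^esub> v = (\<lambda>y. u y \<oplus>\<^bsub>A\<^esub> v y)" "a \<odot>\<^bsub>F\<^esub> u = (\<lambda>y. a \<otimes>\<^bsub>A\<^esub> u y)"
  "\<one>\<^bsub>F\<^esub> = monomial \<one>\<^bsub>A\<^esub> \<one>\<^bsub>G\<^esub>"
  "u \<otimes>\<^bsub>F\<^esub> v = (\<lambda>h. \<Oplus>\<^bsub>A\<^esub>p \<in> {(g, g'). u g \<noteq> \<zero>\<^bsub>A\<^esub> \<and> v g' \<noteq> \<zero>\<^bsub>A\<^esub> \<and> g \<otimes>\<^bsub>G\<^esub> g' = h}. u (fst p) \<otimes>\<^bsub>A\<^esub> v (snd p))"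
  by (simp_all add: monoid_algebra_def free_module_def supp_def monomial_def basis_elt_def)

lemma basis_elt_eq: "basis_elt A g = monomial \<one>\<^bsub>A\<^esub> g"
  by (simp add: basis_elt_def monomial_def)

lemma F_carrierD:
  assumes "u \<in> carrier F"
  shows "u y \<in> carrier A" "finite (supp u)" "supp u \<subseteq> carrier G"
  using assms unfolding F_simps by (auto simp: supp_def)

lemma monomial_closed [simp, intro]: "a \<in> carrier A \<Longrightarrow> g \<in> carrier G \<Longrightarrow> monomial a g \<in> carrier F"
  unfolding F_simps by (auto simp: monomial_def supp_def)

lemma supp_monomial: "supp (monomial a g) \<subseteq> {g}"
  by (auto simp: monomial_def supp_def)

lemma F_abelian_group: "abelian_group F"
proof (rule abelian_groupI)
  fix u v assume uv: "u \<in> carrier F" "v \<in> carrier F"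
  have "supp (u \<oplus>\<^bsub>F\<^esub> v) \<subseteq> supp u \<union> supp v" by (auto simp: supp_def F_simps)
  moreover have "finite (supp u \<union> supp v)" using uv F_carrierD by blast
  ultimately have "finite (supp (u \<oplus>\<^bsub>F\<^esub> v))" by (rule finite_subset)
  then show "u \<oplus>\<^bsub>F\<^esub> v \<in> carrier F" using uv by (auto simp: F_simps)
  show "u \<oplus>\<^bsub>F\<^esub> v = v \<oplus>\<^bsub>F\<^esub> u" using uv by (auto simp: F_simps A.a_comm)
next
  fix u assume u: "u \<in> carrier F"
  have "supp (\<lambda>y. \<ominus>\<^bsub>A\<^esub> u y) = supp u" using u by (auto simp: supp_def F_simps)
  then show "\<exists>v\<in>carrier F. v \<oplus>\<^bsub>F\<^esub> u = \<zero>\<^bsub>F\<^esub>"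
    using u by (intro bexI[of _ "\<lambda>y. \<ominus>\<^bsub>A\<^esub> u y"]) (auto simp: F_simps A.l_neg)
qed (auto simp: F_simps A.a_assoc supp_def)

sublocale F: abelian_group F by (rule F_abelian_group)

text \<open>Induction on the size of the support, splitting off one monomial at a time; additive
  statements are thereby reduced to monomials.\<close>

lemma F_induct [consumes 1, case_names zero add]:
  assumes "u \<in> carrier F" and "Q \<zero>\<^bsub>F\<^esub>"
    and step: "\<And>a g u. a \<in> carrier A \<Longrightarrow> g \<in> carrier G \<Longrightarrow> u \<in> carrier F \<Longrightarrow> Q u \<Longrightarrow> Q (monomial a g \<oplus>\<^bsub>F\<^esub> u)"
  shows "Q u"
  using assms(1)
proof (induction "card (supp u)" arbitrary: u)
  case 0
  then have "supp u = {}" using F_carrierD by simp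
  then have "u = \<zero>\<^bsub>F\<^esub>" by (auto simp: supp_def F_simps)
  then show ?case using assms(2) by simp
next
  case (Suc k)
  then obtain g where g: "g \<in> supp u" by (metis card.empty ex_in_conv nat.distinct(1))
  let ?v = "u(g := \<zero>\<^bsub>A\<^esub>)"
  have s: "supp ?v = supp u - {g}" by (auto simp: supp_def)
  then have v: "?v \<in> carrier F" using Suc(3) by (auto simp: F_simps)
  have "card (supp ?v) = k" using Suc g F_carrierD s by simp
  then have "Q ?v" using Suc(1) v by blast
  moreover have "u = monomial (u g) g \<oplus>\<^bsub>F\<^esub> ?v"
    using F_carrierD[OF Suc(3)] by (auto simp: F_simps monomial_def)
  ultimately show ?case
    using step[of "u g" g ?v] F_carrierD[OF Suc(3)] g v by auto
qed

text \<open>The defining convolution runs over the supports, which change with the factors. Fixed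
  finite sets containing the supports make several products comparable term by term.\<close>

lemma F_mult_over:
  assumes "u \<in> carrier F" "v \<in> carrier F" "finite S" "finite S'" "supp u \<subseteq> S" "supp v \<subseteq> S'"
  shows "(u \<otimes>\<^bsub>F\<^esub> v) h = (\<Oplus>\<^bsub>A\<^esub>p\<in>{p \<in> S \<times> S'. fst p \<otimes>\<^bsub>G\<^esub> snd p = h}. u (fst p) \<otimes>\<^bsub>A\<^esub> v (snd p))"
proof -
  have c: "u g \<in> carrier A" "v g \<in> carrier A" for g using assms F_carrierD by blast+
  show ?thesis
    unfolding F_simps(6)
    by (rule A.add.finprod_mono_neutral_cong_left)
       (use assms(3-) c in \<open>auto simp: supp_def\<close>)
qed

lemma F_mult_closed:
  assumes "u \<in> carrier F" "v \<in> carrier F"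
  shows "u \<otimes>\<^bsub>F\<^esub> v \<in> carrier F"
proof -
  have c: "u g \<in> carrier A" "v g \<in> carrier A" for g using assms F_carrierD by blast+
  have z: "(u \<otimes>\<^bsub>F\<^esub> v) h = \<zero>\<^bsub>A\<^esub>" if "h \<notin> (\<lambda>p. fst p \<otimes>\<^bsub>G\<^esub> snd p) ` (supp u \<times> supp v)" for h
  proof -
    have e: "{(g, g'). u g \<noteq> \<zero>\<^bsub>A\<^esub> \<and> v g' \<noteq> \<zero>\<^bsub>A\<^esub> \<and> g \<otimes>\<^bsub>G\<^esub> g' = h} = {}"
      using that by (force simp: supp_def)
    show ?thesis unfolding F_simps e by simp
  qed
  have "supp (u \<otimes>\<^bsub>F\<^esub> v) \<subseteq> (\<lambda>p. fst p \<otimes>\<^bsub>G\<^esub> snd p) ` (supp u \<times> supp v)"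
    using z by (auto simp: supp_def)
  then have "finite (supp (u \<otimes>\<^bsub>F\<^esub> v))"
    using assms F_carrierD by (meson finite_SigmaI finite_imageI finite_subset)
  moreover have "(u \<otimes>\<^bsub>F\<^esub> v) h = \<zero>\<^bsub>A\<^esub>" if "h \<notin> carrier G" for h
    using z[of h] that F_carrierD(3)[OF assms(1)] F_carrierD(3)[OF assms(2)] by fastforce
  moreover have "(u \<otimes>\<^bsub>F\<^esub> v) h \<in> carrier A" for h
    unfolding F_simps using c by (intro A.finsum_closed) auto
  ultimately show ?thesis unfolding F_simps(1) by blast
qed

lemma F_l_distr:
  assumes "u \<in> carrier F" "v \<in> carrier F" "w \<in> carrier F"
  shows "(u \<oplus>\<^bsub>F\<^esub> v) \<otimes>\<^bsub>F\<^esub> w = u \<otimes>\<^bsub>F\<^esub> w \<oplus>\<^bsub>F\<^esub> v \<otimes>\<^bsub>F\<^esub> w"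
proof
  fix h
  have c: "u g \<in> carrier A" "v g \<in> carrier A" "w g \<in> carrier A" for g using assms F_carrierD by blast+
  let ?S = "supp u \<union> supp v" and ?S' = "supp w"
  have f: "finite ?S" "finite ?S'" using assms F_carrierD by auto
  let ?P = "{p \<in> ?S \<times> ?S'. fst p \<otimes>\<^bsub>G\<^esub> snd p = h}"
  have s: "supp (u \<oplus>\<^bsub>F\<^esub> v) \<subseteq> ?S" by (auto simp: supp_def F_simps)
  have "((u \<oplus>\<^bsub>F\<^esub> v) \<otimes>\<^bsub>F\<^esub> w) h = (\<Oplus>\<^bsub>A\<^esub>p\<in>?P. (u \<oplus>\<^bsub>F\<^esub> v) (fst p) \<otimes>\<^bsub>A\<^esub> w (snd p))"
    using assms f s by (intro F_mult_over) auto
  also have "\<dots> = (\<Oplus>\<^bsub>A\<^esub>p\<in>?P. u (fst p) \<otimes>\<^bsub>A\<^esub> w (snd p) \<oplus>\<^bsub>A\<^esub> v (fst p) \<otimes>\<^bsub>A\<^esub> w (snd p))"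
    using c by (intro A.finsum_cong_on) (auto simp: F_simps A.l_distr)
  also have "\<dots> = (\<Oplus>\<^bsub>A\<^esub>p\<in>?P. u (fst p) \<otimes>\<^bsub>A\<^esub> w (snd p)) \<oplus>\<^bsub>A\<^esub> (\<Oplus>\<^bsub>A\<^esub>p\<in>?P. v (fst p) \<otimes>\<^bsub>A\<^esub> w (snd p))"
    using c by (intro A.finsum_addf) auto
  also have "(\<Oplus>\<^bsub>A\<^esub>p\<in>?P. u (fst p) \<otimes>\<^bsub>A\<^esub> w (snd p)) = (u \<otimes>\<^bsub>F\<^esub> w) h"
    using assms f by (intro F_mult_over[symmetric]) auto
  also have "(\<Oplus>\<^bsub>A\<^esub>p\<in>?P. v (fst p) \<otimes>\<^bsub>A\<^esub> w (snd p)) = (v \<otimes>\<^bsub>F\<^esub> w) h"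
    using assms f by (intro F_mult_over[symmetric]) auto
  finally show "((u \<oplus>\<^bsub>F\<^esub> v) \<otimes>\<^bsub>F\<^esub> w) h = (u \<otimes>\<^bsub>F\<^esub> w \<oplus>\<^bsub>F\<^esub> v \<otimes>\<^bsub>F\<^esub> w) h"
    by (simp add: F_simps(3))
qed

lemma F_comm:
  assumes "u \<in> carrier F" "v \<in> carrier F"
  shows "u \<otimes>\<^bsub>F\<^esub> v = v \<otimes>\<^bsub>F\<^esub> u"
proof
  fix h
  have c: "u g \<in> carrier A" "v g \<in> carrier A" for g using assms F_carrierD by blast+
  have s: "supp u \<subseteq> carrier G" "supp v \<subseteq> carrier G" using assms F_carrierD by auto
  have f: "finite (supp u)" "finite (supp v)" using assms F_carrierD by auto
  let ?P = "{p \<in> supp u \<times> supp v. fst p \<otimes>\<^bsub>G\<^esub> snd p = h}"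
  let ?P' = "{p \<in> supp v \<times> supp u. fst p \<otimes>\<^bsub>G\<^esub> snd p = h}"
  have bij: "bij_betw prod.swap ?P' ?P"
    by (rule bij_betw_byWitness[where f' = prod.swap]) (use s in \<open>auto simp: G.m_comm subset_iff\<close>)
  have "(u \<otimes>\<^bsub>F\<^esub> v) h = (\<Oplus>\<^bsub>A\<^esub>p\<in>?P. u (fst p) \<otimes>\<^bsub>A\<^esub> v (snd p))"
    using assms f by (intro F_mult_over) auto
  also have "\<dots> = (\<Oplus>\<^bsub>A\<^esub>p\<in>?P'. u (fst (prod.swap p)) \<otimes>\<^bsub>A\<^esub> v (snd (prod.swap p)))"
    using c by (intro A.finsum_reindex_bij[OF bij]) auto
  also have "\<dots> = (\<Oplus>\<^bsub>A\<^esub>p\<in>?P'. v (fst p) \<otimes>\<^bsub>A\<^esub> u (snd p))"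
    using c by (intro A.finsum_cong_on) (auto simp: A.m_comm)
  also have "\<dots> = (v \<otimes>\<^bsub>F\<^esub> u) h"
    using assms f by (intro F_mult_over[symmetric]) auto
  finally show "(u \<otimes>\<^bsub>F\<^esub> v) h = (v \<otimes>\<^bsub>F\<^esub> u) h" .
qed

lemma F_r_distr:
  assumes "u \<in> carrier F" "v \<in> carrier F" "w \<in> carrier F"
  shows "w \<otimes>\<^bsub>F\<^esub> (u \<oplus>\<^bsub>F\<^esub> v) = w \<otimes>\<^bsub>F\<^esub> u \<oplus>\<^bsub>F\<^esub> w \<otimes>\<^bsub>F\<^esub> v"
  using assms F_l_distr F_comm F.a_closed by metis

lemma monomial_mult:
  assumes "a \<in> carrier A" "b \<in> carrier A" "g \<in> carrier G" "h \<in> carrier G"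
  shows "monomial a g \<otimes>\<^bsub>F\<^esub> monomial b h = monomial (a \<otimes>\<^bsub>A\<^esub> b) (g \<otimes>\<^bsub>G\<^esub> h)"
proof
  fix k
  have "(monomial a g \<otimes>\<^bsub>F\<^esub> monomial b h) k
      = (\<Oplus>\<^bsub>A\<^esub>p\<in>{p \<in> {g} \<times> {h}. fst p \<otimes>\<^bsub>G\<^esub> snd p = k}. monomial a g (fst p) \<otimes>\<^bsub>A\<^esub> monomial b h (snd p))"
    using assms supp_monomial by (intro F_mult_over) auto
  also have "{p \<in> {g} \<times> {h}. fst p \<otimes>\<^bsub>G\<^esub> snd p = k} = (if g \<otimes>\<^bsub>G\<^esub> h = k then {(g, h)} else {})" by auto
  finally show "(monomial a g \<otimes>\<^bsub>F\<^esub> monomial b h) k = monomial (a \<otimes>\<^bsub>A\<^esub> b) (g \<otimes>\<^bsub>G\<^esub> h) k"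
    using assms by (auto simp: monomial_def)
qed

lemma F_zero_mult: "u \<in> carrier F \<Longrightarrow> \<zero>\<^bsub>F\<^esub> \<otimes>\<^bsub>F\<^esub> u = \<zero>\<^bsub>F\<^esub>"
  by (simp add: F_simps)

text \<open>Both sides are additive in each argument, so monomials suffice, one argument at a time
  starting from the right; for monomials it is associativity in A and in the monoid.\<close>

lemma F_assoc:
  assumes "u \<in> carrier F" "v \<in> carrier F" "w \<in> carrier F"
  shows "(u \<otimes>\<^bsub>F\<^esub> v) \<otimes>\<^bsub>F\<^esub> w = u \<otimes>\<^bsub>F\<^esub> (v \<otimes>\<^bsub>F\<^esub> w)"
proof -
  have zr: "u \<in> carrier F \<Longrightarrow> u \<otimes>\<^bsub>F\<^esub> \<zero>\<^bsub>F\<^esub> = \<zero>\<^bsub>F\<^esub>" for u by (simp add: F_simps)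
  have 1: "(monomial a g \<otimes>\<^bsub>F\<^esub> monomial b h) \<otimes>\<^bsub>F\<^esub> w = monomial a g \<otimes>\<^bsub>F\<^esub> (monomial b h \<otimes>\<^bsub>F\<^esub> w)"
    if "a \<in> carrier A" "g \<in> carrier G" "b \<in> carrier A" "h \<in> carrier G" "w \<in> carrier F" for a b g h w
    using that(5)
  proof (induction w rule: F_induct)
    case zero
    then show ?case using that by (simp add: zr F_mult_closed)
  next
    case (add c k w)
    then show ?case
      using that by (simp add: F_r_distr F_mult_closed monomial_mult A.m_assoc G.m_assoc)
  qed
  have 2: "(monomial a g \<otimes>\<^bsub>F\<^esub> v) \<otimes>\<^bsub>F\<^esub> w = monomial a g \<otimes>\<^bsub>F\<^esub> (v \<otimes>\<^bsub>F\<^esub> w)"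
    if "a \<in> carrier A" "g \<in> carrier G" "v \<in> carrier F" "w \<in> carrier F" for a g v w
    using that(3)
  proof (induction v rule: F_induct)
    case zero
    then show ?case using that by (simp add: zr F_zero_mult F_mult_closed)
  next
    case (add c k v)
    then show ?case
      using that 1[of a g c k w] by (simp add: F_r_distr F_l_distr F_mult_closed)
  qed
  show ?thesis
    using assms(1)
  proof (induction u rule: F_induct)
    case zero
    then show ?case using assms by (simp add: F_zero_mult F_mult_closed)
  next
    case (add c k u)
    then show ?case
      using assms 2[of c k v w] by (simp add: F_l_distr F_mult_closed)
  qed
qed

lemma F_cring: "cring F"
proof (rule cringI[OF F_abelian_group comm_monoidI])
  fix u assume "u \<in> carrier F"
  then show "\<one>\<^bsub>F\<^esub> \<otimes>\<^bsub>F\<^esub> u = u"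
  proof (induction u rule: F_induct)
    case zero
    then show ?case by (simp add: F_simps)
  next
    case (add a g u)
    then show ?case by (simp add: F_simps(5) F_r_distr monomial_mult)
  qed
next
  fix u v w assume "u \<in> carrier F" "v \<in> carrier F" "w \<in> carrier F"
  then show "(u \<oplus>\<^bsub>F\<^esub> v) \<otimes>\<^bsub>F\<^esub> w = u \<otimes>\<^bsub>F\<^esub> w \<oplus>\<^bsub>F\<^esub> v \<otimes>\<^bsub>F\<^esub> w" by (rule F_l_distr)
qed (simp_all add: F_mult_closed F_assoc F_simps(5), simp add: F_comm)

sublocale F: cring F by (rule F_cring)

section \<open>Additive maps out of a monoid algebra and its presented quotients\<close>

definition weighted_sum :: "('c, 'm) ring_scheme \<Rightarrow> ('a \<Rightarrow> 'g \<Rightarrow> 'c) \<Rightarrow> ('g \<Rightarrow> 'a) \<Rightarrow> 'c"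
  where "weighted_sum C w u = (\<Oplus>\<^bsub>C\<^esub>g\<in>{g. u g \<noteq> \<zero>\<^bsub>A\<^esub>}. w (u g) g)"

end

text \<open>The weight takes the coefficient as an argument and is additive in it, since C carries
  no action of A here. It matches \<open>tensor_lift\<close>, where the coefficient acts inside the
  argument of the left map.\<close>

locale monoid_algebra_weight = comm_monoid_algebra A G + C: cring C
  for A :: "('a, 'k) ring_scheme" and G :: "('g, 'l) monoid_scheme" and C :: "('c, 'm) ring_scheme" +
  fixes w :: "'a \<Rightarrow> 'g \<Rightarrow> 'c"
  assumes w_closed [simp, intro]: "\<lbrakk>a \<in> carrier A; g \<in> carrier G\<rbrakk> \<Longrightarrow> w a g \<in> carrier C"
    and w_add: "\<lbrakk>a \<in> carrier A; b \<in> carrier A; g \<in> carrier G\<rbrakk> \<Longrightarrow> w (a \<oplus>\<^bsub>A\<^esub> b) g = w a g \<oplus>\<^bsub>C\<^esub> w b g"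
begin

lemma w_zero: "g \<in> carrier G \<Longrightarrow> w \<zero>\<^bsub>A\<^esub> g = \<zero>\<^bsub>C\<^esub>"
proof -
  assume g: "g \<in> carrier G"
  have "w \<zero>\<^bsub>A\<^esub> g \<oplus>\<^bsub>C\<^esub> w \<zero>\<^bsub>A\<^esub> g = w \<zero>\<^bsub>A\<^esub> g \<oplus>\<^bsub>C\<^esub> \<zero>\<^bsub>C\<^esub>"
    using w_add[of "\<zero>\<^bsub>A\<^esub>" "\<zero>\<^bsub>A\<^esub>" g] g by simp
  then show ?thesis using g C.add.l_cancel by blast
qed

lemma weighted_sum_over:
  assumes "u \<in> carrier F" "finite S" "supp u \<subseteq> S" "S \<subseteq> carrier G"
  shows "weighted_sum C w u = (\<Oplus>\<^bsub>C\<^esub>g\<in>S. w (u g) g)"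
  unfolding weighted_sum_def
  by (rule C.add.finprod_mono_neutral_cong_left)
     (use assms F_carrierD(1)[OF assms(1)] in \<open>auto simp: supp_def w_zero subset_iff\<close>)

lemma weighted_sum_closed [simp, intro]: "u \<in> carrier F \<Longrightarrow> weighted_sum C w u \<in> carrier C"
  using weighted_sum_over[of u "supp u"] F_carrierD[of u] by (auto intro!: C.finsum_closed)

lemma weighted_sum_add:
  assumes "u \<in> carrier F" "v \<in> carrier F"
  shows "weighted_sum C w (u \<oplus>\<^bsub>F\<^esub> v) = weighted_sum C w u \<oplus>\<^bsub>C\<^esub> weighted_sum C w v"
proof -
  let ?S = "supp u \<union> supp v"
  have c: "u g \<in> carrier A" "v g \<in> carrier A" for g using assms F_carrierD by blast+
  have S: "finite ?S" "?S \<subseteq> carrier G" using assms F_carrierD by auto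
  have s: "supp (u \<oplus>\<^bsub>F\<^esub> v) \<subseteq> ?S" by (auto simp: supp_def F_simps)
  have "weighted_sum C w (u \<oplus>\<^bsub>F\<^esub> v) = (\<Oplus>\<^bsub>C\<^esub>g\<in>?S. w ((u \<oplus>\<^bsub>F\<^esub> v) g) g)"
    using assms S s by (intro weighted_sum_over) auto
  also have "\<dots> = (\<Oplus>\<^bsub>C\<^esub>g\<in>?S. w (u g) g \<oplus>\<^bsub>C\<^esub> w (v g) g)"
    using S c by (intro C.finsum_cong_on) (auto simp: F_simps w_add)
  also have "\<dots> = (\<Oplus>\<^bsub>C\<^esub>g\<in>?S. w (u g) g) \<oplus>\<^bsub>C\<^esub> (\<Oplus>\<^bsub>C\<^esub>g\<in>?S. w (v g) g)"
    using S c by (intro C.finsum_addf) auto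
  also have "\<dots> = weighted_sum C w u \<oplus>\<^bsub>C\<^esub> weighted_sum C w v"
    using assms S weighted_sum_over[of u ?S] weighted_sum_over[of v ?S] by simp
  finally show ?thesis .
qed

lemma weighted_sum_monomial:
  assumes "a \<in> carrier A" "g \<in> carrier G"
  shows "weighted_sum C w (monomial a g) = w a g"
  using weighted_sum_over[of "monomial a g" "{g}"] assms supp_monomial[of a g]
  by (simp add: monomial_closed C.finsum_insert) (simp add: monomial_def)

lemma weighted_sum_zero: "weighted_sum C w \<zero>\<^bsub>F\<^esub> = \<zero>\<^bsub>C\<^esub>"
  by (simp add: weighted_sum_def F_simps)

lemma weighted_sum_minus:
  assumes "u \<in> carrier F" "v \<in> carrier F"
  shows "weighted_sum C w (u \<ominus>\<^bsub>F\<^esub> v) = weighted_sum C w u \<ominus>\<^bsub>C\<^esub> weighted_sum C w v"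
proof -
  have "weighted_sum C w (u \<ominus>\<^bsub>F\<^esub> v) \<oplus>\<^bsub>C\<^esub> weighted_sum C w v = weighted_sum C w u"
    using weighted_sum_add[of "u \<ominus>\<^bsub>F\<^esub> v" v] assms F.minus_closed
    by (simp add: F.minus_eq F.a_assoc F.l_neg)
  then show ?thesis
    using assms weighted_sum_closed[of u] weighted_sum_closed[of v] weighted_sum_closed[of "u \<ominus>\<^bsub>F\<^esub> v"]
    by (metis C.minus_eq C.add.inv_solve_right F.minus_closed)
qed

end

text \<open>
  The quotient of a monoid algebra by relations \<open>g = h + k\<close> for \<open>(g, h, k) \<in> S\<close> and
  \<open>g = b h\<close> for \<open>(b, g, h) \<in> S'\<close>.
\<close>

locale presented_algebra = comm_monoid_algebra A G
  for A :: "('a, 'k) ring_scheme" and G :: "('g, 'l) monoid_scheme" +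
  fixes S :: "('g \<times> 'g \<times> 'g) set" and S' :: "('a \<times> 'g \<times> 'g) set"
  assumes S_closed: "S \<subseteq> carrier G \<times> carrier G \<times> carrier G"
    and S'_closed: "S' \<subseteq> carrier A \<times> carrier G \<times> carrier G"
begin

definition relations :: "('g \<Rightarrow> 'a) set"
  where "relations =
    {basis_elt A g \<ominus>\<^bsub>F\<^esub> (basis_elt A h \<oplus>\<^bsub>F\<^esub> basis_elt A k) | g h k. (g, h, k) \<in> S}
    \<union> {basis_elt A g \<ominus>\<^bsub>F\<^esub> b \<odot>\<^bsub>F\<^esub> basis_elt A h | b g h. (b, g, h) \<in> S'}"

definition I :: "('g \<Rightarrow> 'a) set" where "I = Idl\<^bsub>F\<^esub> relations"

definition Q :: "('g \<Rightarrow> 'a) set ring" where "Q = F Quot I"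

definition cls :: "'g \<Rightarrow> ('g \<Rightarrow> 'a) set" where "cls g = I +>\<^bsub>F\<^esub> basis_elt A g"

definition scal :: "'a \<Rightarrow> ('g \<Rightarrow> 'a) set" where "scal a = I +>\<^bsub>F\<^esub> (a \<odot>\<^bsub>F\<^esub> \<one>\<^bsub>F\<^esub>)"

lemma smult_basis: "b \<in> carrier A \<Longrightarrow> b \<odot>\<^bsub>F\<^esub> basis_elt A h = monomial b h"
  by (auto simp: F_simps basis_elt_def monomial_def)

lemma relations_closed: "relations \<subseteq> carrier F"
  unfolding relations_def using S_closed S'_closed
  by (auto simp: smult_basis subset_iff) (auto simp: basis_elt_eq)

lemma I_ideal: "ideal I F"
  unfolding I_def using relations_closed by (rule F.genideal_ideal)

lemma I_subgroup: "abelian_subgroup I F"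
  using I_ideal F.abelian_group_axioms by (intro abelian_subgroupI3) (auto simp: ideal_def)

lemma Q_cring: "cring Q"
  unfolding Q_def using I_ideal F.is_cring by (rule ideal.quotient_is_cring)

sublocale Q: cring Q by (rule Q_cring)

lemma coset_hom: "ring_hom_cring F Q (\<lambda>u. I +>\<^bsub>F\<^esub> u)"
  unfolding Q_def using ideal.rcos_ring_hom_cring[OF I_ideal F.is_cring] by simp

sublocale coset: ring_hom_cring F Q "\<lambda>u. I +>\<^bsub>F\<^esub> u" by (rule coset_hom)

lemma Q_carrierE:
  assumes "t \<in> carrier Q"
  obtains u where "u \<in> carrier F" "t = I +>\<^bsub>F\<^esub> u"
  using assms unfolding Q_def FactRing_simps by auto

lemma coset_eqI:
  assumes "u \<in> carrier F" "v \<in> carrier F" "u \<ominus>\<^bsub>F\<^esub> v \<in> I"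
  shows "I +>\<^bsub>F\<^esub> u = I +>\<^bsub>F\<^esub> v"
  using F.quotient_eq_iff_same_a_r_cos[OF I_ideal assms(1,2)] assms(3) by simp

lemma cls_closed [simp, intro]: "g \<in> carrier G \<Longrightarrow> cls g \<in> carrier Q"
  unfolding cls_def by (simp add: basis_elt_eq)

lemma cls_mult: "\<lbrakk>g \<in> carrier G; h \<in> carrier G\<rbrakk> \<Longrightarrow> cls (g \<otimes>\<^bsub>G\<^esub> h) = cls g \<otimes>\<^bsub>Q\<^esub> cls h"
  unfolding cls_def by (simp add: basis_elt_eq coset.hom_mult[symmetric] monomial_mult del: coset.hom_mult)

lemma cls_one: "cls \<one>\<^bsub>G\<^esub> = \<one>\<^bsub>Q\<^esub>"
  using coset.hom_one unfolding cls_def by (simp add: basis_elt_eq F_simps(5))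

lemma scal_eq: "a \<in> carrier A \<Longrightarrow> scal a = I +>\<^bsub>F\<^esub> monomial a \<one>\<^bsub>G\<^esub>"
  unfolding scal_def F_simps(5) using smult_basis by (simp add: basis_elt_eq)

lemma scal_hom: "ring_hom_cring A Q scal"
proof (intro ring_hom_cringI[OF A.is_cring Q_cring] ring_hom_ringI2 A.ring_axioms Q.ring_axioms ring_hom_memI)
  fix a b assume ab: "a \<in> carrier A" "b \<in> carrier A"
  have "monomial (a \<oplus>\<^bsub>A\<^esub> b) \<one>\<^bsub>G\<^esub> = monomial a \<one>\<^bsub>G\<^esub> \<oplus>\<^bsub>F\<^esub> monomial b \<one>\<^bsub>G\<^esub>"
    by (auto simp: F_simps monomial_def)
  then show "scal (a \<oplus>\<^bsub>A\<^esub> b) = scal a \<oplus>\<^bsub>Q\<^esub> scal b" using ab by (simp add: scal_eq)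
  show "scal (a \<otimes>\<^bsub>A\<^esub> b) = scal a \<otimes>\<^bsub>Q\<^esub> scal b"
    using ab by (simp add: scal_eq coset.hom_mult[symmetric] monomial_mult del: coset.hom_mult)
next
  show "scal \<one>\<^bsub>A\<^esub> = \<one>\<^bsub>Q\<^esub>" using coset.hom_one by (simp add: scal_eq F_simps(5))
qed (simp add: scal_eq)

sublocale scal: ring_hom_cring A Q scal by (rule scal_hom)

lemma coset_monomial:
  assumes "a \<in> carrier A" "g \<in> carrier G"
  shows "I +>\<^bsub>F\<^esub> monomial a g = scal a \<otimes>\<^bsub>Q\<^esub> cls g"
  using assms unfolding cls_def
  by (simp add: scal_eq basis_elt_eq coset.hom_mult[symmetric] monomial_mult del: coset.hom_mult)

lemma cls_add:
  assumes "(g, h, k) \<in> S"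
  shows "cls g = cls h \<oplus>\<^bsub>Q\<^esub> cls k"
proof -
  have c: "g \<in> carrier G" "h \<in> carrier G" "k \<in> carrier G" using assms S_closed by auto
  have "basis_elt A g \<ominus>\<^bsub>F\<^esub> (basis_elt A h \<oplus>\<^bsub>F\<^esub> basis_elt A k) \<in> I"
    unfolding I_def using assms by (intro subsetD[OF F.genideal_self[OF relations_closed]]) (auto simp: relations_def)
  then have "cls g = I +>\<^bsub>F\<^esub> (basis_elt A h \<oplus>\<^bsub>F\<^esub> basis_elt A k)"
    unfolding cls_def using c by (intro coset_eqI) (auto simp: basis_elt_eq)
  then show ?thesis unfolding cls_def using c by (simp add: basis_elt_eq)
qed

lemma cls_smult:
  assumes "(b, g, h) \<in> S'"
  shows "cls g = scal b \<otimes>\<^bsub>Q\<^esub> cls h"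
proof -
  have c: "g \<in> carrier G" "h \<in> carrier G" "b \<in> carrier A" using assms S'_closed by auto
  have "basis_elt A g \<ominus>\<^bsub>F\<^esub> b \<odot>\<^bsub>F\<^esub> basis_elt A h \<in> I"
    unfolding I_def using assms by (intro subsetD[OF F.genideal_self[OF relations_closed]]) (auto simp: relations_def)
  then have "cls g = I +>\<^bsub>F\<^esub> (b \<odot>\<^bsub>F\<^esub> basis_elt A h)"
    unfolding cls_def using c by (intro coset_eqI) (auto simp: smult_basis, auto simp: basis_elt_eq)
  then show ?thesis using c by (simp add: smult_basis coset_monomial)
qed

lemma Q_induct [consumes 1, case_names zero pure add]:
  assumes "t \<in> carrier Q" and "P \<zero>\<^bsub>Q\<^esub>"
    and pure: "\<And>a g. a \<in> carrier A \<Longrightarrow> g \<in> carrier G \<Longrightarrow> P (scal a \<otimes>\<^bsub>Q\<^esub> cls g)"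
    and add: "\<And>s t. s \<in> carrier Q \<Longrightarrow> t \<in> carrier Q \<Longrightarrow> P s \<Longrightarrow> P t \<Longrightarrow> P (s \<oplus>\<^bsub>Q\<^esub> t)"
  shows "P t"
proof -
  obtain u where u: "u \<in> carrier F" "t = I +>\<^bsub>F\<^esub> u" using assms(1) by (rule Q_carrierE)
  have "P (I +>\<^bsub>F\<^esub> u)"
    using u(1)
  proof (induction u rule: F_induct)
    case zero
    then show ?case using assms(2) coset.hom_zero by simp
  next
    case (add a g u)
    then show ?case using pure[of a g] assms(4)[of "I +>\<^bsub>F\<^esub> monomial a g" "I +>\<^bsub>F\<^esub> u"]
      by (simp add: coset_monomial)
  qed
  then show ?thesis using u by simp
qed

text \<open>The value is read off as the only element of the image of a coset. This has the same
  shape as \<open>tensor_lift\<close>, which becomes an instance; it is meaningful once the weighted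
  sum vanishes on the ideal.\<close>

definition lift :: "('c, 'm) ring_scheme \<Rightarrow> ('a \<Rightarrow> 'g \<Rightarrow> 'c) \<Rightarrow> ('g \<Rightarrow> 'a) set \<Rightarrow> 'c"
  where "lift C w Z = the_elem (weighted_sum C w ` Z)"

end

text \<open>The multiplier g is present because the relations generate an ideal: the weighted sum
  has to vanish on every monomial multiple of a relation, and the two conditions ensure
  this.\<close>

locale balanced_weight = presented_algebra A G S S' + monoid_algebra_weight A G C w
  for A :: "('a, 'k) ring_scheme" and G :: "('g, 'l) monoid_scheme" and S S'
    and C :: "('c, 'm) ring_scheme" and w +
  assumes w_S: "\<lbrakk>(p, q, r) \<in> S; a \<in> carrier A; g \<in> carrier G\<rbrakk>
      \<Longrightarrow> w a (g \<otimes>\<^bsub>G\<^esub> p) = w a (g \<otimes>\<^bsub>G\<^esub> q) \<oplus>\<^bsub>C\<^esub> w a (g \<otimes>\<^bsub>G\<^esub> r)"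
    and w_S': "\<lbrakk>(b, p, q) \<in> S'; a \<in> carrier A; g \<in> carrier G\<rbrakk>
      \<Longrightarrow> w a (g \<otimes>\<^bsub>G\<^esub> p) = w (a \<otimes>\<^bsub>A\<^esub> b) (g \<otimes>\<^bsub>G\<^esub> q)"
begin

lemma weighted_sum_monomial_relation:
  assumes "a \<in> carrier A" "g \<in> carrier G" "r \<in> relations"
  shows "weighted_sum C w (monomial a g \<otimes>\<^bsub>F\<^esub> r) = \<zero>\<^bsub>C\<^esub>"
  using assms(3) unfolding relations_def
proof
  assume "r \<in> {basis_elt A g \<ominus>\<^bsub>F\<^esub> (basis_elt A h \<oplus>\<^bsub>F\<^esub> basis_elt A k) | g h k. (g, h, k) \<in> S}"
  then obtain p q s where s: "(p, q, s) \<in> S"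
    and r: "r = basis_elt A p \<ominus>\<^bsub>F\<^esub> (basis_elt A q \<oplus>\<^bsub>F\<^esub> basis_elt A s)" by auto
  then have c: "p \<in> carrier G" "q \<in> carrier G" "s \<in> carrier G" using S_closed by auto
  have "monomial a g \<otimes>\<^bsub>F\<^esub> r = monomial a (g \<otimes>\<^bsub>G\<^esub> p) \<ominus>\<^bsub>F\<^esub> (monomial a (g \<otimes>\<^bsub>G\<^esub> q) \<oplus>\<^bsub>F\<^esub> monomial a (g \<otimes>\<^bsub>G\<^esub> s))"
    unfolding r using c assms
    by (simp add: basis_elt_eq F.minus_eq F.r_distr F.r_minus F.minus_add monomial_mult)
  then show ?thesis using c assms w_S[OF s, of a g]
    by (simp add: weighted_sum_minus weighted_sum_add weighted_sum_monomial C.r_neg C.minus_eq)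
next
  assume "r \<in> {basis_elt A g \<ominus>\<^bsub>F\<^esub> b \<odot>\<^bsub>F\<^esub> basis_elt A h | b g h. (b, g, h) \<in> S'}"
  then obtain b p q where s: "(b, p, q) \<in> S'"
    and r: "r = basis_elt A p \<ominus>\<^bsub>F\<^esub> b \<odot>\<^bsub>F\<^esub> basis_elt A q" by auto
  then have c: "p \<in> carrier G" "q \<in> carrier G" "b \<in> carrier A" using S'_closed by auto
  have "monomial a g \<otimes>\<^bsub>F\<^esub> r = monomial a (g \<otimes>\<^bsub>G\<^esub> p) \<ominus>\<^bsub>F\<^esub> monomial (a \<otimes>\<^bsub>A\<^esub> b) (g \<otimes>\<^bsub>G\<^esub> q)"
    unfolding r smult_basis[OF c(3)] using c assms
    by (simp add: basis_elt_eq F.minus_eq F.r_distr F.r_minus monomial_mult)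
  then show ?thesis using c assms w_S'[OF s, of a g]
    by (simp add: weighted_sum_minus weighted_sum_monomial C.r_neg C.minus_eq)
qed

text \<open>The elements all of whose multiples are killed by the weighted sum form an ideal.\<close>

lemma weighted_sum_I:
  assumes "v \<in> I"
  shows "weighted_sum C w v = \<zero>\<^bsub>C\<^esub>"
proof -
  let ?J = "{v \<in> carrier F. \<forall>u\<in>carrier F. weighted_sum C w (u \<otimes>\<^bsub>F\<^esub> v) = \<zero>\<^bsub>C\<^esub>}"
  have "ideal ?J F"
  proof (rule idealI[OF F.ring_axioms])
    show "subgroup ?J (add_monoid F)"
    proof (rule F.add.subgroupI)
      have "\<zero>\<^bsub>F\<^esub> \<in> ?J" by (simp add: weighted_sum_zero)
      then show "?J \<noteq> {}" by blast
      fix x assume x: "x \<in> ?J"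
      then have "weighted_sum C w (u \<otimes>\<^bsub>F\<^esub> \<ominus>\<^bsub>F\<^esub> x) = \<zero>\<^bsub>C\<^esub>" if "u \<in> carrier F" for u
        using that weighted_sum_minus[of "\<zero>\<^bsub>F\<^esub>" "u \<otimes>\<^bsub>F\<^esub> x"]
        by (simp add: F.r_minus weighted_sum_zero F.minus_eq C.minus_eq)
      then show "\<ominus>\<^bsub>F\<^esub> x \<in> ?J" using x by simp
      fix y assume y: "y \<in> ?J"
      show "x \<oplus>\<^bsub>F\<^esub> y \<in> ?J" using x y by (simp add: F.r_distr weighted_sum_add)
    qed auto
    fix a x assume "a \<in> ?J" "x \<in> carrier F"
    then show "x \<otimes>\<^bsub>F\<^esub> a \<in> ?J" "a \<otimes>\<^bsub>F\<^esub> x \<in> ?J"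
      by (auto simp: F.m_assoc[symmetric] F.m_comm[of a x])
  qed
  moreover have "relations \<subseteq> ?J"
  proof
    fix r assume r: "r \<in> relations"
    then have rc: "r \<in> carrier F" using relations_closed by auto
    have "weighted_sum C w (u \<otimes>\<^bsub>F\<^esub> r) = \<zero>\<^bsub>C\<^esub>" if "u \<in> carrier F" for u
      using that
    proof (induction u rule: F_induct)
      case zero
      then show ?case using rc by (simp add: weighted_sum_zero)
    next
      case (add a g u)
      then show ?case using rc r
        by (simp add: F.l_distr weighted_sum_add weighted_sum_monomial_relation)
    qed
    then show "r \<in> ?J" using rc by simp
  qed
  ultimately have "I \<subseteq> ?J" unfolding I_def by (rule F.genideal_minimal)
  then show ?thesis using assms weighted_sum_add[of v v] F.one_closed F.l_one[of v] by fastforce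
qed

lemma lift_coset:
  assumes "u \<in> carrier F"
  shows "lift C w (I +>\<^bsub>F\<^esub> u) = weighted_sum C w u"
proof -
  have "weighted_sum C w ` (I +>\<^bsub>F\<^esub> u) = {weighted_sum C w u}"
  proof -
    have "weighted_sum C w v = weighted_sum C w u" if "v \<in> I +>\<^bsub>F\<^esub> u" for v
    proof -
      obtain i where i: "i \<in> I" "v = i \<oplus>\<^bsub>F\<^esub> u"
        using \<open>v \<in> _\<close> by (auto simp: a_r_coset_def')
      then have "i \<in> carrier F" using ideal.Icarr[OF I_ideal] by blast
      then show ?thesis using i assms weighted_sum_I[OF i(1)] by (simp add: weighted_sum_add)
    qed
    moreover have "u \<in> I +>\<^bsub>F\<^esub> u"
      using abelian_subgroup.a_rcos_self[OF I_subgroup assms] .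
    ultimately show ?thesis by blast
  qed
  then show ?thesis unfolding lift_def by simp
qed

lemma lift_closed [simp, intro]: "t \<in> carrier Q \<Longrightarrow> lift C w t \<in> carrier C"
  by (erule Q_carrierE) (simp add: lift_coset)

lemma lift_add:
  assumes "s \<in> carrier Q" "t \<in> carrier Q"
  shows "lift C w (s \<oplus>\<^bsub>Q\<^esub> t) = lift C w s \<oplus>\<^bsub>C\<^esub> lift C w t"
proof -
  obtain u v where "u \<in> carrier F" "s = I +>\<^bsub>F\<^esub> u" "v \<in> carrier F" "t = I +>\<^bsub>F\<^esub> v"
    using assms Q_carrierE by metis
  then show ?thesis
    by (simp add: coset.hom_add[symmetric] lift_coset weighted_sum_add del: coset.hom_add)
qed

lemma lift_pure:
  assumes "a \<in> carrier A" "g \<in> carrier G"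
  shows "lift C w (scal a \<otimes>\<^bsub>Q\<^esub> cls g) = w a g"
  using assms by (simp add: coset_monomial[symmetric] lift_coset weighted_sum_monomial)

lemma lift_cls: "g \<in> carrier G \<Longrightarrow> lift C w (cls g) = w \<one>\<^bsub>A\<^esub> g"
  using lift_pure[of "\<one>\<^bsub>A\<^esub>" g] scal.hom_one by simp

lemma lift_zero: "lift C w \<zero>\<^bsub>Q\<^esub> = \<zero>\<^bsub>C\<^esub>"
  using lift_coset[of "\<zero>\<^bsub>F\<^esub>"] coset.hom_zero by (simp add: weighted_sum_zero)

text \<open>Multiplicativity is checked on products of a scalar and a generator, first in the right
  argument, with the left one already of this form, then in the left argument.\<close>

lemma lift_ring_hom:
  assumes mult: "\<And>a b g h. \<lbrakk>a \<in> carrier A; b \<in> carrier A; g \<in> carrier G; h \<in> carrier G\<rbrakk>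
      \<Longrightarrow> w (a \<otimes>\<^bsub>A\<^esub> b) (g \<otimes>\<^bsub>G\<^esub> h) = w a g \<otimes>\<^bsub>C\<^esub> w b h"
    and one: "w \<one>\<^bsub>A\<^esub> \<one>\<^bsub>G\<^esub> = \<one>\<^bsub>C\<^esub>"
  shows "ring_hom_cring Q C (lift C w)"
proof (intro ring_hom_cringI[OF Q_cring C.is_cring] ring_hom_ringI2 Q.ring_axioms C.ring_axioms ring_hom_memI)
  show "lift C w \<one>\<^bsub>Q\<^esub> = \<one>\<^bsub>C\<^esub>" using lift_cls[of "\<one>\<^bsub>G\<^esub>"] one by (simp add: cls_one)
  fix s t assume st: "s \<in> carrier Q" "t \<in> carrier Q"
  have *: "lift C w ((scal a \<otimes>\<^bsub>Q\<^esub> cls g) \<otimes>\<^bsub>Q\<^esub> t) = w a g \<otimes>\<^bsub>C\<^esub> lift C w t"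
    if ag: "a \<in> carrier A" "g \<in> carrier G" for a g
    using st(2)
  proof (induction t rule: Q_induct)
    case zero
    then show ?case using ag by (simp add: lift_zero)
  next
    case (pure b h)
    have "(scal a \<otimes>\<^bsub>Q\<^esub> cls g) \<otimes>\<^bsub>Q\<^esub> (scal b \<otimes>\<^bsub>Q\<^esub> cls h) = scal (a \<otimes>\<^bsub>A\<^esub> b) \<otimes>\<^bsub>Q\<^esub> cls (g \<otimes>\<^bsub>G\<^esub> h)"
      using ag pure by (simp add: cls_mult Q.m_ac)
    then have "lift C w ((scal a \<otimes>\<^bsub>Q\<^esub> cls g) \<otimes>\<^bsub>Q\<^esub> (scal b \<otimes>\<^bsub>Q\<^esub> cls h)) = w (a \<otimes>\<^bsub>A\<^esub> b) (g \<otimes>\<^bsub>G\<^esub> h)"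
      using ag pure lift_pure[of "a \<otimes>\<^bsub>A\<^esub> b" "g \<otimes>\<^bsub>G\<^esub> h"] by simp
    then show ?case using ag pure by (simp add: lift_pure mult)
  next
    case (add s t)
    then show ?case using ag by (simp add: Q.r_distr lift_add C.r_distr)
  qed
  show "lift C w (s \<otimes>\<^bsub>Q\<^esub> t) = lift C w s \<otimes>\<^bsub>C\<^esub> lift C w t"
    using st(1)
  proof (induction s rule: Q_induct)
    case zero
    then show ?case using st by (simp add: lift_zero)
  next
    case (pure a g)
    then show ?case using * by (simp add: lift_pure)
  next
    case (add s t')
    then show ?case using st by (simp add: Q.l_distr lift_add C.l_distr)
  qed
qed (auto simp: lift_add)

end

section \<open>Localization\<close>

locale multiplicative_set = S: cring S for S :: "('s, 'k) ring_scheme" +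
  fixes D :: "'s set"
  assumes D_subset: "D \<subseteq> carrier S" and D_one [simp, intro]: "\<one>\<^bsub>S\<^esub> \<in> D"
    and D_mult [simp, intro]: "\<lbrakk>s \<in> D; t \<in> D\<rbrakk> \<Longrightarrow> s \<otimes>\<^bsub>S\<^esub> t \<in> D"
begin

abbreviation frac where "frac \<equiv> fraction S D"

abbreviation L where "L \<equiv> localization S D"

lemma D_closed [simp, intro]: "s \<in> D \<Longrightarrow> s \<in> carrier S"
  using D_subset by auto

lemma frac_mem_iff:
  assumes "a \<in> carrier S" "s \<in> D"
  shows "(b, t) \<in> frac a s \<longleftrightarrow>
    b \<in> carrier S \<and> t \<in> D \<and> (\<exists>d\<in>D. d \<otimes>\<^bsub>S\<^esub> (a \<otimes>\<^bsub>S\<^esub> t) = d \<otimes>\<^bsub>S\<^esub> (b \<otimes>\<^bsub>S\<^esub> s))"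
proof -
  have "d \<otimes>\<^bsub>S\<^esub> (a \<otimes>\<^bsub>S\<^esub> t \<ominus>\<^bsub>S\<^esub> b \<otimes>\<^bsub>S\<^esub> s) = \<zero>\<^bsub>S\<^esub> \<longleftrightarrow> d \<otimes>\<^bsub>S\<^esub> (a \<otimes>\<^bsub>S\<^esub> t) = d \<otimes>\<^bsub>S\<^esub> (b \<otimes>\<^bsub>S\<^esub> s)"
    if "b \<in> carrier S" "t \<in> D" "d \<in> D" for d
  proof -
    have "d \<otimes>\<^bsub>S\<^esub> (a \<otimes>\<^bsub>S\<^esub> t \<ominus>\<^bsub>S\<^esub> b \<otimes>\<^bsub>S\<^esub> s) = d \<otimes>\<^bsub>S\<^esub> (a \<otimes>\<^bsub>S\<^esub> t) \<ominus>\<^bsub>S\<^esub> d \<otimes>\<^bsub>S\<^esub> (b \<otimes>\<^bsub>S\<^esub> s)"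
      using that assms by (simp add: S.minus_eq S.r_distr S.r_minus)
    then show ?thesis using that assms by simp
  qed
  then show ?thesis unfolding fraction_def by auto
qed

lemma frac_self: "\<lbrakk>a \<in> carrier S; s \<in> D\<rbrakk> \<Longrightarrow> (a, s) \<in> frac a s"
  using D_one by (subst frac_mem_iff) auto

lemma frac_trans:
  assumes "a \<in> carrier S" "s \<in> D" "(b, t) \<in> frac a s" "(c, r) \<in> frac b t"
  shows "(c, r) \<in> frac a s"
proof -
  from assms obtain d where d: "b \<in> carrier S" "t \<in> D" "d \<in> D" "d \<otimes>\<^bsub>S\<^esub> (a \<otimes>\<^bsub>S\<^esub> t) = d \<otimes>\<^bsub>S\<^esub> (b \<otimes>\<^bsub>S\<^esub> s)"
    by (auto simp: frac_mem_iff)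
  from assms d obtain d' where d': "c \<in> carrier S" "r \<in> D" "d' \<in> D" "d' \<otimes>\<^bsub>S\<^esub> (b \<otimes>\<^bsub>S\<^esub> r) = d' \<otimes>\<^bsub>S\<^esub> (c \<otimes>\<^bsub>S\<^esub> t)"
    by (auto simp: frac_mem_iff)
  \<comment> \<open>The witness contains the intermediate denominator t besides d and d', because t
    may be a zero divisor and cannot be cancelled.\<close>
  have "(d \<otimes>\<^bsub>S\<^esub> (d' \<otimes>\<^bsub>S\<^esub> t)) \<otimes>\<^bsub>S\<^esub> (a \<otimes>\<^bsub>S\<^esub> r) = (d' \<otimes>\<^bsub>S\<^esub> r) \<otimes>\<^bsub>S\<^esub> (d \<otimes>\<^bsub>S\<^esub> (a \<otimes>\<^bsub>S\<^esub> t))"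
    using assms(1,2) d(1-3) d'(1-3) by (simp add: S.m_ac)
  also have "\<dots> = (d \<otimes>\<^bsub>S\<^esub> s) \<otimes>\<^bsub>S\<^esub> (d' \<otimes>\<^bsub>S\<^esub> (b \<otimes>\<^bsub>S\<^esub> r))"
    unfolding d(4) using assms(1,2) d(1-3) d'(1-3) by (simp add: S.m_ac)
  also have "\<dots> = (d \<otimes>\<^bsub>S\<^esub> (d' \<otimes>\<^bsub>S\<^esub> t)) \<otimes>\<^bsub>S\<^esub> (c \<otimes>\<^bsub>S\<^esub> s)"
    unfolding d'(4) using assms(1,2) d(1-3) d'(1-3) by (simp add: S.m_ac)
  finally show ?thesis using assms d d' by (subst frac_mem_iff) auto
qed

lemma frac_sym:
  assumes "a \<in> carrier S" "s \<in> D" "(b, t) \<in> frac a s"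
  shows "(a, s) \<in> frac b t"
  using assms by (auto simp: frac_mem_iff) metis

lemma frac_eq_of_mem:
  assumes "a \<in> carrier S" "s \<in> D" "(b, t) \<in> frac a s"
  shows "frac b t = frac a s"
proof -
  have "b \<in> carrier S" "t \<in> D" using assms by (auto simp: frac_mem_iff)
  then show ?thesis
    using frac_trans[OF assms] frac_trans[of b t a s] frac_sym[OF assms] by auto
qed

lemma frac_eqI:
  assumes "a \<in> carrier S" "s \<in> D" "b \<in> carrier S" "t \<in> D" "d \<in> D"
    and "d \<otimes>\<^bsub>S\<^esub> (a \<otimes>\<^bsub>S\<^esub> t) = d \<otimes>\<^bsub>S\<^esub> (b \<otimes>\<^bsub>S\<^esub> s)"
  shows "frac a s = frac b t"
  using assms by (intro frac_eq_of_mem[symmetric]) (auto simp: frac_mem_iff)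

lemma frac_eqI1:
  assumes "a \<in> carrier S" "s \<in> D" "b \<in> carrier S" "t \<in> D" "a \<otimes>\<^bsub>S\<^esub> t = b \<otimes>\<^bsub>S\<^esub> s"
  shows "frac a s = frac b t"
  using frac_eqI[OF assms(1-4) D_one] assms(5) by simp

lemma L_carrier: "carrier L = {frac a s | a s. a \<in> carrier S \<and> s \<in> D}"
  by (simp add: localization_def)

lemma L_zero: "\<zero>\<^bsub>L\<^esub> = frac \<zero>\<^bsub>S\<^esub> \<one>\<^bsub>S\<^esub>" and L_one: "\<one>\<^bsub>L\<^esub> = frac \<one>\<^bsub>S\<^esub> \<one>\<^bsub>S\<^esub>"
  by (simp_all add: localization_def)

lemma frac_closed [simp, intro]: "\<lbrakk>a \<in> carrier S; s \<in> D\<rbrakk> \<Longrightarrow> frac a s \<in> carrier L"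
  by (auto simp: L_carrier)

lemma L_carrierE:
  assumes "z \<in> carrier L"
  obtains a s where "a \<in> carrier S" "s \<in> D" "z = frac a s"
  using assms by (auto simp: L_carrier)

text \<open>Sums and products of fractions are defined as unions over all representatives. If the
  resulting class does not depend on them, the union consists of copies of one and the same
  class.\<close>

lemma Union_frac_eq:
  assumes "a \<in> carrier S" "s \<in> D" "b \<in> carrier S" "t \<in> D"
    and "\<And>a' s' b' t'. \<lbrakk>(a', s') \<in> frac a s; (b', t') \<in> frac b t\<rbrakk> \<Longrightarrow> f a' s' b' t' = f a s b t"
  shows "(\<Union>(a', s') \<in> frac a s. \<Union>(b', t') \<in> frac b t. f a' s' b' t') = f a s b t"
proof (intro equalityI subsetI)
  fix z assume "z \<in> (\<Union>(a', s') \<in> frac a s. \<Union>(b', t') \<in> frac b t. f a' s' b' t')"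
  then obtain a' s' b' t' where "(a', s') \<in> frac a s" "(b', t') \<in> frac b t" "z \<in> f a' s' b' t'" by blast
  then show "z \<in> f a s b t" using assms(5) by blast
next
  fix z assume "z \<in> f a s b t"
  then show "z \<in> (\<Union>(a', s') \<in> frac a s. \<Union>(b', t') \<in> frac b t. f a' s' b' t')"
    using frac_self[OF assms(1,2)] frac_self[OF assms(3,4)] by blast
qed

lemma frac_mult:
  assumes "a \<in> carrier S" "s \<in> D" "b \<in> carrier S" "t \<in> D"
  shows "frac a s \<otimes>\<^bsub>L\<^esub> frac b t = frac (a \<otimes>\<^bsub>S\<^esub> b) (s \<otimes>\<^bsub>S\<^esub> t)"
proof -
  have "(\<Union>(a', s') \<in> frac a s. \<Union>(b', t') \<in> frac b t. frac (a' \<otimes>\<^bsub>S\<^esub> b') (s' \<otimes>\<^bsub>S\<^esub> t'))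
      = frac (a \<otimes>\<^bsub>S\<^esub> b) (s \<otimes>\<^bsub>S\<^esub> t)"
  proof (rule Union_frac_eq[OF assms])
    fix a' s' b' t' assume m: "(a', s') \<in> frac a s" "(b', t') \<in> frac b t"
    from m assms obtain d where d: "a' \<in> carrier S" "s' \<in> D" "d \<in> D" "d \<otimes>\<^bsub>S\<^esub> (a \<otimes>\<^bsub>S\<^esub> s') = d \<otimes>\<^bsub>S\<^esub> (a' \<otimes>\<^bsub>S\<^esub> s)"
      by (auto simp: frac_mem_iff)
    from m assms obtain e where e: "b' \<in> carrier S" "t' \<in> D" "e \<in> D" "e \<otimes>\<^bsub>S\<^esub> (b \<otimes>\<^bsub>S\<^esub> t') = e \<otimes>\<^bsub>S\<^esub> (b' \<otimes>\<^bsub>S\<^esub> t)"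
      by (auto simp: frac_mem_iff)
    show "frac (a' \<otimes>\<^bsub>S\<^esub> b') (s' \<otimes>\<^bsub>S\<^esub> t') = frac (a \<otimes>\<^bsub>S\<^esub> b) (s \<otimes>\<^bsub>S\<^esub> t)"
    proof (rule frac_eqI[where d = "d \<otimes>\<^bsub>S\<^esub> e"])
      have "(d \<otimes>\<^bsub>S\<^esub> e) \<otimes>\<^bsub>S\<^esub> ((a' \<otimes>\<^bsub>S\<^esub> b') \<otimes>\<^bsub>S\<^esub> (s \<otimes>\<^bsub>S\<^esub> t)) = (d \<otimes>\<^bsub>S\<^esub> (a' \<otimes>\<^bsub>S\<^esub> s)) \<otimes>\<^bsub>S\<^esub> (e \<otimes>\<^bsub>S\<^esub> (b' \<otimes>\<^bsub>S\<^esub> t))"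
        using assms d(1-3) e(1-3) by (simp add: S.m_ac)
      also have "\<dots> = (d \<otimes>\<^bsub>S\<^esub> (a \<otimes>\<^bsub>S\<^esub> s')) \<otimes>\<^bsub>S\<^esub> (e \<otimes>\<^bsub>S\<^esub> (b \<otimes>\<^bsub>S\<^esub> t'))" by (simp only: d(4) e(4))
      also have "\<dots> = (d \<otimes>\<^bsub>S\<^esub> e) \<otimes>\<^bsub>S\<^esub> ((a \<otimes>\<^bsub>S\<^esub> b) \<otimes>\<^bsub>S\<^esub> (s' \<otimes>\<^bsub>S\<^esub> t'))"
        using assms d(1-3) e(1-3) by (simp add: S.m_ac)
      finally show "(d \<otimes>\<^bsub>S\<^esub> e) \<otimes>\<^bsub>S\<^esub> ((a' \<otimes>\<^bsub>S\<^esub> b') \<otimes>\<^bsub>S\<^esub> (s \<otimes>\<^bsub>S\<^esub> t)) = (d \<otimes>\<^bsub>S\<^esub> e) \<otimes>\<^bsub>S\<^esub> ((a \<otimes>\<^bsub>S\<^esub> b) \<otimes>\<^bsub>S\<^esub> (s' \<otimes>\<^bsub>S\<^esub> t'))" .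
    qed (use assms d e in auto)
  qed
  then show ?thesis by (simp add: localization_def)
qed

lemma frac_add:
  assumes "a \<in> carrier S" "s \<in> D" "b \<in> carrier S" "t \<in> D"
  shows "frac a s \<oplus>\<^bsub>L\<^esub> frac b t = frac (a \<otimes>\<^bsub>S\<^esub> t \<oplus>\<^bsub>S\<^esub> b \<otimes>\<^bsub>S\<^esub> s) (s \<otimes>\<^bsub>S\<^esub> t)"
proof -
  have "(\<Union>(a', s') \<in> frac a s. \<Union>(b', t') \<in> frac b t. frac (a' \<otimes>\<^bsub>S\<^esub> t' \<oplus>\<^bsub>S\<^esub> b' \<otimes>\<^bsub>S\<^esub> s') (s' \<otimes>\<^bsub>S\<^esub> t'))
      = frac (a \<otimes>\<^bsub>S\<^esub> t \<oplus>\<^bsub>S\<^esub> b \<otimes>\<^bsub>S\<^esub> s) (s \<otimes>\<^bsub>S\<^esub> t)"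
  proof (rule Union_frac_eq[OF assms])
    fix a' s' b' t' assume m: "(a', s') \<in> frac a s" "(b', t') \<in> frac b t"
    from m assms obtain d where d: "a' \<in> carrier S" "s' \<in> D" "d \<in> D" "d \<otimes>\<^bsub>S\<^esub> (a \<otimes>\<^bsub>S\<^esub> s') = d \<otimes>\<^bsub>S\<^esub> (a' \<otimes>\<^bsub>S\<^esub> s)"
      by (auto simp: frac_mem_iff)
    from m assms obtain e where e: "b' \<in> carrier S" "t' \<in> D" "e \<in> D" "e \<otimes>\<^bsub>S\<^esub> (b \<otimes>\<^bsub>S\<^esub> t') = e \<otimes>\<^bsub>S\<^esub> (b' \<otimes>\<^bsub>S\<^esub> t)"
      by (auto simp: frac_mem_iff)
    show "frac (a' \<otimes>\<^bsub>S\<^esub> t' \<oplus>\<^bsub>S\<^esub> b' \<otimes>\<^bsub>S\<^esub> s') (s' \<otimes>\<^bsub>S\<^esub> t') = frac (a \<otimes>\<^bsub>S\<^esub> t \<oplus>\<^bsub>S\<^esub> b \<otimes>\<^bsub>S\<^esub> s) (s \<otimes>\<^bsub>S\<^esub> t)"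
    proof (rule frac_eqI[where d = "d \<otimes>\<^bsub>S\<^esub> e"])
      have "(d \<otimes>\<^bsub>S\<^esub> e) \<otimes>\<^bsub>S\<^esub> ((a' \<otimes>\<^bsub>S\<^esub> t' \<oplus>\<^bsub>S\<^esub> b' \<otimes>\<^bsub>S\<^esub> s') \<otimes>\<^bsub>S\<^esub> (s \<otimes>\<^bsub>S\<^esub> t))
          = (d \<otimes>\<^bsub>S\<^esub> (a' \<otimes>\<^bsub>S\<^esub> s)) \<otimes>\<^bsub>S\<^esub> (e \<otimes>\<^bsub>S\<^esub> (t \<otimes>\<^bsub>S\<^esub> t')) \<oplus>\<^bsub>S\<^esub> (e \<otimes>\<^bsub>S\<^esub> (b' \<otimes>\<^bsub>S\<^esub> t)) \<otimes>\<^bsub>S\<^esub> (d \<otimes>\<^bsub>S\<^esub> (s \<otimes>\<^bsub>S\<^esub> s'))"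
        using assms d(1-3) e(1-3) by (simp add: S.m_ac S.l_distr S.r_distr)
      also have "\<dots> = (d \<otimes>\<^bsub>S\<^esub> (a \<otimes>\<^bsub>S\<^esub> s')) \<otimes>\<^bsub>S\<^esub> (e \<otimes>\<^bsub>S\<^esub> (t \<otimes>\<^bsub>S\<^esub> t')) \<oplus>\<^bsub>S\<^esub> (e \<otimes>\<^bsub>S\<^esub> (b \<otimes>\<^bsub>S\<^esub> t')) \<otimes>\<^bsub>S\<^esub> (d \<otimes>\<^bsub>S\<^esub> (s \<otimes>\<^bsub>S\<^esub> s'))"
        by (simp only: d(4) e(4))
      also have "\<dots> = (d \<otimes>\<^bsub>S\<^esub> e) \<otimes>\<^bsub>S\<^esub> ((a \<otimes>\<^bsub>S\<^esub> t \<oplus>\<^bsub>S\<^esub> b \<otimes>\<^bsub>S\<^esub> s) \<otimes>\<^bsub>S\<^esub> (s' \<otimes>\<^bsub>S\<^esub> t'))"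
        using assms d(1-3) e(1-3) by (simp add: S.m_ac S.l_distr S.r_distr)
      finally show "(d \<otimes>\<^bsub>S\<^esub> e) \<otimes>\<^bsub>S\<^esub> ((a' \<otimes>\<^bsub>S\<^esub> t' \<oplus>\<^bsub>S\<^esub> b' \<otimes>\<^bsub>S\<^esub> s') \<otimes>\<^bsub>S\<^esub> (s \<otimes>\<^bsub>S\<^esub> t))
          = (d \<otimes>\<^bsub>S\<^esub> e) \<otimes>\<^bsub>S\<^esub> ((a \<otimes>\<^bsub>S\<^esub> t \<oplus>\<^bsub>S\<^esub> b \<otimes>\<^bsub>S\<^esub> s) \<otimes>\<^bsub>S\<^esub> (s' \<otimes>\<^bsub>S\<^esub> t'))" .
    qed (use assms d e in auto)
  qed
  then show ?thesis by (simp add: localization_def)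
qed

lemma L_cring: "cring L"
proof (intro cringI abelian_groupI comm_monoidI)
  fix x y assume "x \<in> carrier L" "y \<in> carrier L"
  then obtain a s b t where *: "a \<in> carrier S" "s \<in> D" "x = frac a s" "b \<in> carrier S" "t \<in> D" "y = frac b t"
    by (metis L_carrierE)
  show "x \<oplus>\<^bsub>L\<^esub> y \<in> carrier L" "x \<otimes>\<^bsub>L\<^esub> y \<in> carrier L"
    using * by (auto simp: frac_mult frac_add)
  show "x \<oplus>\<^bsub>L\<^esub> y = y \<oplus>\<^bsub>L\<^esub> x" "x \<otimes>\<^bsub>L\<^esub> y = y \<otimes>\<^bsub>L\<^esub> x"
    using * by (simp_all add: frac_mult frac_add S.m_comm S.a_comm)
next
  fix x y z assume "x \<in> carrier L" "y \<in> carrier L" "z \<in> carrier L"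
  then obtain a s b t c r where *: "a \<in> carrier S" "s \<in> D" "x = frac a s" "b \<in> carrier S" "t \<in> D" "y = frac b t"
    "c \<in> carrier S" "r \<in> D" "z = frac c r"
    by (metis L_carrierE)
  show "x \<oplus>\<^bsub>L\<^esub> y \<oplus>\<^bsub>L\<^esub> z = x \<oplus>\<^bsub>L\<^esub> (y \<oplus>\<^bsub>L\<^esub> z)"
    using * by (simp add: frac_add S.l_distr S.r_distr S.m_ac S.a_assoc)
  show "x \<otimes>\<^bsub>L\<^esub> y \<otimes>\<^bsub>L\<^esub> z = x \<otimes>\<^bsub>L\<^esub> (y \<otimes>\<^bsub>L\<^esub> z)"
    using * by (simp add: frac_mult S.m_assoc)
  show "(x \<oplus>\<^bsub>L\<^esub> y) \<otimes>\<^bsub>L\<^esub> z = x \<otimes>\<^bsub>L\<^esub> z \<oplus>\<^bsub>L\<^esub> y \<otimes>\<^bsub>L\<^esub> z"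
    using * by (simp add: frac_mult frac_add, intro frac_eqI1) (auto simp: S.l_distr S.r_distr S.m_ac)
next
  fix x assume "x \<in> carrier L"
  then obtain a s where *: "a \<in> carrier S" "s \<in> D" "x = frac a s" by (metis L_carrierE)
  show "\<zero>\<^bsub>L\<^esub> \<oplus>\<^bsub>L\<^esub> x = x" "\<one>\<^bsub>L\<^esub> \<otimes>\<^bsub>L\<^esub> x = x"
    using * by (simp_all add: L_zero L_one frac_add frac_mult)
  have "frac (\<ominus>\<^bsub>S\<^esub> a) s \<oplus>\<^bsub>L\<^esub> x = frac \<zero>\<^bsub>S\<^esub> \<one>\<^bsub>S\<^esub>"
    using * by (simp add: frac_add, intro frac_eqI1) (auto simp: S.l_minus S.l_neg)
  then show "\<exists>y\<in>carrier L. y \<oplus>\<^bsub>L\<^esub> x = \<zero>\<^bsub>L\<^esub>"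
    using * by (intro bexI[of _ "frac (\<ominus>\<^bsub>S\<^esub> a) s"]) (auto simp: L_zero)
qed (auto simp: L_zero L_one)

sublocale L: cring L by (rule L_cring)

lemma frac_one_hom: "ring_hom_cring S L (\<lambda>a. frac a \<one>\<^bsub>S\<^esub>)"
  by (intro ring_hom_cringI[OF S.is_cring L_cring] ring_hom_ringI2 S.ring_axioms L.ring_axioms ring_hom_memI)
     (auto simp: frac_mult frac_add L_one)

lemma frac_cancel:
  assumes "a \<in> carrier S" "s \<in> D"
  shows "frac a s \<otimes>\<^bsub>L\<^esub> frac s \<one>\<^bsub>S\<^esub> = frac a \<one>\<^bsub>S\<^esub>"
  using assms by (simp add: frac_mult, intro frac_eqI1) (auto simp: S.m_comm)

lemma frac_num_mult:
  assumes "a \<in> carrier S" "b \<in> carrier S" "s \<in> D"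
  shows "frac (a \<otimes>\<^bsub>S\<^esub> b) s = frac a \<one>\<^bsub>S\<^esub> \<otimes>\<^bsub>L\<^esub> frac b s"
  using assms by (simp add: frac_mult)

lemma frac_add_same:
  assumes "a \<in> carrier S" "b \<in> carrier S" "s \<in> D"
  shows "frac (a \<oplus>\<^bsub>S\<^esub> b) s = frac a s \<oplus>\<^bsub>L\<^esub> frac b s"
  using assms by (simp add: frac_add, intro frac_eqI1) (auto simp: S.l_distr S.r_distr S.m_ac)

lemma frac_zero: "s \<in> D \<Longrightarrow> frac \<zero>\<^bsub>S\<^esub> s = \<zero>\<^bsub>L\<^esub>"
  unfolding L_zero by (intro frac_eqI1) auto

lemma frac_finsum:
  assumes "finite I" "\<And>i. i \<in> I \<Longrightarrow> f i \<in> carrier S" "s \<in> D"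
  shows "frac (\<Oplus>\<^bsub>S\<^esub>i\<in>I. f i) s = (\<Oplus>\<^bsub>L\<^esub>i\<in>I. frac (f i) s)"
  using assms(1,2)
proof (induction I)
  case empty
  then show ?case using assms by (simp add: frac_zero)
next
  case (insert i I)
  then show ?case using assms(3) by (simp add: S.finsum_insert L.finsum_insert Pi_def frac_add_same S.finsum_closed)
qed

end

text \<open>The map \<open>l\<close> is additive and semilinear with respect to a multiplicative
  \<open>c\<close> on the denominators. Two cases are needed: a ring homomorphism, with
  \<open>l\<close> and \<open>c\<close> equal, and a trace functional on \<open>TS'\<close>, which
  is not multiplicative.\<close>

locale localization_functional = multiplicative_set S D + C: cring C
  for S :: "('s, 'k) ring_scheme" and D and C :: "('c, 'm) ring_scheme" +
  fixes l :: "'s \<Rightarrow> 'c" and c :: "'s \<Rightarrow> 'c"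
  assumes l_closed [simp, intro]: "a \<in> carrier S \<Longrightarrow> l a \<in> carrier C"
    and l_add: "\<lbrakk>a \<in> carrier S; b \<in> carrier S\<rbrakk> \<Longrightarrow> l (a \<oplus>\<^bsub>S\<^esub> b) = l a \<oplus>\<^bsub>C\<^esub> l b"
    and c_unit [simp, intro]: "s \<in> D \<Longrightarrow> c s \<in> Units C"
    and c_mult: "\<lbrakk>s \<in> D; t \<in> D\<rbrakk> \<Longrightarrow> c (s \<otimes>\<^bsub>S\<^esub> t) = c s \<otimes>\<^bsub>C\<^esub> c t"
    and l_smult: "\<lbrakk>s \<in> D; a \<in> carrier S\<rbrakk> \<Longrightarrow> l (s \<otimes>\<^bsub>S\<^esub> a) = c s \<otimes>\<^bsub>C\<^esub> l a"
begin

definition loc_lift :: "('s \<times> 's) set \<Rightarrow> 'c"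
  where "loc_lift Z = the_elem ((\<lambda>(a, s). inv\<^bsub>C\<^esub> (c s) \<otimes>\<^bsub>C\<^esub> l a) ` Z)"

lemma c_closed [simp, intro]: "s \<in> D \<Longrightarrow> c s \<in> carrier C" "s \<in> D \<Longrightarrow> inv\<^bsub>C\<^esub> (c s) \<in> carrier C"
  using c_unit C.Units_closed C.Units_inv_closed by blast+

lemma loc_lift_eqI:
  assumes "s \<in> D" "v \<in> carrier C" "u \<in> carrier C" "c s \<otimes>\<^bsub>C\<^esub> u = c s \<otimes>\<^bsub>C\<^esub> v"
  shows "u = v"
proof -
  have "u = inv\<^bsub>C\<^esub> (c s) \<otimes>\<^bsub>C\<^esub> (c s \<otimes>\<^bsub>C\<^esub> u)" using assms by (simp add: C.m_assoc[symmetric])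
  also have "\<dots> = v" unfolding assms(4) using assms(1-3) by (simp add: C.m_assoc[symmetric])
  finally show ?thesis .
qed

lemma c_cancel: "\<lbrakk>s \<in> D; u \<in> carrier C\<rbrakk> \<Longrightarrow> c s \<otimes>\<^bsub>C\<^esub> (inv\<^bsub>C\<^esub> (c s) \<otimes>\<^bsub>C\<^esub> u) = u"
  by (simp add: C.m_assoc[symmetric])

lemma loc_lift_frac:
  assumes "a \<in> carrier S" "s \<in> D"
  shows "loc_lift (frac a s) = inv\<^bsub>C\<^esub> (c s) \<otimes>\<^bsub>C\<^esub> l a"
proof -
  have "inv\<^bsub>C\<^esub> (c t) \<otimes>\<^bsub>C\<^esub> l b = inv\<^bsub>C\<^esub> (c s) \<otimes>\<^bsub>C\<^esub> l a" if m: "(b, t) \<in> frac a s" for b t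
  proof -
    from m assms obtain d where d: "b \<in> carrier S" "t \<in> D" "d \<in> D" "d \<otimes>\<^bsub>S\<^esub> (a \<otimes>\<^bsub>S\<^esub> t) = d \<otimes>\<^bsub>S\<^esub> (b \<otimes>\<^bsub>S\<^esub> s)"
      by (auto simp: frac_mem_iff)
    have "(d \<otimes>\<^bsub>S\<^esub> t) \<otimes>\<^bsub>S\<^esub> a = (d \<otimes>\<^bsub>S\<^esub> s) \<otimes>\<^bsub>S\<^esub> b" using d assms by (simp add: S.m_ac)
    then have e: "c (d \<otimes>\<^bsub>S\<^esub> t) \<otimes>\<^bsub>C\<^esub> l a = c (d \<otimes>\<^bsub>S\<^esub> s) \<otimes>\<^bsub>C\<^esub> l b"
      using d assms by (metis D_mult l_smult)
    \<comment> \<open>Both values are compared after multiplication by the unit c(d s t), which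
      clears the two denominators and the witness d of the equality of fractions.\<close>
    show ?thesis
    proof (rule loc_lift_eqI[of "d \<otimes>\<^bsub>S\<^esub> (s \<otimes>\<^bsub>S\<^esub> t)"])
      have "c (d \<otimes>\<^bsub>S\<^esub> (s \<otimes>\<^bsub>S\<^esub> t)) \<otimes>\<^bsub>C\<^esub> (inv\<^bsub>C\<^esub> (c t) \<otimes>\<^bsub>C\<^esub> l b)
          = c (d \<otimes>\<^bsub>S\<^esub> s) \<otimes>\<^bsub>C\<^esub> (c t \<otimes>\<^bsub>C\<^esub> (inv\<^bsub>C\<^esub> (c t) \<otimes>\<^bsub>C\<^esub> l b))"
        using d assms by (simp add: c_mult C.m_assoc)
      also have "\<dots> = c (d \<otimes>\<^bsub>S\<^esub> s) \<otimes>\<^bsub>C\<^esub> l b" using d by (simp only: c_cancel l_closed)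
      also have "\<dots> = c (d \<otimes>\<^bsub>S\<^esub> t) \<otimes>\<^bsub>C\<^esub> l a" by (rule e[symmetric])
      also have "\<dots> = c (d \<otimes>\<^bsub>S\<^esub> t) \<otimes>\<^bsub>C\<^esub> (c s \<otimes>\<^bsub>C\<^esub> (inv\<^bsub>C\<^esub> (c s) \<otimes>\<^bsub>C\<^esub> l a))"
        using d assms by (simp only: c_cancel l_closed)
      also have "\<dots> = c (d \<otimes>\<^bsub>S\<^esub> (s \<otimes>\<^bsub>S\<^esub> t)) \<otimes>\<^bsub>C\<^esub> (inv\<^bsub>C\<^esub> (c s) \<otimes>\<^bsub>C\<^esub> l a)"
        using d assms by (simp add: c_mult C.m_assoc C.m_comm[of "c s" "c t"] C.m_lcomm[of "c s" "c t"])
      finally show "c (d \<otimes>\<^bsub>S\<^esub> (s \<otimes>\<^bsub>S\<^esub> t)) \<otimes>\<^bsub>C\<^esub> (inv\<^bsub>C\<^esub> (c t) \<otimes>\<^bsub>C\<^esub> l b)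
          = c (d \<otimes>\<^bsub>S\<^esub> (s \<otimes>\<^bsub>S\<^esub> t)) \<otimes>\<^bsub>C\<^esub> (inv\<^bsub>C\<^esub> (c s) \<otimes>\<^bsub>C\<^esub> l a)" .
    qed (use d assms in auto)
  qed
  then have "(\<lambda>p. inv\<^bsub>C\<^esub> (c (snd p)) \<otimes>\<^bsub>C\<^esub> l (fst p)) ` frac a s \<subseteq> {inv\<^bsub>C\<^esub> (c s) \<otimes>\<^bsub>C\<^esub> l a}"
    by (intro image_subsetI) (metis prod.collapse singletonI)
  moreover have "frac a s \<noteq> {}" using frac_self[OF assms] by blast
  ultimately have "(\<lambda>(a, s). inv\<^bsub>C\<^esub> (c s) \<otimes>\<^bsub>C\<^esub> l a) ` frac a s = {inv\<^bsub>C\<^esub> (c s) \<otimes>\<^bsub>C\<^esub> l a}"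
    unfolding case_prod_beta by (metis image_is_empty subset_singletonD)
  then show ?thesis unfolding loc_lift_def by simp
qed

lemma loc_lift_closed [simp, intro]: "z \<in> carrier L \<Longrightarrow> loc_lift z \<in> carrier C"
  by (erule L_carrierE) (simp add: loc_lift_frac)

lemma loc_lift_add:
  assumes "x \<in> carrier L" "y \<in> carrier L"
  shows "loc_lift (x \<oplus>\<^bsub>L\<^esub> y) = loc_lift x \<oplus>\<^bsub>C\<^esub> loc_lift y"
proof -
  obtain a s b t where *: "a \<in> carrier S" "s \<in> D" "x = frac a s" "b \<in> carrier S" "t \<in> D" "y = frac b t"
    using assms by (metis L_carrierE)
  have 1: "a \<otimes>\<^bsub>S\<^esub> t = t \<otimes>\<^bsub>S\<^esub> a" "b \<otimes>\<^bsub>S\<^esub> s = s \<otimes>\<^bsub>S\<^esub> b" using * by (auto simp: S.m_comm)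
  have e: "l (a \<otimes>\<^bsub>S\<^esub> t \<oplus>\<^bsub>S\<^esub> b \<otimes>\<^bsub>S\<^esub> s) = c t \<otimes>\<^bsub>C\<^esub> l a \<oplus>\<^bsub>C\<^esub> c s \<otimes>\<^bsub>C\<^esub> l b"
    unfolding 1 using * by (simp add: l_add l_smult)
  show ?thesis
  proof (rule loc_lift_eqI[of "s \<otimes>\<^bsub>S\<^esub> t"])
    have "c (s \<otimes>\<^bsub>S\<^esub> t) \<otimes>\<^bsub>C\<^esub> loc_lift (x \<oplus>\<^bsub>L\<^esub> y) = c t \<otimes>\<^bsub>C\<^esub> l a \<oplus>\<^bsub>C\<^esub> c s \<otimes>\<^bsub>C\<^esub> l b"
      using * by (simp add: frac_add loc_lift_frac c_cancel e)
    also have "\<dots> = c t \<otimes>\<^bsub>C\<^esub> (c s \<otimes>\<^bsub>C\<^esub> loc_lift x) \<oplus>\<^bsub>C\<^esub> c s \<otimes>\<^bsub>C\<^esub> (c t \<otimes>\<^bsub>C\<^esub> loc_lift y)"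
      using * by (simp add: loc_lift_frac c_cancel)
    also have "\<dots> = c (s \<otimes>\<^bsub>S\<^esub> t) \<otimes>\<^bsub>C\<^esub> (loc_lift x \<oplus>\<^bsub>C\<^esub> loc_lift y)"
      using * assms by (simp add: c_mult C.r_distr C.m_assoc C.m_lcomm[of "c t" "c s"])
    finally show "c (s \<otimes>\<^bsub>S\<^esub> t) \<otimes>\<^bsub>C\<^esub> loc_lift (x \<oplus>\<^bsub>L\<^esub> y) = c (s \<otimes>\<^bsub>S\<^esub> t) \<otimes>\<^bsub>C\<^esub> (loc_lift x \<oplus>\<^bsub>C\<^esub> loc_lift y)" .
  qed (use * assms in auto)
qed

lemma loc_lift_frac_one:
  assumes "a \<in> carrier S" "c \<one>\<^bsub>S\<^esub> = \<one>\<^bsub>C\<^esub>"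
  shows "loc_lift (frac a \<one>\<^bsub>S\<^esub>) = l a"
  using assms by (simp add: loc_lift_frac)

end

text \<open>The given homomorphism serves as the functional and as its own multiplier.\<close>

lemma (in multiplicative_set) localization_hom:
  assumes "ring_hom_cring S C h" "\<And>s. s \<in> D \<Longrightarrow> h s \<in> Units C"
  shows "\<exists>H. ring_hom_cring L C H \<and> (\<forall>a\<in>carrier S. H (frac a \<one>\<^bsub>S\<^esub>) = h a)"
proof -
  interpret h: ring_hom_cring S C h by fact
  interpret localization_functional S D C h h
    by unfold_locales (use assms(2) in auto)
  have cc: "s \<in> D \<Longrightarrow> h s \<in> carrier C" for s by auto
  have "ring_hom_cring L C loc_lift"
  proof (intro ring_hom_cringI[OF L_cring h.S.is_cring] ring_hom_ringI2 L.ring_axioms h.S.ring_axioms ring_hom_memI)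
    show "loc_lift \<one>\<^bsub>L\<^esub> = \<one>\<^bsub>C\<^esub>" by (simp add: L_one loc_lift_frac)
    fix x y assume xy: "x \<in> carrier L" "y \<in> carrier L"
    obtain a s b t where *: "a \<in> carrier S" "s \<in> D" "x = frac a s" "b \<in> carrier S" "t \<in> D" "y = frac b t"
      using xy by (metis L_carrierE)
    show "loc_lift (x \<otimes>\<^bsub>L\<^esub> y) = loc_lift x \<otimes>\<^bsub>C\<^esub> loc_lift y"
    proof (rule loc_lift_eqI[of "s \<otimes>\<^bsub>S\<^esub> t"])
      have "h (s \<otimes>\<^bsub>S\<^esub> t) \<otimes>\<^bsub>C\<^esub> loc_lift (x \<otimes>\<^bsub>L\<^esub> y) = h (a \<otimes>\<^bsub>S\<^esub> b)"
        unfolding *(3,6) frac_mult[OF *(1,2,4,5)] using * loc_lift_frac[of "a \<otimes>\<^bsub>S\<^esub> b" "s \<otimes>\<^bsub>S\<^esub> t"]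
        by (simp only: c_cancel D_mult S.m_closed l_closed)
      also have "\<dots> = (h s \<otimes>\<^bsub>C\<^esub> loc_lift x) \<otimes>\<^bsub>C\<^esub> (h t \<otimes>\<^bsub>C\<^esub> loc_lift y)"
        using * by (simp add: loc_lift_frac c_cancel)
      also have "\<dots> = h (s \<otimes>\<^bsub>S\<^esub> t) \<otimes>\<^bsub>C\<^esub> (loc_lift x \<otimes>\<^bsub>C\<^esub> loc_lift y)"
        using * xy cc loc_lift_closed by (simp add: h.S.m_ac)
      finally show "h (s \<otimes>\<^bsub>S\<^esub> t) \<otimes>\<^bsub>C\<^esub> loc_lift (x \<otimes>\<^bsub>L\<^esub> y) = h (s \<otimes>\<^bsub>S\<^esub> t) \<otimes>\<^bsub>C\<^esub> (loc_lift x \<otimes>\<^bsub>C\<^esub> loc_lift y)" .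
    qed (use * xy in auto)
  qed (auto simp: loc_lift_add)
  then show ?thesis using loc_lift_frac_one by (intro exI[of _ loc_lift]) auto
qed

section \<open>Tensor products of two algebras\<close>

lemma alg_module_simps [simp]:
  "carrier (alg_module R i) = carrier R" "x \<otimes>\<^bsub>alg_module R i\<^esub> y = x \<otimes>\<^bsub>R\<^esub> y" "\<one>\<^bsub>alg_module R i\<^esub> = \<one>\<^bsub>R\<^esub>"
  "\<zero>\<^bsub>alg_module R i\<^esub> = \<zero>\<^bsub>R\<^esub>" "x \<oplus>\<^bsub>alg_module R i\<^esub> y = x \<oplus>\<^bsub>R\<^esub> y" "a \<odot>\<^bsub>alg_module R i\<^esub> x = i a \<otimes>\<^bsub>R\<^esub> x"
  by (simp_all add: alg_module_def)

text \<open>The bilinear and multilinear relations are formulated in the free module, the ideal in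
  the monoid algebra. The two records differ in multiplication and unit, but subtraction depends on
  the additive part alone.\<close>

lemma a_minus_monoid_algebra: "a_minus (monoid_algebra A G) = a_minus (free_module A (carrier G))"
proof -
  have "add_monoid (monoid_algebra A G) = add_monoid (free_module A (carrier G))"
    by (simp add: monoid_algebra_def)
  moreover have "(\<oplus>\<^bsub>monoid_algebra A G\<^esub>) = (\<oplus>\<^bsub>free_module A (carrier G)\<^esub>)"
    by (simp add: monoid_algebra_def)
  ultimately show ?thesis by (intro ext) (simp add: a_minus_def a_inv_def)
qed

lemma monoid_algebra_module_simps:
  "(\<oplus>\<^bsub>monoid_algebra A G\<^esub>) = (\<oplus>\<^bsub>free_module A (carrier G)\<^esub>)"
  "(\<odot>\<^bsub>monoid_algebra A G\<^esub>) = (\<odot>\<^bsub>free_module A (carrier G)\<^esub>)"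
  by (simp_all add: monoid_algebra_def)

lemma Collect_triple_image:
  "{f g h k | g h k. (g, h, k) \<in> {(p x y z, q x y z, r x y z) | x y z. P x y z}}
    = {f (p x y z) (q x y z) (r x y z) | x y z. P x y z}"
  by blast

lemma Collect_triple_Un:
  "{f g h k | g h k. (g, h, k) \<in> U \<union> V} = {f g h k | g h k. (g, h, k) \<in> U} \<union> {f g h k | g h k. (g, h, k) \<in> V}"
  by blast

locale algebra_pair = R: ring_hom_cring A R i + B: ring_hom_cring A B j
  for A :: "('a, 'k) ring_scheme" and R :: "('r, 'l) ring_scheme" and i
    and B :: "('b, 'm) ring_scheme" and j
begin

abbreviation M where "M \<equiv> alg_module R i"
abbreviation N where "N \<equiv> alg_module B j"
abbreviation TP where "TP \<equiv> tensor_algebra A M N"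
abbreviation tens (infixl \<open>\<boxtimes>\<close> 75) where "m \<boxtimes> y \<equiv> tensor_pure A M N m y"

text \<open>The additive relations in either factor, as triples g = h + k; the scalar relations
  follow in the same manner. Together they rewrite \<open>bilinear_relations\<close> in the format
  of \<open>presented_algebra\<close>.\<close>

definition S\<^sub>t :: "(('r \<times> 'b) \<times> ('r \<times> 'b) \<times> ('r \<times> 'b)) set"
  where "S\<^sub>t = {((m \<oplus>\<^bsub>R\<^esub> m', y), (m, y), (m', y)) | m m' y. m \<in> carrier R \<and> m' \<in> carrier R \<and> y \<in> carrier B}
    \<union> {((m, y \<oplus>\<^bsub>B\<^esub> y'), (m, y), (m, y')) | m y y'. m \<in> carrier R \<and> y \<in> carrier B \<and> y' \<in> carrier B}"

definition S\<^sub>t' :: "('a \<times> ('r \<times> 'b) \<times> ('r \<times> 'b)) set"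
  where "S\<^sub>t' = {(a, (i a \<otimes>\<^bsub>R\<^esub> m, y), (m, y)) | a m y. a \<in> carrier A \<and> m \<in> carrier R \<and> y \<in> carrier B}
    \<union> {(a, (m, j a \<otimes>\<^bsub>B\<^esub> y), (m, y)) | a m y. a \<in> carrier A \<and> m \<in> carrier R \<and> y \<in> carrier B}"

lemma pairs_comm_monoid: "comm_monoid (M \<times>\<times> N)"
  by (rule comm_monoidI) (auto simp: mult_DirProd' R.S.m_ac B.S.m_ac)

interpretation presented_algebra A "M \<times>\<times> N" S\<^sub>t S\<^sub>t'
proof -
  interpret pm: comm_monoid "M \<times>\<times> N" by (rule pairs_comm_monoid)
  show "presented_algebra A (M \<times>\<times> N) S\<^sub>t S\<^sub>t'"
    by unfold_locales (auto simp: S\<^sub>t_def S\<^sub>t'_def)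
qed

lemma relations_eq: "relations = bilinear_relations A M N"
proof -
  define r3 where "r3 = (\<lambda>g h k. basis_elt A g \<ominus>\<^bsub>F\<^esub> (basis_elt A h \<oplus>\<^bsub>F\<^esub> basis_elt A k) :: 'r \<times> 'b \<Rightarrow> 'a)"
  define r2 where "r2 = (\<lambda>b g h. basis_elt A g \<ominus>\<^bsub>F\<^esub> b \<odot>\<^bsub>F\<^esub> basis_elt A h :: 'r \<times> 'b \<Rightarrow> 'a)"
  have 1: "relations = {r3 g h k | g h k. (g, h, k) \<in> S\<^sub>t} \<union> {r2 b g h | b g h. (b, g, h) \<in> S\<^sub>t'}"
    unfolding relations_def r3_def r2_def ..
  have 2: "bilinear_relations A M N =
      {r3 (m \<oplus>\<^bsub>R\<^esub> m', y) (m, y) (m', y) | m m' y. m \<in> carrier R \<and> m' \<in> carrier R \<and> y \<in> carrier B}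
    \<union> {r3 (m, y \<oplus>\<^bsub>B\<^esub> y') (m, y) (m, y') | m y y'. m \<in> carrier R \<and> y \<in> carrier B \<and> y' \<in> carrier B}
    \<union> {r2 a (i a \<otimes>\<^bsub>R\<^esub> m, y) (m, y) | a m y. a \<in> carrier A \<and> m \<in> carrier R \<and> y \<in> carrier B}
    \<union> {r2 a (m, j a \<otimes>\<^bsub>B\<^esub> y) (m, y) | a m y. a \<in> carrier A \<and> m \<in> carrier R \<and> y \<in> carrier B}"
    unfolding bilinear_relations_def Let_def r3_def r2_def a_minus_monoid_algebra monoid_algebra_module_simps
    by simp
  show ?thesis unfolding 1 2 unfolding S\<^sub>t_def S\<^sub>t'_def Collect_triple_Un Collect_triple_image by (simp only: Un_assoc)
qed

lemma tensor_algebra_eq: "TP = Q"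
  unfolding tensor_algebra_def tensor_ideal_def Q_def I_def relations_eq ..

lemma tensor_pure_eq: "m \<boxtimes> y = cls (m, y)"
  unfolding tensor_pure_def tensor_ideal_def cls_def I_def relations_eq ..

lemma TP_cring: "cring TP" unfolding tensor_algebra_eq by (rule Q_cring)

sublocale TP: cring TP by (rule TP_cring)

lemma tens_closed [simp, intro]: "\<lbrakk>m \<in> carrier R; y \<in> carrier B\<rbrakk> \<Longrightarrow> m \<boxtimes> y \<in> carrier TP"
  unfolding tensor_pure_eq tensor_algebra_eq by auto

lemma tens_mult:
  "\<lbrakk>m \<in> carrier R; y \<in> carrier B; m' \<in> carrier R; y' \<in> carrier B\<rbrakk>
    \<Longrightarrow> (m \<boxtimes> y) \<otimes>\<^bsub>TP\<^esub> (m' \<boxtimes> y') = (m \<otimes>\<^bsub>R\<^esub> m') \<boxtimes> (y \<otimes>\<^bsub>B\<^esub> y')"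
  unfolding tensor_pure_eq tensor_algebra_eq by (simp add: cls_mult[symmetric])

lemma tens_one: "\<one>\<^bsub>R\<^esub> \<boxtimes> \<one>\<^bsub>B\<^esub> = \<one>\<^bsub>TP\<^esub>"
  unfolding tensor_pure_eq tensor_algebra_eq using cls_one by simp

lemma tens_add_left:
  "\<lbrakk>m \<in> carrier R; m' \<in> carrier R; y \<in> carrier B\<rbrakk> \<Longrightarrow> (m \<oplus>\<^bsub>R\<^esub> m') \<boxtimes> y = (m \<boxtimes> y) \<oplus>\<^bsub>TP\<^esub> (m' \<boxtimes> y)"
  unfolding tensor_pure_eq tensor_algebra_eq by (intro cls_add) (auto simp: S\<^sub>t_def)

lemma tens_add_right:
  "\<lbrakk>m \<in> carrier R; y \<in> carrier B; y' \<in> carrier B\<rbrakk> \<Longrightarrow> m \<boxtimes> (y \<oplus>\<^bsub>B\<^esub> y') = (m \<boxtimes> y) \<oplus>\<^bsub>TP\<^esub> (m \<boxtimes> y')"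
  unfolding tensor_pure_eq tensor_algebra_eq by (intro cls_add) (auto simp: S\<^sub>t_def)

lemma scal_tens_left:
  "\<lbrakk>a \<in> carrier A; m \<in> carrier R; y \<in> carrier B\<rbrakk> \<Longrightarrow> scal a \<otimes>\<^bsub>TP\<^esub> (m \<boxtimes> y) = (i a \<otimes>\<^bsub>R\<^esub> m) \<boxtimes> y"
  unfolding tensor_pure_eq tensor_algebra_eq by (intro cls_smult[symmetric]) (auto simp: S\<^sub>t'_def)

lemma scal_tens_right:
  "\<lbrakk>a \<in> carrier A; m \<in> carrier R; y \<in> carrier B\<rbrakk> \<Longrightarrow> scal a \<otimes>\<^bsub>TP\<^esub> (m \<boxtimes> y) = m \<boxtimes> (j a \<otimes>\<^bsub>B\<^esub> y)"
  unfolding tensor_pure_eq tensor_algebra_eq by (intro cls_smult[symmetric]) (auto simp: S\<^sub>t'_def)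

lemma tens_balanced:
  "\<lbrakk>a \<in> carrier A; m \<in> carrier R; y \<in> carrier B\<rbrakk> \<Longrightarrow> (i a \<otimes>\<^bsub>R\<^esub> m) \<boxtimes> y = m \<boxtimes> (j a \<otimes>\<^bsub>B\<^esub> y)"
  using scal_tens_left scal_tens_right by metis

text \<open>A scalar is absorbed into the left factor, so sums of pure tensors exhaust the tensor
  product; zero occurs as a pure tensor with scalar zero absorbed.\<close>

lemma TP_induct [consumes 1, case_names tens add]:
  assumes "t \<in> carrier TP"
    and tens: "\<And>m y. m \<in> carrier R \<Longrightarrow> y \<in> carrier B \<Longrightarrow> P (m \<boxtimes> y)"
    and add: "\<And>s t. s \<in> carrier TP \<Longrightarrow> t \<in> carrier TP \<Longrightarrow> P s \<Longrightarrow> P t \<Longrightarrow> P (s \<oplus>\<^bsub>TP\<^esub> t)"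
  shows "P t"
proof -
  have sc: "P (scal a \<otimes>\<^bsub>Q\<^esub> cls g)" if ag: "a \<in> carrier A" "g \<in> carrier (M \<times>\<times> N)" for a g
  proof -
    obtain m y where g: "g = (m, y)" "m \<in> carrier R" "y \<in> carrier B" using ag by auto
    show ?thesis
      using scal_tens_left[of a m y] tens[of "i a \<otimes>\<^bsub>R\<^esub> m" y] g ag
      by (simp add: tensor_algebra_eq tensor_pure_eq[symmetric])
  qed
  show ?thesis
  proof (rule Q_induct[of t P])
    show "t \<in> carrier Q" using assms(1) by (simp add: tensor_algebra_eq)
    have "P (scal \<zero>\<^bsub>A\<^esub> \<otimes>\<^bsub>Q\<^esub> cls (\<one>\<^bsub>R\<^esub>, \<one>\<^bsub>B\<^esub>))" by (rule sc) auto
    then show "P \<zero>\<^bsub>Q\<^esub>" by simp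
  qed (use sc add in \<open>auto simp: tensor_algebra_eq\<close>)
qed

lemma left_hom: "ring_hom_cring R TP (\<lambda>m. m \<boxtimes> \<one>\<^bsub>B\<^esub>)"
  by (intro ring_hom_cringI[OF R.S.is_cring TP_cring] ring_hom_ringI2 R.S.ring_axioms TP.ring_axioms ring_hom_memI)
     (auto simp: tens_mult tens_one tens_add_left)

lemma right_hom: "ring_hom_cring B TP (\<lambda>y. \<one>\<^bsub>R\<^esub> \<boxtimes> y)"
  by (intro ring_hom_cringI[OF B.S.is_cring TP_cring] ring_hom_ringI2 B.S.ring_axioms TP.ring_axioms ring_hom_memI)
     (auto simp: tens_mult tens_one tens_add_right)

text \<open>The coefficient is placed in the left factor as in \<open>tensor_lift\<close>. The
  scalar relation in the right factor then needs the balancing hypothesis to carry the scalar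
  across, after multiplication by an arbitrary pair; this is \<open>bal'\<close>.\<close>

lemma bilinear_weight:
  assumes "cring C" and k: "\<And>m y. \<lbrakk>m \<in> carrier R; y \<in> carrier B\<rbrakk> \<Longrightarrow> k m y \<in> carrier C"
    and "\<And>m m' y. \<lbrakk>m \<in> carrier R; m' \<in> carrier R; y \<in> carrier B\<rbrakk> \<Longrightarrow> k (m \<oplus>\<^bsub>R\<^esub> m') y = k m y \<oplus>\<^bsub>C\<^esub> k m' y"
    and "\<And>m y y'. \<lbrakk>m \<in> carrier R; y \<in> carrier B; y' \<in> carrier B\<rbrakk> \<Longrightarrow> k m (y \<oplus>\<^bsub>B\<^esub> y') = k m y \<oplus>\<^bsub>C\<^esub> k m y'"
    and bal: "\<And>a m y. \<lbrakk>a \<in> carrier A; m \<in> carrier R; y \<in> carrier B\<rbrakk> \<Longrightarrow> k (i a \<otimes>\<^bsub>R\<^esub> m) y = k m (j a \<otimes>\<^bsub>B\<^esub> y)"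
  shows "balanced_weight A (M \<times>\<times> N) S\<^sub>t S\<^sub>t' C (\<lambda>a w. k (i a \<otimes>\<^bsub>R\<^esub> fst w) (snd w))"
proof -
  interpret C: cring C by fact
  have bal': "k (i a \<otimes>\<^bsub>R\<^esub> (n \<otimes>\<^bsub>R\<^esub> m)) (z \<otimes>\<^bsub>B\<^esub> (j b \<otimes>\<^bsub>B\<^esub> y)) = k (i a \<otimes>\<^bsub>R\<^esub> i b \<otimes>\<^bsub>R\<^esub> (n \<otimes>\<^bsub>R\<^esub> m)) (z \<otimes>\<^bsub>B\<^esub> y)"
    if "a \<in> carrier A" "b \<in> carrier A" "m \<in> carrier R" "n \<in> carrier R" "y \<in> carrier B" "z \<in> carrier B" for a b m n y z
    using bal[of b "i a \<otimes>\<^bsub>R\<^esub> (n \<otimes>\<^bsub>R\<^esub> m)" "z \<otimes>\<^bsub>B\<^esub> y"] that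
    by (simp add: B.S.m_lcomm[of z] R.S.m_assoc R.S.m_lcomm[of "i b"])
  show ?thesis
  proof (unfold_locales, goal_cases)
    case (1 a g)
    then show ?case using k by auto
  next
    case (2 a b g)
    then show ?case using assms(3) by (auto simp: R.S.l_distr)
  next
    case (3 p q r a g)
    obtain n z where g: "g = (n, z)" "n \<in> carrier R" "z \<in> carrier B" using 3 by auto
    from 3(1) show ?case
      unfolding S\<^sub>t_def using g 3 assms(3)[of "i a \<otimes>\<^bsub>R\<^esub> (n \<otimes>\<^bsub>R\<^esub> _)" "i a \<otimes>\<^bsub>R\<^esub> (n \<otimes>\<^bsub>R\<^esub> _)"]
        assms(4)[of "i a \<otimes>\<^bsub>R\<^esub> (n \<otimes>\<^bsub>R\<^esub> _)" "z \<otimes>\<^bsub>B\<^esub> _" "z \<otimes>\<^bsub>B\<^esub> _"]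
      by (elim UnE CollectE exE conjE) (simp_all add: R.S.r_distr B.S.r_distr)
  next
    case (4 b p q a g)
    obtain n z where g: "g = (n, z)" "n \<in> carrier R" "z \<in> carrier B" using 4 by auto
    from 4(1) show ?case
      unfolding S\<^sub>t'_def using g 4(2) bal'[of a b _ n _ z]
      by (elim UnE CollectE exE conjE) (simp_all add: R.S.m_assoc R.S.m_lcomm[of n])
  qed
qed

text \<open>The universal property for balanced biadditive maps that need not be multiplicative. It
  yields the coordinate contractions on E \<otimes> E and the trace functional on \<R> \<otimes>
  B.\<close>

lemma bilinear_lift:
  assumes "cring C" and k: "\<And>m y. \<lbrakk>m \<in> carrier R; y \<in> carrier B\<rbrakk> \<Longrightarrow> k m y \<in> carrier C"
    and "\<And>m m' y. \<lbrakk>m \<in> carrier R; m' \<in> carrier R; y \<in> carrier B\<rbrakk> \<Longrightarrow> k (m \<oplus>\<^bsub>R\<^esub> m') y = k m y \<oplus>\<^bsub>C\<^esub> k m' y"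
    and "\<And>m y y'. \<lbrakk>m \<in> carrier R; y \<in> carrier B; y' \<in> carrier B\<rbrakk> \<Longrightarrow> k m (y \<oplus>\<^bsub>B\<^esub> y') = k m y \<oplus>\<^bsub>C\<^esub> k m y'"
    and bal: "\<And>a m y. \<lbrakk>a \<in> carrier A; m \<in> carrier R; y \<in> carrier B\<rbrakk> \<Longrightarrow> k (i a \<otimes>\<^bsub>R\<^esub> m) y = k m (j a \<otimes>\<^bsub>B\<^esub> y)"
  shows "\<exists>H \<in> carrier TP \<rightarrow> carrier C. (\<forall>s\<in>carrier TP. \<forall>t\<in>carrier TP. H (s \<oplus>\<^bsub>TP\<^esub> t) = H s \<oplus>\<^bsub>C\<^esub> H t)
    \<and> (\<forall>m\<in>carrier R. \<forall>y\<in>carrier B. H (m \<boxtimes> y) = k m y)"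
proof -
  interpret w: balanced_weight A "M \<times>\<times> N" S\<^sub>t S\<^sub>t' C "\<lambda>a w. k (i a \<otimes>\<^bsub>R\<^esub> fst w) (snd w)"
    by (rule bilinear_weight) fact+
  show ?thesis
    by (rule bexI[of _ "lift C (\<lambda>a w. k (i a \<otimes>\<^bsub>R\<^esub> fst w) (snd w))"])
       (auto simp: tensor_algebra_eq tensor_pure_eq w.lift_add w.lift_cls)
qed

lemma tensor_lift_hom:
  assumes "ring_hom_cring R C p" "ring_hom_cring B C q" "\<And>a. a \<in> carrier A \<Longrightarrow> p (i a) = q (j a)"
  shows "ring_hom_cring TP C (tensor_lift A M N C p q)"
    and "\<lbrakk>m \<in> carrier R; y \<in> carrier B\<rbrakk> \<Longrightarrow> tensor_lift A M N C p q (m \<boxtimes> y) = p m \<otimes>\<^bsub>C\<^esub> q y"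
proof -
  interpret p: ring_hom_cring R C p by fact
  interpret q: ring_hom_cring B C q by fact
  interpret w: balanced_weight A "M \<times>\<times> N" S\<^sub>t S\<^sub>t' C "\<lambda>a w. p (i a \<otimes>\<^bsub>R\<^esub> fst w) \<otimes>\<^bsub>C\<^esub> q (snd w)"
    by (rule bilinear_weight)
       (use assms(3) p.S.is_cring in \<open>auto simp: p.S.l_distr p.S.r_distr p.S.m_ac\<close>)
  \<comment> \<open>The sum in \<open>tensor_lift\<close> is literally the weighted sum of this
    weight, so the general lift applies.\<close>
  have e: "tensor_lift A M N C p q = lift C (\<lambda>a w. p (i a \<otimes>\<^bsub>R\<^esub> fst w) \<otimes>\<^bsub>C\<^esub> q (snd w))"
    by (intro ext) (simp add: tensor_lift_def lift_def weighted_sum_def)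
  show "ring_hom_cring TP C (tensor_lift A M N C p q)"
    unfolding e tensor_algebra_eq
    by (rule w.lift_ring_hom) (auto simp: mult_DirProd' p.S.m_ac)
  show "\<lbrakk>m \<in> carrier R; y \<in> carrier B\<rbrakk> \<Longrightarrow> tensor_lift A M N C p q (m \<boxtimes> y) = p m \<otimes>\<^bsub>C\<^esub> q y"
    unfolding e tensor_pure_eq by (simp add: w.lift_cls)
qed

end

lemma (in algebra_pair) tens_zero_left: "y \<in> carrier B \<Longrightarrow> \<zero>\<^bsub>R\<^esub> \<boxtimes> y = \<zero>\<^bsub>TP\<^esub>"
proof -
  assume y: "y \<in> carrier B"
  have "\<zero>\<^bsub>R\<^esub> \<boxtimes> y \<oplus>\<^bsub>TP\<^esub> \<zero>\<^bsub>R\<^esub> \<boxtimes> y = \<zero>\<^bsub>R\<^esub> \<boxtimes> y \<oplus>\<^bsub>TP\<^esub> \<zero>\<^bsub>TP\<^esub>"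
    using tens_add_left[of "\<zero>\<^bsub>R\<^esub>" "\<zero>\<^bsub>R\<^esub>" y] y by simp
  then show ?thesis
    using TP.add.l_cancel[OF _ tens_closed[OF R.S.zero_closed y] TP.zero_closed] y by simp
qed

lemma (in algebra_pair) tens_finsum_left:
  assumes "finite I" "\<And>k. k \<in> I \<Longrightarrow> r k \<in> carrier R" "y \<in> carrier B"
  shows "(\<Oplus>\<^bsub>R\<^esub>k\<in>I. r k) \<boxtimes> y = (\<Oplus>\<^bsub>TP\<^esub>k\<in>I. r k \<boxtimes> y)"
  using assms(1,2)
proof (induction I)
  case empty
  then show ?case using assms(3) by (simp add: tens_zero_left)
next
  case (insert k I)
  have "(\<Oplus>\<^bsub>R\<^esub>k\<in>insert k I. r k) \<boxtimes> y = (r k \<oplus>\<^bsub>R\<^esub> (\<Oplus>\<^bsub>R\<^esub>k\<in>I. r k)) \<boxtimes> y"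
    using insert by (subst R.S.finsum_insert) auto
  also have "\<dots> = (r k \<boxtimes> y) \<oplus>\<^bsub>TP\<^esub> (\<Oplus>\<^bsub>TP\<^esub>k\<in>I. r k \<boxtimes> y)"
    using insert assms(3) by (subst tens_add_left) (auto intro!: R.S.finsum_closed)
  also have "\<dots> = (\<Oplus>\<^bsub>TP\<^esub>k\<in>insert k I. r k \<boxtimes> y)"
    using insert assms(3) by (intro TP.finsum_insert[symmetric]) auto
  finally show ?case .
qed

section \<open>Finite free algebras\<close>

lemma finsum_alg_module: "finsum (alg_module E g) f I = finsum E f I"
  by (simp add: finsum_def finprod_def alg_module_def)

locale finite_free_algebra = ring_hom_cring B E g
  for B :: "('b, 'k) ring_scheme" and E :: "('e, 'l) ring_scheme" and g +
  fixes n :: nat and e :: "nat \<Rightarrow> 'e"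
  assumes basis: "module_basis B (alg_module E g) n e"
begin

definition co :: "'e \<Rightarrow> nat \<Rightarrow> 'b"
  where "co = coordinates B (alg_module E g) n e"

definition tr :: "'e \<Rightarrow> 'b"
  where "tr z = (\<Oplus>\<^bsub>B\<^esub>i\<in>{1..n}. co (z \<otimes>\<^bsub>E\<^esub> e i) i)"

lemma e_closed [simp, intro]: "i \<in> {1..n} \<Longrightarrow> e i \<in> carrier E"
  using basis by (auto simp: module_basis_def)

lemma ex1_coordinates:
  assumes "y \<in> carrier E"
  shows "\<exists>!c. c \<in> {1..n} \<rightarrow>\<^sub>E carrier B \<and> y = (\<Oplus>\<^bsub>E\<^esub>i\<in>{1..n}. g (c i) \<otimes>\<^bsub>E\<^esub> e i)"
  using basis assms unfolding module_basis_def by (simp add: finsum_alg_module)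

lemma co_spec:
  assumes "y \<in> carrier E"
  shows "co y \<in> {1..n} \<rightarrow>\<^sub>E carrier B" "y = (\<Oplus>\<^bsub>E\<^esub>i\<in>{1..n}. g (co y i) \<otimes>\<^bsub>E\<^esub> e i)"
  using theI'[OF ex1_coordinates[OF assms]] unfolding co_def coordinates_def
  by (simp_all add: finsum_alg_module)

lemma co_closed [simp, intro]: "\<lbrakk>y \<in> carrier E; i \<in> {1..n}\<rbrakk> \<Longrightarrow> co y i \<in> carrier B"
  using co_spec(1)[of y] by auto

lemma co_unique:
  assumes "\<And>i. i \<in> {1..n} \<Longrightarrow> c i \<in> carrier B" "y = (\<Oplus>\<^bsub>E\<^esub>i\<in>{1..n}. g (c i) \<otimes>\<^bsub>E\<^esub> e i)" "i \<in> {1..n}"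
  shows "co y i = c i"
proof -
  have y: "y \<in> carrier E" unfolding assms(2) using assms(1) by (intro S.finsum_closed) auto
  have "y = (\<Oplus>\<^bsub>E\<^esub>i\<in>{1..n}. g (restrict c {1..n} i) \<otimes>\<^bsub>E\<^esub> e i)"
    unfolding assms(2) using assms(1) by (intro S.finsum_cong_on) auto
  moreover have "restrict c {1..n} \<in> {1..n} \<rightarrow>\<^sub>E carrier B" using assms(1) by auto
  ultimately have "co y = restrict c {1..n}"
    using ex1_coordinates[OF y] co_spec[OF y] by blast
  then show ?thesis using assms(3) by simp
qed

lemma co_add:
  assumes "y \<in> carrier E" "z \<in> carrier E" "i \<in> {1..n}"
  shows "co (y \<oplus>\<^bsub>E\<^esub> z) i = co y i \<oplus>\<^bsub>B\<^esub> co z i"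
proof (rule co_unique[OF _ _ assms(3)])
  have "(\<Oplus>\<^bsub>E\<^esub>i\<in>{1..n}. g (co y i \<oplus>\<^bsub>B\<^esub> co z i) \<otimes>\<^bsub>E\<^esub> e i)
      = (\<Oplus>\<^bsub>E\<^esub>i\<in>{1..n}. g (co y i) \<otimes>\<^bsub>E\<^esub> e i \<oplus>\<^bsub>E\<^esub> g (co z i) \<otimes>\<^bsub>E\<^esub> e i)"
    using assms by (intro S.finsum_cong_on) (auto simp: S.l_distr)
  also have "\<dots> = (\<Oplus>\<^bsub>E\<^esub>i\<in>{1..n}. g (co y i) \<otimes>\<^bsub>E\<^esub> e i) \<oplus>\<^bsub>E\<^esub> (\<Oplus>\<^bsub>E\<^esub>i\<in>{1..n}. g (co z i) \<otimes>\<^bsub>E\<^esub> e i)"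
    using assms by (intro S.finsum_addf) auto
  finally show "y \<oplus>\<^bsub>E\<^esub> z = (\<Oplus>\<^bsub>E\<^esub>i\<in>{1..n}. g (co y i \<oplus>\<^bsub>B\<^esub> co z i) \<otimes>\<^bsub>E\<^esub> e i)"
    using co_spec(2)[OF assms(1)] co_spec(2)[OF assms(2)] by simp
qed (use assms in auto)

lemma co_smult:
  assumes "b \<in> carrier B" "y \<in> carrier E" "i \<in> {1..n}"
  shows "co (g b \<otimes>\<^bsub>E\<^esub> y) i = b \<otimes>\<^bsub>B\<^esub> co y i"
proof (rule co_unique[OF _ _ assms(3)])
  have "g b \<otimes>\<^bsub>E\<^esub> (\<Oplus>\<^bsub>E\<^esub>i\<in>{1..n}. g (co y i) \<otimes>\<^bsub>E\<^esub> e i)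
      = (\<Oplus>\<^bsub>E\<^esub>i\<in>{1..n}. g b \<otimes>\<^bsub>E\<^esub> (g (co y i) \<otimes>\<^bsub>E\<^esub> e i))"
    using assms by (intro S.finsum_lmult) auto
  also have "\<dots> = (\<Oplus>\<^bsub>E\<^esub>i\<in>{1..n}. g (b \<otimes>\<^bsub>B\<^esub> co y i) \<otimes>\<^bsub>E\<^esub> e i)"
    using assms by (intro S.finsum_cong_on) (auto simp: S.m_assoc)
  finally show "g b \<otimes>\<^bsub>E\<^esub> y = (\<Oplus>\<^bsub>E\<^esub>i\<in>{1..n}. g (b \<otimes>\<^bsub>B\<^esub> co y i) \<otimes>\<^bsub>E\<^esub> e i)"
    using co_spec(2)[OF assms(2)] by simp
qed (use assms in auto)

lemma co_zero: "i \<in> {1..n} \<Longrightarrow> co \<zero>\<^bsub>E\<^esub> i = \<zero>\<^bsub>B\<^esub>"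
  using co_smult[of "\<zero>\<^bsub>B\<^esub>" "\<zero>\<^bsub>E\<^esub>" i] by simp

lemma co_basis:
  assumes "i \<in> {1..n}" "j \<in> {1..n}"
  shows "co (e i) j = (if i = j then \<one>\<^bsub>B\<^esub> else \<zero>\<^bsub>B\<^esub>)"
proof (rule co_unique[OF _ _ assms(2)])
  have "(\<Oplus>\<^bsub>E\<^esub>j\<in>{1..n}. g (if i = j then \<one>\<^bsub>B\<^esub> else \<zero>\<^bsub>B\<^esub>) \<otimes>\<^bsub>E\<^esub> e j) = g (if i = i then \<one>\<^bsub>B\<^esub> else \<zero>\<^bsub>B\<^esub>) \<otimes>\<^bsub>E\<^esub> e i"
    using assms by (intro S.finsum_delta) auto
  then show "e i = (\<Oplus>\<^bsub>E\<^esub>j\<in>{1..n}. g (if i = j then \<one>\<^bsub>B\<^esub> else \<zero>\<^bsub>B\<^esub>) \<otimes>\<^bsub>E\<^esub> e j)"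
    using assms by simp
qed auto

lemma co_finsum:
  assumes "finite I" "\<And>k. k \<in> I \<Longrightarrow> y k \<in> carrier E" "i \<in> {1..n}"
  shows "co (\<Oplus>\<^bsub>E\<^esub>k\<in>I. y k) i = (\<Oplus>\<^bsub>B\<^esub>k\<in>I. co (y k) i)"
  using assms(1,2)
proof (induction I)
  case empty
  then show ?case using assms(3) by (simp add: co_zero)
next
  case (insert k I)
  have "co (\<Oplus>\<^bsub>E\<^esub>k\<in>insert k I. y k) i = co (y k \<oplus>\<^bsub>E\<^esub> (\<Oplus>\<^bsub>E\<^esub>k\<in>I. y k)) i"
    using insert by (subst S.finsum_insert) auto
  also have "\<dots> = co (y k) i \<oplus>\<^bsub>B\<^esub> (\<Oplus>\<^bsub>B\<^esub>k\<in>I. co (y k) i)"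
    using insert assms(3) by (subst co_add) (auto intro!: S.finsum_closed)
  also have "\<dots> = (\<Oplus>\<^bsub>B\<^esub>k\<in>insert k I. co (y k) i)"
    using insert assms(3) by (subst R.finsum_insert) auto
  finally show ?case .
qed

lemma co_eqI:
  assumes "y \<in> carrier E" "z \<in> carrier E" "\<And>i. i \<in> {1..n} \<Longrightarrow> co y i = co z i"
  shows "y = z"
proof -
  have "y = (\<Oplus>\<^bsub>E\<^esub>i\<in>{1..n}. g (co y i) \<otimes>\<^bsub>E\<^esub> e i)" using co_spec assms by blast
  also have "\<dots> = (\<Oplus>\<^bsub>E\<^esub>i\<in>{1..n}. g (co z i) \<otimes>\<^bsub>E\<^esub> e i)"
    using assms by (intro S.finsum_cong_on) auto
  also have "\<dots> = z" using co_spec assms by metis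
  finally show ?thesis .
qed

lemma co_linear_map:
  assumes "u \<in> carrier E \<rightarrow> carrier E"
    and add: "\<And>y z. \<lbrakk>y \<in> carrier E; z \<in> carrier E\<rbrakk> \<Longrightarrow> u (y \<oplus>\<^bsub>E\<^esub> z) = u y \<oplus>\<^bsub>E\<^esub> u z"
    and smult: "\<And>b y. \<lbrakk>b \<in> carrier B; y \<in> carrier E\<rbrakk> \<Longrightarrow> u (g b \<otimes>\<^bsub>E\<^esub> y) = g b \<otimes>\<^bsub>E\<^esub> u y"
    and "y \<in> carrier E"
  shows "u y = (\<Oplus>\<^bsub>E\<^esub>i\<in>{1..n}. g (co y i) \<otimes>\<^bsub>E\<^esub> u (e i))"
proof -
  have uz: "u \<zero>\<^bsub>E\<^esub> \<in> carrier E" using assms(1) by auto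
  then have u0: "u \<zero>\<^bsub>E\<^esub> = \<zero>\<^bsub>E\<^esub>" using smult[of "\<zero>\<^bsub>B\<^esub>" "\<zero>\<^bsub>E\<^esub>"] by simp
  have uf: "u (\<Oplus>\<^bsub>E\<^esub>i\<in>I. f i) = (\<Oplus>\<^bsub>E\<^esub>i\<in>I. u (f i))" if "finite I" "\<And>i. i \<in> I \<Longrightarrow> f i \<in> carrier E" for f and I :: "nat set"
    using that
  proof (induction I)
    case empty
    then show ?case using u0 by simp
  next
    case (insert k I)
    then have "u (\<Oplus>\<^bsub>E\<^esub>i\<in>insert k I. f i) = u (f k \<oplus>\<^bsub>E\<^esub> (\<Oplus>\<^bsub>E\<^esub>i\<in>I. f i))"
      by (subst S.finsum_insert) auto
    also have "\<dots> = u (f k) \<oplus>\<^bsub>E\<^esub> (\<Oplus>\<^bsub>E\<^esub>i\<in>I. u (f i))"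
      using insert by (subst add) (auto intro!: S.finsum_closed)
    also have "\<dots> = (\<Oplus>\<^bsub>E\<^esub>i\<in>insert k I. u (f i))"
      using insert assms(1) by (subst S.finsum_insert) auto
    finally show ?case .
  qed
  have "u (\<Oplus>\<^bsub>E\<^esub>i\<in>{1..n}. g (co y i) \<otimes>\<^bsub>E\<^esub> e i) = (\<Oplus>\<^bsub>E\<^esub>i\<in>{1..n}. u (g (co y i) \<otimes>\<^bsub>E\<^esub> e i))"
    using assms(4) by (intro uf) auto
  also have "\<dots> = (\<Oplus>\<^bsub>E\<^esub>i\<in>{1..n}. g (co y i) \<otimes>\<^bsub>E\<^esub> u (e i))"
    using assms by (intro S.finsum_cong_on) (auto simp: Pi_iff)
  finally show ?thesis using co_spec(2)[OF assms(4)] by simp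
qed

lemma co_mult:
  assumes "z \<in> carrier E" "y \<in> carrier E" "i \<in> {1..n}"
  shows "co (z \<otimes>\<^bsub>E\<^esub> y) i = (\<Oplus>\<^bsub>B\<^esub>j\<in>{1..n}. co y j \<otimes>\<^bsub>B\<^esub> co (z \<otimes>\<^bsub>E\<^esub> e j) i)"
proof -
  have "z \<otimes>\<^bsub>E\<^esub> y = (\<Oplus>\<^bsub>E\<^esub>j\<in>{1..n}. g (co y j) \<otimes>\<^bsub>E\<^esub> (z \<otimes>\<^bsub>E\<^esub> e j))"
    using assms by (intro co_linear_map) (auto simp: S.r_distr S.m_lcomm)
  then have "co (z \<otimes>\<^bsub>E\<^esub> y) i = (\<Oplus>\<^bsub>B\<^esub>j\<in>{1..n}. co (g (co y j) \<otimes>\<^bsub>E\<^esub> (z \<otimes>\<^bsub>E\<^esub> e j)) i)"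
    using assms by (simp only:, intro co_finsum) auto
  also have "\<dots> = (\<Oplus>\<^bsub>B\<^esub>j\<in>{1..n}. co y j \<otimes>\<^bsub>B\<^esub> co (z \<otimes>\<^bsub>E\<^esub> e j) i)"
    using assms by (intro R.finsum_cong_on) (auto simp: co_smult)
  finally show ?thesis .
qed

section \<open>The trace of a multiplication map\<close>

lemma tr_closed [simp, intro]: "z \<in> carrier E \<Longrightarrow> tr z \<in> carrier B"
  unfolding tr_def by (intro R.finsum_closed) auto

text \<open>The usual tr(QMP) = tr(MPQ) for the two coordinate matrices P and Q, written out as an
  exchange of sums. The length k of the other basis is left free: over the zero ring bases of
  different lengths coexist, and the definition of \<open>module_trace\<close> ranges over all of
  them.\<close>

lemma trace_basis_independent:
  assumes "module_basis B (alg_module E g) k e'" and z: "z \<in> carrier E"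
  shows "(\<Oplus>\<^bsub>B\<^esub>i\<in>{1..k}. coordinates B (alg_module E g) k e' (z \<otimes>\<^bsub>E\<^esub> e' i) i) = tr z"
proof -
  interpret F: finite_free_algebra B E g k e'
    by (unfold_locales) (rule assms(1))
  have 1: "F.co (z \<otimes>\<^bsub>E\<^esub> e' j) j
      = (\<Oplus>\<^bsub>B\<^esub>i\<in>{1..n}. \<Oplus>\<^bsub>B\<^esub>l\<in>{1..n}. co (z \<otimes>\<^bsub>E\<^esub> e l) i \<otimes>\<^bsub>B\<^esub> (co (e' j) l \<otimes>\<^bsub>B\<^esub> F.co (e i) j))" (is "_ = ?R j")
    if j: "j \<in> {1..k}" for j
  proof -
    have "F.co (z \<otimes>\<^bsub>E\<^esub> e' j) j = F.co (\<Oplus>\<^bsub>E\<^esub>i\<in>{1..n}. g (co (z \<otimes>\<^bsub>E\<^esub> e' j) i) \<otimes>\<^bsub>E\<^esub> e i) j"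
      using co_spec(2)[of "z \<otimes>\<^bsub>E\<^esub> e' j"] z j by simp
    also have "\<dots> = (\<Oplus>\<^bsub>B\<^esub>i\<in>{1..n}. F.co (g (co (z \<otimes>\<^bsub>E\<^esub> e' j) i) \<otimes>\<^bsub>E\<^esub> e i) j)"
      using z j by (intro F.co_finsum) auto
    also have "\<dots> = (\<Oplus>\<^bsub>B\<^esub>i\<in>{1..n}. co (z \<otimes>\<^bsub>E\<^esub> e' j) i \<otimes>\<^bsub>B\<^esub> F.co (e i) j)"
      using z j by (intro R.finsum_cong_on) (auto simp: F.co_smult)
    also have "\<dots> = ?R j"
    proof (intro R.finsum_cong_on)
      fix i assume i: "i \<in> {1..n}"
      have "co (z \<otimes>\<^bsub>E\<^esub> e' j) i \<otimes>\<^bsub>B\<^esub> F.co (e i) j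
          = (\<Oplus>\<^bsub>B\<^esub>l\<in>{1..n}. (co (e' j) l \<otimes>\<^bsub>B\<^esub> co (z \<otimes>\<^bsub>E\<^esub> e l) i) \<otimes>\<^bsub>B\<^esub> F.co (e i) j)"
        using z i j by (simp add: co_mult[of z "e' j"], intro R.finsum_rmult) auto
      also have "\<dots> = (\<Oplus>\<^bsub>B\<^esub>l\<in>{1..n}. co (z \<otimes>\<^bsub>E\<^esub> e l) i \<otimes>\<^bsub>B\<^esub> (co (e' j) l \<otimes>\<^bsub>B\<^esub> F.co (e i) j))"
        using z i j by (intro R.finsum_cong_on) (auto simp: R.m_ac)
      finally show "co (z \<otimes>\<^bsub>E\<^esub> e' j) i \<otimes>\<^bsub>B\<^esub> F.co (e i) j
          = (\<Oplus>\<^bsub>B\<^esub>l\<in>{1..n}. co (z \<otimes>\<^bsub>E\<^esub> e l) i \<otimes>\<^bsub>B\<^esub> (co (e' j) l \<otimes>\<^bsub>B\<^esub> F.co (e i) j))" .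
      show "(\<Oplus>\<^bsub>B\<^esub>l\<in>{1..n}. co (z \<otimes>\<^bsub>E\<^esub> e l) i \<otimes>\<^bsub>B\<^esub> (co (e' j) l \<otimes>\<^bsub>B\<^esub> F.co (e i) j)) \<in> carrier B"
        using z i j by (intro R.finsum_closed) auto
    qed
    finally show ?thesis .
  qed
  \<comment> \<open>Passing from the basis e to e' and back gives the identity matrix.\<close>
  have 2: "(\<Oplus>\<^bsub>B\<^esub>j\<in>{1..k}. co (e' j) l \<otimes>\<^bsub>B\<^esub> F.co (e i) j) = (if i = l then \<one>\<^bsub>B\<^esub> else \<zero>\<^bsub>B\<^esub>)"
    if il: "i \<in> {1..n}" "l \<in> {1..n}" for i l
  proof -
    have "co (e i) l = co (\<Oplus>\<^bsub>E\<^esub>j\<in>{1..k}. g (F.co (e i) j) \<otimes>\<^bsub>E\<^esub> e' j) l"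
      using F.co_spec(2)[of "e i"] il by simp
    also have "\<dots> = (\<Oplus>\<^bsub>B\<^esub>j\<in>{1..k}. co (g (F.co (e i) j) \<otimes>\<^bsub>E\<^esub> e' j) l)"
      using il by (intro co_finsum) auto
    also have "\<dots> = (\<Oplus>\<^bsub>B\<^esub>j\<in>{1..k}. co (e' j) l \<otimes>\<^bsub>B\<^esub> F.co (e i) j)"
      using il by (intro R.finsum_cong_on) (auto simp: co_smult R.m_comm)
    finally show ?thesis using co_basis[OF il] by simp
  qed
  have "(\<Oplus>\<^bsub>B\<^esub>j\<in>{1..k}. F.co (z \<otimes>\<^bsub>E\<^esub> e' j) j) = (\<Oplus>\<^bsub>B\<^esub>j\<in>{1..k}. ?R j)"
    using 1 z by (intro R.finsum_cong_on) (auto intro!: R.finsum_closed)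
  also have "\<dots> = (\<Oplus>\<^bsub>B\<^esub>i\<in>{1..n}. \<Oplus>\<^bsub>B\<^esub>j\<in>{1..k}. \<Oplus>\<^bsub>B\<^esub>l\<in>{1..n}. co (z \<otimes>\<^bsub>E\<^esub> e l) i \<otimes>\<^bsub>B\<^esub> (co (e' j) l \<otimes>\<^bsub>B\<^esub> F.co (e i) j))"
    using z by (intro R.finsum_fubini) (auto intro!: R.finsum_closed)
  also have "\<dots> = (\<Oplus>\<^bsub>B\<^esub>i\<in>{1..n}. co (z \<otimes>\<^bsub>E\<^esub> e i) i)"
  proof (intro R.finsum_cong_on)
    fix i assume i: "i \<in> {1..n}"
    have "(\<Oplus>\<^bsub>B\<^esub>j\<in>{1..k}. \<Oplus>\<^bsub>B\<^esub>l\<in>{1..n}. co (z \<otimes>\<^bsub>E\<^esub> e l) i \<otimes>\<^bsub>B\<^esub> (co (e' j) l \<otimes>\<^bsub>B\<^esub> F.co (e i) j))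
        = (\<Oplus>\<^bsub>B\<^esub>l\<in>{1..n}. \<Oplus>\<^bsub>B\<^esub>j\<in>{1..k}. co (z \<otimes>\<^bsub>E\<^esub> e l) i \<otimes>\<^bsub>B\<^esub> (co (e' j) l \<otimes>\<^bsub>B\<^esub> F.co (e i) j))"
      using z i by (intro R.finsum_fubini) auto
    also have "\<dots> = (\<Oplus>\<^bsub>B\<^esub>l\<in>{1..n}. co (z \<otimes>\<^bsub>E\<^esub> e l) i \<otimes>\<^bsub>B\<^esub> (if i = l then \<one>\<^bsub>B\<^esub> else \<zero>\<^bsub>B\<^esub>))"
    proof (intro R.finsum_cong_on)
      fix l assume l: "l \<in> {1..n}"
      have "(\<Oplus>\<^bsub>B\<^esub>j\<in>{1..k}. co (z \<otimes>\<^bsub>E\<^esub> e l) i \<otimes>\<^bsub>B\<^esub> (co (e' j) l \<otimes>\<^bsub>B\<^esub> F.co (e i) j))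
          = co (z \<otimes>\<^bsub>E\<^esub> e l) i \<otimes>\<^bsub>B\<^esub> (\<Oplus>\<^bsub>B\<^esub>j\<in>{1..k}. co (e' j) l \<otimes>\<^bsub>B\<^esub> F.co (e i) j)"
        using z i l by (intro R.finsum_lmult[symmetric]) auto
      then show "(\<Oplus>\<^bsub>B\<^esub>j\<in>{1..k}. co (z \<otimes>\<^bsub>E\<^esub> e l) i \<otimes>\<^bsub>B\<^esub> (co (e' j) l \<otimes>\<^bsub>B\<^esub> F.co (e i) j))
          = co (z \<otimes>\<^bsub>E\<^esub> e l) i \<otimes>\<^bsub>B\<^esub> (if i = l then \<one>\<^bsub>B\<^esub> else \<zero>\<^bsub>B\<^esub>)" using 2[OF i l] by simp
    qed (use z i in auto)
    also have "\<dots> = co (z \<otimes>\<^bsub>E\<^esub> e i) i \<otimes>\<^bsub>B\<^esub> (if i = i then \<one>\<^bsub>B\<^esub> else \<zero>\<^bsub>B\<^esub>)"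
      using z i by (intro R.finsum_delta) auto
    finally show "(\<Oplus>\<^bsub>B\<^esub>j\<in>{1..k}. \<Oplus>\<^bsub>B\<^esub>l\<in>{1..n}. co (z \<otimes>\<^bsub>E\<^esub> e l) i \<otimes>\<^bsub>B\<^esub> (co (e' j) l \<otimes>\<^bsub>B\<^esub> F.co (e i) j))
        = co (z \<otimes>\<^bsub>E\<^esub> e i) i" using z i by simp
  qed (use z in auto)
  finally show ?thesis by (simp add: tr_def F.co_def)
qed

lemma module_trace_eq:
  assumes "z \<in> carrier E"
  shows "module_trace B (alg_module E g) (\<lambda>y. z \<otimes>\<^bsub>E\<^esub> y) = tr z"
  unfolding module_trace_def
proof (rule the_equality)
  show "\<exists>k e'. module_basis B (alg_module E g) k e' \<and>
      tr z = (\<Oplus>\<^bsub>B\<^esub>i\<in>{1..k}. coordinates B (alg_module E g) k e' (z \<otimes>\<^bsub>E\<^esub> e' i) i)"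
    using basis by (intro exI[of _ n] exI[of _ e]) (simp add: tr_def co_def)
qed (use trace_basis_independent[OF _ assms] in auto)

text \<open>The discriminant of the basis.\<close>

definition trace_form :: 'b
  where "trace_form = R.det {1..n} (\<lambda>i j. tr (e i \<otimes>\<^bsub>E\<^esub> e j))"

end

section \<open>The trace form of an etale algebra\<close>

locale unramified_free_algebra = finite_free_algebra B E g n e
  for B :: "('b, 'k) ring_scheme" and E :: "('e, 'l) ring_scheme" and g n e +
  assumes unramified: "carrier (differentials B E g) = {\<one>\<^bsub>differentials B E g\<^esub>}"
begin

sublocale EE: algebra_pair B E g E g ..

abbreviation TE where "TE \<equiv> tensor_algebra B (alg_module E g) (alg_module E g)"

abbreviation tens2 (infixl \<open>\<boxtimes>\<close> 75)
  where "y \<boxtimes> z \<equiv> tensor_pure B (alg_module E g) (alg_module E g) y z"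

definition \<mu> where "\<mu> = tensor_lift B (alg_module E g) (alg_module E g) E id id"

definition Ker where "Ker = a_kernel TE E \<mu>"

definition d :: "nat \<Rightarrow> ('e \<times> 'e \<Rightarrow> 'b) set" where "d i = e i \<boxtimes> \<one>\<^bsub>E\<^esub> \<ominus>\<^bsub>TE\<^esub> \<one>\<^bsub>E\<^esub> \<boxtimes> e i"

lemma id_hom: "ring_hom_cring E E id"
  by (intro ring_hom_cringI[OF S.is_cring S.is_cring] ring_hom_ringI2 S.ring_axioms ring_hom_memI) auto

lemma \<mu>_hom: "ring_hom_cring TE E \<mu>"
  unfolding \<mu>_def using EE.tensor_lift_hom(1)[OF id_hom id_hom] by simp

sublocale \<mu>: ring_hom_cring TE E \<mu> by (rule \<mu>_hom)

lemma \<mu>_tens: "\<lbrakk>y \<in> carrier E; z \<in> carrier E\<rbrakk> \<Longrightarrow> \<mu> (y \<boxtimes> z) = y \<otimes>\<^bsub>E\<^esub> z"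
  unfolding \<mu>_def using EE.tensor_lift_hom(2)[OF id_hom id_hom] by simp

lemma Ker_iff: "t \<in> Ker \<longleftrightarrow> t \<in> carrier TE \<and> \<mu> t = \<zero>\<^bsub>E\<^esub>"
  unfolding Ker_def a_kernel_def' by blast

lemma Ker_ideal: "ideal Ker TE"
  unfolding Ker_def by (rule \<mu>.ring.kernel_is_ideal)

text \<open>The differentials are the kernel of multiplication modulo its square. If only the
  trivial class exists, the coset of t equals the square of the kernel, and it contains 0 +
  t.\<close>

lemma Ker_square:
  assumes "t \<in> Ker"
  shows "t \<in> Ker \<cdot>\<^bsub>TE\<^esub> Ker"
proof -
  let ?I2 = "Ker \<cdot>\<^bsub>TE\<^esub> Ker"
  have D: "differentials B E g = TE\<lparr>carrier := Ker\<rparr> A_Mod ?I2"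
    unfolding differentials_def Let_def Ker_def \<mu>_def ..
  have "ideal ?I2 TE" using EE.TP.ideal_prod_is_ideal[OF Ker_ideal Ker_ideal] .
  then have z: "\<zero>\<^bsub>TE\<^esub> \<in> ?I2" by (simp add: additive_subgroup.zero_closed ideal_def)
  have "?I2 +>\<^bsub>TE\<lparr>carrier := Ker\<rparr>\<^esub> t \<in> carrier (differentials B E g)"
    unfolding D A_FactGroup_def FactGroup_def RCOSETS_def a_r_coset_def using assms by auto
  then have "?I2 +>\<^bsub>TE\<lparr>carrier := Ker\<rparr>\<^esub> t = ?I2"
    unfolding unramified unfolding D A_FactGroup_def FactGroup_def by simp
  moreover have "\<zero>\<^bsub>TE\<^esub> \<oplus>\<^bsub>TE\<^esub> t \<in> ?I2 +>\<^bsub>TE\<lparr>carrier := Ker\<rparr>\<^esub> t"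
    unfolding a_r_coset_def r_coset_def using z by auto
  ultimately show ?thesis using assms by (simp add: Ker_iff)
qed

lemma d_closed [simp, intro]: "i \<in> {1..n} \<Longrightarrow> d i \<in> carrier TE"
  unfolding d_def by auto

lemma d_Ker: "i \<in> {1..n} \<Longrightarrow> d i \<in> Ker"
  unfolding Ker_iff by (simp add: d_def \<mu>_tens EE.TP.minus_eq S.r_neg)

text \<open>Combinations of the differences d_i with coefficients in an ideal V. With V the whole
  ring they exhaust the kernel of multiplication, with V the kernel they contain its square.\<close>

definition span where "span V = {\<Oplus>\<^bsub>TE\<^esub>j\<in>{1..n}. m j \<otimes>\<^bsub>TE\<^esub> d j | m. m \<in> {1..n} \<rightarrow> V}"

lemma span_add:
  assumes "ideal V TE" "s \<in> span V" "t \<in> span V"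
  shows "s \<oplus>\<^bsub>TE\<^esub> t \<in> span V"
proof -
  interpret V: ideal V TE by fact
  from assms obtain m m' where m: "m \<in> {1..n} \<rightarrow> V" "s = (\<Oplus>\<^bsub>TE\<^esub>j\<in>{1..n}. m j \<otimes>\<^bsub>TE\<^esub> d j)"
    "m' \<in> {1..n} \<rightarrow> V" "t = (\<Oplus>\<^bsub>TE\<^esub>j\<in>{1..n}. m' j \<otimes>\<^bsub>TE\<^esub> d j)" by (auto simp: span_def)
  have c: "j \<in> {1..n} \<Longrightarrow> m j \<in> carrier TE" "j \<in> {1..n} \<Longrightarrow> m' j \<in> carrier TE" for j
    using funcset_mem[OF m(1)] funcset_mem[OF m(3)] V.Icarr by blast+
  have "s \<oplus>\<^bsub>TE\<^esub> t = (\<Oplus>\<^bsub>TE\<^esub>j\<in>{1..n}. m j \<otimes>\<^bsub>TE\<^esub> d j \<oplus>\<^bsub>TE\<^esub> m' j \<otimes>\<^bsub>TE\<^esub> d j)"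
    unfolding m using c by (intro EE.TP.finsum_addf[symmetric]) auto
  also have "\<dots> = (\<Oplus>\<^bsub>TE\<^esub>j\<in>{1..n}. (m j \<oplus>\<^bsub>TE\<^esub> m' j) \<otimes>\<^bsub>TE\<^esub> d j)"
    using c by (intro EE.TP.finsum_cong_on) (auto simp: EE.TP.l_distr)
  finally show ?thesis using m unfolding span_def by (intro CollectI exI[of _ "\<lambda>j. m j \<oplus>\<^bsub>TE\<^esub> m' j"]) auto
qed

lemma span_mult:
  assumes "ideal V TE" "a \<in> V" "s \<in> span (carrier TE)"
  shows "a \<otimes>\<^bsub>TE\<^esub> s \<in> span V"
proof -
  interpret V: ideal V TE by fact
  from assms obtain m where m: "m \<in> {1..n} \<rightarrow> carrier TE" "s = (\<Oplus>\<^bsub>TE\<^esub>j\<in>{1..n}. m j \<otimes>\<^bsub>TE\<^esub> d j)"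
    by (auto simp: span_def)
  have a: "a \<in> carrier TE" using assms(2) by (rule V.Icarr)
  have mc: "j \<in> {1..n} \<Longrightarrow> m j \<in> carrier TE" for j using m(1) by (rule funcset_mem)
  have "a \<otimes>\<^bsub>TE\<^esub> s = (\<Oplus>\<^bsub>TE\<^esub>j\<in>{1..n}. a \<otimes>\<^bsub>TE\<^esub> (m j \<otimes>\<^bsub>TE\<^esub> d j))"
    unfolding m using a mc by (intro EE.TP.finsum_lmult) auto
  also have "\<dots> = (\<Oplus>\<^bsub>TE\<^esub>j\<in>{1..n}. (a \<otimes>\<^bsub>TE\<^esub> m j) \<otimes>\<^bsub>TE\<^esub> d j)"
    using a mc by (intro EE.TP.finsum_cong_on) (auto simp: EE.TP.m_assoc)
  finally show ?thesis using mc assms(2) unfolding span_def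
    by (intro CollectI exI[of _ "\<lambda>j. a \<otimes>\<^bsub>TE\<^esub> m j"]) (auto intro: V.I_r_closed)
qed

lemma TE_ideal: "ideal (carrier TE) TE" by (rule EE.TP.oneideal)

text \<open>Expand w in the basis; the coefficients come from B and can be moved across the tensor
  sign, so both terms have the same coefficients in front of e_i \<otimes> 1 and 1 \<otimes>
  e_i.\<close>

lemma difference_in_span:
  assumes "w \<in> carrier E"
  shows "w \<boxtimes> \<one>\<^bsub>E\<^esub> \<ominus>\<^bsub>TE\<^esub> \<one>\<^bsub>E\<^esub> \<boxtimes> w \<in> span (carrier TE)"
proof -
  let ?s = "\<lambda>i. g (co w i) \<boxtimes> \<one>\<^bsub>E\<^esub>"
  have sc: "i \<in> {1..n} \<Longrightarrow> ?s i \<in> carrier TE" for i using assms by auto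
  have p1: "(g (co w i) \<otimes>\<^bsub>E\<^esub> e i) \<boxtimes> \<one>\<^bsub>E\<^esub> = ?s i \<otimes>\<^bsub>TE\<^esub> (e i \<boxtimes> \<one>\<^bsub>E\<^esub>)"
    "\<one>\<^bsub>E\<^esub> \<boxtimes> (g (co w i) \<otimes>\<^bsub>E\<^esub> e i) = ?s i \<otimes>\<^bsub>TE\<^esub> (\<one>\<^bsub>E\<^esub> \<boxtimes> e i)" if "i \<in> {1..n}" for i
    using EE.tens_balanced[of "co w i" "\<one>\<^bsub>E\<^esub>" "e i"] that assms by (simp_all add: EE.tens_mult)
  interpret l: ring_hom_cring E TE "\<lambda>y. y \<boxtimes> \<one>\<^bsub>E\<^esub>" by (rule EE.left_hom)
  interpret r: ring_hom_cring E TE "\<lambda>y. \<one>\<^bsub>E\<^esub> \<boxtimes> y" by (rule EE.right_hom)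
  have wc: "(\<lambda>i. g (co w i) \<otimes>\<^bsub>E\<^esub> e i) \<in> {1..n} \<rightarrow> carrier E" using assms by auto
  have "w \<boxtimes> \<one>\<^bsub>E\<^esub> = (\<Oplus>\<^bsub>TE\<^esub>i\<in>{1..n}. (g (co w i) \<otimes>\<^bsub>E\<^esub> e i) \<boxtimes> \<one>\<^bsub>E\<^esub>)"
    using l.hom_finsum[OF wc] by (simp only: co_spec(2)[OF assms, symmetric] o_def)
  also have "\<dots> = (\<Oplus>\<^bsub>TE\<^esub>i\<in>{1..n}. ?s i \<otimes>\<^bsub>TE\<^esub> (e i \<boxtimes> \<one>\<^bsub>E\<^esub>))"
    using sc p1(1) by (intro EE.TP.finsum_cong_on) (simp_all del: l.hom_mult)
  finally have 1: "w \<boxtimes> \<one>\<^bsub>E\<^esub> = (\<Oplus>\<^bsub>TE\<^esub>i\<in>{1..n}. ?s i \<otimes>\<^bsub>TE\<^esub> (e i \<boxtimes> \<one>\<^bsub>E\<^esub>))" .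
  have "\<one>\<^bsub>E\<^esub> \<boxtimes> w = (\<Oplus>\<^bsub>TE\<^esub>i\<in>{1..n}. \<one>\<^bsub>E\<^esub> \<boxtimes> (g (co w i) \<otimes>\<^bsub>E\<^esub> e i))"
    using r.hom_finsum[OF wc] by (simp only: co_spec(2)[OF assms, symmetric] o_def)
  also have "\<dots> = (\<Oplus>\<^bsub>TE\<^esub>i\<in>{1..n}. ?s i \<otimes>\<^bsub>TE\<^esub> (\<one>\<^bsub>E\<^esub> \<boxtimes> e i))"
    using sc p1(2) by (intro EE.TP.finsum_cong_on) (simp_all del: r.hom_mult)
  finally have 2: "\<one>\<^bsub>E\<^esub> \<boxtimes> w = (\<Oplus>\<^bsub>TE\<^esub>i\<in>{1..n}. ?s i \<otimes>\<^bsub>TE\<^esub> (\<one>\<^bsub>E\<^esub> \<boxtimes> e i))" .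
  have "w \<boxtimes> \<one>\<^bsub>E\<^esub> = (\<Oplus>\<^bsub>TE\<^esub>i\<in>{1..n}. ?s i \<otimes>\<^bsub>TE\<^esub> d i \<oplus>\<^bsub>TE\<^esub> ?s i \<otimes>\<^bsub>TE\<^esub> (\<one>\<^bsub>E\<^esub> \<boxtimes> e i))"
    unfolding 1 d_def using sc
    by (intro EE.TP.finsum_cong_on)
       (auto simp: EE.TP.r_distr[symmetric] EE.TP.minus_eq EE.TP.a_assoc EE.TP.l_neg)
  also have "\<dots> = (\<Oplus>\<^bsub>TE\<^esub>i\<in>{1..n}. ?s i \<otimes>\<^bsub>TE\<^esub> d i) \<oplus>\<^bsub>TE\<^esub> (\<Oplus>\<^bsub>TE\<^esub>i\<in>{1..n}. ?s i \<otimes>\<^bsub>TE\<^esub> (\<one>\<^bsub>E\<^esub> \<boxtimes> e i))"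
    using sc by (intro EE.TP.finsum_addf) auto
  finally have "w \<boxtimes> \<one>\<^bsub>E\<^esub> = (\<Oplus>\<^bsub>TE\<^esub>i\<in>{1..n}. ?s i \<otimes>\<^bsub>TE\<^esub> d i) \<oplus>\<^bsub>TE\<^esub> \<one>\<^bsub>E\<^esub> \<boxtimes> w"
    using 2 by simp
  then have "w \<boxtimes> \<one>\<^bsub>E\<^esub> \<ominus>\<^bsub>TE\<^esub> \<one>\<^bsub>E\<^esub> \<boxtimes> w = (\<Oplus>\<^bsub>TE\<^esub>i\<in>{1..n}. ?s i \<otimes>\<^bsub>TE\<^esub> d i)"
    using assms sc EE.TP.finsum_closed[of "\<lambda>i. ?s i \<otimes>\<^bsub>TE\<^esub> d i" "{1..n}"]
    by (simp add: EE.TP.minus_eq EE.TP.a_assoc EE.TP.r_neg Pi_iff)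
  then show ?thesis using sc unfolding span_def by (intro CollectI exI[of _ ?s]) auto
qed

lemma span_minus: "t \<in> span (carrier TE) \<Longrightarrow> \<ominus>\<^bsub>TE\<^esub> t \<in> span (carrier TE)"
proof -
  assume t: "t \<in> span (carrier TE)"
  have "t \<in> carrier TE" using t by (auto simp: span_def intro!: EE.TP.finsum_closed)
  then have "\<ominus>\<^bsub>TE\<^esub> t = (\<ominus>\<^bsub>TE\<^esub> \<one>\<^bsub>TE\<^esub>) \<otimes>\<^bsub>TE\<^esub> t" by (simp add: EE.TP.l_minus)
  then show ?thesis using span_mult[OF TE_ideal _ t, of "\<ominus>\<^bsub>TE\<^esub> \<one>\<^bsub>TE\<^esub>"] by simp
qed

text \<open>For a pure tensor y \<otimes> w the difference is y \<otimes> 1 times the negative of w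
  \<otimes> 1 - 1 \<otimes> w. On the kernel the correction term is zero, so the d_i generate the
  kernel as an ideal.\<close>

lemma minus_mult_in_span:
  assumes "t \<in> carrier TE"
  shows "t \<ominus>\<^bsub>TE\<^esub> \<mu> t \<boxtimes> \<one>\<^bsub>E\<^esub> \<in> span (carrier TE)"
  using assms
proof (induction t rule: EE.TP_induct)
  case (tens y w)
  have "y \<boxtimes> w \<ominus>\<^bsub>TE\<^esub> \<mu> (y \<boxtimes> w) \<boxtimes> \<one>\<^bsub>E\<^esub>
      = (y \<boxtimes> \<one>\<^bsub>E\<^esub>) \<otimes>\<^bsub>TE\<^esub> (\<ominus>\<^bsub>TE\<^esub> (w \<boxtimes> \<one>\<^bsub>E\<^esub> \<ominus>\<^bsub>TE\<^esub> \<one>\<^bsub>E\<^esub> \<boxtimes> w))"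
    using tens by (simp add: \<mu>_tens EE.TP.minus_eq EE.TP.minus_add EE.TP.r_distr EE.TP.r_minus EE.tens_mult EE.TP.a_comm)
  then show ?case
    using tens span_mult[OF TE_ideal _ span_minus[OF difference_in_span[of w]], of "y \<boxtimes> \<one>\<^bsub>E\<^esub>"] by simp
next
  case (add s t)
  have "s \<oplus>\<^bsub>TE\<^esub> t \<ominus>\<^bsub>TE\<^esub> \<mu> (s \<oplus>\<^bsub>TE\<^esub> t) \<boxtimes> \<one>\<^bsub>E\<^esub>
      = (s \<ominus>\<^bsub>TE\<^esub> \<mu> s \<boxtimes> \<one>\<^bsub>E\<^esub>) \<oplus>\<^bsub>TE\<^esub> (t \<ominus>\<^bsub>TE\<^esub> \<mu> t \<boxtimes> \<one>\<^bsub>E\<^esub>)"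
    using add by (simp add: EE.tens_add_left EE.TP.minus_eq EE.TP.minus_add EE.TP.a_ac)
  then show ?case using span_add[OF TE_ideal] add by simp
qed

lemma Ker_in_span: "t \<in> Ker \<Longrightarrow> t \<in> span (carrier TE)"
proof -
  interpret l: ring_hom_cring E TE "\<lambda>y. y \<boxtimes> \<one>\<^bsub>E\<^esub>" by (rule EE.left_hom)
  show "t \<in> Ker \<Longrightarrow> t \<in> span (carrier TE)"
    using minus_mult_in_span[of t] l.hom_zero by (simp add: Ker_iff EE.TP.minus_eq)
qed

lemma Ker_square_in_span:
  assumes "t \<in> Ker \<cdot>\<^bsub>TE\<^esub> Ker"
  shows "t \<in> span Ker"
  using assms
proof (induction t rule: ideal_prod.induct)
  case (prod a b)
  then show ?case using span_mult[OF Ker_ideal] Ker_in_span by blast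
next
  case (sum s t)
  then show ?case using span_add[OF Ker_ideal] by blast
qed

text \<open>Nakayama: the determinant of \<open>1 - M\<close>, where \<open>d = M d\<close> with entries of \<open>M\<close> in the kernel.\<close>

lemma separability_element:
  "\<exists>s\<in>carrier TE. \<mu> s = \<one>\<^bsub>E\<^esub> \<and> (\<forall>z\<in>carrier E. (z \<boxtimes> \<one>\<^bsub>E\<^esub>) \<otimes>\<^bsub>TE\<^esub> s = (\<one>\<^bsub>E\<^esub> \<boxtimes> z) \<otimes>\<^bsub>TE\<^esub> s)"
proof -
  have "\<exists>m. m \<in> {1..n} \<rightarrow> Ker \<and> d i = (\<Oplus>\<^bsub>TE\<^esub>j\<in>{1..n}. m j \<otimes>\<^bsub>TE\<^esub> d j)" if "i \<in> {1..n}" for i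
    using Ker_square_in_span[OF Ker_square[OF d_Ker[OF that]]] by (auto simp: span_def)
  then have "\<forall>i\<in>{1..n}. \<exists>m. m \<in> {1..n} \<rightarrow> Ker \<and> d i = (\<Oplus>\<^bsub>TE\<^esub>j\<in>{1..n}. m j \<otimes>\<^bsub>TE\<^esub> d j)" by blast
  from bchoice[OF this] obtain m where m: "\<And>i. i \<in> {1..n} \<Longrightarrow> m i \<in> {1..n} \<rightarrow> Ker"
      "\<And>i. i \<in> {1..n} \<Longrightarrow> d i = (\<Oplus>\<^bsub>TE\<^esub>j\<in>{1..n}. m i j \<otimes>\<^bsub>TE\<^esub> d j)"
    by blast
  have mc: "m i j \<in> carrier TE" "\<mu> (m i j) = \<zero>\<^bsub>E\<^esub>" if "i \<in> {1..n}" "j \<in> {1..n}" for i j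
    using funcset_mem[OF m(1)[OF that(1)] that(2)] Ker_iff by blast+
  let ?\<delta> = "\<lambda>i j. if i = (j :: nat) then \<one>\<^bsub>TE\<^esub> else \<zero>\<^bsub>TE\<^esub>"
  let ?N = "\<lambda>i j. ?\<delta> i j \<ominus>\<^bsub>TE\<^esub> m i j"
  have Nc: "?N i j \<in> carrier TE" if "i \<in> {1..n}" "j \<in> {1..n}" for i j using mc that by auto
  \<comment> \<open>The multiplication map kills the entries of m, so it sends this determinant to
    that of the identity matrix.\<close>
  define s where "s = EE.TP.det {1..n} ?N"
  have s: "s \<in> carrier TE" unfolding s_def using Nc by (intro EE.TP.det_closed) auto
  have "\<mu> s = S.det {1..n} (\<lambda>i j. \<mu> (?N i j))"
    unfolding s_def using Nc by (intro \<mu>.hom_det) auto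
  also have "\<dots> = S.det {1..n} (\<lambda>i j. if i = j then \<one>\<^bsub>E\<^esub> else \<zero>\<^bsub>E\<^esub>)"
    using mc by (intro S.det_cong) (auto simp: EE.TP.minus_eq)
  finally have \<mu>s: "\<mu> s = \<one>\<^bsub>E\<^esub>" by (simp add: S.det_identity)
  \<comment> \<open>The vector d lies in the kernel of 1 - m, hence is annihilated by the
    determinant s.\<close>
  have sd: "s \<otimes>\<^bsub>TE\<^esub> d q = \<zero>\<^bsub>TE\<^esub>" if "q \<in> {1..n}" for q
    unfolding s_def
  proof (rule EE.TP.det_annihilates_kernel)
    fix i assume i: "i \<in> {1..n}"
    let ?X = "\<Oplus>\<^bsub>TE\<^esub>j\<in>{1..n}. ?N i j \<otimes>\<^bsub>TE\<^esub> d j"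
    have X: "?X \<in> carrier TE" using i Nc by (intro EE.TP.finsum_closed) auto
    have "d i = ?\<delta> i i \<otimes>\<^bsub>TE\<^esub> d i" using i by simp
    also have "\<dots> = (\<Oplus>\<^bsub>TE\<^esub>j\<in>{1..n}. ?\<delta> i j \<otimes>\<^bsub>TE\<^esub> d j)"
      using i by (intro EE.TP.finsum_delta[symmetric]) auto
    also have "\<dots> = (\<Oplus>\<^bsub>TE\<^esub>j\<in>{1..n}. ?N i j \<otimes>\<^bsub>TE\<^esub> d j \<oplus>\<^bsub>TE\<^esub> m i j \<otimes>\<^bsub>TE\<^esub> d j)"
      using i mc by (intro EE.TP.finsum_cong_on)
        (auto simp: EE.TP.l_distr[symmetric] EE.TP.minus_eq EE.TP.a_assoc EE.TP.l_neg)
    also have "\<dots> = ?X \<oplus>\<^bsub>TE\<^esub> (\<Oplus>\<^bsub>TE\<^esub>j\<in>{1..n}. m i j \<otimes>\<^bsub>TE\<^esub> d j)"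
      using i mc by (intro EE.TP.finsum_addf) auto
    also have "(\<Oplus>\<^bsub>TE\<^esub>j\<in>{1..n}. m i j \<otimes>\<^bsub>TE\<^esub> d j) = d i" using m(2)[OF i] by (rule sym)
    finally have "d i = ?X \<oplus>\<^bsub>TE\<^esub> d i" .
    then have "?X \<oplus>\<^bsub>TE\<^esub> d i = \<zero>\<^bsub>TE\<^esub> \<oplus>\<^bsub>TE\<^esub> d i" using d_closed[OF i] EE.TP.l_zero by metis
    then show "?X = \<zero>\<^bsub>TE\<^esub>"
      using EE.TP.add.r_cancel[OF _ X EE.TP.zero_closed d_closed[OF i]] by blast
  qed (use Nc that in auto)
  have "(z \<boxtimes> \<one>\<^bsub>E\<^esub>) \<otimes>\<^bsub>TE\<^esub> s = (\<one>\<^bsub>E\<^esub> \<boxtimes> z) \<otimes>\<^bsub>TE\<^esub> s" if z: "z \<in> carrier E" for z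
  proof -
    obtain c where c: "c \<in> {1..n} \<rightarrow> carrier TE"
        "z \<boxtimes> \<one>\<^bsub>E\<^esub> \<ominus>\<^bsub>TE\<^esub> \<one>\<^bsub>E\<^esub> \<boxtimes> z = (\<Oplus>\<^bsub>TE\<^esub>j\<in>{1..n}. c j \<otimes>\<^bsub>TE\<^esub> d j)"
      using difference_in_span[OF z] by (auto simp: span_def)
    have cc: "j \<in> {1..n} \<Longrightarrow> c j \<in> carrier TE" for j using c(1) by (rule funcset_mem)
    have "(z \<boxtimes> \<one>\<^bsub>E\<^esub> \<ominus>\<^bsub>TE\<^esub> \<one>\<^bsub>E\<^esub> \<boxtimes> z) \<otimes>\<^bsub>TE\<^esub> s = (\<Oplus>\<^bsub>TE\<^esub>j\<in>{1..n}. (c j \<otimes>\<^bsub>TE\<^esub> d j) \<otimes>\<^bsub>TE\<^esub> s)"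
      unfolding c(2) using cc s by (intro EE.TP.finsum_rmult) auto
    also have "\<dots> = (\<Oplus>\<^bsub>TE\<^esub>j\<in>{1..n}. \<zero>\<^bsub>TE\<^esub>)"
      using cc s sd by (intro EE.TP.finsum_cong_on) (simp_all add: EE.TP.m_assoc EE.TP.m_comm[of "d _" s])
    finally have "(z \<boxtimes> \<one>\<^bsub>E\<^esub> \<ominus>\<^bsub>TE\<^esub> \<one>\<^bsub>E\<^esub> \<boxtimes> z) \<otimes>\<^bsub>TE\<^esub> s = \<zero>\<^bsub>TE\<^esub>" by (simp add: EE.TP.finsum_zero)
    then have "(z \<boxtimes> \<one>\<^bsub>E\<^esub>) \<otimes>\<^bsub>TE\<^esub> s \<ominus>\<^bsub>TE\<^esub> (\<one>\<^bsub>E\<^esub> \<boxtimes> z) \<otimes>\<^bsub>TE\<^esub> s = \<zero>\<^bsub>TE\<^esub>"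
      using z s by (simp add: EE.TP.minus_eq EE.TP.l_distr EE.TP.l_minus)
    then show ?thesis using z s by simp
  qed
  then show ?thesis using s \<mu>s by blast
qed

text \<open>Writing the separability element as the sum of b_i \<otimes> e_i, every z equals the sum
  of tr(z e_i) b_i. Taking coordinates for z = e_k shows that the coordinate matrix of the b_i is
  inverse to the trace matrix.\<close>

lemma trace_form_unit: "trace_form \<in> Units B"
proof -
  obtain s where s: "s \<in> carrier TE" "\<mu> s = \<one>\<^bsub>E\<^esub>"
      "\<And>z. z \<in> carrier E \<Longrightarrow> (z \<boxtimes> \<one>\<^bsub>E\<^esub>) \<otimes>\<^bsub>TE\<^esub> s = (\<one>\<^bsub>E\<^esub> \<boxtimes> z) \<otimes>\<^bsub>TE\<^esub> s"
    using separability_element by blast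
  \<comment> \<open>The contraction of the right factor with the i-th coordinate function. It
    commutes with multiplication on the left factor, turns multiplication on the right factor into
    the matrix of that multiplication, and recovers the multiplication map when summed against the
    basis.\<close>
  have "\<forall>i\<in>{1..n}. \<exists>H. H \<in> carrier TE \<rightarrow> carrier E
      \<and> (\<forall>s\<in>carrier TE. \<forall>t\<in>carrier TE. H (s \<oplus>\<^bsub>TE\<^esub> t) = H s \<oplus>\<^bsub>E\<^esub> H t)
      \<and> (\<forall>y\<in>carrier E. \<forall>w\<in>carrier E. H (y \<boxtimes> w) = y \<otimes>\<^bsub>E\<^esub> g (co w i))"
    (is "\<forall>i\<in>_. ?P i")
  proof
    fix i assume i: "i \<in> {1..n}"
    have "\<exists>H \<in> carrier TE \<rightarrow> carrier E. (\<forall>s\<in>carrier TE. \<forall>t\<in>carrier TE. H (s \<oplus>\<^bsub>TE\<^esub> t) = H s \<oplus>\<^bsub>E\<^esub> H t)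
      \<and> (\<forall>y\<in>carrier E. \<forall>w\<in>carrier E. H (y \<boxtimes> w) = y \<otimes>\<^bsub>E\<^esub> g (co w i))"
      using i by (intro EE.bilinear_lift S.is_cring) (auto simp: S.l_distr S.r_distr co_add co_smult S.m_assoc S.m_lcomm[of "g _"])
    then show "?P i" by blast
  qed
  from bchoice[OF this] obtain H where H: "\<forall>i\<in>{1..n}. H i \<in> carrier TE \<rightarrow> carrier E
      \<and> (\<forall>s\<in>carrier TE. \<forall>t\<in>carrier TE. H i (s \<oplus>\<^bsub>TE\<^esub> t) = H i s \<oplus>\<^bsub>E\<^esub> H i t)
      \<and> (\<forall>y\<in>carrier E. \<forall>w\<in>carrier E. H i (y \<boxtimes> w) = y \<otimes>\<^bsub>E\<^esub> g (co w i))" ..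
  then have Hc: "\<And>i t. \<lbrakk>i \<in> {1..n}; t \<in> carrier TE\<rbrakk> \<Longrightarrow> H i t \<in> carrier E"
    and Hadd: "\<And>i s t. \<lbrakk>i \<in> {1..n}; s \<in> carrier TE; t \<in> carrier TE\<rbrakk> \<Longrightarrow> H i (s \<oplus>\<^bsub>TE\<^esub> t) = H i s \<oplus>\<^bsub>E\<^esub> H i t"
    and Ht: "\<And>i y w. \<lbrakk>i \<in> {1..n}; y \<in> carrier E; w \<in> carrier E\<rbrakk> \<Longrightarrow> H i (y \<boxtimes> w) = y \<otimes>\<^bsub>E\<^esub> g (co w i)"
    by blast+
  have H1: "H i ((z \<boxtimes> \<one>\<^bsub>E\<^esub>) \<otimes>\<^bsub>TE\<^esub> t) = z \<otimes>\<^bsub>E\<^esub> H i t"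
    if iz: "i \<in> {1..n}" "z \<in> carrier E" and "t \<in> carrier TE" for i z t
    using that(3)
  proof (induction t rule: EE.TP_induct)
    case (tens y w)
    then show ?case using iz by (simp add: EE.tens_mult Ht S.m_assoc)
  next
    case (add s t)
    then show ?case using iz by (simp add: EE.TP.r_distr Hadd S.r_distr Hc)
  qed
  have H2: "H i ((\<one>\<^bsub>E\<^esub> \<boxtimes> z) \<otimes>\<^bsub>TE\<^esub> t) = (\<Oplus>\<^bsub>E\<^esub>j\<in>{1..n}. g (co (z \<otimes>\<^bsub>E\<^esub> e j) i) \<otimes>\<^bsub>E\<^esub> H j t)"
    if iz: "i \<in> {1..n}" "z \<in> carrier E" and "t \<in> carrier TE" for i z t
    using that(3)
  proof (induction t rule: EE.TP_induct)
    case (tens y w)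
    have "H i ((\<one>\<^bsub>E\<^esub> \<boxtimes> z) \<otimes>\<^bsub>TE\<^esub> (y \<boxtimes> w)) = y \<otimes>\<^bsub>E\<^esub> g (\<Oplus>\<^bsub>B\<^esub>j\<in>{1..n}. co w j \<otimes>\<^bsub>B\<^esub> co (z \<otimes>\<^bsub>E\<^esub> e j) i)"
      using tens iz by (simp add: EE.tens_mult Ht co_mult)
    also have "\<dots> = y \<otimes>\<^bsub>E\<^esub> (\<Oplus>\<^bsub>E\<^esub>j\<in>{1..n}. g (co w j \<otimes>\<^bsub>B\<^esub> co (z \<otimes>\<^bsub>E\<^esub> e j) i))"
      using tens iz by (subst hom_finsum) (auto simp: o_def)
    also have "\<dots> = (\<Oplus>\<^bsub>E\<^esub>j\<in>{1..n}. y \<otimes>\<^bsub>E\<^esub> g (co w j \<otimes>\<^bsub>B\<^esub> co (z \<otimes>\<^bsub>E\<^esub> e j) i))"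
      using tens iz by (intro S.finsum_lmult) auto
    also have "\<dots> = (\<Oplus>\<^bsub>E\<^esub>j\<in>{1..n}. g (co (z \<otimes>\<^bsub>E\<^esub> e j) i) \<otimes>\<^bsub>E\<^esub> H j (y \<boxtimes> w))"
      using tens iz by (intro S.finsum_cong_on) (auto simp: Ht S.m_ac)
    finally show ?case .
  next
    case (add s t)
    have "H i ((\<one>\<^bsub>E\<^esub> \<boxtimes> z) \<otimes>\<^bsub>TE\<^esub> (s \<oplus>\<^bsub>TE\<^esub> t))
        = (\<Oplus>\<^bsub>E\<^esub>j\<in>{1..n}. g (co (z \<otimes>\<^bsub>E\<^esub> e j) i) \<otimes>\<^bsub>E\<^esub> H j s) \<oplus>\<^bsub>E\<^esub> (\<Oplus>\<^bsub>E\<^esub>j\<in>{1..n}. g (co (z \<otimes>\<^bsub>E\<^esub> e j) i) \<otimes>\<^bsub>E\<^esub> H j t)"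
      using add iz by (simp add: EE.TP.r_distr Hadd)
    also have "\<dots> = (\<Oplus>\<^bsub>E\<^esub>j\<in>{1..n}. g (co (z \<otimes>\<^bsub>E\<^esub> e j) i) \<otimes>\<^bsub>E\<^esub> H j s \<oplus>\<^bsub>E\<^esub> g (co (z \<otimes>\<^bsub>E\<^esub> e j) i) \<otimes>\<^bsub>E\<^esub> H j t)"
      using add iz Hc by (intro S.finsum_addf[symmetric]) auto
    also have "\<dots> = (\<Oplus>\<^bsub>E\<^esub>j\<in>{1..n}. g (co (z \<otimes>\<^bsub>E\<^esub> e j) i) \<otimes>\<^bsub>E\<^esub> H j (s \<oplus>\<^bsub>TE\<^esub> t))"
      using add iz Hc by (intro S.finsum_cong_on) (auto simp: Hadd S.r_distr)
    finally show ?case .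
  qed
  have H3: "\<mu> t = (\<Oplus>\<^bsub>E\<^esub>i\<in>{1..n}. e i \<otimes>\<^bsub>E\<^esub> H i t)" if "t \<in> carrier TE" for t
    using that
  proof (induction t rule: EE.TP_induct)
    case (tens y w)
    have "\<mu> (y \<boxtimes> w) = y \<otimes>\<^bsub>E\<^esub> (\<Oplus>\<^bsub>E\<^esub>i\<in>{1..n}. g (co w i) \<otimes>\<^bsub>E\<^esub> e i)"
      using tens co_spec(2)[of w] by (simp add: \<mu>_tens)
    also have "\<dots> = (\<Oplus>\<^bsub>E\<^esub>i\<in>{1..n}. y \<otimes>\<^bsub>E\<^esub> (g (co w i) \<otimes>\<^bsub>E\<^esub> e i))"
      using tens by (intro S.finsum_lmult) auto
    also have "\<dots> = (\<Oplus>\<^bsub>E\<^esub>i\<in>{1..n}. e i \<otimes>\<^bsub>E\<^esub> H i (y \<boxtimes> w))"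
      using tens by (intro S.finsum_cong_on) (auto simp: Ht S.m_ac)
    finally show ?case .
  next
    case (add s t)
    have "\<mu> (s \<oplus>\<^bsub>TE\<^esub> t) = (\<Oplus>\<^bsub>E\<^esub>i\<in>{1..n}. e i \<otimes>\<^bsub>E\<^esub> H i s \<oplus>\<^bsub>E\<^esub> e i \<otimes>\<^bsub>E\<^esub> H i t)"
      using add Hc by (subst S.finsum_addf) auto
    also have "\<dots> = (\<Oplus>\<^bsub>E\<^esub>i\<in>{1..n}. e i \<otimes>\<^bsub>E\<^esub> H i (s \<oplus>\<^bsub>TE\<^esub> t))"
      using add Hc by (intro S.finsum_cong_on) (auto simp: Hadd S.r_distr)
    finally show ?case .
  qed
  \<comment> \<open>The coefficient of s at e_i in the right factor.\<close>
  define b where "b i = H i s" for i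
  have bc: "i \<in> {1..n} \<Longrightarrow> b i \<in> carrier E" for i unfolding b_def using Hc s by auto
  have dual: "z = (\<Oplus>\<^bsub>E\<^esub>i\<in>{1..n}. g (tr (z \<otimes>\<^bsub>E\<^esub> e i)) \<otimes>\<^bsub>E\<^esub> b i)" if z: "z \<in> carrier E" for z
  proof -
    have "z = z \<otimes>\<^bsub>E\<^esub> (\<Oplus>\<^bsub>E\<^esub>j\<in>{1..n}. e j \<otimes>\<^bsub>E\<^esub> b j)"
      unfolding b_def H3[OF s(1), symmetric] s(2) using z by simp
    also have "\<dots> = (\<Oplus>\<^bsub>E\<^esub>j\<in>{1..n}. z \<otimes>\<^bsub>E\<^esub> (e j \<otimes>\<^bsub>E\<^esub> b j))" using z bc by (intro S.finsum_lmult) auto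
    also have "\<dots> = (\<Oplus>\<^bsub>E\<^esub>j\<in>{1..n}. \<Oplus>\<^bsub>E\<^esub>i\<in>{1..n}. g (co (z \<otimes>\<^bsub>E\<^esub> e i \<otimes>\<^bsub>E\<^esub> e j) j) \<otimes>\<^bsub>E\<^esub> b i)"
    proof (intro S.finsum_cong_on)
      fix j assume j: "j \<in> {1..n}"
      \<comment> \<open>The factor z e_j enters on the left of s and leaves on the right, where the
        contraction turns it into matrix entries. Summing the diagonal ones over j then produces the
        trace of z e_i.\<close>
      have "z \<otimes>\<^bsub>E\<^esub> (e j \<otimes>\<^bsub>E\<^esub> b j) = H j (((z \<otimes>\<^bsub>E\<^esub> e j) \<boxtimes> \<one>\<^bsub>E\<^esub>) \<otimes>\<^bsub>TE\<^esub> s)"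
        using H1[of j "z \<otimes>\<^bsub>E\<^esub> e j" s] j z s bc by (simp add: b_def S.m_assoc)
      also have "\<dots> = H j ((\<one>\<^bsub>E\<^esub> \<boxtimes> (z \<otimes>\<^bsub>E\<^esub> e j)) \<otimes>\<^bsub>TE\<^esub> s)" using s(3) z j by simp
      also have "\<dots> = (\<Oplus>\<^bsub>E\<^esub>i\<in>{1..n}. g (co (z \<otimes>\<^bsub>E\<^esub> e j \<otimes>\<^bsub>E\<^esub> e i) j) \<otimes>\<^bsub>E\<^esub> b i)"
        unfolding b_def using z j s by (intro H2) auto
      also have "\<dots> = (\<Oplus>\<^bsub>E\<^esub>i\<in>{1..n}. g (co (z \<otimes>\<^bsub>E\<^esub> e i \<otimes>\<^bsub>E\<^esub> e j) j) \<otimes>\<^bsub>E\<^esub> b i)"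
        using z j bc by (intro S.finsum_cong_on) (auto simp: S.m_ac)
      finally show "z \<otimes>\<^bsub>E\<^esub> (e j \<otimes>\<^bsub>E\<^esub> b j) = (\<Oplus>\<^bsub>E\<^esub>i\<in>{1..n}. g (co (z \<otimes>\<^bsub>E\<^esub> e i \<otimes>\<^bsub>E\<^esub> e j) j) \<otimes>\<^bsub>E\<^esub> b i)" .
      show "(\<Oplus>\<^bsub>E\<^esub>i\<in>{1..n}. g (co (z \<otimes>\<^bsub>E\<^esub> e i \<otimes>\<^bsub>E\<^esub> e j) j) \<otimes>\<^bsub>E\<^esub> b i) \<in> carrier E"
        using z j bc by (intro S.finsum_closed) auto
    qed
    also have "\<dots> = (\<Oplus>\<^bsub>E\<^esub>i\<in>{1..n}. \<Oplus>\<^bsub>E\<^esub>j\<in>{1..n}. g (co (z \<otimes>\<^bsub>E\<^esub> e i \<otimes>\<^bsub>E\<^esub> e j) j) \<otimes>\<^bsub>E\<^esub> b i)"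
      using z bc by (intro S.finsum_fubini) auto
    also have "\<dots> = (\<Oplus>\<^bsub>E\<^esub>i\<in>{1..n}. g (tr (z \<otimes>\<^bsub>E\<^esub> e i)) \<otimes>\<^bsub>E\<^esub> b i)"
    proof (intro S.finsum_cong_on)
      fix i assume i: "i \<in> {1..n}"
      have "g (tr (z \<otimes>\<^bsub>E\<^esub> e i)) = (\<Oplus>\<^bsub>E\<^esub>j\<in>{1..n}. g (co (z \<otimes>\<^bsub>E\<^esub> e i \<otimes>\<^bsub>E\<^esub> e j) j))"
        unfolding tr_def using z i by (subst hom_finsum) (auto simp: o_def)
      then show "(\<Oplus>\<^bsub>E\<^esub>j\<in>{1..n}. g (co (z \<otimes>\<^bsub>E\<^esub> e i \<otimes>\<^bsub>E\<^esub> e j) j) \<otimes>\<^bsub>E\<^esub> b i) = g (tr (z \<otimes>\<^bsub>E\<^esub> e i)) \<otimes>\<^bsub>E\<^esub> b i"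
        using z i bc by (simp, subst S.finsum_rmult) auto
    qed (use z bc in auto)
    finally show ?thesis .
  qed
  have "(\<Oplus>\<^bsub>B\<^esub>i\<in>{1..n}. tr (e k \<otimes>\<^bsub>E\<^esub> e i) \<otimes>\<^bsub>B\<^esub> co (b i) l) = (if k = l then \<one>\<^bsub>B\<^esub> else \<zero>\<^bsub>B\<^esub>)"
    if kl: "k \<in> {1..n}" "l \<in> {1..n}" for k l
  proof -
    have "co (e k) l = co (\<Oplus>\<^bsub>E\<^esub>i\<in>{1..n}. g (tr (e k \<otimes>\<^bsub>E\<^esub> e i)) \<otimes>\<^bsub>E\<^esub> b i) l"
      using dual[of "e k"] kl by simp
    also have "\<dots> = (\<Oplus>\<^bsub>B\<^esub>i\<in>{1..n}. co (g (tr (e k \<otimes>\<^bsub>E\<^esub> e i)) \<otimes>\<^bsub>E\<^esub> b i) l)"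
      using kl bc by (intro co_finsum) auto
    also have "\<dots> = (\<Oplus>\<^bsub>B\<^esub>i\<in>{1..n}. tr (e k \<otimes>\<^bsub>E\<^esub> e i) \<otimes>\<^bsub>B\<^esub> co (b i) l)"
      using kl bc by (intro R.finsum_cong_on) (auto simp: co_smult)
    finally show ?thesis using co_basis[OF kl] by simp
  qed
  then have "R.det {1..n} (\<lambda>k l. \<Oplus>\<^bsub>B\<^esub>i\<in>{1..n}. tr (e k \<otimes>\<^bsub>E\<^esub> e i) \<otimes>\<^bsub>B\<^esub> co (b i) l)
      = R.det {1..n} (\<lambda>k l. if k = l then \<one>\<^bsub>B\<^esub> else \<zero>\<^bsub>B\<^esub>)"
    by (intro R.det_cong) auto
  then have "trace_form \<otimes>\<^bsub>B\<^esub> R.det {1..n} (\<lambda>i l. co (b i) l) = \<one>\<^bsub>B\<^esub>"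
    unfolding trace_form_def using bc by (subst R.det_mult[symmetric]) (auto simp: R.det_identity)
  moreover have "trace_form \<in> carrier B" "R.det {1..n} (\<lambda>i l. co (b i) l) \<in> carrier B"
    unfolding trace_form_def using bc by (auto intro!: R.det_closed)
  ultimately show ?thesis by (metis R.Units_one_closed R.unit_factor)
qed

end

section \<open>Tensor powers\<close>

locale algebra_power = Al: ring_hom_cring A R iR + tensor_power A R iR n
  for A :: "('a, 'k) ring_scheme" and R :: "('r, 'l) ring_scheme" and iR :: "'a \<Rightarrow> 'r" and n :: nat +
  assumes n_pos: "n \<ge> 1"
begin

definition tuples :: "(nat \<Rightarrow> 'r) monoid"
  where "tuples = product_group {1..n} (\<lambda>_. R)"

lemma tuples_simps:
  "carrier tuples = {1..n} \<rightarrow>\<^sub>E carrier R"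
  "g \<otimes>\<^bsub>tuples\<^esub> h = (\<lambda>i\<in>{1..n}. g i \<otimes>\<^bsub>R\<^esub> h i)"
  "\<one>\<^bsub>tuples\<^esub> = (\<lambda>i\<in>{1..n}. \<one>\<^bsub>R\<^esub>)"
  by (simp_all add: tuples_def)

definition S\<^sub>T :: "((nat \<Rightarrow> 'r) \<times> (nat \<Rightarrow> 'r) \<times> (nat \<Rightarrow> 'r)) set"
  where "S\<^sub>T = {(y(i := m \<oplus>\<^bsub>R\<^esub> m'), y(i := m), y(i := m')) | y i m m'.
    y \<in> {1..n} \<rightarrow>\<^sub>E carrier R \<and> i \<in> {1..n} \<and> m \<in> carrier R \<and> m' \<in> carrier R}"

definition S\<^sub>T' :: "('a \<times> (nat \<Rightarrow> 'r) \<times> (nat \<Rightarrow> 'r)) set"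
  where "S\<^sub>T' = {(a, y(i := iR a \<otimes>\<^bsub>R\<^esub> m), y(i := m)) | y i a m.
    y \<in> {1..n} \<rightarrow>\<^sub>E carrier R \<and> i \<in> {1..n} \<and> a \<in> carrier A \<and> m \<in> carrier R}"

lemma tuples_comm_monoid: "comm_monoid tuples"
proof (rule comm_monoidI)
  fix x assume "x \<in> carrier tuples"
  then show "\<one>\<^bsub>tuples\<^esub> \<otimes>\<^bsub>tuples\<^esub> x = x"
    by (intro extensionalityI[of _ "{1..n}"]) (auto simp: tuples_simps PiE_iff)
qed (auto simp: tuples_simps Al.S.m_ac PiE_iff intro!: restrict_ext)

lemma fun_upd_tuple: "\<lbrakk>y \<in> {1..n} \<rightarrow>\<^sub>E carrier R; i \<in> {1..n}; m \<in> carrier R\<rbrakk> \<Longrightarrow> y(i := m) \<in> {1..n} \<rightarrow>\<^sub>E carrier R"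
  by (auto simp: PiE_iff extensional_def)

interpretation P: presented_algebra A tuples S\<^sub>T S\<^sub>T'
proof -
  interpret G: comm_monoid tuples by (rule tuples_comm_monoid)
  show "presented_algebra A tuples S\<^sub>T S\<^sub>T'"
    by unfold_locales (auto simp: tuples_simps(1) S\<^sub>T_def S\<^sub>T'_def simp del: PiE_iff intro!: fun_upd_tuple)
qed

lemma relations_eq: "P.relations = multilinear_relations A (alg_module R iR) n"
proof -
  define r3 where "r3 = (\<lambda>g h k. basis_elt A g \<ominus>\<^bsub>P.F\<^esub> (basis_elt A h \<oplus>\<^bsub>P.F\<^esub> basis_elt A k) :: (nat \<Rightarrow> 'r) \<Rightarrow> 'a)"
  define r2 where "r2 = (\<lambda>b g h. basis_elt A g \<ominus>\<^bsub>P.F\<^esub> b \<odot>\<^bsub>P.F\<^esub> basis_elt A h :: (nat \<Rightarrow> 'r) \<Rightarrow> 'a)"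
  have 1: "P.relations = {r3 g h k | g h k. (g, h, k) \<in> S\<^sub>T} \<union> {r2 b g h | b g h. (b, g, h) \<in> S\<^sub>T'}"
    unfolding P.relations_def r3_def r2_def ..
  have 2: "multilinear_relations A (alg_module R iR) n =
      {r3 (y(i := m \<oplus>\<^bsub>R\<^esub> m')) (y(i := m)) (y(i := m')) | y i m m'.
         y \<in> {1..n} \<rightarrow>\<^sub>E carrier R \<and> i \<in> {1..n} \<and> m \<in> carrier R \<and> m' \<in> carrier R}
    \<union> {r2 a (y(i := iR a \<otimes>\<^bsub>R\<^esub> m)) (y(i := m)) | y i a m.
         y \<in> {1..n} \<rightarrow>\<^sub>E carrier R \<and> i \<in> {1..n} \<and> a \<in> carrier A \<and> m \<in> carrier R}"
    unfolding multilinear_relations_def Let_def r3_def r2_def a_minus_monoid_algebra monoid_algebra_module_simps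
      tuples_simps(1)
    by simp
  have 3: "{r3 g h k | g h k. (g, h, k) \<in> S\<^sub>T} = {r3 (y(i := m \<oplus>\<^bsub>R\<^esub> m')) (y(i := m)) (y(i := m')) | y i m m'.
         y \<in> {1..n} \<rightarrow>\<^sub>E carrier R \<and> i \<in> {1..n} \<and> m \<in> carrier R \<and> m' \<in> carrier R}"
    unfolding S\<^sub>T_def by blast
  have 4: "{r2 b g h | b g h. (b, g, h) \<in> S\<^sub>T'} = {r2 a (y(i := iR a \<otimes>\<^bsub>R\<^esub> m)) (y(i := m)) | y i a m.
         y \<in> {1..n} \<rightarrow>\<^sub>E carrier R \<and> i \<in> {1..n} \<and> a \<in> carrier A \<and> m \<in> carrier R}"
    unfolding S\<^sub>T'_def by blast
  show ?thesis unfolding 1 2 3 4 ..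
qed

lemma T_ideal_eq: "T_ideal = P.I"
  unfolding T_ideal_def tuple_algebra_def tuples_def[symmetric] P.I_def relations_eq ..

lemma T_eq: "T = P.Q"
  unfolding T_def P.Q_def T_ideal_eq tuple_algebra_def tuples_def[symmetric] ..

lemma pure_eq: "pure y = P.cls (restrict y {1..n})"
  unfolding pure_def P.cls_def T_ideal_eq tuple_algebra_def tuples_def[symmetric] ..

lemma T_map_eq: "T_map a = P.scal a"
  unfolding T_map_def P.scal_def T_ideal_eq tuple_algebra_def tuples_def[symmetric] ..

lemma T_cring: "cring T" unfolding T_eq by (rule P.Q_cring)

sublocale T: cring T by (rule T_cring)

lemma T_map_hom: "ring_hom_cring A T T_map"
proof -
  have "T_map = P.scal" by (intro ext) (rule T_map_eq)
  then show ?thesis unfolding T_eq using P.scal_hom by simp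
qed

lemma restrict_tuple: "y \<in> {1..n} \<rightarrow> carrier R \<Longrightarrow> restrict y {1..n} \<in> carrier tuples"
  by (auto simp: tuples_simps)

lemma pure_closed [simp, intro]: "y \<in> {1..n} \<rightarrow> carrier R \<Longrightarrow> pure y \<in> carrier T"
  unfolding pure_eq T_eq by (intro P.cls_closed restrict_tuple)

lemma pure_cong: "(\<And>i. i \<in> {1..n} \<Longrightarrow> y i = z i) \<Longrightarrow> pure y = pure z"
  unfolding pure_def by (metis restrict_ext)

lemma pure_mult:
  assumes "y \<in> {1..n} \<rightarrow> carrier R" "z \<in> {1..n} \<rightarrow> carrier R"
  shows "pure y \<otimes>\<^bsub>T\<^esub> pure z = pure (\<lambda>i. y i \<otimes>\<^bsub>R\<^esub> z i)"
proof -
  have "restrict (\<lambda>i. y i \<otimes>\<^bsub>R\<^esub> z i) {1..n} = restrict y {1..n} \<otimes>\<^bsub>tuples\<^esub> restrict z {1..n}"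
    by (auto simp: tuples_simps restrict_def)
  then show ?thesis
    unfolding pure_eq T_eq using P.cls_mult[OF restrict_tuple restrict_tuple, OF assms] by simp
qed

lemma pure_one: "pure (\<lambda>i. \<one>\<^bsub>R\<^esub>) = \<one>\<^bsub>T\<^esub>"
  unfolding pure_eq T_eq using P.cls_one by (simp add: tuples_simps)

lemma restrict_fun_upd: "i \<in> J \<Longrightarrow> restrict (y(i := m)) J = (restrict y J)(i := m)"
  by (auto simp: restrict_def fun_eq_iff)

lemma pure_add:
  assumes "y \<in> {1..n} \<rightarrow> carrier R" "i \<in> {1..n}" "m \<in> carrier R" "m' \<in> carrier R"
  shows "pure (y(i := m \<oplus>\<^bsub>R\<^esub> m')) = pure (y(i := m)) \<oplus>\<^bsub>T\<^esub> pure (y(i := m'))"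
  unfolding pure_eq T_eq restrict_fun_upd[OF assms(2)]
  using assms
  by (intro P.cls_add, unfold S\<^sub>T_def,
      intro CollectI exI[of _ "restrict y {1..n}"] exI[of _ i] exI[of _ m] exI[of _ m'] conjI refl) auto

lemma pure_smult:
  assumes "y \<in> {1..n} \<rightarrow> carrier R" "i \<in> {1..n}" "m \<in> carrier R" "a \<in> carrier A"
  shows "pure (y(i := iR a \<otimes>\<^bsub>R\<^esub> m)) = T_map a \<otimes>\<^bsub>T\<^esub> pure (y(i := m))"
  unfolding pure_eq T_eq T_map_eq restrict_fun_upd[OF assms(2)]
  using assms
  by (intro P.cls_smult, unfold S\<^sub>T'_def,
      intro CollectI exI[of _ "restrict y {1..n}"] exI[of _ i] exI[of _ a] exI[of _ m] conjI refl) auto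

text \<open>A scalar is absorbed into the first factor, which exists because n is at least 1; hence
  pure tensors generate the tensor power additively.\<close>

lemma T_induct [consumes 1, case_names pure add]:
  assumes "t \<in> carrier T"
    and pure: "\<And>y. y \<in> {1..n} \<rightarrow> carrier R \<Longrightarrow> Q (pure y)"
    and add: "\<And>s t. s \<in> carrier T \<Longrightarrow> t \<in> carrier T \<Longrightarrow> Q s \<Longrightarrow> Q t \<Longrightarrow> Q (s \<oplus>\<^bsub>T\<^esub> t)"
  shows "Q t"
proof -
  have sc: "Q (P.scal a \<otimes>\<^bsub>P.Q\<^esub> P.cls y)" if ay: "a \<in> carrier A" "y \<in> carrier tuples" for a y
  proof -
    have y: "y \<in> {1..n} \<rightarrow>\<^sub>E carrier R" using ay by (simp add: tuples_simps)
    have y1: "1 \<in> {1..n}" "y 1 \<in> carrier R" using n_pos y by auto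
    have e: "pure y = P.cls y" unfolding pure_eq using y by (simp add: PiE_restrict)
    have "pure (y(1 := iR a \<otimes>\<^bsub>R\<^esub> y 1)) = T_map a \<otimes>\<^bsub>T\<^esub> pure (y(1 := y 1))"
      using ay y y1 by (intro pure_smult) auto
    then have "P.scal a \<otimes>\<^bsub>P.Q\<^esub> P.cls y = pure (y(1 := iR a \<otimes>\<^bsub>R\<^esub> y 1))"
      by (simp add: e T_map_eq T_eq)
    moreover have "y(1 := iR a \<otimes>\<^bsub>R\<^esub> y 1) \<in> {1..n} \<rightarrow> carrier R" using ay y y1 by auto
    ultimately show ?thesis using pure by simp
  qed
  show ?thesis
  proof (rule P.Q_induct[of t Q])
    show "t \<in> carrier P.Q" using assms(1) by (simp add: T_eq)
    have "Q (P.scal \<zero>\<^bsub>A\<^esub> \<otimes>\<^bsub>P.Q\<^esub> P.cls \<one>\<^bsub>tuples\<^esub>)" by (rule sc) auto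
    moreover have "P.scal \<zero>\<^bsub>A\<^esub> \<otimes>\<^bsub>P.Q\<^esub> P.cls \<one>\<^bsub>tuples\<^esub> = \<zero>\<^bsub>P.Q\<^esub>"
      using P.scal.hom_zero P.cls_closed[of "\<one>\<^bsub>tuples\<^esub>"] by simp
    ultimately show "Q \<zero>\<^bsub>P.Q\<^esub>" by simp
  qed (use sc add in \<open>auto simp: T_eq\<close>)
qed

text \<open>The universal property for multilinear maps, with no multiplicativity demanded of k. The
  coefficient acts through j on the value, which is why C comes with a homomorphism from A.\<close>

lemma multilinear_lift:
  assumes "ring_hom_cring A C j"
    and k: "\<And>y. y \<in> {1..n} \<rightarrow>\<^sub>E carrier R \<Longrightarrow> k y \<in> carrier C"
    and k_add: "\<And>y i m m'. \<lbrakk>y \<in> {1..n} \<rightarrow>\<^sub>E carrier R; i \<in> {1..n}; m \<in> carrier R; m' \<in> carrier R\<rbrakk>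
      \<Longrightarrow> k (y(i := m \<oplus>\<^bsub>R\<^esub> m')) = k (y(i := m)) \<oplus>\<^bsub>C\<^esub> k (y(i := m'))"
    and k_smult: "\<And>y i a m. \<lbrakk>y \<in> {1..n} \<rightarrow>\<^sub>E carrier R; i \<in> {1..n}; m \<in> carrier R; a \<in> carrier A\<rbrakk>
      \<Longrightarrow> k (y(i := iR a \<otimes>\<^bsub>R\<^esub> m)) = j a \<otimes>\<^bsub>C\<^esub> k (y(i := m))"
  shows "\<exists>H \<in> carrier T \<rightarrow> carrier C. (\<forall>s\<in>carrier T. \<forall>t\<in>carrier T. H (s \<oplus>\<^bsub>T\<^esub> t) = H s \<oplus>\<^bsub>C\<^esub> H t)
    \<and> (\<forall>y \<in> {1..n} \<rightarrow> carrier R. H (pure y) = k (restrict y {1..n}))"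
proof -
  interpret j: ring_hom_cring A C j by fact
  \<comment> \<open>Multiplying by a tuple g turns the substitution of m in slot i into the
    substitution of \<open>g i\<close> times m, so the relations remain multilinear
    relations.\<close>
  have mul: "g \<otimes>\<^bsub>tuples\<^esub> y(i := m) = (g \<otimes>\<^bsub>tuples\<^esub> y)(i := g i \<otimes>\<^bsub>R\<^esub> m)" if "i \<in> {1..n}" for g y i m
    using that by (auto simp: tuples_simps restrict_def fun_eq_iff)
  have mulc: "g \<otimes>\<^bsub>tuples\<^esub> y \<in> {1..n} \<rightarrow>\<^sub>E carrier R" if "g \<in> {1..n} \<rightarrow>\<^sub>E carrier R" "y \<in> {1..n} \<rightarrow>\<^sub>E carrier R" for g y
    using that by (auto simp: tuples_simps)
  have "balanced_weight A tuples S\<^sub>T S\<^sub>T' C (\<lambda>a y. j a \<otimes>\<^bsub>C\<^esub> k y)"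
  proof (unfold_locales, goal_cases)
    case (1 a g)
    then show ?case using k[of g] by (simp add: tuples_simps(1))
  next
    case (2 a b g)
    then show ?case using k[of g] by (simp add: tuples_simps(1) j.S.l_distr)
  next
    case (3 p q r a g)
    then obtain y i m m' where *: "y \<in> {1..n} \<rightarrow>\<^sub>E carrier R" "i \<in> {1..n}" "m \<in> carrier R" "m' \<in> carrier R"
      "p = y(i := m \<oplus>\<^bsub>R\<^esub> m')" "q = y(i := m)" "r = y(i := m')" unfolding S\<^sub>T_def by blast
    have g: "g \<in> {1..n} \<rightarrow>\<^sub>E carrier R" using 3 by (simp add: tuples_simps)
    then have gi: "g i \<in> carrier R" using * by auto
    note gy = mulc[OF g *(1)]
    have "k ((g \<otimes>\<^bsub>tuples\<^esub> y)(i := g i \<otimes>\<^bsub>R\<^esub> m \<oplus>\<^bsub>R\<^esub> g i \<otimes>\<^bsub>R\<^esub> m'))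
        = k ((g \<otimes>\<^bsub>tuples\<^esub> y)(i := g i \<otimes>\<^bsub>R\<^esub> m)) \<oplus>\<^bsub>C\<^esub> k ((g \<otimes>\<^bsub>tuples\<^esub> y)(i := g i \<otimes>\<^bsub>R\<^esub> m'))"
      using * gi gy by (intro k_add) auto
    moreover have "k ((g \<otimes>\<^bsub>tuples\<^esub> y)(i := g i \<otimes>\<^bsub>R\<^esub> m)) \<in> carrier C" "k ((g \<otimes>\<^bsub>tuples\<^esub> y)(i := g i \<otimes>\<^bsub>R\<^esub> m')) \<in> carrier C"
      using * gi gy by (auto simp del: PiE_iff intro!: k fun_upd_tuple)
    ultimately show ?case
      unfolding *(5-7) mul[OF *(2)] using * gi 3 by (simp add: Al.S.r_distr j.S.r_distr)
  next
    case (4 b p q a g)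
    then obtain y i m where *: "y \<in> {1..n} \<rightarrow>\<^sub>E carrier R" "i \<in> {1..n}" "m \<in> carrier R" "b \<in> carrier A"
      "p = y(i := iR b \<otimes>\<^bsub>R\<^esub> m)" "q = y(i := m)" unfolding S\<^sub>T'_def by blast
    have g: "g \<in> {1..n} \<rightarrow>\<^sub>E carrier R" using 4 by (simp add: tuples_simps)
    then have gi: "g i \<in> carrier R" using * by auto
    note gy = mulc[OF g *(1)]
    have e: "g i \<otimes>\<^bsub>R\<^esub> (iR b \<otimes>\<^bsub>R\<^esub> m) = iR b \<otimes>\<^bsub>R\<^esub> (g i \<otimes>\<^bsub>R\<^esub> m)" using * gi by (simp add: Al.S.m_lcomm)
    have "k ((g \<otimes>\<^bsub>tuples\<^esub> y)(i := iR b \<otimes>\<^bsub>R\<^esub> (g i \<otimes>\<^bsub>R\<^esub> m))) = j b \<otimes>\<^bsub>C\<^esub> k ((g \<otimes>\<^bsub>tuples\<^esub> y)(i := g i \<otimes>\<^bsub>R\<^esub> m))"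
      using * gi gy by (intro k_smult) auto
    moreover have "k ((g \<otimes>\<^bsub>tuples\<^esub> y)(i := g i \<otimes>\<^bsub>R\<^esub> m)) \<in> carrier C"
      using * gi gy by (auto simp del: PiE_iff intro!: k fun_upd_tuple)
    ultimately show ?case
      unfolding *(5-6) mul[OF *(2)] e using * gi 4 by (simp add: j.S.m_assoc)
  qed
  then interpret w: balanced_weight A tuples S\<^sub>T S\<^sub>T' C "\<lambda>a y. j a \<otimes>\<^bsub>C\<^esub> k y" .
  have "P.lift C (\<lambda>a y. j a \<otimes>\<^bsub>C\<^esub> k y) (pure y) = k (restrict y {1..n})" if y: "y \<in> {1..n} \<rightarrow> carrier R" for y
    unfolding pure_eq using w.lift_cls[OF restrict_tuple[OF y]] k[of "restrict y {1..n}"] y by simp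
  then show ?thesis
    by (intro bexI[of _ "P.lift C (\<lambda>a y. j a \<otimes>\<^bsub>C\<^esub> k y)"]) (auto simp: T_eq w.lift_add)
qed

subsection \<open>Permutation of the factors\<close>

text \<open>The action of a permutation before passing to cosets. A monomial at the tuple g goes to
  the one at g composed with the inverse of \<open>\<pi>\<close>, so that factor p moves to position
  \<open>\<pi> p\<close>.\<close>

definition pull :: "(nat \<Rightarrow> nat) \<Rightarrow> ((nat \<Rightarrow> 'r) \<Rightarrow> 'a) \<Rightarrow> (nat \<Rightarrow> 'r) \<Rightarrow> 'a"
  where "pull \<pi> u = (\<lambda>y. u (y \<circ> \<pi>))"

lemma permute_pull: "permute_factors \<pi> Z = pull \<pi> ` Z"
  unfolding permute_factors_def pull_def ..

lemma tuple_comp: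
  assumes "\<pi> permutes {1..n}"
  shows "y \<circ> \<pi> \<in> {1..n} \<rightarrow>\<^sub>E carrier R \<longleftrightarrow> y \<in> {1..n} \<rightarrow>\<^sub>E carrier R"
proof -
  have 1: "y \<circ> \<tau> \<in> {1..n} \<rightarrow>\<^sub>E carrier R" if "y \<in> {1..n} \<rightarrow>\<^sub>E carrier R" "\<tau> permutes {1..n}" for y \<tau>
    using that permutes_in_image[OF that(2)] permutes_not_in[OF that(2)]
    by (auto simp: PiE_iff extensional_def)
  have "y = (y \<circ> \<pi>) \<circ> inv_into UNIV \<pi>" using assms by (simp add: o_assoc[symmetric] permutes_inv_o)
  then show ?thesis using 1[of y \<pi>] 1[of "y \<circ> \<pi>" "inv_into UNIV \<pi>"] assms permutes_inv[OF assms] by metis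
qed

lemma pull_monomial:
  assumes "\<pi> permutes {1..n}"
  shows "pull \<pi> (P.monomial a g) = P.monomial a (g \<circ> inv_into UNIV \<pi>)"
proof -
  have "y \<circ> \<pi> = g \<longleftrightarrow> y = g \<circ> inv_into UNIV \<pi>" for y :: "nat \<Rightarrow> 'r"
    using assms by (auto simp: o_assoc[symmetric] permutes_inv_o)
  then show ?thesis unfolding pull_def P.monomial_def by auto
qed

lemma pull_closed:
  assumes "\<pi> permutes {1..n}" "u \<in> carrier P.F"
  shows "pull \<pi> u \<in> carrier P.F"
proof -
  have inj: "inj (\<lambda>y :: nat \<Rightarrow> 'r. y \<circ> \<pi>)"
  proof (rule injI)
    fix y z :: "nat \<Rightarrow> 'r" assume "y \<circ> \<pi> = z \<circ> \<pi>"
    then have "y \<circ> \<pi> \<circ> inv_into UNIV \<pi> = z \<circ> \<pi> \<circ> inv_into UNIV \<pi>" by simp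
    then show "y = z" using assms(1) by (simp add: o_assoc[symmetric] permutes_inv_o)
  qed
  have "P.supp (pull \<pi> u) = (\<lambda>y. y \<circ> \<pi>) -` P.supp u" by (auto simp: P.supp_def pull_def)
  then have "finite (P.supp (pull \<pi> u))"
    using finite_vimageI[OF P.F_carrierD(2)[OF assms(2)] inj] by simp
  moreover have "pull \<pi> u y = \<zero>\<^bsub>A\<^esub>" if "y \<notin> carrier tuples" for y
  proof -
    have "y \<circ> \<pi> \<notin> carrier tuples" using that tuple_comp[OF assms(1)] by (simp add: tuples_simps)
    then show ?thesis using assms(2) unfolding P.F_simps(1) pull_def by blast
  qed
  ultimately show ?thesis using P.F_carrierD(1)[OF assms(2)] unfolding P.F_simps(1) pull_def by blast
qed

text \<open>Permuting the slots is an automorphism of the monoid of tuples, so the induced map is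
  multiplicative on monomials and hence everywhere.\<close>

lemma pull_hom:
  assumes "\<pi> permutes {1..n}"
  shows "ring_hom_cring P.F P.F (pull \<pi>)"
proof -
  let ?\<rho> = "inv_into UNIV \<pi>"
  have inv: "?\<rho> permutes {1..n}" using assms by (rule permutes_inv)
  have gc: "g \<circ> ?\<rho> \<in> carrier tuples" if "g \<in> carrier tuples" for g
    using that tuple_comp[OF inv, of g] by (simp add: tuples_simps)
  have gm: "(g \<otimes>\<^bsub>tuples\<^esub> h) \<circ> ?\<rho> = (g \<circ> ?\<rho>) \<otimes>\<^bsub>tuples\<^esub> (h \<circ> ?\<rho>)" for g h
    using permutes_in_image[OF inv] by (auto simp: tuples_simps fun_eq_iff restrict_def)
  have add: "pull \<pi> (u \<oplus>\<^bsub>P.F\<^esub> v) = pull \<pi> u \<oplus>\<^bsub>P.F\<^esub> pull \<pi> v" for u v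
    by (simp add: P.F_simps pull_def)
  have zero: "pull \<pi> \<zero>\<^bsub>P.F\<^esub> = \<zero>\<^bsub>P.F\<^esub>" by (simp add: P.F_simps pull_def)
  have mm: "pull \<pi> (P.monomial a g \<otimes>\<^bsub>P.F\<^esub> v) = pull \<pi> (P.monomial a g) \<otimes>\<^bsub>P.F\<^esub> pull \<pi> v"
    if ag: "a \<in> carrier A" "g \<in> carrier tuples" and "v \<in> carrier P.F" for a g v
    using that(3)
  proof (induction v rule: P.F_induct)
    case zero
    then show ?case using ag pull_closed[OF assms] P.monomial_closed \<open>pull \<pi> \<zero>\<^bsub>P.F\<^esub> = \<zero>\<^bsub>P.F\<^esub>\<close> by simp
  next
    case (add b h v)
    have "pull \<pi> (P.monomial a g \<otimes>\<^bsub>P.F\<^esub> P.monomial b h) = pull \<pi> (P.monomial a g) \<otimes>\<^bsub>P.F\<^esub> pull \<pi> (P.monomial b h)"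
      using ag add(1,2) gc gm by (simp add: P.monomial_mult pull_monomial[OF assms])
    then show ?case
      using ag add pull_closed[OF assms] P.monomial_closed
      by (simp add: P.F.r_distr \<open>\<And>u v. pull \<pi> (u \<oplus>\<^bsub>P.F\<^esub> v) = _\<close>)
  qed
  show ?thesis
  proof (intro ring_hom_cringI[OF P.F_cring P.F_cring] ring_hom_ringI2 P.F.ring_axioms ring_hom_memI)
    fix u v assume uv: "u \<in> carrier P.F" "v \<in> carrier P.F"
    show "pull \<pi> (u \<oplus>\<^bsub>P.F\<^esub> v) = pull \<pi> u \<oplus>\<^bsub>P.F\<^esub> pull \<pi> v" by (rule add)
    show "pull \<pi> (u \<otimes>\<^bsub>P.F\<^esub> v) = pull \<pi> u \<otimes>\<^bsub>P.F\<^esub> pull \<pi> v"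
      using uv(1)
    proof (induction u rule: P.F_induct)
      case zero
      then show ?case using uv pull_closed[OF assms] \<open>pull \<pi> \<zero>\<^bsub>P.F\<^esub> = \<zero>\<^bsub>P.F\<^esub>\<close> by simp
    next
      case (add b h w)
      then show ?case
        using uv mm pull_closed[OF assms] P.monomial_closed
        by (simp add: P.F.l_distr \<open>\<And>u v. pull \<pi> (u \<oplus>\<^bsub>P.F\<^esub> v) = _\<close>)
    qed
  next
    have "\<one>\<^bsub>tuples\<^esub> \<circ> ?\<rho> = \<one>\<^bsub>tuples\<^esub>"
      using permutes_in_image[OF inv] by (auto simp: tuples_simps fun_eq_iff restrict_def)
    then show "pull \<pi> \<one>\<^bsub>P.F\<^esub> = \<one>\<^bsub>P.F\<^esub>"
      by (simp add: P.F_simps(5) pull_monomial[OF assms])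
  qed (use pull_closed[OF assms] in auto)
qed

lemma fun_upd_comp_inv:
  assumes "\<pi> permutes {1..n}"
  shows "y(i := m) \<circ> inv_into UNIV \<pi> = (y \<circ> inv_into UNIV \<pi>)(\<pi> i := m)"
proof
  fix k show "(y(i := m) \<circ> inv_into UNIV \<pi>) k = ((y \<circ> inv_into UNIV \<pi>)(\<pi> i := m)) k"
    using permutes_inverses[OF assms] by (cases "k = \<pi> i") (auto simp: permutes_inv_eq[OF assms])
qed

text \<open>A relation in slot i is carried to the relation of the same kind in slot
  \<open>\<pi> i\<close>.\<close>

lemma pull_relations:
  assumes "\<pi> permutes {1..n}" "r \<in> P.relations"
  shows "pull \<pi> r \<in> P.relations"
proof -
  interpret p: ring_hom_cring P.F P.F "pull \<pi>" by (rule pull_hom) fact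
  let ?\<rho> = "inv_into UNIV \<pi>"
  have inv: "?\<rho> permutes {1..n}" using assms(1) by (rule permutes_inv)
  have be: "pull \<pi> (basis_elt A g) = basis_elt A (g \<circ> ?\<rho>)" for g
    by (simp add: P.basis_elt_eq pull_monomial[OF assms(1)])
  have bc: "g \<in> {1..n} \<rightarrow>\<^sub>E carrier R \<Longrightarrow> basis_elt A g \<in> carrier P.F" for g
    by (simp add: P.basis_elt_eq tuples_simps(1))
  have sm: "pull \<pi> (b \<odot>\<^bsub>P.F\<^esub> u) = b \<odot>\<^bsub>P.F\<^esub> pull \<pi> u" for b u by (simp add: P.F_simps pull_def)
  have sc: "b \<in> carrier A \<Longrightarrow> g \<in> {1..n} \<rightarrow>\<^sub>E carrier R \<Longrightarrow> b \<odot>\<^bsub>P.F\<^esub> basis_elt A g \<in> carrier P.F" for b g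
    by (simp add: P.smult_basis tuples_simps(1))
  have yc: "y \<circ> ?\<rho> \<in> {1..n} \<rightarrow>\<^sub>E carrier R" if "y \<in> {1..n} \<rightarrow>\<^sub>E carrier R" for y
    using that tuple_comp[OF inv, of y] by simp
  have S: "(g \<circ> ?\<rho>, h \<circ> ?\<rho>, k \<circ> ?\<rho>) \<in> S\<^sub>T" if "(g, h, k) \<in> S\<^sub>T" for g h k
  proof -
    from that obtain y i m m' where *: "y \<in> {1..n} \<rightarrow>\<^sub>E carrier R" "i \<in> {1..n}" "m \<in> carrier R" "m' \<in> carrier R"
      "g = y(i := m \<oplus>\<^bsub>R\<^esub> m')" "h = y(i := m)" "k = y(i := m')" unfolding S\<^sub>T_def by blast
    show ?thesis unfolding *(5-7) fun_upd_comp_inv[OF assms(1)]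
      unfolding S\<^sub>T_def using *(1-4) yc[OF *(1)] permutes_in_image[OF assms(1), of i] by blast
  qed
  have S': "(b, g \<circ> ?\<rho>, h \<circ> ?\<rho>) \<in> S\<^sub>T'" if "(b, g, h) \<in> S\<^sub>T'" for b g h
  proof -
    from that obtain y i m where *: "y \<in> {1..n} \<rightarrow>\<^sub>E carrier R" "i \<in> {1..n}" "m \<in> carrier R" "b \<in> carrier A"
      "g = y(i := iR b \<otimes>\<^bsub>R\<^esub> m)" "h = y(i := m)" unfolding S\<^sub>T'_def by blast
    show ?thesis unfolding *(5-6) fun_upd_comp_inv[OF assms(1)]
      unfolding S\<^sub>T'_def using *(1-4) yc[OF *(1)] permutes_in_image[OF assms(1), of i] by blast
  qed
  from assms(2) consider
    (1) g h k where "(g, h, k) \<in> S\<^sub>T" "r = basis_elt A g \<ominus>\<^bsub>P.F\<^esub> (basis_elt A h \<oplus>\<^bsub>P.F\<^esub> basis_elt A k)"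
    | (2) b g h where "(b, g, h) \<in> S\<^sub>T'" "r = basis_elt A g \<ominus>\<^bsub>P.F\<^esub> b \<odot>\<^bsub>P.F\<^esub> basis_elt A h"
    unfolding P.relations_def by blast
  then show ?thesis
  proof cases
    case 1
    then have "g \<in> {1..n} \<rightarrow>\<^sub>E carrier R" "h \<in> {1..n} \<rightarrow>\<^sub>E carrier R" "k \<in> {1..n} \<rightarrow>\<^sub>E carrier R"
      using P.S_closed by (auto simp: tuples_simps(1))
    then have "pull \<pi> r = basis_elt A (g \<circ> ?\<rho>) \<ominus>\<^bsub>P.F\<^esub> (basis_elt A (h \<circ> ?\<rho>) \<oplus>\<^bsub>P.F\<^esub> basis_elt A (k \<circ> ?\<rho>))"
      unfolding 1(2) using bc by (simp add: P.F.minus_eq be)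
    then show ?thesis using S[OF 1(1)] unfolding P.relations_def by blast
  next
    case 2
    then have "g \<in> {1..n} \<rightarrow>\<^sub>E carrier R" "h \<in> {1..n} \<rightarrow>\<^sub>E carrier R" "b \<in> carrier A"
      using P.S'_closed by (auto simp: tuples_simps(1))
    then have "pull \<pi> r = basis_elt A (g \<circ> ?\<rho>) \<ominus>\<^bsub>P.F\<^esub> b \<odot>\<^bsub>P.F\<^esub> basis_elt A (h \<circ> ?\<rho>)"
      unfolding 2(2) using bc sc by (simp add: P.F.minus_eq be sm)
    then show ?thesis using S'[OF 2(1)] unfolding P.relations_def by blast
  qed
qed

text \<open>The preimage of the ideal is an ideal that contains the relations.\<close>

lemma pull_I:
  assumes "\<pi> permutes {1..n}" "r \<in> P.I"
  shows "pull \<pi> r \<in> P.I"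
proof -
  interpret p: ring_hom_cring P.F P.F "pull \<pi>" by (rule pull_hom) fact
  have "P.relations \<subseteq> P.I" unfolding P.I_def by (rule P.F.genideal_self[OF P.relations_closed])
  then have "P.relations \<subseteq> {r \<in> carrier P.F. pull \<pi> r \<in> P.I}"
    using pull_relations[OF assms(1)] P.relations_closed by blast
  then have "P.I \<subseteq> {r \<in> carrier P.F. pull \<pi> r \<in> P.I}"
    using P.F.genideal_minimal[OF p.ring.ideal_vimage[OF P.I_ideal]] unfolding P.I_def by blast
  then show ?thesis using assms(2) by blast
qed

lemma pull_pull: "pull \<pi> (pull \<tau> u) = pull (\<pi> \<circ> \<tau>) u"
  by (simp add: pull_def o_assoc)

lemma permute_coset:
  assumes "\<pi> permutes {1..n}" "u \<in> carrier P.F"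
  shows "permute_factors \<pi> (P.I +>\<^bsub>P.F\<^esub> u) = P.I +>\<^bsub>P.F\<^esub> pull \<pi> u"
proof -
  interpret p: ring_hom_cring P.F P.F "pull \<pi>" by (rule pull_hom) fact
  let ?\<rho> = "inv_into UNIV \<pi>"
  have inv: "?\<rho> permutes {1..n}" using assms(1) by (rule permutes_inv)
  have Ic: "i \<in> P.I \<Longrightarrow> i \<in> carrier P.F" for i using ideal.Icarr[OF P.I_ideal] by blast
  show ?thesis unfolding permute_pull a_r_coset_def'
  proof (intro equalityI subsetI)
    fix v assume "v \<in> pull \<pi> ` (\<Union>h\<in>P.I. {h \<oplus>\<^bsub>P.F\<^esub> u})"
    then obtain i where "i \<in> P.I" "v = pull \<pi> (i \<oplus>\<^bsub>P.F\<^esub> u)" by blast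
    then show "v \<in> (\<Union>h\<in>P.I. {h \<oplus>\<^bsub>P.F\<^esub> pull \<pi> u})"
      using pull_I[OF assms(1)] Ic assms(2) by auto
  next
    fix v assume "v \<in> (\<Union>h\<in>P.I. {h \<oplus>\<^bsub>P.F\<^esub> pull \<pi> u})"
    then obtain i where i: "i \<in> P.I" "v = i \<oplus>\<^bsub>P.F\<^esub> pull \<pi> u" by blast
    \<comment> \<open>The inverse permutation also preserves the ideal, so each element of the
      target coset is attained.\<close>
    have "pull \<pi> (pull ?\<rho> i) = i"
      unfolding pull_pull using assms(1) by (simp add: permutes_inv_o pull_def)
    then have "v = pull \<pi> (pull ?\<rho> i \<oplus>\<^bsub>P.F\<^esub> u)"
      using i Ic assms(2) pull_I[OF inv i(1)] by simp
    then show "v \<in> pull \<pi> ` (\<Union>h\<in>P.I. {h \<oplus>\<^bsub>P.F\<^esub> u})" using pull_I[OF inv i(1)] by blast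
  qed
qed

lemma permute_hom:
  assumes "\<pi> permutes {1..n}"
  shows "ring_hom_cring T T (permute_factors \<pi>)"
proof -
  interpret p: ring_hom_cring P.F P.F "pull \<pi>" by (rule pull_hom) fact
  show ?thesis
  proof (intro ring_hom_cringI[OF T_cring T_cring] ring_hom_ringI2 T.ring_axioms ring_hom_memI)
    fix s t assume "s \<in> carrier T" "t \<in> carrier T"
    then obtain u v where uv: "u \<in> carrier P.F" "s = P.I +>\<^bsub>P.F\<^esub> u" "v \<in> carrier P.F" "t = P.I +>\<^bsub>P.F\<^esub> v"
      unfolding T_eq by (metis P.Q_carrierE)
    show "permute_factors \<pi> s \<in> carrier T"
      unfolding uv T_eq permute_coset[OF assms uv(1)] using uv by simp
    show "permute_factors \<pi> (s \<otimes>\<^bsub>T\<^esub> t) = permute_factors \<pi> s \<otimes>\<^bsub>T\<^esub> permute_factors \<pi> t"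
      unfolding uv T_eq using uv assms
      by (simp add: P.coset.hom_mult[symmetric] permute_coset del: P.coset.hom_mult)
    show "permute_factors \<pi> (s \<oplus>\<^bsub>T\<^esub> t) = permute_factors \<pi> s \<oplus>\<^bsub>T\<^esub> permute_factors \<pi> t"
      unfolding uv T_eq using uv assms
      by (simp add: P.coset.hom_add[symmetric] permute_coset del: P.coset.hom_add)
  next
    have "permute_factors \<pi> (P.I +>\<^bsub>P.F\<^esub> \<one>\<^bsub>P.F\<^esub>) = P.I +>\<^bsub>P.F\<^esub> \<one>\<^bsub>P.F\<^esub>"
      by (simp add: permute_coset[OF assms] del: P.coset.hom_one)
    then show "permute_factors \<pi> \<one>\<^bsub>T\<^esub> = \<one>\<^bsub>T\<^esub>" unfolding T_eq by simp
  qed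
qed

lemma permute_closed [simp]: "\<lbrakk>\<pi> permutes {1..n}; t \<in> carrier T\<rbrakk> \<Longrightarrow> permute_factors \<pi> t \<in> carrier T"
  using ring_hom_closed[OF ring_hom_cring.homh[OF permute_hom]] .

lemma permute_pure:
  assumes "\<pi> permutes {1..n}" "y \<in> {1..n} \<rightarrow> carrier R"
  shows "permute_factors \<pi> (pure y) = pure (y \<circ> inv_into UNIV \<pi>)"
proof -
  let ?\<rho> = "inv_into UNIV \<pi>"
  have inv: "?\<rho> permutes {1..n}" using assms(1) by (rule permutes_inv)
  have e: "restrict y {1..n} \<circ> ?\<rho> = restrict (y \<circ> ?\<rho>) {1..n}"
    using permutes_in_image[OF inv] by (auto simp: fun_eq_iff restrict_def)
  have b: "basis_elt A (restrict y {1..n}) \<in> carrier P.F"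
    using restrict_tuple[OF assms(2)] by (simp add: P.basis_elt_eq)
  show ?thesis
    unfolding pure_eq P.cls_def permute_coset[OF assms(1) b]
    unfolding P.basis_elt_eq pull_monomial[OF assms(1)] e ..
qed

lemma permute_permute: "permute_factors \<pi> (permute_factors \<tau> t) = permute_factors (\<pi> \<circ> \<tau>) t"
  unfolding permute_pull image_image pull_pull ..

subsection \<open>Symmetric and alternating tensors\<close>

lemma phi_fun_upd: "\<phi> p z = pure ((\<lambda>_. \<one>\<^bsub>R\<^esub>)(p := z))"
  unfolding \<phi>_def by (rule arg_cong[of _ _ pure]) auto

lemma phi_hom:
  assumes "p \<in> {1..n}"
  shows "ring_hom_cring R T (\<phi> p)"
proof (intro ring_hom_cringI[OF Al.S.is_cring T_cring] ring_hom_ringI2 Al.S.ring_axioms T.ring_axioms ring_hom_memI)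
  fix y z assume yz: "y \<in> carrier R" "z \<in> carrier R"
  show "\<phi> p y \<in> carrier T" unfolding \<phi>_def using yz by (intro pure_closed) auto
  show "\<phi> p (y \<oplus>\<^bsub>R\<^esub> z) = \<phi> p y \<oplus>\<^bsub>T\<^esub> \<phi> p z"
    unfolding phi_fun_upd using yz assms by (intro pure_add) auto
  have "\<phi> p y \<otimes>\<^bsub>T\<^esub> \<phi> p z = pure (\<lambda>i. (if i = p then y else \<one>\<^bsub>R\<^esub>) \<otimes>\<^bsub>R\<^esub> (if i = p then z else \<one>\<^bsub>R\<^esub>))"
    unfolding \<phi>_def using yz by (intro pure_mult) auto
  also have "\<dots> = \<phi> p (y \<otimes>\<^bsub>R\<^esub> z)"
    unfolding \<phi>_def using yz by (intro pure_cong) auto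
  finally show "\<phi> p (y \<otimes>\<^bsub>R\<^esub> z) = \<phi> p y \<otimes>\<^bsub>T\<^esub> \<phi> p z" ..
next
  have "(\<lambda>i. if i = p then \<one>\<^bsub>R\<^esub> else \<one>\<^bsub>R\<^esub>) = (\<lambda>_. \<one>\<^bsub>R\<^esub>)" by auto
  then show "\<phi> p \<one>\<^bsub>R\<^esub> = \<one>\<^bsub>T\<^esub>" unfolding \<phi>_def using pure_one by simp
qed

lemma phi_closed [simp, intro]: "p \<in> {1..n} \<Longrightarrow> z \<in> carrier R \<Longrightarrow> \<phi> p z \<in> carrier T"
  using ring_hom_closed[OF ring_hom_cring.homh[OF phi_hom]] .

lemma phi_mult:
  "\<lbrakk>p \<in> {1..n}; y \<in> carrier R; z \<in> carrier R\<rbrakk> \<Longrightarrow> \<phi> p (y \<otimes>\<^bsub>R\<^esub> z) = \<phi> p y \<otimes>\<^bsub>T\<^esub> \<phi> p z"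
  using ring_hom_mult[OF ring_hom_cring.homh[OF phi_hom]] .

text \<open>Induction over the set J of slots already filled, the remaining ones holding the
  unit.\<close>

lemma pure_prod:
  assumes "y \<in> {1..n} \<rightarrow> carrier R"
  shows "pure y = (\<Otimes>\<^bsub>T\<^esub>p\<in>{1..n}. \<phi> p (y p))"
proof -
  have "pure (\<lambda>i. if i \<in> J then y i else \<one>\<^bsub>R\<^esub>) = (\<Otimes>\<^bsub>T\<^esub>p\<in>J. \<phi> p (y p))" if "finite J" "J \<subseteq> {1..n}" for J
    using that
  proof (induction J)
    case empty
    then show ?case using pure_one by simp
  next
    case (insert k J)
    have yc: "\<And>i. i \<in> insert k J \<Longrightarrow> y i \<in> carrier R" using insert assms by auto
    have "pure (\<lambda>i. if i \<in> insert k J then y i else \<one>\<^bsub>R\<^esub>)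
        = pure (\<lambda>i. (if i = k then y k else \<one>\<^bsub>R\<^esub>) \<otimes>\<^bsub>R\<^esub> (if i \<in> J then y i else \<one>\<^bsub>R\<^esub>))"
      using insert yc by (intro pure_cong) auto
    also have "\<dots> = \<phi> k (y k) \<otimes>\<^bsub>T\<^esub> pure (\<lambda>i. if i \<in> J then y i else \<one>\<^bsub>R\<^esub>)"
      unfolding \<phi>_def using yc by (intro pure_mult[symmetric]) auto
    also have "\<dots> = \<phi> k (y k) \<otimes>\<^bsub>T\<^esub> (\<Otimes>\<^bsub>T\<^esub>p\<in>J. \<phi> p (y p))" using insert by simp
    also have "\<dots> = (\<Otimes>\<^bsub>T\<^esub>p\<in>insert k J. \<phi> p (y p))"
      using insert yc by (intro T.finprod_insert[symmetric]) (auto intro!: phi_closed)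
    finally show ?case .
  qed
  from this[of "{1..n}"] have "(\<Otimes>\<^bsub>T\<^esub>p\<in>{1..n}. \<phi> p (y p)) = pure (\<lambda>i. if i \<in> {1..n} then y i else \<one>\<^bsub>R\<^esub>)" by simp
  also have "\<dots> = pure y" by (intro pure_cong) auto
  finally show ?thesis ..
qed

lemma permute_phi:
  assumes "\<pi> permutes {1..n}" "p \<in> {1..n}" "z \<in> carrier R"
  shows "permute_factors \<pi> (\<phi> p z) = \<phi> (\<pi> p) z"
proof -
  have "(\<lambda>i. if i = p then z else \<one>\<^bsub>R\<^esub>) \<circ> inv_into UNIV \<pi> = (\<lambda>i. if i = \<pi> p then z else \<one>\<^bsub>R\<^esub>)"
    using permutes_inv_eq[OF assms(1)] by (auto simp: fun_eq_iff)
  then show ?thesis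
    unfolding \<phi>_def using permute_pure[OF assms(1), of "\<lambda>i. if i = p then z else \<one>\<^bsub>R\<^esub>"] assms(3) by auto
qed

text \<open>The structure map factors through every co-projection; hence its image is invariant
  under all permutations.\<close>

lemma T_map_phi:
  assumes "p \<in> {1..n}" "a \<in> carrier A"
  shows "T_map a = \<phi> p (iR a)"
proof -
  interpret m: ring_hom_cring A T T_map by (rule T_map_hom)
  have "pure ((\<lambda>_. \<one>\<^bsub>R\<^esub>)(p := iR a \<otimes>\<^bsub>R\<^esub> \<one>\<^bsub>R\<^esub>)) = T_map a \<otimes>\<^bsub>T\<^esub> pure ((\<lambda>_. \<one>\<^bsub>R\<^esub>)(p := \<one>\<^bsub>R\<^esub>))"
    using assms by (intro pure_smult) auto
  then show ?thesis using assms by (simp add: phi_fun_upd pure_one fun_upd_idem)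
qed

text \<open>The gateway from tensors to linear algebra: each permutation contributes the product of
  the entries \<phi>_p(x_i) along its graph, by \<open>pure_prod\<close>.\<close>

lemma alpha_det:
  assumes "x \<in> {1..n} \<rightarrow> carrier R"
  shows "\<alpha> x = T.det {1..n} (\<lambda>p i. \<phi> p (x i))"
  unfolding \<alpha>_def T.det_def
proof (rule T.finsum_cong_on)
  fix \<pi> assume "\<pi> \<in> {\<pi>. \<pi> permutes {1..n}}"
  then have p: "\<pi> permutes {1..n}" by simp
  have xc: "x \<circ> \<pi> \<in> {1..n} \<rightarrow> carrier R" using assms permutes_in_image[OF p] by auto
  have "[sign \<pi>] \<cdot>\<^bsub>T\<^esub> pure (x \<circ> \<pi>) = T.psgn \<pi> \<otimes>\<^bsub>T\<^esub> pure (x \<circ> \<pi>)"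
    using pure_closed[OF xc] by (rule T.psgn_mult)
  then show "[sign \<pi>] \<cdot>\<^bsub>T\<^esub> pure (x \<circ> \<pi>) = T.psgn \<pi> \<otimes>\<^bsub>T\<^esub> (\<Otimes>\<^bsub>T\<^esub>p\<in>{1..n}. \<phi> p (x (\<pi> p)))"
    using pure_prod[OF xc] by simp
  show "T.psgn \<pi> \<otimes>\<^bsub>T\<^esub> (\<Otimes>\<^bsub>T\<^esub>p\<in>{1..n}. \<phi> p (x (\<pi> p))) \<in> carrier T"
    using pure_closed[OF xc] pure_prod[OF xc] by simp
qed

lemma phi_matrix_closed:
  "\<lbrakk>x \<in> {1..n} \<rightarrow> carrier R; p \<in> {1..n}; i \<in> {1..n}\<rbrakk> \<Longrightarrow> \<phi> p (x i) \<in> carrier T"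
  by (auto intro!: phi_closed)

lemma alpha_closed [simp, intro]: "x \<in> {1..n} \<rightarrow> carrier R \<Longrightarrow> \<alpha> x \<in> carrier T"
  unfolding alpha_det using phi_matrix_closed by (intro T.det_closed)

text \<open>If a permutation of the factors permutes the rows of W, the determinant changes by the
  sign. This covers both \<alpha>(x) and the Cramer numerators.\<close>

lemma permute_row_det:
  assumes p: "\<pi> permutes {1..n}"
    and W: "\<And>p j. \<lbrakk>p \<in> {1..n}; j \<in> {1..n}\<rbrakk> \<Longrightarrow> W p j \<in> carrier T"
    and e: "\<And>p j. \<lbrakk>p \<in> {1..n}; j \<in> {1..n}\<rbrakk> \<Longrightarrow> permute_factors \<pi> (W p j) = W (\<pi> p) j"
  shows "permute_factors \<pi> (T.det {1..n} W) = T.psgn \<pi> \<otimes>\<^bsub>T\<^esub> T.det {1..n} W"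
proof -
  interpret h: ring_hom_cring T T "permute_factors \<pi>" by (rule permute_hom[OF p])
  have "permute_factors \<pi> (T.det {1..n} W) = T.det {1..n} (\<lambda>p j. permute_factors \<pi> (W p j))"
    using W by (intro h.hom_det) auto
  also have "\<dots> = T.det {1..n} (\<lambda>p. W (\<pi> p))"
    using W e permutes_in_image[OF p] by (intro T.det_cong) auto
  also have "\<dots> = T.psgn \<pi> \<otimes>\<^bsub>T\<^esub> T.det {1..n} W"
    using W p by (intro T.det_row_perm) auto
  finally show ?thesis .
qed

lemma permute_alpha:
  assumes "\<pi> permutes {1..n}" "x \<in> {1..n} \<rightarrow> carrier R"
  shows "permute_factors \<pi> (\<alpha> x) = T.psgn \<pi> \<otimes>\<^bsub>T\<^esub> \<alpha> x"
  unfolding alpha_det[OF assms(2)]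
proof (rule permute_row_det[OF assms(1)])
  fix p j assume pj: "p \<in> {1..n}" "j \<in> {1..n}"
  show "\<phi> p (x j) \<in> carrier T" by (rule phi_matrix_closed[OF assms(2) pj])
  show "permute_factors \<pi> (\<phi> p (x j)) = \<phi> (\<pi> p) (x j)"
    by (rule permute_phi[OF assms(1) pj(1) funcset_mem[OF assms(2) pj(2)]])
qed

section \<open>Invariant subrings\<close>

lemma TS_iff: "t \<in> carrier TS \<longleftrightarrow> t \<in> carrier T \<and> (\<forall>\<pi>. \<pi> permutes {1..n} \<longrightarrow> permute_factors \<pi> t = t)"
  by (simp add: TS_def)

lemma TS'_iff: "t \<in> carrier TS' \<longleftrightarrow> t \<in> carrier T \<and> (\<forall>\<pi>. \<pi> permutes {1..n - 1} \<longrightarrow> permute_factors \<pi> t = t)"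
  by (simp add: TS'_def)

lemma permutes_pred: "\<pi> permutes {1..n - 1} \<Longrightarrow> \<pi> permutes {1..n}"
  by (rule permutes_subset[of _ "{1..n - 1}"]) auto

lemma TS_subset_TS': "carrier TS \<subseteq> carrier TS'"
  unfolding TS_iff TS'_iff subset_iff using permutes_pred by blast

text \<open>The set H of permutations is arbitrary, so that one argument serves the symmetric groups
  on n and on n - 1 letters.\<close>

lemma subring_invariants:
  assumes "\<And>\<pi>. \<pi> \<in> H \<Longrightarrow> \<pi> permutes {1..n}"
  shows "subring {t \<in> carrier T. \<forall>\<pi>\<in>H. permute_factors \<pi> t = t} T"
proof (rule T.subringI)
  have hom: "permute_factors \<pi> \<in> ring_hom T T" if "\<pi> \<in> H" for \<pi>
    using ring_hom_cring.homh[OF permute_hom[OF assms[OF that]]] .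
  show "\<one>\<^bsub>T\<^esub> \<in> {t \<in> carrier T. \<forall>\<pi>\<in>H. permute_factors \<pi> t = t}"
    using ring_hom_one[OF hom] by simp
  fix s assume s: "s \<in> {t \<in> carrier T. \<forall>\<pi>\<in>H. permute_factors \<pi> t = t}"
  have "permute_factors \<pi> (\<ominus>\<^bsub>T\<^esub> s) = \<ominus>\<^bsub>T\<^esub> s" if "\<pi> \<in> H" for \<pi>
  proof -
    interpret h: ring_hom_cring T T "permute_factors \<pi>" by (rule permute_hom[OF assms[OF that]])
    show ?thesis using s that by simp
  qed
  then show "\<ominus>\<^bsub>T\<^esub> s \<in> {t \<in> carrier T. \<forall>\<pi>\<in>H. permute_factors \<pi> t = t}" using s by simp
  fix t assume t: "t \<in> {t \<in> carrier T. \<forall>\<pi>\<in>H. permute_factors \<pi> t = t}"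
  show "s \<otimes>\<^bsub>T\<^esub> t \<in> {t \<in> carrier T. \<forall>\<pi>\<in>H. permute_factors \<pi> t = t}"
    "s \<oplus>\<^bsub>T\<^esub> t \<in> {t \<in> carrier T. \<forall>\<pi>\<in>H. permute_factors \<pi> t = t}"
    using s t ring_hom_mult[OF hom] ring_hom_add[OF hom] by simp_all
qed auto

lemma TS_subring: "subring (carrier TS) T" and TS_cring: "cring TS"
proof -
  show s: "subring (carrier TS) T"
    using subring_invariants[of "{\<pi>. \<pi> permutes {1..n}}"] by (simp add: TS_def)
  have "TS = T\<lparr>carrier := carrier TS\<rparr>" by (simp add: TS_def)
  then show "cring TS" using T.subcring_iff[of "carrier TS"] T.subcringI'[OF s] subringE(1)[OF s] by simp
qed

lemma TS'_subring: "subring (carrier TS') T" and TS'_cring: "cring TS'"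
proof -
  show s: "subring (carrier TS') T"
    using subring_invariants[of "{\<pi>. \<pi> permutes {1..n - 1}}"] permutes_pred by (simp add: TS'_def)
  have "TS' = T\<lparr>carrier := carrier TS'\<rparr>" by (simp add: TS'_def)
  then show "cring TS'" using T.subcring_iff[of "carrier TS'"] T.subcringI'[OF s] subringE(1)[OF s] by simp
qed

lemma TS_ops: "(\<otimes>\<^bsub>TS\<^esub>) = (\<otimes>\<^bsub>T\<^esub>)" "(\<oplus>\<^bsub>TS\<^esub>) = (\<oplus>\<^bsub>T\<^esub>)" "\<one>\<^bsub>TS\<^esub> = \<one>\<^bsub>T\<^esub>" "\<zero>\<^bsub>TS\<^esub> = \<zero>\<^bsub>T\<^esub>"
  "(\<otimes>\<^bsub>TS'\<^esub>) = (\<otimes>\<^bsub>T\<^esub>)" "(\<oplus>\<^bsub>TS'\<^esub>) = (\<oplus>\<^bsub>T\<^esub>)" "\<one>\<^bsub>TS'\<^esub> = \<one>\<^bsub>T\<^esub>" "\<zero>\<^bsub>TS'\<^esub> = \<zero>\<^bsub>T\<^esub>"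
  by (simp_all add: TS_def TS'_def)

lemma TS_closed: "t \<in> carrier TS \<Longrightarrow> t \<in> carrier T" "t \<in> carrier TS' \<Longrightarrow> t \<in> carrier T"
  by (simp_all add: TS_iff TS'_iff)

text \<open>The two signs cancel.\<close>

lemma anti_mult_sym:
  assumes "s \<in> carrier T" "t \<in> carrier T"
    and "\<And>\<pi>. \<pi> permutes {1..n} \<Longrightarrow> permute_factors \<pi> s = T.psgn \<pi> \<otimes>\<^bsub>T\<^esub> s"
    and "\<And>\<pi>. \<pi> permutes {1..n} \<Longrightarrow> permute_factors \<pi> t = T.psgn \<pi> \<otimes>\<^bsub>T\<^esub> t"
  shows "s \<otimes>\<^bsub>T\<^esub> t \<in> carrier TS"
proof -
  have "permute_factors \<pi> (s \<otimes>\<^bsub>T\<^esub> t) = s \<otimes>\<^bsub>T\<^esub> t" if p: "\<pi> permutes {1..n}" for \<pi>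
  proof -
    have "permute_factors \<pi> (s \<otimes>\<^bsub>T\<^esub> t) = (T.psgn \<pi> \<otimes>\<^bsub>T\<^esub> s) \<otimes>\<^bsub>T\<^esub> (T.psgn \<pi> \<otimes>\<^bsub>T\<^esub> t)"
      using ring_hom_mult[OF ring_hom_cring.homh[OF permute_hom[OF p]] assms(1,2)] assms(3,4) p by simp
    also have "\<dots> = (T.psgn \<pi> \<otimes>\<^bsub>T\<^esub> T.psgn \<pi>) \<otimes>\<^bsub>T\<^esub> (s \<otimes>\<^bsub>T\<^esub> t)"
      using assms(1,2) by (simp add: T.m_ac)
    finally show ?thesis using assms(1,2) by (simp add: T.psgn_square)
  qed
  then show ?thesis using assms by (simp add: TS_iff)
qed

lemma alpha_mult_TS:
  assumes "x \<in> {1..n} \<rightarrow> carrier R" "y \<in> {1..n} \<rightarrow> carrier R"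
  shows "\<alpha> x \<otimes>\<^bsub>T\<^esub> \<alpha> y \<in> carrier TS"
  using assms by (intro anti_mult_sym) (auto simp: permute_alpha)

lemma p_closed [simp, intro]: "z \<in> carrier R \<Longrightarrow> \<pp> z \<in> carrier T"
  unfolding \<pp>_def by (intro T.finsum_closed) auto

lemma p_TS:
  assumes "z \<in> carrier R"
  shows "\<pp> z \<in> carrier TS"
proof -
  have "permute_factors \<pi> (\<pp> z) = \<pp> z" if p: "\<pi> permutes {1..n}" for \<pi>
  proof -
    interpret h: ring_hom_cring T T "permute_factors \<pi>" by (rule permute_hom[OF p])
    have "permute_factors \<pi> (\<pp> z) = (\<Oplus>\<^bsub>T\<^esub>q\<in>{1..n}. permute_factors \<pi> (\<phi> q z))"
      unfolding \<pp>_def using assms h.hom_finsum[of "\<lambda>q. \<phi> q z" "{1..n}"] phi_closed by (simp add: o_def Pi_iff)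
    also have "\<dots> = (\<Oplus>\<^bsub>T\<^esub>q\<in>{1..n}. \<phi> (\<pi> q) z)"
      using assms p permutes_in_image[OF p] by (intro T.finsum_cong_on permute_phi phi_closed) auto
    also have "\<dots> = \<pp> z"
      unfolding \<pp>_def using assms p by (intro T.finsum_reindex_bij[symmetric] permutes_imp_bij) auto
    finally show ?thesis .
  qed
  then show ?thesis using assms by (simp add: TS_iff)
qed

lemma phi_n_TS': "z \<in> carrier R \<Longrightarrow> \<phi> n z \<in> carrier TS'"
proof -
  assume z: "z \<in> carrier R"
  have n: "n \<in> {1..n}" using n_pos by simp
  have "permute_factors \<pi> (\<phi> n z) = \<phi> n z" if "\<pi> permutes {1..n - 1}" for \<pi>
    using permute_phi[OF permutes_pred[OF that] n z] permutes_not_in[OF that, of n] n_pos by simp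
  then show ?thesis using z phi_closed[OF n] by (simp add: TS'_iff)
qed

lemma T_map_TS: "a \<in> carrier A \<Longrightarrow> T_map a \<in> carrier TS"
proof -
  assume a: "a \<in> carrier A"
  have n: "n \<in> {1..n}" using n_pos by simp
  have "permute_factors \<pi> (T_map a) = T_map a" if p: "\<pi> permutes {1..n}" for \<pi>
    using permute_phi[OF p n, of "iR a"] T_map_phi[OF n a] T_map_phi[of "\<pi> n" a] a
      permutes_in_image[OF p, of n] n by simp
  moreover have "T_map a \<in> carrier T" using a n by (simp add: T_map_phi[OF n a] phi_closed)
  ultimately show ?thesis by (simp add: TS_iff)
qed

text \<open>Transpose the matrix of \<alpha>(x) and multiply it by that of \<alpha>(y): the entry at
  i, j is the sum over the factors p of \<phi>_p(x_i y_j). Products of two alternating tensors are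
  thus polynomials in power sums.\<close>

lemma alpha_mult_det:
  assumes "x \<in> {1..n} \<rightarrow> carrier R" "y \<in> {1..n} \<rightarrow> carrier R"
  shows "\<alpha> x \<otimes>\<^bsub>T\<^esub> \<alpha> y = T.det {1..n} (\<lambda>i j. \<pp> (x i \<otimes>\<^bsub>R\<^esub> y j))"
proof -
  note c = phi_matrix_closed[OF assms(1)] phi_matrix_closed[OF assms(2)]
  have xc: "i \<in> {1..n} \<Longrightarrow> x i \<in> carrier R" and yc: "i \<in> {1..n} \<Longrightarrow> y i \<in> carrier R" for i
    using assms by auto
  have "\<alpha> x \<otimes>\<^bsub>T\<^esub> \<alpha> y = T.det {1..n} (\<lambda>i p. \<phi> p (x i)) \<otimes>\<^bsub>T\<^esub> T.det {1..n} (\<lambda>p i. \<phi> p (y i))"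
    unfolding alpha_det[OF assms(1)] alpha_det[OF assms(2)]
    using T.det_transpose[of "{1..n}" "\<lambda>p i. \<phi> p (x i)"] c by simp
  also have "\<dots> = T.det {1..n} (\<lambda>i j. \<Oplus>\<^bsub>T\<^esub>p\<in>{1..n}. \<phi> p (x i) \<otimes>\<^bsub>T\<^esub> \<phi> p (y j))"
    using c by (intro T.det_mult[symmetric]) auto
  also have "\<dots> = T.det {1..n} (\<lambda>i j. \<pp> (x i \<otimes>\<^bsub>R\<^esub> y j))"
    unfolding \<pp>_def using xc yc
    by (intro T.det_cong T.finsum_cong_on T.finsum_closed) (simp_all add: phi_mult phi_closed Pi_iff)
  finally show ?thesis .
qed

text \<open>Antisymmetrization without dividing by n!. The inverse permutation appears so that a
  pure tensor is sent to its alternating tensor as defined by composition with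
  \<open>\<pi>\<close>.\<close>

definition alt :: "((nat \<Rightarrow> 'r) \<Rightarrow> 'a) set \<Rightarrow> ((nat \<Rightarrow> 'r) \<Rightarrow> 'a) set"
  where "alt t = (\<Oplus>\<^bsub>T\<^esub>\<pi>\<in>{\<pi>. \<pi> permutes {1..n}}. T.psgn \<pi> \<otimes>\<^bsub>T\<^esub> permute_factors (inv_into UNIV \<pi>) t)"

lemma alt_term_closed:
  "\<lbrakk>\<pi> permutes {1..n}; t \<in> carrier T\<rbrakk> \<Longrightarrow> T.psgn \<pi> \<otimes>\<^bsub>T\<^esub> permute_factors (inv_into UNIV \<pi>) t \<in> carrier T"
  using permute_closed[OF permutes_inv] by (intro T.m_closed) auto

lemma alt_closed: "t \<in> carrier T \<Longrightarrow> alt t \<in> carrier T"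
  unfolding alt_def using alt_term_closed by (intro T.finsum_closed Pi_I) blast

lemma alt_add:
  assumes "s \<in> carrier T" "t \<in> carrier T"
  shows "alt (s \<oplus>\<^bsub>T\<^esub> t) = alt s \<oplus>\<^bsub>T\<^esub> alt t"
proof -
  have "alt (s \<oplus>\<^bsub>T\<^esub> t) = (\<Oplus>\<^bsub>T\<^esub>\<pi>\<in>{\<pi>. \<pi> permutes {1..n}}.
      T.psgn \<pi> \<otimes>\<^bsub>T\<^esub> permute_factors (inv_into UNIV \<pi>) s \<oplus>\<^bsub>T\<^esub> T.psgn \<pi> \<otimes>\<^bsub>T\<^esub> permute_factors (inv_into UNIV \<pi>) t)"
    unfolding alt_def
  proof (rule T.finsum_cong_on)
    fix \<pi> assume "\<pi> \<in> {\<pi>. \<pi> permutes {1..n}}"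
    then have p: "inv_into UNIV \<pi> permutes {1..n}" using permutes_inv by auto
    note h = ring_hom_cring.homh[OF permute_hom[OF p]]
    show "T.psgn \<pi> \<otimes>\<^bsub>T\<^esub> permute_factors (inv_into UNIV \<pi>) (s \<oplus>\<^bsub>T\<^esub> t)
      = T.psgn \<pi> \<otimes>\<^bsub>T\<^esub> permute_factors (inv_into UNIV \<pi>) s \<oplus>\<^bsub>T\<^esub> T.psgn \<pi> \<otimes>\<^bsub>T\<^esub> permute_factors (inv_into UNIV \<pi>) t"
      using ring_hom_add[OF h assms] permute_closed[OF p] assms by (simp add: T.r_distr)
    show "T.psgn \<pi> \<otimes>\<^bsub>T\<^esub> permute_factors (inv_into UNIV \<pi>) s \<oplus>\<^bsub>T\<^esub> T.psgn \<pi> \<otimes>\<^bsub>T\<^esub> permute_factors (inv_into UNIV \<pi>) t \<in> carrier T"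
      using permute_closed[OF p] assms by simp
  qed
  also have "\<dots> = alt s \<oplus>\<^bsub>T\<^esub> alt t"
    unfolding alt_def using assms alt_term_closed by (intro T.finsum_addf Pi_I) blast+
  finally show ?thesis .
qed

lemma alt_pure:
  assumes "y \<in> {1..n} \<rightarrow> carrier R"
  shows "alt (pure y) = \<alpha> y"
  unfolding alt_def \<alpha>_def
proof (rule T.finsum_cong_on)
  fix \<pi> assume "\<pi> \<in> {\<pi>. \<pi> permutes {1..n}}"
  then have p: "\<pi> permutes {1..n}" by simp
  have yc: "y \<circ> \<pi> \<in> {1..n} \<rightarrow> carrier R" using assms permutes_in_image[OF p] by auto
  show "T.psgn \<pi> \<otimes>\<^bsub>T\<^esub> permute_factors (inv_into UNIV \<pi>) (pure y) = [sign \<pi>] \<cdot>\<^bsub>T\<^esub> pure (y \<circ> \<pi>)"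
    using permute_pure[OF permutes_inv[OF p] assms] permutes_inv_inv[OF p] T.psgn_mult[OF pure_closed[OF yc], of \<pi>] by simp
  show "[sign \<pi>] \<cdot>\<^bsub>T\<^esub> pure (y \<circ> \<pi>) \<in> carrier T"
    using T.psgn_mult[OF pure_closed[OF yc], of \<pi>] pure_closed[OF yc] by simp
qed

lemma alt_sym_mult:
  assumes "t \<in> carrier TS" "u \<in> carrier T"
  shows "alt (t \<otimes>\<^bsub>T\<^esub> u) = t \<otimes>\<^bsub>T\<^esub> alt u"
proof -
  have t: "t \<in> carrier T" using assms TS_closed by auto
  have "alt (t \<otimes>\<^bsub>T\<^esub> u) = (\<Oplus>\<^bsub>T\<^esub>\<pi>\<in>{\<pi>. \<pi> permutes {1..n}}. t \<otimes>\<^bsub>T\<^esub> (T.psgn \<pi> \<otimes>\<^bsub>T\<^esub> permute_factors (inv_into UNIV \<pi>) u))"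
    unfolding alt_def
  proof (rule T.finsum_cong_on)
    fix \<pi> assume "\<pi> \<in> {\<pi>. \<pi> permutes {1..n}}"
    then have p: "inv_into UNIV \<pi> permutes {1..n}" using permutes_inv by auto
    have "permute_factors (inv_into UNIV \<pi>) t = t" using assms(1) p by (simp add: TS_iff)
    then show "T.psgn \<pi> \<otimes>\<^bsub>T\<^esub> permute_factors (inv_into UNIV \<pi>) (t \<otimes>\<^bsub>T\<^esub> u)
        = t \<otimes>\<^bsub>T\<^esub> (T.psgn \<pi> \<otimes>\<^bsub>T\<^esub> permute_factors (inv_into UNIV \<pi>) u)"
      using ring_hom_mult[OF ring_hom_cring.homh[OF permute_hom[OF p]] t assms(2)] permute_closed[OF p assms(2)] t
      by (simp add: T.m_lcomm)
    show "t \<otimes>\<^bsub>T\<^esub> (T.psgn \<pi> \<otimes>\<^bsub>T\<^esub> permute_factors (inv_into UNIV \<pi>) u) \<in> carrier T"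
      using permute_closed[OF p assms(2)] t by simp
  qed
  also have "\<dots> = t \<otimes>\<^bsub>T\<^esub> alt u"
    unfolding alt_def using assms t alt_term_closed finite_permutations[of "{1..n}"]
    by (intro T.finsum_lmult[symmetric]) blast+
  finally show ?thesis .
qed

text \<open>A symmetric factor passes through antisymmetrization. Writing t as a sum of pure tensors
  y, whose terms need not be symmetric, makes the right-hand side the sum of the alternating tensors
  of the tuples y_i x_i.\<close>

lemma sym_mult_alpha:
  assumes "t \<in> carrier TS" "x \<in> {1..n} \<rightarrow> carrier R"
  shows "t \<otimes>\<^bsub>T\<^esub> \<alpha> x = alt (t \<otimes>\<^bsub>T\<^esub> pure x)"
  using assms by (simp add: alt_sym_mult alt_pure)

text \<open>The p-th conjugate of an element of \<open>TS'\<close>, represented by the transposition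
  of p and n; for \<phi>_n(z) it is \<phi>_p(z).\<close>

definition orbit :: "((nat \<Rightarrow> 'r) \<Rightarrow> 'a) set \<Rightarrow> nat \<Rightarrow> ((nat \<Rightarrow> 'r) \<Rightarrow> 'a) set"
  where "orbit t p = permute_factors (transpose p n) t"

lemma transpose_n_permutes: "p \<in> {1..n} \<Longrightarrow> transpose p n permutes {1..n}"
  using n_pos by (intro permutes_swap_id) auto

lemma orbit_closed: "\<lbrakk>t \<in> carrier T; p \<in> {1..n}\<rbrakk> \<Longrightarrow> orbit t p \<in> carrier T"
  unfolding orbit_def using transpose_n_permutes by auto

lemma orbit_n: "orbit t n = t"
  unfolding orbit_def permute_factors_def by simp

lemma orbit_phi: "\<lbrakk>z \<in> carrier R; p \<in> {1..n}\<rbrakk> \<Longrightarrow> orbit (\<phi> n z) p = \<phi> p z"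
  unfolding orbit_def using permute_phi[OF transpose_n_permutes, of p n z] n_pos by simp

lemma permute_orbit:
  assumes "\<pi> permutes {1..n}" "t \<in> carrier TS'" "p \<in> {1..n}"
  shows "permute_factors \<pi> (orbit t p) = orbit t (\<pi> p)"
proof -
  have pp: "\<pi> p \<in> {1..n}" using assms permutes_in_image[OF assms(1)] by simp
  \<comment> \<open>This permutation fixes n, hence lies in the group that leaves t invariant; it
    measures the difference between \<open>\<pi>\<close> after one transposition and the other
    transposition.\<close>
  let ?\<rho> = "transpose (\<pi> p) n \<circ> (\<pi> \<circ> transpose p n)"
  have r: "?\<rho> permutes {1..n}"
    using transpose_n_permutes assms pp by (intro permutes_compose) auto
  have "?\<rho> permutes {1..n - 1}"
  proof (rule permutes_superset[OF r])
    fix k assume "k \<in> {1..n} - {1..n - 1}"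
    then have "k = n" by auto
    then show "?\<rho> k = k" by simp
  qed
  then have "permute_factors ?\<rho> t = t" using assms(2) by (simp add: TS'_iff)
  then have "orbit t (\<pi> p) = permute_factors (transpose (\<pi> p) n) (permute_factors ?\<rho> t)" by (simp add: orbit_def)
  also have "\<dots> = permute_factors (transpose (\<pi> p) n \<circ> ?\<rho>) t" by (rule permute_permute)
  also have "transpose (\<pi> p) n \<circ> ?\<rho> = \<pi> \<circ> transpose p n"
    by (auto simp: fun_eq_iff)
  also have "permute_factors (\<pi> \<circ> transpose p n) t = permute_factors \<pi> (orbit t p)"
    unfolding orbit_def by (rule permute_permute[symmetric])
  finally show ?thesis ..
qed

text \<open>The Cramer numerator with column i replaced by the conjugates of t is alternating. The
  extra factor \<alpha>(x) makes it symmetric and turns the denominator \<alpha>(x) into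
  \<alpha>^2(x).\<close>

definition cramer_coeff :: "(nat \<Rightarrow> 'r) \<Rightarrow> ((nat \<Rightarrow> 'r) \<Rightarrow> 'a) set \<Rightarrow> nat \<Rightarrow> ((nat \<Rightarrow> 'r) \<Rightarrow> 'a) set"
  where "cramer_coeff x t i = \<alpha> x \<otimes>\<^bsub>T\<^esub> T.det {1..n} (\<lambda>p j. if j = i then orbit t p else \<phi> p (x j))"

lemma cramer_coeff_TS:
  assumes "x \<in> {1..n} \<rightarrow> carrier R" "t \<in> carrier TS'"
  shows "cramer_coeff x t i \<in> carrier TS"
proof -
  let ?W = "\<lambda>p j. if j = i then orbit t p else \<phi> p (x j)"
  have t: "t \<in> carrier T" using assms TS_closed by auto
  have xc: "j \<in> {1..n} \<Longrightarrow> x j \<in> carrier R" for j using assms by auto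
  have W: "?W p j \<in> carrier T" if "p \<in> {1..n}" "j \<in> {1..n}" for p j
    using that orbit_closed[OF t] phi_matrix_closed[OF assms(1)] by simp
  have "permute_factors \<pi> (T.det {1..n} ?W) = T.psgn \<pi> \<otimes>\<^bsub>T\<^esub> T.det {1..n} ?W" if p: "\<pi> permutes {1..n}" for \<pi>
    using W permute_orbit[OF p assms(2)] permute_phi[OF p] xc by (intro permute_row_det[OF p]) simp_all
  then show ?thesis
    unfolding cramer_coeff_def using assms W T.det_closed[of "{1..n}" ?W]
    by (intro anti_mult_sym) (simp_all add: permute_alpha)
qed

text \<open>Cramer's rule for the system with matrix \<phi>_p(x_i) and right-hand side the
  conjugates of t, read off in row n, where the conjugate is t itself.\<close>

lemma cramer_TS':
  assumes "x \<in> {1..n} \<rightarrow> carrier R" "t \<in> carrier TS'"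
  shows "(\<alpha> x \<otimes>\<^bsub>T\<^esub> \<alpha> x) \<otimes>\<^bsub>T\<^esub> t = (\<Oplus>\<^bsub>T\<^esub>i\<in>{1..n}. \<phi> n (x i) \<otimes>\<^bsub>T\<^esub> cramer_coeff x t i)"
proof -
  let ?W = "\<lambda>i p j. if j = i then orbit t p else \<phi> p (x j)"
  have n: "n \<in> {1..n}" using n_pos by simp
  have t: "t \<in> carrier T" using assms TS_closed by auto
  have W: "T.det {1..n} (?W i) \<in> carrier T" for i
    using orbit_closed[OF t] phi_matrix_closed[OF assms(1)] by (intro T.det_closed) simp
  have c: "i \<in> {1..n} \<Longrightarrow> \<phi> n (x i) \<in> carrier T" for i using phi_matrix_closed[OF assms(1) n] .
  have "\<alpha> x \<otimes>\<^bsub>T\<^esub> t = T.det {1..n} (\<lambda>p i. \<phi> p (x i)) \<otimes>\<^bsub>T\<^esub> orbit t n"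
    by (simp only: orbit_n alpha_det[OF assms(1)])
  also have "\<dots> = (\<Oplus>\<^bsub>T\<^esub>i\<in>{1..n}. \<phi> n (x i) \<otimes>\<^bsub>T\<^esub> T.det {1..n} (?W i))"
    using orbit_closed[OF t] phi_matrix_closed[OF assms(1)] n by (intro T.cramer) auto
  finally have "\<alpha> x \<otimes>\<^bsub>T\<^esub> (\<alpha> x \<otimes>\<^bsub>T\<^esub> t) = (\<Oplus>\<^bsub>T\<^esub>i\<in>{1..n}. \<alpha> x \<otimes>\<^bsub>T\<^esub> (\<phi> n (x i) \<otimes>\<^bsub>T\<^esub> T.det {1..n} (?W i)))"
    using c W assms(1) by (simp only:, intro T.finsum_lmult) auto
  also have "\<dots> = (\<Oplus>\<^bsub>T\<^esub>i\<in>{1..n}. \<phi> n (x i) \<otimes>\<^bsub>T\<^esub> cramer_coeff x t i)"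
    unfolding cramer_coeff_def using c W assms(1) by (intro T.finsum_cong_on) (simp_all add: T.m_lcomm)
  finally show ?thesis using assms(1) t by (simp add: T.m_assoc)
qed

lemma cramer_coeff_phi:
  assumes "x \<in> {1..n} \<rightarrow> carrier R" "z \<in> carrier R"
  shows "cramer_coeff x (\<phi> n z) i = \<alpha> x \<otimes>\<^bsub>T\<^esub> \<alpha> (x(i := z))"
proof -
  have xc: "j \<in> {1..n} \<Longrightarrow> x j \<in> carrier R" for j using assms by auto
  have xi: "x(i := z) \<in> {1..n} \<rightarrow> carrier R" using assms by auto
  have "T.det {1..n} (\<lambda>p j. if j = i then orbit (\<phi> n z) p else \<phi> p (x j)) = \<alpha> (x(i := z))"
    unfolding alpha_det[OF xi] using assms(2) xc phi_matrix_closed[OF xi]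
    by (intro T.det_cong) (simp_all add: orbit_phi)
  then show ?thesis by (simp add: cramer_coeff_def)
qed

text \<open>Replacing x_i by z x_i multiplies column i by the diagonal matrix of the \<phi>_p(z),
  whose trace is \<pp>(z). After division by \<alpha>^2(x) the terms are the diagonal Cramer
  coefficients of multiplication by \<phi>_n(z).\<close>

lemma alpha_derivation:
  assumes "x \<in> {1..n} \<rightarrow> carrier R" "z \<in> carrier R"
  shows "(\<Oplus>\<^bsub>T\<^esub>i\<in>{1..n}. \<alpha> x \<otimes>\<^bsub>T\<^esub> \<alpha> (x(i := z \<otimes>\<^bsub>R\<^esub> x i))) = (\<alpha> x \<otimes>\<^bsub>T\<^esub> \<alpha> x) \<otimes>\<^bsub>T\<^esub> \<pp> z"
proof -
  have xc: "j \<in> {1..n} \<Longrightarrow> x j \<in> carrier R" for j using assms by auto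
  have xi: "x(i := z \<otimes>\<^bsub>R\<^esub> x i) \<in> {1..n} \<rightarrow> carrier R" if "i \<in> {1..n}" for i using assms(2) xc that by (auto simp: Pi_iff)
  have 1: "\<alpha> (x(i := z \<otimes>\<^bsub>R\<^esub> x i)) = T.det {1..n} (\<lambda>p j. if j = i then \<phi> p z \<otimes>\<^bsub>T\<^esub> \<phi> p (x j) else \<phi> p (x j))"
    if i: "i \<in> {1..n}" for i
    unfolding alpha_det[OF xi[OF i]] using assms(2) xc
    by (intro T.det_cong) (simp_all add: phi_mult phi_closed)
  have "(\<Oplus>\<^bsub>T\<^esub>i\<in>{1..n}. \<alpha> (x(i := z \<otimes>\<^bsub>R\<^esub> x i)))
      = (\<Oplus>\<^bsub>T\<^esub>i\<in>{1..n}. T.det {1..n} (\<lambda>p j. if j = i then \<phi> p z \<otimes>\<^bsub>T\<^esub> \<phi> p (x j) else \<phi> p (x j)))"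
    using 1 assms(2) xc by (intro T.finsum_cong_on T.det_closed) (simp_all add: phi_closed)
  also have "\<dots> = \<pp> z \<otimes>\<^bsub>T\<^esub> \<alpha> x"
    unfolding \<pp>_def alpha_det[OF assms(1)] using assms(2) xc
    by (intro T.det_diagonal_derivation) (simp_all add: phi_closed)
  finally have e: "(\<Oplus>\<^bsub>T\<^esub>i\<in>{1..n}. \<alpha> (x(i := z \<otimes>\<^bsub>R\<^esub> x i))) = \<pp> z \<otimes>\<^bsub>T\<^esub> \<alpha> x" .
  have "(\<Oplus>\<^bsub>T\<^esub>i\<in>{1..n}. \<alpha> x \<otimes>\<^bsub>T\<^esub> \<alpha> (x(i := z \<otimes>\<^bsub>R\<^esub> x i)))
      = \<alpha> x \<otimes>\<^bsub>T\<^esub> (\<Oplus>\<^bsub>T\<^esub>i\<in>{1..n}. \<alpha> (x(i := z \<otimes>\<^bsub>R\<^esub> x i)))"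
    using alpha_closed[OF assms(1)] alpha_closed[OF xi] by (intro T.finsum_lmult[symmetric]) auto
  then show ?thesis using e assms by (simp add: T.m_ac)
qed

end

section \<open>The norm homomorphism on symmetric tensors\<close>

locale norm_setting = algebra_power A R iR n + FE: finite_free_algebra B E g n "\<lambda>i. f (x i)"
  for A :: "('a, 'k) ring_scheme" and R :: "('r, 'l) ring_scheme" and iR :: "'a \<Rightarrow> 'r" and n :: nat
    and B :: "('b, 'm) ring_scheme" and E :: "('e, 'q) ring_scheme" and g :: "'b \<Rightarrow> 'e"
    and f :: "'r \<Rightarrow> 'e" and x :: "nat \<Rightarrow> 'r" +
  fixes iB :: "'a \<Rightarrow> 'b"
  assumes iB_hom: "ring_hom_cring A B iB" and f_hom: "ring_hom_cring R E f"
    and gi: "\<And>a. a \<in> carrier A \<Longrightarrow> g (iB a) = f (iR a)"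
    and x_closed: "x \<in> {1..n} \<rightarrow> carrier R"
    and trace_unit: "FE.trace_form \<in> Units B"
begin

lemma f_simps [simp]:
  "z \<in> carrier R \<Longrightarrow> f z \<in> carrier E"
  "\<lbrakk>z \<in> carrier R; y \<in> carrier R\<rbrakk> \<Longrightarrow> f (z \<otimes>\<^bsub>R\<^esub> y) = f z \<otimes>\<^bsub>E\<^esub> f y"
  "\<lbrakk>z \<in> carrier R; y \<in> carrier R\<rbrakk> \<Longrightarrow> f (z \<oplus>\<^bsub>R\<^esub> y) = f z \<oplus>\<^bsub>E\<^esub> f y"
  "f \<one>\<^bsub>R\<^esub> = \<one>\<^bsub>E\<^esub>"
  using ring_hom_memE[OF ring_hom_cring.homh[OF f_hom]] by simp_all

lemma iB_closed [simp]: "a \<in> carrier A \<Longrightarrow> iB a \<in> carrier B"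
  using ring_hom_closed[OF ring_hom_cring.homh[OF iB_hom]] .

lemma x_mem [simp]: "i \<in> {1..n} \<Longrightarrow> x i \<in> carrier R"
  using x_closed by auto

section \<open>The coordinate functional\<close>

definition is_coordinate_functional :: "(((nat \<Rightarrow> 'r) \<Rightarrow> 'a) set \<Rightarrow> 'b) \<Rightarrow> bool"
  where "is_coordinate_functional H \<longleftrightarrow> H \<in> carrier T \<rightarrow> carrier B
    \<and> (\<forall>s\<in>carrier T. \<forall>t\<in>carrier T. H (s \<oplus>\<^bsub>T\<^esub> t) = H s \<oplus>\<^bsub>B\<^esub> H t)
    \<and> (\<forall>y \<in> {1..n} \<rightarrow> carrier R. H (pure y) = (\<Otimes>\<^bsub>B\<^esub>p\<in>{1..n}. FE.co (f (y p)) p))"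

text \<open>Only one factor of the product involves the i-th entry; \<open>split\<close> isolates
  it, and linearity of that coordinate gives multilinearity. Scalars from A reach B because
  \<open>gi\<close> matches the two structures on E.\<close>

lemma ex_coordinate_functional: "\<exists>H. is_coordinate_functional H"
proof -
  let ?k = "\<lambda>y. \<Otimes>\<^bsub>B\<^esub>p\<in>{1..n}. FE.co (f (y p)) p"
  have split: "?k (y(i := m)) = FE.co (f m) i \<otimes>\<^bsub>B\<^esub> (\<Otimes>\<^bsub>B\<^esub>p\<in>{1..n} - {i}. FE.co (f (y p)) p)"
    if "y \<in> {1..n} \<rightarrow>\<^sub>E carrier R" "i \<in> {1..n}" "m \<in> carrier R" for y i m
  proof -
    have yc: "p \<in> {1..n} \<Longrightarrow> y p \<in> carrier R" for p using that by auto
    have "?k (y(i := m)) = FE.co (f ((y(i := m)) i)) i \<otimes>\<^bsub>B\<^esub> (\<Otimes>\<^bsub>B\<^esub>p\<in>{1..n} - {i}. FE.co (f ((y(i := m)) p)) p)"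
      using that yc by (intro FE.R.finprod_remove) (auto simp: FE.co_closed)
    also have "(\<Otimes>\<^bsub>B\<^esub>p\<in>{1..n} - {i}. FE.co (f ((y(i := m)) p)) p) = (\<Otimes>\<^bsub>B\<^esub>p\<in>{1..n} - {i}. FE.co (f (y p)) p)"
      using that yc by (intro FE.R.finprod_cong_on) (auto simp: FE.co_closed)
    finally show ?thesis by simp
  qed
  have rest: "(\<Otimes>\<^bsub>B\<^esub>p\<in>{1..n} - {i}. FE.co (f (y p)) p) \<in> carrier B" if "y \<in> {1..n} \<rightarrow>\<^sub>E carrier R" for y i
    using that by (intro FE.R.finprod_closed) (auto simp: FE.co_closed PiE_iff)
  have "\<exists>H \<in> carrier T \<rightarrow> carrier B. (\<forall>s\<in>carrier T. \<forall>t\<in>carrier T. H (s \<oplus>\<^bsub>T\<^esub> t) = H s \<oplus>\<^bsub>B\<^esub> H t)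
    \<and> (\<forall>y \<in> {1..n} \<rightarrow> carrier R. H (pure y) = ?k (restrict y {1..n}))"
  proof (rule multilinear_lift[OF iB_hom])
    fix y assume "y \<in> {1..n} \<rightarrow>\<^sub>E carrier R"
    then show "?k y \<in> carrier B" by (intro FE.R.finprod_closed) (auto simp: FE.co_closed PiE_iff)
  next
    fix y i m m' assume a: "y \<in> {1..n} \<rightarrow>\<^sub>E carrier R" "i \<in> {1..n}" "m \<in> carrier R" "m' \<in> carrier R"
    show "?k (y(i := m \<oplus>\<^bsub>R\<^esub> m')) = ?k (y(i := m)) \<oplus>\<^bsub>B\<^esub> ?k (y(i := m'))"
      unfolding split[OF a(1,2) a(3)] split[OF a(1,2) a(4)] split[OF a(1,2) Al.S.a_closed[OF a(3,4)]]
      using a rest[OF a(1), of i] FE.co_closed[of "f m" i] FE.co_closed[of "f m'" i]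
      by (simp only: f_simps FE.co_add FE.R.l_distr)
  next
    fix y i a m assume a: "y \<in> {1..n} \<rightarrow>\<^sub>E carrier R" "i \<in> {1..n}" "m \<in> carrier R" "a \<in> carrier A"
    have ic: "iR a \<in> carrier R" using a(4) by simp
    have e: "f (iR a \<otimes>\<^bsub>R\<^esub> m) = g (iB a) \<otimes>\<^bsub>E\<^esub> f m" using a ic gi by simp
    show "?k (y(i := iR a \<otimes>\<^bsub>R\<^esub> m)) = iB a \<otimes>\<^bsub>B\<^esub> ?k (y(i := m))"
      unfolding split[OF a(1,2) a(3)] split[OF a(1,2) Al.S.m_closed[OF ic a(3)]] e
      using a rest[OF a(1), of i] FE.co_closed[of "f m" i]
      by (simp only: f_simps FE.co_smult FE.R.m_assoc iB_closed)
  qed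
  then obtain H where H: "H \<in> carrier T \<rightarrow> carrier B"
    "\<forall>s\<in>carrier T. \<forall>t\<in>carrier T. H (s \<oplus>\<^bsub>T\<^esub> t) = H s \<oplus>\<^bsub>B\<^esub> H t"
    "\<forall>y \<in> {1..n} \<rightarrow> carrier R. H (pure y) = ?k (restrict y {1..n})" by blast
  have "?k (restrict y {1..n}) = ?k y" if "y \<in> {1..n} \<rightarrow> carrier R" for y
    using that by (intro FE.R.finprod_cong_on) (auto simp: FE.co_closed Pi_iff)
  then show ?thesis unfolding is_coordinate_functional_def using H by (intro exI[of _ H]) simp
qed

definition K :: "((nat \<Rightarrow> 'r) \<Rightarrow> 'a) set \<Rightarrow> 'b"
  where "K = (SOME H. is_coordinate_functional H)"

lemma K_functional: "is_coordinate_functional K"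
  unfolding K_def using ex_coordinate_functional by (rule someI_ex)

lemma K_closed [simp]: "t \<in> carrier T \<Longrightarrow> K t \<in> carrier B"
  and K_add: "\<lbrakk>s \<in> carrier T; t \<in> carrier T\<rbrakk> \<Longrightarrow> K (s \<oplus>\<^bsub>T\<^esub> t) = K s \<oplus>\<^bsub>B\<^esub> K t"
  and K_pure: "y \<in> {1..n} \<rightarrow> carrier R \<Longrightarrow> K (pure y) = (\<Otimes>\<^bsub>B\<^esub>p\<in>{1..n}. FE.co (f (y p)) p)"
  using K_functional unfolding is_coordinate_functional_def by blast+

lemma K_zero: "K \<zero>\<^bsub>T\<^esub> = \<zero>\<^bsub>B\<^esub>"
proof -
  have "K \<zero>\<^bsub>T\<^esub> \<oplus>\<^bsub>B\<^esub> K \<zero>\<^bsub>T\<^esub> = K \<zero>\<^bsub>T\<^esub> \<oplus>\<^bsub>B\<^esub> \<zero>\<^bsub>B\<^esub>"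
    using K_add[of "\<zero>\<^bsub>T\<^esub>" "\<zero>\<^bsub>T\<^esub>"] by simp
  then show ?thesis using FE.R.add.l_cancel by simp
qed

lemma K_finsum:
  assumes "finite J" "\<And>j. j \<in> J \<Longrightarrow> t j \<in> carrier T"
  shows "K (\<Oplus>\<^bsub>T\<^esub>j\<in>J. t j) = (\<Oplus>\<^bsub>B\<^esub>j\<in>J. K (t j))"
  using assms
proof (induction J)
  case empty
  then show ?case by (simp add: K_zero)
next
  case (insert k J)
  have "K (\<Oplus>\<^bsub>T\<^esub>j\<in>insert k J. t j) = K (t k \<oplus>\<^bsub>T\<^esub> (\<Oplus>\<^bsub>T\<^esub>j\<in>J. t j))"
    using insert by (subst T.finsum_insert) auto
  also have "\<dots> = K (t k) \<oplus>\<^bsub>B\<^esub> (\<Oplus>\<^bsub>B\<^esub>j\<in>J. K (t j))"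
    using insert by (subst K_add) (auto intro!: T.finsum_closed)
  also have "\<dots> = (\<Oplus>\<^bsub>B\<^esub>j\<in>insert k J. K (t j))"
    using insert by (subst FE.R.finsum_insert) auto
  finally show ?case .
qed

lemma K_psgn:
  assumes "t \<in> carrier T"
  shows "K (T.psgn \<pi> \<otimes>\<^bsub>T\<^esub> t) = FE.R.psgn \<pi> \<otimes>\<^bsub>B\<^esub> K t"
proof -
  have "K (\<ominus>\<^bsub>T\<^esub> t) \<oplus>\<^bsub>B\<^esub> K t = \<zero>\<^bsub>B\<^esub>"
    using assms K_add[of "\<ominus>\<^bsub>T\<^esub> t" t] by (simp add: T.l_neg K_zero)
  then have "K (\<ominus>\<^bsub>T\<^esub> t) = \<ominus>\<^bsub>B\<^esub> K t"
    using assms FE.R.minus_equality[of "K (\<ominus>\<^bsub>T\<^esub> t)" "K t"] by simp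
  then show ?thesis using assms by (simp add: T.psgn_cases FE.R.psgn_cases T.l_minus FE.R.l_minus)
qed

text \<open>In the Leibniz sum for \<alpha>(z), the term of \<open>\<pi>\<close> multiplied by w has
  the entry w_p z_(\<pi> p) in factor p, whose p-th coordinate is the matrix entry in row p and
  column \<open>\<pi> p\<close>.\<close>

lemma K_pure_alpha:
  assumes w: "w \<in> {1..n} \<rightarrow> carrier R" and z: "z \<in> {1..n} \<rightarrow> carrier R"
  shows "K (pure w \<otimes>\<^bsub>T\<^esub> \<alpha> z) = FE.R.det {1..n} (\<lambda>p i. FE.co (f (w p) \<otimes>\<^bsub>E\<^esub> f (z i)) p)"
proof -
  let ?S = "{\<pi>. \<pi> permutes {1..n}}"
  have wc: "i \<in> {1..n} \<Longrightarrow> w i \<in> carrier R" and zc: "i \<in> {1..n} \<Longrightarrow> z i \<in> carrier R" for i using w z by auto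
  have zp: "z \<circ> \<pi> \<in> {1..n} \<rightarrow> carrier R" if "\<pi> permutes {1..n}" for \<pi>
    using z permutes_in_image[OF that] by auto
  have tc: "T.psgn \<pi> \<otimes>\<^bsub>T\<^esub> (pure w \<otimes>\<^bsub>T\<^esub> pure (z \<circ> \<pi>)) \<in> carrier T" if "\<pi> permutes {1..n}" for \<pi>
    using pure_closed[OF w] pure_closed[OF zp[OF that]] by simp
  have sg: "[sign \<pi>] \<cdot>\<^bsub>T\<^esub> pure (z \<circ> \<pi>) = T.psgn \<pi> \<otimes>\<^bsub>T\<^esub> pure (z \<circ> \<pi>)" if "\<pi> permutes {1..n}" for \<pi>
    using pure_closed[OF zp[OF that]] by (rule T.psgn_mult)
  have "pure w \<otimes>\<^bsub>T\<^esub> \<alpha> z = (\<Oplus>\<^bsub>T\<^esub>\<pi>\<in>?S. pure w \<otimes>\<^bsub>T\<^esub> ([sign \<pi>] \<cdot>\<^bsub>T\<^esub> pure (z \<circ> \<pi>)))"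
    unfolding \<alpha>_def using pure_closed[OF w] pure_closed[OF zp] sg
    by (intro T.finsum_lmult) (auto simp: finite_permutations)
  also have "\<dots> = (\<Oplus>\<^bsub>T\<^esub>\<pi>\<in>?S. T.psgn \<pi> \<otimes>\<^bsub>T\<^esub> (pure w \<otimes>\<^bsub>T\<^esub> pure (z \<circ> \<pi>)))"
    using pure_closed[OF w] pure_closed[OF zp] sg
    by (intro T.finsum_cong_on) (simp_all add: T.m_lcomm)
  finally have "K (pure w \<otimes>\<^bsub>T\<^esub> \<alpha> z) = (\<Oplus>\<^bsub>B\<^esub>\<pi>\<in>?S. K (T.psgn \<pi> \<otimes>\<^bsub>T\<^esub> (pure w \<otimes>\<^bsub>T\<^esub> pure (z \<circ> \<pi>))))"
    using tc by (simp only:, intro K_finsum) (auto simp: finite_permutations)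
  also have "\<dots> = (\<Oplus>\<^bsub>B\<^esub>\<pi>\<in>?S. FE.R.psgn \<pi> \<otimes>\<^bsub>B\<^esub> (\<Otimes>\<^bsub>B\<^esub>p\<in>{1..n}. FE.co (f (w p) \<otimes>\<^bsub>E\<^esub> f (z (\<pi> p))) p))"
  proof (rule FE.R.finsum_cong_on)
    fix \<pi> assume "\<pi> \<in> ?S"
    then have p: "\<pi> permutes {1..n}" by simp
    have zpc: "i \<in> {1..n} \<Longrightarrow> z (\<pi> i) \<in> carrier R" for i using zc permutes_in_image[OF p] by blast
    have "pure w \<otimes>\<^bsub>T\<^esub> pure (z \<circ> \<pi>) = pure (\<lambda>i. w i \<otimes>\<^bsub>R\<^esub> z (\<pi> i))"
      using pure_mult[OF w zp[OF p]] by simp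
    then have "K (pure w \<otimes>\<^bsub>T\<^esub> pure (z \<circ> \<pi>)) = (\<Otimes>\<^bsub>B\<^esub>p\<in>{1..n}. FE.co (f (w p \<otimes>\<^bsub>R\<^esub> z (\<pi> p))) p)"
      using wc zpc by (simp only:, intro K_pure) auto
    also have "\<dots> = (\<Otimes>\<^bsub>B\<^esub>p\<in>{1..n}. FE.co (f (w p) \<otimes>\<^bsub>E\<^esub> f (z (\<pi> p))) p)"
      using wc zpc by (intro FE.R.finprod_cong_on) (auto simp: FE.co_closed)
    finally show "K (T.psgn \<pi> \<otimes>\<^bsub>T\<^esub> (pure w \<otimes>\<^bsub>T\<^esub> pure (z \<circ> \<pi>)))
        = FE.R.psgn \<pi> \<otimes>\<^bsub>B\<^esub> (\<Otimes>\<^bsub>B\<^esub>p\<in>{1..n}. FE.co (f (w p) \<otimes>\<^bsub>E\<^esub> f (z (\<pi> p))) p)"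
      using pure_closed[OF w] pure_closed[OF zp[OF p]] by (simp add: K_psgn)
    show "FE.R.psgn \<pi> \<otimes>\<^bsub>B\<^esub> (\<Otimes>\<^bsub>B\<^esub>p\<in>{1..n}. FE.co (f (w p) \<otimes>\<^bsub>E\<^esub> f (z (\<pi> p))) p) \<in> carrier B"
      using wc zpc by (intro FE.R.m_closed FE.R.finprod_closed) (auto simp: FE.co_closed)
  qed
  finally show ?thesis unfolding FE.R.det_def .
qed

lemma K_alpha:
  assumes z: "z \<in> {1..n} \<rightarrow> carrier R"
  shows "K (\<alpha> z) = FE.R.det {1..n} (\<lambda>p i. FE.co (f (z i)) p)"
proof -
  have zc: "i \<in> {1..n} \<Longrightarrow> z i \<in> carrier R" for i using z by auto
  have "K (\<alpha> z) = K (pure (\<lambda>_. \<one>\<^bsub>R\<^esub>) \<otimes>\<^bsub>T\<^esub> \<alpha> z)" using z by (simp add: pure_one)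
  also have "\<dots> = FE.R.det {1..n} (\<lambda>p i. FE.co (f \<one>\<^bsub>R\<^esub> \<otimes>\<^bsub>E\<^esub> f (z i)) p)"
    using z by (intro K_pure_alpha) auto
  also have "\<dots> = FE.R.det {1..n} (\<lambda>p i. FE.co (f (z i)) p)"
    using zc by (intro FE.R.det_cong) (auto simp: FE.co_closed)
  finally show ?thesis .
qed

text \<open>It suffices to take s pure. The coordinates of f(w_p) f(z_i) are obtained from those of
  f(w_p) f(x_j) through the coordinate matrix of z, and the determinant of this matrix product
  splits.\<close>

lemma K_mult_alpha:
  assumes s: "s \<in> carrier T" and z: "z \<in> {1..n} \<rightarrow> carrier R"
  shows "K (s \<otimes>\<^bsub>T\<^esub> \<alpha> z) = K (s \<otimes>\<^bsub>T\<^esub> \<alpha> x) \<otimes>\<^bsub>B\<^esub> K (\<alpha> z)"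
  using s
proof (induction s rule: T_induct)
  case (pure w)
  have wc: "i \<in> {1..n} \<Longrightarrow> w i \<in> carrier R" and zc: "i \<in> {1..n} \<Longrightarrow> z i \<in> carrier R" for i using pure z by auto
  have "K (pure w \<otimes>\<^bsub>T\<^esub> \<alpha> z) = FE.R.det {1..n} (\<lambda>p i. FE.co (f (w p) \<otimes>\<^bsub>E\<^esub> f (z i)) p)"
    by (rule K_pure_alpha[OF pure z])
  also have "\<dots> = FE.R.det {1..n} (\<lambda>p i. \<Oplus>\<^bsub>B\<^esub>j\<in>{1..n}. FE.co (f (w p) \<otimes>\<^bsub>E\<^esub> f (x j)) p \<otimes>\<^bsub>B\<^esub> FE.co (f (z i)) j)"
  proof (rule FE.R.det_cong)
    fix p i assume pi: "p \<in> {1..n}" "i \<in> {1..n}"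
    have "FE.co (f (w p) \<otimes>\<^bsub>E\<^esub> f (z i)) p = (\<Oplus>\<^bsub>B\<^esub>j\<in>{1..n}. FE.co (f (z i)) j \<otimes>\<^bsub>B\<^esub> FE.co (f (w p) \<otimes>\<^bsub>E\<^esub> f (x j)) p)"
      using pi wc zc by (intro FE.co_mult) auto
    also have "\<dots> = (\<Oplus>\<^bsub>B\<^esub>j\<in>{1..n}. FE.co (f (w p) \<otimes>\<^bsub>E\<^esub> f (x j)) p \<otimes>\<^bsub>B\<^esub> FE.co (f (z i)) j)"
      using pi wc zc by (intro FE.R.finsum_cong_on) (auto simp: FE.R.m_comm FE.co_closed)
    finally show "FE.co (f (w p) \<otimes>\<^bsub>E\<^esub> f (z i)) p = (\<Oplus>\<^bsub>B\<^esub>j\<in>{1..n}. FE.co (f (w p) \<otimes>\<^bsub>E\<^esub> f (x j)) p \<otimes>\<^bsub>B\<^esub> FE.co (f (z i)) j)" .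
    show "(\<Oplus>\<^bsub>B\<^esub>j\<in>{1..n}. FE.co (f (w p) \<otimes>\<^bsub>E\<^esub> f (x j)) p \<otimes>\<^bsub>B\<^esub> FE.co (f (z i)) j) \<in> carrier B"
      using pi wc zc by (intro FE.R.finsum_closed) (auto simp: FE.co_closed)
  qed
  also have "\<dots> = FE.R.det {1..n} (\<lambda>p i. FE.co (f (w p) \<otimes>\<^bsub>E\<^esub> f (x i)) p) \<otimes>\<^bsub>B\<^esub> FE.R.det {1..n} (\<lambda>j i. FE.co (f (z i)) j)"
    using wc zc by (intro FE.R.det_mult) (auto simp: FE.co_closed)
  also have "\<dots> = K (pure w \<otimes>\<^bsub>T\<^esub> \<alpha> x) \<otimes>\<^bsub>B\<^esub> K (\<alpha> z)"
    unfolding K_pure_alpha[OF pure x_closed] K_alpha[OF z] ..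
  finally show ?case .
next
  case (add s t)
  then show ?case using alpha_closed[OF x_closed] alpha_closed[OF z]
    by (simp add: T.l_distr K_add FE.R.l_distr)
qed

section \<open>The homomorphism on symmetric tensors\<close>

definition c :: "((nat \<Rightarrow> 'r) \<Rightarrow> 'a) set \<Rightarrow> 'b"
  where "c t = K (t \<otimes>\<^bsub>T\<^esub> \<alpha> x)"

abbreviation \<Delta> :: "((nat \<Rightarrow> 'r) \<Rightarrow> 'a) set" where "\<Delta> \<equiv> \<alpha> x \<otimes>\<^bsub>T\<^esub> \<alpha> x"

lemma alpha_x_closed [simp]: "\<alpha> x \<in> carrier T"
  using alpha_closed[OF x_closed] .

lemma c_closed [simp]: "t \<in> carrier T \<Longrightarrow> c t \<in> carrier B"
  unfolding c_def by simp

lemma c_add: "\<lbrakk>s \<in> carrier T; t \<in> carrier T\<rbrakk> \<Longrightarrow> c (s \<oplus>\<^bsub>T\<^esub> t) = c s \<oplus>\<^bsub>B\<^esub> c t"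
  unfolding c_def by (simp add: T.l_distr K_add)

lemma c_finsum:
  assumes "finite J" "\<And>j. j \<in> J \<Longrightarrow> t j \<in> carrier T"
  shows "c (\<Oplus>\<^bsub>T\<^esub>j\<in>J. t j) = (\<Oplus>\<^bsub>B\<^esub>j\<in>J. c (t j))"
  unfolding c_def using assms by (simp add: T.finsum_rmult K_finsum)

text \<open>Additivity in t reduces to a pure tensor y, for which the antisymmetrization is the
  alternating tensor of the tuple y_i x_i.\<close>

lemma K_mult_alt:
  assumes s: "s \<in> carrier T" and t: "t \<in> carrier T"
  shows "K (s \<otimes>\<^bsub>T\<^esub> alt (t \<otimes>\<^bsub>T\<^esub> pure x)) = c s \<otimes>\<^bsub>B\<^esub> K (alt (t \<otimes>\<^bsub>T\<^esub> pure x))"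
  using t
proof (induction t rule: T_induct)
  case (pure y)
  have z: "(\<lambda>i. y i \<otimes>\<^bsub>R\<^esub> x i) \<in> {1..n} \<rightarrow> carrier R" using funcset_mem[OF pure] by auto
  show ?case unfolding pure_mult[OF pure x_closed] alt_pure[OF z] c_def
    by (rule K_mult_alpha[OF s z])
next
  case (add t u)
  then show ?case using s pure_closed[OF x_closed]
    by (simp add: T.l_distr alt_add alt_closed T.r_distr K_add FE.R.r_distr)
qed

text \<open>Only the right factor has to be symmetric, so \<open>c\<close> is semilinear on the
  whole tensor power. This is used for the conjugates of elements of \<open>TS'\<close>, which are
  not symmetric.\<close>

lemma c_mult:
  assumes "s \<in> carrier T" "t \<in> carrier TS"
  shows "c (s \<otimes>\<^bsub>T\<^esub> t) = c s \<otimes>\<^bsub>B\<^esub> c t"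
proof -
  have t: "t \<in> carrier T" using assms TS_closed by auto
  have "c (s \<otimes>\<^bsub>T\<^esub> t) = K (s \<otimes>\<^bsub>T\<^esub> (t \<otimes>\<^bsub>T\<^esub> \<alpha> x))"
    unfolding c_def using assms t by (simp add: T.m_assoc)
  also have "\<dots> = c s \<otimes>\<^bsub>B\<^esub> K (t \<otimes>\<^bsub>T\<^esub> \<alpha> x)"
    unfolding sym_mult_alpha[OF assms(2) x_closed] by (rule K_mult_alt[OF assms(1) t])
  finally show ?thesis by (simp add: c_def)
qed

lemma c_one: "c \<one>\<^bsub>T\<^esub> = \<one>\<^bsub>B\<^esub>"
proof -
  have "c \<one>\<^bsub>T\<^esub> = FE.R.det {1..n} (\<lambda>p i. FE.co (f (x i)) p)"
    unfolding c_def using K_alpha[OF x_closed] by simp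
  also have "\<dots> = FE.R.det {1..n} (\<lambda>p i. if p = i then \<one>\<^bsub>B\<^esub> else \<zero>\<^bsub>B\<^esub>)"
    using FE.co_basis by (intro FE.R.det_cong) auto
  finally show ?thesis by (simp add: FE.R.det_identity)
qed

lemma c_hom: "ring_hom_cring TS B c"
proof -
  interpret TS: cring TS by (rule TS_cring)
  show ?thesis
    by (intro ring_hom_cringI[OF TS_cring FE.R.is_cring] ring_hom_ringI2 TS.ring_axioms FE.R.ring_axioms ring_hom_memI)
       (simp_all add: TS_ops TS_closed c_add c_mult c_one)
qed

text \<open>All factors except q carry the unit, so the determinant has identity rows outside row q.
  The tensor \<phi>_q(z) alone is in general not symmetric, which is a reason for defining
  \<open>c\<close> on the whole tensor power.\<close>

lemma c_phi:
  assumes "q \<in> {1..n}" "z \<in> carrier R"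
  shows "c (\<phi> q z) = FE.co (f z \<otimes>\<^bsub>E\<^esub> f (x q)) q"
proof -
  let ?w = "\<lambda>i. if i = q then z else \<one>\<^bsub>R\<^esub>"
  let ?M = "\<lambda>p i. FE.co (f (?w p) \<otimes>\<^bsub>E\<^esub> f (x i)) p"
  have "c (\<phi> q z) = FE.R.det {1..n} ?M"
    unfolding c_def \<phi>_def using assms by (intro K_pure_alpha x_closed) auto
  also have "\<dots> = ?M q q"
    using assms FE.co_basis by (intro FE.R.det_identity_except_row) (auto simp: FE.co_closed)
  finally show ?thesis by simp
qed

lemma c_p: "z \<in> carrier R \<Longrightarrow> c (\<pp> z) = FE.tr (f z)"
  unfolding \<pp>_def FE.tr_def
proof -
  assume z: "z \<in> carrier R"
  have "c (\<Oplus>\<^bsub>T\<^esub>p\<in>{1..n}. \<phi> p z) = (\<Oplus>\<^bsub>B\<^esub>p\<in>{1..n}. c (\<phi> p z))"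
    using z by (intro c_finsum) auto
  also have "\<dots> = (\<Oplus>\<^bsub>B\<^esub>i\<in>{1..n}. FE.co (f z \<otimes>\<^bsub>E\<^esub> f (x i)) i)"
    using z c_phi by (intro FE.R.finsum_cong_on) (auto simp: FE.co_closed)
  finally show "c (\<Oplus>\<^bsub>T\<^esub>p\<in>{1..n}. \<phi> p z) = (\<Oplus>\<^bsub>B\<^esub>i\<in>{1..n}. FE.co (f z \<otimes>\<^bsub>E\<^esub> f (x i)) i)" .
qed

lemma c_T_map:
  assumes "a \<in> carrier A"
  shows "c (T_map a) = iB a"
proof -
  have n: "n \<in> {1..n}" using n_pos by simp
  have "c (T_map a) = FE.co (g (iB a) \<otimes>\<^bsub>E\<^esub> f (x n)) n"
    using T_map_phi[OF n assms] c_phi[OF n, of "iR a"] gi[OF assms] assms by simp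
  also have "\<dots> = iB a \<otimes>\<^bsub>B\<^esub> FE.co (f (x n)) n" using n assms by (intro FE.co_smult) auto
  finally show ?thesis using FE.co_basis[OF n n] assms by simp
qed

text \<open>The determinant is formed in the tensor power, while h is a homomorphism only on the
  symmetric tensors; computing it in the subring first makes h applicable.\<close>

lemma det_TS:
  assumes "\<And>i j. \<lbrakk>i \<in> {1..n}; j \<in> {1..n}\<rbrakk> \<Longrightarrow> M i j \<in> carrier TS" "ring_hom_cring TS C h"
  shows "h (T.det {1..n} M) = cring.det C {1..n} (\<lambda>i j. h (M i j))" "T.det {1..n} M \<in> carrier TS"
proof -
  interpret TS: cring TS by (rule TS_cring)
  interpret incl: ring_hom_cring TS T id
    by (intro ring_hom_cringI[OF TS_cring T_cring] ring_hom_ringI2 TS.ring_axioms T.ring_axioms ring_hom_memI)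
       (simp_all add: TS_ops TS_closed)
  interpret h: ring_hom_cring TS C h by fact
  have e: "T.det {1..n} M = TS.det {1..n} M"
    using incl.hom_det[of "{1..n}" M] assms(1) by simp
  show "T.det {1..n} M \<in> carrier TS" unfolding e using assms(1) by (intro TS.det_closed) auto
  show "h (T.det {1..n} M) = cring.det C {1..n} (\<lambda>i j. h (M i j))"
    unfolding e using assms(1) by (intro h.hom_det) auto
qed

lemma c_Delta: "c \<Delta> = FE.trace_form"
proof -
  have "c \<Delta> = FE.R.det {1..n} (\<lambda>i j. c (\<pp> (x i \<otimes>\<^bsub>R\<^esub> x j)))"
    unfolding alpha_mult_det[OF x_closed x_closed] using p_TS by (intro det_TS(1) c_hom) simp
  also have "\<dots> = FE.R.det {1..n} (\<lambda>i j. FE.tr (f (x i) \<otimes>\<^bsub>E\<^esub> f (x j)))"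
    using c_p by (intro FE.R.det_cong) simp_all
  finally show ?thesis by (simp add: FE.trace_form_def)
qed

lemma c_Delta_unit: "c \<Delta> \<in> Units B"
  unfolding c_Delta by (rule trace_unit)

text \<open>The coordinate matrix of the modified tuple is the identity outside column i, and its
  transpose the identity outside row i, so only the i-th coordinate of f(z) survives.\<close>

lemma c_alpha_upd:
  assumes "z \<in> carrier R" "i \<in> {1..n}"
  shows "c (\<alpha> x \<otimes>\<^bsub>T\<^esub> \<alpha> (x(i := z))) = c \<Delta> \<otimes>\<^bsub>B\<^esub> FE.co (f z) i"
proof -
  have xi: "x(i := z) \<in> {1..n} \<rightarrow> carrier R" using assms by auto
  have "c (\<alpha> x \<otimes>\<^bsub>T\<^esub> \<alpha> (x(i := z))) = K (\<Delta> \<otimes>\<^bsub>T\<^esub> \<alpha> (x(i := z)))"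
    unfolding c_def using alpha_closed[OF xi] by (simp add: T.m_assoc T.m_comm[of "\<alpha> (x(i := z))"])
  also have "\<dots> = c \<Delta> \<otimes>\<^bsub>B\<^esub> K (\<alpha> (x(i := z)))"
    unfolding c_def[of \<Delta>] by (rule K_mult_alpha[OF _ xi]) simp
  also have "K (\<alpha> (x(i := z))) = FE.R.det {1..n} (\<lambda>p j. FE.co (f ((x(i := z)) j)) p)"
    by (rule K_alpha[OF xi])
  also have "\<dots> = FE.R.det {1..n} (\<lambda>j p. FE.co (f ((x(i := z)) j)) p)"
    using assms by (intro FE.R.det_transpose) (auto simp: FE.co_closed)
  also have "\<dots> = FE.co (f ((x(i := z)) i)) i"
    using assms FE.co_basis by (intro FE.R.det_identity_except_row) (auto simp: FE.co_closed)
  finally show ?thesis by (simp only: fun_upd_same)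
qed

text \<open>On \<open>TS'\<close> this is \<open>c\<close> applied to the sum of all conjugates,
  that is to the trace down to the symmetric tensors. Its value at \<phi>_n(z) is the trace of
  f(z).\<close>

definition l :: "((nat \<Rightarrow> 'r) \<Rightarrow> 'a) set \<Rightarrow> 'b"
  where "l t = (\<Oplus>\<^bsub>B\<^esub>q\<in>{1..n}. c (orbit t q))"

lemma l_closed: "t \<in> carrier T \<Longrightarrow> l t \<in> carrier B"
  unfolding l_def using orbit_closed by (intro FE.R.finsum_closed) auto

lemma l_add:
  assumes "s \<in> carrier T" "t \<in> carrier T"
  shows "l (s \<oplus>\<^bsub>T\<^esub> t) = l s \<oplus>\<^bsub>B\<^esub> l t"
proof -
  have "l (s \<oplus>\<^bsub>T\<^esub> t) = (\<Oplus>\<^bsub>B\<^esub>q\<in>{1..n}. c (orbit s q) \<oplus>\<^bsub>B\<^esub> c (orbit t q))"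
    unfolding l_def
  proof (rule FE.R.finsum_cong_on)
    fix q assume q: "q \<in> {1..n}"
    have "orbit (s \<oplus>\<^bsub>T\<^esub> t) q = orbit s q \<oplus>\<^bsub>T\<^esub> orbit t q"
      unfolding orbit_def using ring_hom_add[OF ring_hom_cring.homh[OF permute_hom[OF transpose_n_permutes[OF q]]]] assms by simp
    then show "c (orbit (s \<oplus>\<^bsub>T\<^esub> t) q) = c (orbit s q) \<oplus>\<^bsub>B\<^esub> c (orbit t q)"
      using assms orbit_closed q by (simp add: c_add)
    show "c (orbit s q) \<oplus>\<^bsub>B\<^esub> c (orbit t q) \<in> carrier B" using assms orbit_closed q by simp
  qed
  also have "\<dots> = l s \<oplus>\<^bsub>B\<^esub> l t"
    unfolding l_def using assms orbit_closed by (intro FE.R.finsum_addf) auto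
  finally show ?thesis .
qed

text \<open>Symmetric tensors are fixed by the transpositions that define the conjugates, and
  \<open>c\<close> is multiplicative as soon as one factor is symmetric.\<close>

lemma l_mult:
  assumes "s \<in> carrier TS" "t \<in> carrier T"
  shows "l (s \<otimes>\<^bsub>T\<^esub> t) = c s \<otimes>\<^bsub>B\<^esub> l t"
proof -
  have s: "s \<in> carrier T" using assms TS_closed by auto
  have "l (s \<otimes>\<^bsub>T\<^esub> t) = (\<Oplus>\<^bsub>B\<^esub>q\<in>{1..n}. c s \<otimes>\<^bsub>B\<^esub> c (orbit t q))"
    unfolding l_def
  proof (rule FE.R.finsum_cong_on)
    fix q assume q: "q \<in> {1..n}"
    note p = transpose_n_permutes[OF q]
    have "orbit (s \<otimes>\<^bsub>T\<^esub> t) q = orbit t q \<otimes>\<^bsub>T\<^esub> s"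
      unfolding orbit_def using ring_hom_mult[OF ring_hom_cring.homh[OF permute_hom[OF p]] s assms(2)] assms(1) s
        permute_closed[OF p assms(2)] p by (simp add: TS_iff T.m_comm)
    then show "c (orbit (s \<otimes>\<^bsub>T\<^esub> t) q) = c s \<otimes>\<^bsub>B\<^esub> c (orbit t q)"
      using assms s orbit_closed q by (simp add: c_mult FE.R.m_comm)
    show "c s \<otimes>\<^bsub>B\<^esub> c (orbit t q) \<in> carrier B" using assms s orbit_closed q by simp
  qed
  also have "\<dots> = c s \<otimes>\<^bsub>B\<^esub> l t"
    unfolding l_def using assms s orbit_closed by (intro FE.R.finsum_lmult[symmetric]) auto
  finally show ?thesis .
qed

lemma l_phi: "z \<in> carrier R \<Longrightarrow> l (\<phi> n z) = FE.tr (f z)"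
proof -
  assume z: "z \<in> carrier R"
  have "l (\<phi> n z) = (\<Oplus>\<^bsub>B\<^esub>q\<in>{1..n}. c (\<phi> q z))"
    unfolding l_def using z by (intro FE.R.finsum_cong_on) (simp_all add: orbit_phi)
  also have "\<dots> = c (\<pp> z)"
    unfolding \<pp>_def using z by (intro c_finsum[symmetric]) auto
  finally show ?thesis using c_p[OF z] by simp
qed

end

lemma ring_hom_cring_comp:
  assumes "ring_hom_cring R S p" "ring_hom_cring S C q"
  shows "ring_hom_cring R C (\<lambda>z. q (p z))"
proof -
  interpret p: ring_hom_cring R S p by fact
  interpret q: ring_hom_cring S C q by fact
  show ?thesis
    by (intro ring_hom_cringI[OF p.R.is_cring q.S.is_cring] ring_hom_ringI2 p.R.ring_axioms q.S.ring_axioms ring_hom_memI)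
       simp_all
qed

context norm_setting
begin

section \<open>The localized rings and homomorphisms from symmetric fractions\<close>

abbreviation D where "D \<equiv> denominators x"

lemma Delta_TS: "\<Delta> \<in> carrier TS"
  using alpha_mult_TS[OF x_closed x_closed] .

lemma D_eq: "D = range (\<lambda>k :: nat. \<Delta> [^]\<^bsub>T\<^esub> k)"
  unfolding denominators_def element_powers_def ..

lemma D_TS: "s \<in> D \<Longrightarrow> s \<in> carrier TS"
proof -
  have "\<Delta> [^]\<^bsub>T\<^esub> (k :: nat) \<in> carrier TS" for k
    using Delta_TS subringE(3)[OF TS_subring] subringE(6)[OF TS_subring] by (induction k) auto
  then show "s \<in> D \<Longrightarrow> s \<in> carrier TS" unfolding D_eq by auto
qed

lemma D_TS': "s \<in> D \<Longrightarrow> s \<in> carrier TS'"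
  using D_TS TS_subset_TS' by blast

lemma D_one: "\<one>\<^bsub>T\<^esub> \<in> D" and D_Delta: "\<Delta> \<in> D"
  unfolding D_eq by (rule range_eqI[of _ _ "0 :: nat"], simp, rule range_eqI[of _ _ "1 :: nat"], simp)

lemma D_mult: "\<lbrakk>s \<in> D; t \<in> D\<rbrakk> \<Longrightarrow> s \<otimes>\<^bsub>T\<^esub> t \<in> D"
  unfolding D_eq by (auto simp: T.nat_pow_mult)

lemma c_D_unit: "s \<in> D \<Longrightarrow> c s \<in> Units B"
proof -
  have "c (\<Delta> [^]\<^bsub>T\<^esub> (k :: nat)) \<in> Units B" for k
  proof (induction k)
    case 0
    then show ?case by (simp add: c_one)
  next
    case (Suc k)
    then show ?case using c_mult[OF _ Delta_TS, of "\<Delta> [^]\<^bsub>T\<^esub> k"] c_Delta_unit by simp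
  qed
  then show "s \<in> D \<Longrightarrow> c s \<in> Units B" unfolding D_eq by auto
qed

lemma TS_denominators: "multiplicative_set TS D"
  by (intro multiplicative_set.intro TS_cring multiplicative_set_axioms.intro)
     (auto simp: TS_ops D_one D_mult D_TS)

lemma TS'_denominators: "multiplicative_set TS' D"
  by (intro multiplicative_set.intro TS'_cring multiplicative_set_axioms.intro)
     (auto simp: TS_ops D_one D_mult D_TS')

interpretation LS: multiplicative_set TS D by (rule TS_denominators)
interpretation LS': multiplicative_set TS' D by (rule TS'_denominators)

lemma A_cring: "cring (\<A> x)" unfolding \<A>_def by (rule LS.L_cring)
lemma R_cring: "cring (\<R> x)" unfolding \<R>_def by (rule LS'.L_cring)

lemma A_carrierE:
  assumes "z \<in> carrier (\<A> x)"
  obtains t s where "t \<in> carrier TS" "s \<in> D" "z = fraction TS D t s"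
  using assms unfolding \<A>_def by (rule LS.L_carrierE)

lemma R_carrierE:
  assumes "z \<in> carrier (\<R> x)"
  obtains t s where "t \<in> carrier TS'" "s \<in> D" "z = fraction TS' D t s"
  using assms unfolding \<R>_def by (rule LS'.L_carrierE)

lemma fraction_closed:
  "\<lbrakk>t \<in> carrier TS; s \<in> D\<rbrakk> \<Longrightarrow> fraction TS D t s \<in> carrier (\<A> x)"
  "\<lbrakk>t \<in> carrier TS'; s \<in> D\<rbrakk> \<Longrightarrow> fraction TS' D t s \<in> carrier (\<R> x)"
  unfolding \<A>_def \<R>_def by (rule LS.frac_closed LS'.frac_closed; assumption)+

lemma to_A_hom: "ring_hom_cring TS (\<A> x) (to_\<A> x)"
proof -
  have "to_\<A> x = (\<lambda>t. fraction TS D t \<one>\<^bsub>TS\<^esub>)" by (intro ext) (simp add: to_\<A>_def TS_ops)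
  then show ?thesis unfolding \<A>_def using LS.frac_one_hom by simp
qed

lemma to_R_hom: "ring_hom_cring TS' (\<R> x) (to_\<R> x)"
proof -
  have "to_\<R> x = (\<lambda>t. fraction TS' D t \<one>\<^bsub>TS'\<^esub>)" by (intro ext) (simp add: to_\<R>_def TS_ops)
  then show ?thesis unfolding \<R>_def using LS'.frac_one_hom by simp
qed

text \<open>Every representative of a class over \<open>TS\<close> gives the same class over
  \<open>TS'\<close>, with the same witness, so the union in the definition collapses.\<close>

lemma A_to_R_frac:
  assumes "t \<in> carrier TS" "s \<in> D"
  shows "\<A>_to_\<R> x (fraction TS D t s) = fraction TS' D t s"
proof -
  have t: "t \<in> carrier TS'" using assms TS_subset_TS' by auto
  have "fraction TS' D b r = fraction TS' D t s" if "(b, r) \<in> fraction TS D t s" for b r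
  proof (rule LS'.frac_eq_of_mem[OF t assms(2)])
    show "(b, r) \<in> fraction TS' D t s"
      using that TS_subset_TS' unfolding LS.frac_mem_iff[OF assms] LS'.frac_mem_iff[OF t assms(2)] TS_ops
      by blast
  qed
  then have "(\<Union>(b, r) \<in> fraction TS D t s. fraction TS' D b r) = fraction TS' D t s"
    using LS.frac_self[OF assms] by blast
  then show ?thesis unfolding \<A>_to_\<R>_def .
qed

lemma A_to_R_hom: "ring_hom_cring (\<A> x) (\<R> x) (\<A>_to_\<R> x)"
proof -
  interpret AA: cring "\<A> x" by (rule A_cring)
  interpret RR: cring "\<R> x" by (rule R_cring)
  have sub: "t \<in> carrier TS \<Longrightarrow> t \<in> carrier TS'" for t using TS_subset_TS' by auto
  have TSm: "\<lbrakk>s \<in> carrier TS; t \<in> carrier TS\<rbrakk> \<Longrightarrow> s \<otimes>\<^bsub>T\<^esub> t \<in> carrier TS" for s t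
    using LS.S.m_closed[of s t] by (simp add: TS_ops)
  have TSa: "\<lbrakk>s \<in> carrier TS; t \<in> carrier TS\<rbrakk> \<Longrightarrow> s \<oplus>\<^bsub>T\<^esub> t \<in> carrier TS" for s t
    using LS.S.a_closed[of s t] by (simp add: TS_ops)
  show ?thesis
  proof (intro ring_hom_cringI[OF A_cring R_cring] ring_hom_ringI2 AA.ring_axioms RR.ring_axioms ring_hom_memI)
    fix y z assume "y \<in> carrier (\<A> x)" "z \<in> carrier (\<A> x)"
    then obtain a s b t where *: "a \<in> carrier TS" "s \<in> D" "y = fraction TS D a s"
      "b \<in> carrier TS" "t \<in> D" "z = fraction TS D b t" by (metis A_carrierE)
    show "\<A>_to_\<R> x y \<in> carrier (\<R> x)"
      using * sub by (simp add: A_to_R_frac fraction_closed)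
    have m: "y \<otimes>\<^bsub>\<A> x\<^esub> z = fraction TS D (a \<otimes>\<^bsub>T\<^esub> b) (s \<otimes>\<^bsub>T\<^esub> t)"
      unfolding \<A>_def *(3,6) using LS.frac_mult[OF *(1,2,4,5)] by (simp add: TS_ops)
    have a: "y \<oplus>\<^bsub>\<A> x\<^esub> z = fraction TS D (a \<otimes>\<^bsub>T\<^esub> t \<oplus>\<^bsub>T\<^esub> b \<otimes>\<^bsub>T\<^esub> s) (s \<otimes>\<^bsub>T\<^esub> t)"
      unfolding \<A>_def *(3,6) using LS.frac_add[OF *(1,2,4,5)] by (simp add: TS_ops)
    show "\<A>_to_\<R> x (y \<otimes>\<^bsub>\<A> x\<^esub> z) = \<A>_to_\<R> x y \<otimes>\<^bsub>\<R> x\<^esub> \<A>_to_\<R> x z"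
      unfolding m unfolding *(3,6) \<R>_def using * sub LS'.frac_mult[OF sub[OF *(1)] *(2) sub[OF *(4)] *(5)]
      by (simp add: A_to_R_frac TSm D_mult TS_ops)
    show "\<A>_to_\<R> x (y \<oplus>\<^bsub>\<A> x\<^esub> z) = \<A>_to_\<R> x y \<oplus>\<^bsub>\<R> x\<^esub> \<A>_to_\<R> x z"
      unfolding a unfolding *(3,6) \<R>_def using * sub LS'.frac_add[OF sub[OF *(1)] *(2) sub[OF *(4)] *(5)]
      by (simp add: A_to_R_frac TSm TSa D_TS D_mult TS_ops)
  next
    show "\<A>_to_\<R> x \<one>\<^bsub>\<A> x\<^esub> = \<one>\<^bsub>\<R> x\<^esub>"
      unfolding \<A>_def \<R>_def LS.L_one LS'.L_one using A_to_R_frac[OF LS.S.one_closed LS.D_one] by (simp add: TS_ops)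
  qed
qed

lemma norm_hom_exists: "\<exists>H. ring_hom_cring (\<A> x) B H \<and> (\<forall>t\<in>carrier TS. H (to_\<A> x t) = c t)"
  unfolding \<A>_def to_\<A>_def using LS.localization_hom[OF c_hom c_D_unit] by (simp add: TS_ops)

lemma fraction_to_A:
  assumes "t \<in> carrier TS" "s \<in> D"
  shows "fraction TS D t s \<otimes>\<^bsub>\<A> x\<^esub> to_\<A> x s = to_\<A> x t"
  unfolding \<A>_def to_\<A>_def using LS.frac_cancel[OF assms] by (simp add: TS_ops)

lemma hom_to_A_unit:
  assumes "ring_hom_cring (\<A> x) B h" "s \<in> D"
  shows "h (to_\<A> x s) \<in> Units B"
proof -
  interpret h: ring_hom_cring "\<A> x" B h by fact
  interpret t: ring_hom_cring TS "\<A> x" "to_\<A> x" by (rule to_A_hom)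
  have o: "\<one>\<^bsub>T\<^esub> \<in> carrier TS" using LS.S.one_closed by (simp add: TS_ops)
  have "h (fraction TS D \<one>\<^bsub>T\<^esub> s) \<otimes>\<^bsub>B\<^esub> h (to_\<A> x s) = h (to_\<A> x \<one>\<^bsub>T\<^esub>)"
    using h.hom_mult[OF fraction_closed(1)[OF o assms(2)] t.hom_closed[OF D_TS[OF assms(2)]]]
      fraction_to_A[OF o assms(2)] by simp
  also have "\<dots> = \<one>\<^bsub>B\<^esub>" using t.hom_one by (simp add: TS_ops)
  finally show ?thesis
    using fraction_closed(1)[OF o assms(2)] t.hom_closed[OF D_TS[OF assms(2)]] FE.R.m_comm
    unfolding Units_def by (auto intro!: bexI[of _ "h (fraction TS D \<one>\<^bsub>T\<^esub> s)"])
qed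

text \<open>The image of the denominator is a unit of B, so the value at t/s is pinned down by its
  product with that unit.\<close>

lemma hom_fraction_unique:
  assumes "ring_hom_cring (\<A> x) B h" "t \<in> carrier TS" "s \<in> D" "v \<in> carrier B"
    and "v \<otimes>\<^bsub>B\<^esub> h (to_\<A> x s) = h (to_\<A> x t)"
  shows "h (fraction TS D t s) = v"
proof -
  interpret h: ring_hom_cring "\<A> x" B h by fact
  interpret t: ring_hom_cring TS "\<A> x" "to_\<A> x" by (rule to_A_hom)
  note u = hom_to_A_unit[OF assms(1,3)]
  have e: "h (fraction TS D t s) \<otimes>\<^bsub>B\<^esub> h (to_\<A> x s) = v \<otimes>\<^bsub>B\<^esub> h (to_\<A> x s)"
    using h.hom_mult[OF fraction_closed(1)[OF assms(2,3)] t.hom_closed[OF D_TS[OF assms(3)]]]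
      fraction_to_A[OF assms(2,3)] assms(5) by simp
  have hc: "h (fraction TS D t s) \<in> carrier B" using fraction_closed(1)[OF assms(2,3)] by simp
  have c: "w = (w \<otimes>\<^bsub>B\<^esub> h (to_\<A> x s)) \<otimes>\<^bsub>B\<^esub> inv\<^bsub>B\<^esub> h (to_\<A> x s)" if "w \<in> carrier B" for w
    using FE.R.m_assoc[OF that FE.R.Units_closed[OF u] FE.R.Units_inv_closed[OF u]] FE.R.Units_r_inv[OF u] that by simp
  show ?thesis using c[OF hc] c[OF assms(4)] e by simp
qed

text \<open>The symmetric tensors themselves are not claimed to be polynomials in power sums; only
  their multiples by \<alpha>^2(x) are. Both homomorphisms send this element to a unit, and it can
  be cancelled.\<close>

lemma hom_determined_by_power_sums:
  assumes h: "ring_hom_cring (\<A> x) B h" and h': "ring_hom_cring (\<A> x) B h'"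
    and eq: "\<And>z. z \<in> carrier R \<Longrightarrow> h (to_\<A> x (\<pp> z)) = h' (to_\<A> x (\<pp> z))"
    and "z \<in> carrier (\<A> x)"
  shows "h z = h' z"
proof -
  interpret TS: cring TS by (rule TS_cring)
  let ?k = "\<lambda>t. h (to_\<A> x t)" and ?k' = "\<lambda>t. h' (to_\<A> x t)"
  have kh: "ring_hom_cring TS B ?k" by (rule ring_hom_cring_comp[OF to_A_hom h])
  have kh': "ring_hom_cring TS B ?k'" by (rule ring_hom_cring_comp[OF to_A_hom h'])
  interpret k: ring_hom_cring TS B ?k by (rule kh)
  interpret k': ring_hom_cring TS B ?k' by (rule kh')
  \<comment> \<open>By \<open>alpha_mult_det\<close> this product is a determinant in power sums,
    where the two homomorphisms agree.\<close>
  have aa: "\<alpha> x \<otimes>\<^bsub>T\<^esub> \<alpha> y \<in> carrier TS \<and> ?k (\<alpha> x \<otimes>\<^bsub>T\<^esub> \<alpha> y) = ?k' (\<alpha> x \<otimes>\<^bsub>T\<^esub> \<alpha> y)"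
    if y: "y \<in> {1..n} \<rightarrow> carrier R" for y
  proof -
    have c: "i \<in> {1..n} \<Longrightarrow> j \<in> {1..n} \<Longrightarrow> x i \<otimes>\<^bsub>R\<^esub> y j \<in> carrier R" for i j using funcset_mem[OF y] by simp
    have e: "FE.R.det {1..n} (\<lambda>i j. ?k (\<pp> (x i \<otimes>\<^bsub>R\<^esub> y j))) = FE.R.det {1..n} (\<lambda>i j. ?k' (\<pp> (x i \<otimes>\<^bsub>R\<^esub> y j)))"
      using eq c k'.hom_closed p_TS by (intro FE.R.det_cong) auto
    have "?k (\<alpha> x \<otimes>\<^bsub>T\<^esub> \<alpha> y) = ?k' (\<alpha> x \<otimes>\<^bsub>T\<^esub> \<alpha> y)"
      unfolding alpha_mult_det[OF x_closed y] using c p_TS e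
        det_TS(1)[OF _ kh, of "\<lambda>i j. \<pp> (x i \<otimes>\<^bsub>R\<^esub> y j)"] det_TS(1)[OF _ kh', of "\<lambda>i j. \<pp> (x i \<otimes>\<^bsub>R\<^esub> y j)"]
      by simp
    then show ?thesis using alpha_mult_TS[OF x_closed y] by simp
  qed
  \<comment> \<open>Membership in \<open>TS\<close> is carried through the induction, since
    additivity of the homomorphisms is available only for symmetric summands.\<close>
  have alt: "\<alpha> x \<otimes>\<^bsub>T\<^esub> alt (t \<otimes>\<^bsub>T\<^esub> pure x) \<in> carrier TS \<and> ?k (\<alpha> x \<otimes>\<^bsub>T\<^esub> alt (t \<otimes>\<^bsub>T\<^esub> pure x)) = ?k' (\<alpha> x \<otimes>\<^bsub>T\<^esub> alt (t \<otimes>\<^bsub>T\<^esub> pure x))"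
    if "t \<in> carrier T" for t
    using that
  proof (induction t rule: T_induct)
    case (pure y)
    have z: "(\<lambda>i. y i \<otimes>\<^bsub>R\<^esub> x i) \<in> {1..n} \<rightarrow> carrier R" using funcset_mem[OF pure] by auto
    show ?case unfolding pure_mult[OF pure x_closed] alt_pure[OF z] by (rule aa[OF z])
  next
    case (add s t)
    have e: "\<alpha> x \<otimes>\<^bsub>T\<^esub> alt ((s \<oplus>\<^bsub>T\<^esub> t) \<otimes>\<^bsub>T\<^esub> pure x)
        = \<alpha> x \<otimes>\<^bsub>T\<^esub> alt (s \<otimes>\<^bsub>T\<^esub> pure x) \<oplus>\<^bsub>TS\<^esub> \<alpha> x \<otimes>\<^bsub>T\<^esub> alt (t \<otimes>\<^bsub>T\<^esub> pure x)"
      using add pure_closed[OF x_closed] by (simp add: TS_ops T.l_distr alt_add T.r_distr alt_closed)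
    show ?case unfolding e using add by simp
  qed
  have kk: "?k t = ?k' t" if t: "t \<in> carrier TS" for t
  proof -
    have tT: "t \<in> carrier T" using t TS_closed by auto
    have "\<Delta> \<otimes>\<^bsub>TS\<^esub> t = \<alpha> x \<otimes>\<^bsub>T\<^esub> alt (t \<otimes>\<^bsub>T\<^esub> pure x)"
      unfolding sym_mult_alpha[OF t x_closed, symmetric] TS_ops using tT by (simp add: T.m_ac)
    then have "?k \<Delta> \<otimes>\<^bsub>B\<^esub> ?k t = ?k' \<Delta> \<otimes>\<^bsub>B\<^esub> ?k' t"
      using alt[OF tT] k.hom_mult[OF Delta_TS t] k'.hom_mult[OF Delta_TS t] by simp
    moreover have "?k \<Delta> = ?k' \<Delta>" using aa[OF x_closed] by simp
    ultimately show ?thesis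
      using hom_to_A_unit[OF h' D_Delta] k.hom_closed[OF t] k'.hom_closed[OF t] FE.R.Units_l_cancel by simp
  qed
  obtain t s where ts: "t \<in> carrier TS" "s \<in> D" "z = fraction TS D t s" using assms(4) by (rule A_carrierE)
  interpret h': ring_hom_cring "\<A> x" B h' by fact
  interpret to: ring_hom_cring TS "\<A> x" "to_\<A> x" by (rule to_A_hom)
  show ?thesis unfolding ts(3)
  proof (rule hom_fraction_unique[OF h ts(1,2)])
    show "h' (fraction TS D t s) \<in> carrier B" using fraction_closed(1)[OF ts(1,2)] by simp
    have "h' (fraction TS D t s) \<otimes>\<^bsub>B\<^esub> h' (to_\<A> x s) = h' (to_\<A> x t)"
      using h'.hom_mult[OF fraction_closed(1)[OF ts(1,2)] to.hom_closed[OF D_TS[OF ts(2)]]]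
        fraction_to_A[OF ts(1,2)] by simp
    then show "h' (fraction TS D t s) \<otimes>\<^bsub>B\<^esub> h (to_\<A> x s) = h (to_\<A> x t)"
      using kk[OF ts(1)] kk[OF D_TS[OF ts(2)]] by simp
  qed
qed

section \<open>Generators of the extension and the trace functional on it\<close>

lemma finsum_TS:
  assumes "finite I" "\<And>i. i \<in> I \<Longrightarrow> t i \<in> carrier TS"
  shows "(\<Oplus>\<^bsub>TS\<^esub>i\<in>I. t i) = (\<Oplus>\<^bsub>T\<^esub>i\<in>I. t i)"
proof -
  interpret incl: ring_hom_cring TS T id
    by (intro ring_hom_cringI[OF TS_cring T_cring] ring_hom_ringI2 LS.S.ring_axioms T.ring_axioms ring_hom_memI)
       (simp_all add: TS_ops TS_closed)
  show ?thesis using incl.hom_finsum[of t I] assms(2) by (simp add: Pi_iff)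
qed

lemma finsum_TS':
  assumes "finite I" "\<And>i. i \<in> I \<Longrightarrow> t i \<in> carrier TS'"
  shows "(\<Oplus>\<^bsub>TS'\<^esub>i\<in>I. t i) = (\<Oplus>\<^bsub>T\<^esub>i\<in>I. t i)"
proof -
  interpret incl: ring_hom_cring TS' T id
    by (intro ring_hom_cringI[OF TS'_cring T_cring] ring_hom_ringI2 LS'.S.ring_axioms T.ring_axioms ring_hom_memI)
       (simp_all add: TS_ops TS_closed)
  show ?thesis using incl.hom_finsum[of t I] assms(2) by (simp add: Pi_iff)
qed

text \<open>Cramer's rule divided by \<Delta> s: the elements \<phi>_n(x_i) generate \<R> over \<A>,
  with explicit coefficients.\<close>

lemma R_expansion:
  assumes "t \<in> carrier TS'" "s \<in> D"
  shows "fraction TS' D t s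
    = (\<Oplus>\<^bsub>\<R> x\<^esub>i\<in>{1..n}. \<A>_to_\<R> x (fraction TS D (cramer_coeff x t i) (\<Delta> \<otimes>\<^bsub>T\<^esub> s)) \<otimes>\<^bsub>\<R> x\<^esub> to_\<R> x (\<phi> n (x i)))"
proof -
  have sT: "s \<in> carrier T" "t \<in> carrier T" using assms D_TS TS_closed by auto
  have Ds: "\<Delta> \<otimes>\<^bsub>T\<^esub> s \<in> D" using D_mult[OF D_Delta assms(2)] .
  have cc: "cramer_coeff x t i \<in> carrier TS" for i using cramer_coeff_TS[OF x_closed assms(1)] .
  have cc': "cramer_coeff x t i \<in> carrier TS'" for i using cc TS_subset_TS' by auto
  have ph: "i \<in> {1..n} \<Longrightarrow> \<phi> n (x i) \<in> carrier TS'" for i using phi_n_TS' by simp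
  have pc: "i \<in> {1..n} \<Longrightarrow> \<phi> n (x i) \<otimes>\<^bsub>T\<^esub> cramer_coeff x t i \<in> carrier TS'" for i
    using LS'.S.m_closed[OF ph cc'] by (simp add: TS_ops)
  have "fraction TS' D t s = fraction TS' D (\<Delta> \<otimes>\<^bsub>TS'\<^esub> t) (\<Delta> \<otimes>\<^bsub>TS'\<^esub> s)"
    using assms D_Delta LS'.D_mult D_TS'[OF D_Delta]
    by (intro LS'.frac_eqI1) (simp_all add: LS'.S.m_ac)
  also have "\<dots> = fraction TS' D (\<Oplus>\<^bsub>TS'\<^esub>i\<in>{1..n}. \<phi> n (x i) \<otimes>\<^bsub>T\<^esub> cramer_coeff x t i) (\<Delta> \<otimes>\<^bsub>T\<^esub> s)"
    using cramer_TS'[OF x_closed assms(1)] finsum_TS'[of "{1..n}" "\<lambda>i. \<phi> n (x i) \<otimes>\<^bsub>T\<^esub> cramer_coeff x t i"] pc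
    by (simp add: TS_ops)
  also have "\<dots> = (\<Oplus>\<^bsub>\<R> x\<^esub>i\<in>{1..n}. fraction TS' D (\<phi> n (x i) \<otimes>\<^bsub>T\<^esub> cramer_coeff x t i) (\<Delta> \<otimes>\<^bsub>T\<^esub> s))"
    unfolding \<R>_def using pc Ds by (intro LS'.frac_finsum) auto
  also have "\<dots> = (\<Oplus>\<^bsub>\<R> x\<^esub>i\<in>{1..n}. \<A>_to_\<R> x (fraction TS D (cramer_coeff x t i) (\<Delta> \<otimes>\<^bsub>T\<^esub> s)) \<otimes>\<^bsub>\<R> x\<^esub> to_\<R> x (\<phi> n (x i)))"
    unfolding \<R>_def
  proof (rule LS'.L.finsum_cong_on)
    fix i assume i: "i \<in> {1..n}"
    have a: "fraction TS' D (cramer_coeff x t i) (\<Delta> \<otimes>\<^bsub>T\<^esub> s) \<in> carrier LS'.L" using cc' Ds by auto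
    have b: "fraction TS' D (\<phi> n (x i)) \<one>\<^bsub>TS'\<^esub> \<in> carrier LS'.L" using ph[OF i] by auto
    have e: "fraction TS' D (\<phi> n (x i) \<otimes>\<^bsub>T\<^esub> cramer_coeff x t i) (\<Delta> \<otimes>\<^bsub>T\<^esub> s)
        = fraction TS' D (\<phi> n (x i)) \<one>\<^bsub>TS'\<^esub> \<otimes>\<^bsub>LS'.L\<^esub> fraction TS' D (cramer_coeff x t i) (\<Delta> \<otimes>\<^bsub>T\<^esub> s)"
      using LS'.frac_num_mult[OF ph[OF i] cc' Ds] by (simp add: TS_ops)
    show "fraction TS' D (\<phi> n (x i) \<otimes>\<^bsub>T\<^esub> cramer_coeff x t i) (\<Delta> \<otimes>\<^bsub>T\<^esub> s)
        = \<A>_to_\<R> x (fraction TS D (cramer_coeff x t i) (\<Delta> \<otimes>\<^bsub>T\<^esub> s)) \<otimes>\<^bsub>LS'.L\<^esub> to_\<R> x (\<phi> n (x i))"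
      unfolding e A_to_R_frac[OF cc Ds] to_\<R>_def using LS'.L.m_comm[OF b a] by (simp add: TS_ops)
    show "\<A>_to_\<R> x (fraction TS D (cramer_coeff x t i) (\<Delta> \<otimes>\<^bsub>T\<^esub> s)) \<otimes>\<^bsub>LS'.L\<^esub> to_\<R> x (\<phi> n (x i)) \<in> carrier LS'.L"
      unfolding A_to_R_frac[OF cc Ds] to_\<R>_def using a b by (simp add: TS_ops)
  qed
  finally show ?thesis .
qed

lemma phi_n_hom: "ring_hom_cring R TS' (\<phi> n)"
proof -
  have n: "n \<in> {1..n}" using n_pos by simp
  note h = ring_hom_cring.homh[OF phi_hom[OF n]]
  show ?thesis
    by (intro ring_hom_cringI[OF Al.S.is_cring TS'_cring] ring_hom_ringI2 Al.S.ring_axioms LS'.S.ring_axioms ring_hom_memI)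
       (simp_all add: TS_ops phi_n_TS' ring_hom_mult[OF h] ring_hom_add[OF h] ring_hom_one[OF h])
qed

text \<open>The descent of \<open>l\<close> to fractions, possible because \<open>l\<close> is
  semilinear with respect to \<open>c\<close> and \<open>c\<close> is invertible on
  denominators.\<close>

definition \<Lambda> :: "(((nat \<Rightarrow> 'r) \<Rightarrow> 'a) set \<times> ((nat \<Rightarrow> 'r) \<Rightarrow> 'a) set) set \<Rightarrow> 'b"
  where "\<Lambda> = localization_functional.loc_lift B l c"

lemma trace_functional: "localization_functional TS' D B l c"
  by (intro localization_functional.intro localization_functional_axioms.intro TS'_denominators FE.R.is_cring)
     (simp_all add: TS_ops TS_closed l_closed l_add l_mult c_D_unit D_TS c_mult)

lemma Lambda_closed: "r \<in> carrier (\<R> x) \<Longrightarrow> \<Lambda> r \<in> carrier B"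
  unfolding \<Lambda>_def \<R>_def by (rule localization_functional.loc_lift_closed[OF trace_functional])

lemma Lambda_add: "\<lbrakk>r \<in> carrier (\<R> x); s \<in> carrier (\<R> x)\<rbrakk> \<Longrightarrow> \<Lambda> (r \<oplus>\<^bsub>\<R> x\<^esub> s) = \<Lambda> r \<oplus>\<^bsub>B\<^esub> \<Lambda> s"
  unfolding \<Lambda>_def \<R>_def by (rule localization_functional.loc_lift_add[OF trace_functional])

lemma Lambda_frac: "\<lbrakk>t \<in> carrier TS'; s \<in> D\<rbrakk> \<Longrightarrow> \<Lambda> (fraction TS' D t s) = inv\<^bsub>B\<^esub> (c s) \<otimes>\<^bsub>B\<^esub> l t"
  unfolding \<Lambda>_def by (rule localization_functional.loc_lift_frac[OF trace_functional])

end

section \<open>Base change along homomorphisms to the base\<close>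

text \<open>Here h is an arbitrary homomorphism of A-algebras. The locale is used for the
  constructed homomorphism and for any competing solution.\<close>

locale norm_hom = norm_setting A R iR n B E g f x iB
  for A :: "('a, 'k) ring_scheme" and R :: "('r, 'l) ring_scheme" and iR :: "'a \<Rightarrow> 'r" and n :: nat
    and B :: "('b, 'm) ring_scheme" and E :: "('e, 'q) ring_scheme" and g :: "'b \<Rightarrow> 'e"
    and f :: "'r \<Rightarrow> 'e" and x :: "nat \<Rightarrow> 'r" and iB :: "'a \<Rightarrow> 'b" +
  fixes h :: "(((nat \<Rightarrow> 'r) \<Rightarrow> 'a) set \<times> ((nat \<Rightarrow> 'r) \<Rightarrow> 'a) set) set \<Rightarrow> 'b"
  assumes h_hom: "ring_hom_cring (\<A> x) B h"
    and h_map: "\<And>a. a \<in> carrier A \<Longrightarrow> h (\<A>_map x a) = iB a"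
begin

lemma RB_pair: "algebra_pair A R iR B iB"
  by (intro algebra_pair.intro iB_hom) (rule Al.ring_hom_cring_axioms)

lemma P_pair: "algebra_pair (\<A> x) (\<R> x) (\<A>_to_\<R> x) B h"
  by (intro algebra_pair.intro A_to_R_hom h_hom)

interpretation RB: algebra_pair A R iR B iB by (rule RB_pair)
interpretation P: algebra_pair "\<A> x" "\<R> x" "\<A>_to_\<R> x" B h by (rule P_pair)

definition pq where "pq = tensor_lift A (alg_module R iR) (alg_module B iB) P.TP
  (\<lambda>z. P.tens (to_\<R> x (\<phi> n z)) \<one>\<^bsub>B\<^esub>) (\<lambda>b. P.tens \<one>\<^bsub>\<R> x\<^esub> b)"

definition qq where "qq = tensor_lift A (alg_module R iR) (alg_module B iB) E f g"

lemma base_change_iff: "base_change_is x B iB E g f h \<longleftrightarrow> equal_quotients RB.TP P.TP pq E qq"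
  unfolding base_change_is_def Let_def pq_def qq_def ..

lemma to_R_phi_closed [simp]: "z \<in> carrier R \<Longrightarrow> to_\<R> x (\<phi> n z) \<in> carrier (\<R> x)"
  unfolding to_\<R>_def using phi_n_TS' D_one by (rule fraction_closed(2))

text \<open>The element \<phi>_n(a) comes from \<A>, since \<open>T_map\<close> factors through each
  co-projection, so it can be moved across the tensor sign through h. This is the compatibility over
  A that the left quotient map requires.\<close>

lemma to_R_phi_map:
  assumes "a \<in> carrier A"
  shows "P.tens (to_\<R> x (\<phi> n (iR a))) \<one>\<^bsub>B\<^esub> = P.tens \<one>\<^bsub>\<R> x\<^esub> (iB a)"
proof -
  have n: "n \<in> {1..n}" using n_pos by simp
  have ac: "\<A>_map x a \<in> carrier (\<A> x)"
    unfolding \<A>_map_def to_\<A>_def using T_map_TS[OF assms] D_one by (rule fraction_closed(1))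
  have "to_\<R> x (\<phi> n (iR a)) = \<A>_to_\<R> x (\<A>_map x a)"
    unfolding to_\<R>_def \<A>_map_def to_\<A>_def T_map_phi[OF n assms, symmetric]
    using A_to_R_frac[OF T_map_TS[OF assms] D_one] by simp
  then show ?thesis
    using P.tens_balanced[OF ac P.R.S.one_closed FE.R.one_closed] h_map[OF assms] P.R.hom_closed[OF ac] assms
    by simp
qed

lemma pq_hom: "ring_hom_cring RB.TP P.TP pq"
  and pq_tens: "\<lbrakk>z \<in> carrier R; b \<in> carrier B\<rbrakk> \<Longrightarrow> pq (RB.tens z b) = P.tens (to_\<R> x (\<phi> n z)) b"
proof -
  have 1: "ring_hom_cring R P.TP (\<lambda>z. P.tens (to_\<R> x (\<phi> n z)) \<one>\<^bsub>B\<^esub>)"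
    by (rule ring_hom_cring_comp[OF ring_hom_cring_comp[OF phi_n_hom to_R_hom] P.left_hom])
  show "ring_hom_cring RB.TP P.TP pq"
    unfolding pq_def by (rule RB.tensor_lift_hom(1)[OF 1 P.right_hom to_R_phi_map])
  show "pq (RB.tens z b) = P.tens (to_\<R> x (\<phi> n z)) b" if zb: "z \<in> carrier R" "b \<in> carrier B"
    using RB.tensor_lift_hom(2)[OF 1 P.right_hom to_R_phi_map zb]
      P.tens_mult[OF to_R_phi_closed[OF zb(1)] FE.R.one_closed P.R.S.one_closed zb(2)]
      P.R.S.r_one[OF to_R_phi_closed[OF zb(1)]] FE.R.l_one[OF zb(2)]
    unfolding pq_def by simp
qed

lemma qq_hom: "ring_hom_cring RB.TP E qq"
  and qq_tens: "\<lbrakk>z \<in> carrier R; b \<in> carrier B\<rbrakk> \<Longrightarrow> qq (RB.tens z b) = f z \<otimes>\<^bsub>E\<^esub> g b"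
  unfolding qq_def using RB.tensor_lift_hom[OF f_hom FE.ring_hom_cring_axioms] gi by simp_all

interpretation pq: ring_hom_cring RB.TP P.TP pq by (rule pq_hom)
interpretation qq: ring_hom_cring RB.TP E qq by (rule qq_hom)

abbreviation coeff where "coeff t s i \<equiv> h (fraction TS D (cramer_coeff x t i) (\<Delta> \<otimes>\<^bsub>T\<^esub> s))"

lemma coeff_closed: "\<lbrakk>t \<in> carrier TS'; s \<in> D\<rbrakk> \<Longrightarrow> coeff t s i \<in> carrier B"
  using P.B.hom_closed[OF fraction_closed(1)[OF cramer_coeff_TS[OF x_closed] D_mult[OF D_Delta]]] .

text \<open>In the expansion over the generators \<phi>_n(x_i) the coefficients in \<A> cross the
  tensor sign and become elements of B. The result is visibly in the image of \<open>pq\<close>,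
  which gives surjectivity.\<close>

lemma tens_expansion:
  assumes "t \<in> carrier TS'" "s \<in> D" "b \<in> carrier B"
  shows "P.tens (fraction TS' D t s) b = pq (\<Oplus>\<^bsub>RB.TP\<^esub>i\<in>{1..n}. RB.tens (x i) (coeff t s i \<otimes>\<^bsub>B\<^esub> b))"
proof -
  let ?w = "\<lambda>i. fraction TS D (cramer_coeff x t i) (\<Delta> \<otimes>\<^bsub>T\<^esub> s)"
  have wc: "?w i \<in> carrier (\<A> x)" for i
    using fraction_closed(1)[OF cramer_coeff_TS[OF x_closed assms(1)] D_mult[OF D_Delta assms(2)]] .
  have "P.tens (fraction TS' D t s) b
      = P.tens (\<Oplus>\<^bsub>\<R> x\<^esub>i\<in>{1..n}. \<A>_to_\<R> x (?w i) \<otimes>\<^bsub>\<R> x\<^esub> to_\<R> x (\<phi> n (x i))) b"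
    unfolding R_expansion[OF assms(1,2)] ..
  also have "\<dots> = (\<Oplus>\<^bsub>P.TP\<^esub>i\<in>{1..n}. P.tens (\<A>_to_\<R> x (?w i) \<otimes>\<^bsub>\<R> x\<^esub> to_\<R> x (\<phi> n (x i))) b)"
    using wc assms(3) by (intro P.tens_finsum_left) simp_all
  also have "\<dots> = (\<Oplus>\<^bsub>P.TP\<^esub>i\<in>{1..n}. pq (RB.tens (x i) (coeff t s i \<otimes>\<^bsub>B\<^esub> b)))"
  proof (rule P.TP.finsum_cong_on)
    fix i assume i: "i \<in> {1..n}"
    have cb: "coeff t s i \<otimes>\<^bsub>B\<^esub> b \<in> carrier B" using coeff_closed[OF assms(1,2)] assms(3) by simp
    show "P.tens (\<A>_to_\<R> x (?w i) \<otimes>\<^bsub>\<R> x\<^esub> to_\<R> x (\<phi> n (x i))) b = pq (RB.tens (x i) (coeff t s i \<otimes>\<^bsub>B\<^esub> b))"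
      using pq_tens[OF x_mem[OF i] cb] P.tens_balanced[OF wc to_R_phi_closed[OF x_mem[OF i]] assms(3), of i] by simp
    show "pq (RB.tens (x i) (coeff t s i \<otimes>\<^bsub>B\<^esub> b)) \<in> carrier P.TP"
      using x_mem[OF i] cb by (intro pq.hom_closed RB.tens_closed)
  qed
  also have "\<dots> = pq (\<Oplus>\<^bsub>RB.TP\<^esub>i\<in>{1..n}. RB.tens (x i) (coeff t s i \<otimes>\<^bsub>B\<^esub> b))"
  proof -
    have "(\<lambda>i. RB.tens (x i) (coeff t s i \<otimes>\<^bsub>B\<^esub> b)) \<in> {1..n} \<rightarrow> carrier RB.TP"
      using coeff_closed[OF assms(1,2)] assms(3) by (intro Pi_I RB.tens_closed) simp_all
    then show ?thesis using pq.hom_finsum by (simp add: o_def)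
  qed
  finally show ?thesis .
qed

lemma pq_surj: "pq ` carrier RB.TP = carrier P.TP"
proof (intro equalityI subsetI)
  fix v assume "v \<in> carrier P.TP"
  then show "v \<in> pq ` carrier RB.TP"
  proof (induction v rule: P.TP_induct)
    case (tens r b)
    obtain t s where ts: "t \<in> carrier TS'" "s \<in> D" "r = fraction TS' D t s" using tens(1) by (rule R_carrierE)
    have "(\<Oplus>\<^bsub>RB.TP\<^esub>i\<in>{1..n}. RB.tens (x i) (coeff t s i \<otimes>\<^bsub>B\<^esub> b)) \<in> carrier RB.TP"
      using coeff_closed[OF ts(1,2)] tens(2) by (intro RB.TP.finsum_closed Pi_I RB.tens_closed) simp_all
    then show ?case unfolding ts(3) tens_expansion[OF ts(1,2) tens(2)] by blast
  next
    case (add v w)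
    then obtain v' w' where "v' \<in> carrier RB.TP" "v = pq v'" "w' \<in> carrier RB.TP" "w = pq w'" by blast
    then show ?case using pq.hom_add[of v' w'] by (metis RB.TP.a_closed imageI)
  qed
qed auto

lemma qq_expansion:
  assumes "\<And>i. i \<in> {1..n} \<Longrightarrow> b i \<in> carrier B"
  shows "qq (\<Oplus>\<^bsub>RB.TP\<^esub>i\<in>{1..n}. RB.tens (x i) (b i)) = (\<Oplus>\<^bsub>E\<^esub>i\<in>{1..n}. g (b i) \<otimes>\<^bsub>E\<^esub> f (x i))"
proof -
  have "(\<lambda>i. RB.tens (x i) (b i)) \<in> {1..n} \<rightarrow> carrier RB.TP"
    using assms by (intro Pi_I RB.tens_closed) simp_all
  then have "qq (\<Oplus>\<^bsub>RB.TP\<^esub>i\<in>{1..n}. RB.tens (x i) (b i)) = (\<Oplus>\<^bsub>E\<^esub>i\<in>{1..n}. qq (RB.tens (x i) (b i)))"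
    using qq.hom_finsum by (simp add: o_def)
  also have "\<dots> = (\<Oplus>\<^bsub>E\<^esub>i\<in>{1..n}. g (b i) \<otimes>\<^bsub>E\<^esub> f (x i))"
    using assms by (intro FE.S.finsum_cong_on) (simp_all add: qq_tens FE.S.m_comm)
  finally show ?thesis .
qed

lemma qq_surj: "qq ` carrier RB.TP = carrier E"
proof (intro equalityI subsetI)
  fix y assume y: "y \<in> carrier E"
  have "y = qq (\<Oplus>\<^bsub>RB.TP\<^esub>i\<in>{1..n}. RB.tens (x i) (FE.co y i))"
    using qq_expansion[of "FE.co y"] FE.co_spec(2)[OF y] FE.co_closed[OF y] by simp
  moreover have "(\<Oplus>\<^bsub>RB.TP\<^esub>i\<in>{1..n}. RB.tens (x i) (FE.co y i)) \<in> carrier RB.TP"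
    using FE.co_closed[OF y] by (intro RB.TP.finsum_closed Pi_I RB.tens_closed) simp_all
  ultimately show "y \<in> qq ` carrier RB.TP" by blast
qed auto

text \<open>Relations in \<R> \<otimes> B must hold in E. Applied to the expansion of \<phi>_n(z
  x_j), this identifies the images of the Cramer coefficients with the matrix of multiplication by
  f(z), and the sum of the diagonal coefficients is \<pp>(z) by
  \<open>alpha_derivation\<close>.\<close>

lemma hom_power_sum:
  assumes ker: "a_kernel RB.TP P.TP pq \<subseteq> a_kernel RB.TP E qq" and z: "z \<in> carrier R"
  shows "h (to_\<A> x (\<pp> z)) = FE.tr (f z)"
proof -
  interpret LS: multiplicative_set TS D by (rule TS_denominators)
  let ?y = "\<lambda>j. z \<otimes>\<^bsub>R\<^esub> x j"
  let ?t = "\<lambda>j. \<phi> n (?y j)"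
  have yc: "j \<in> {1..n} \<Longrightarrow> ?y j \<in> carrier R" for j using z by simp
  have tc: "j \<in> {1..n} \<Longrightarrow> ?t j \<in> carrier TS'" for j using phi_n_TS'[OF yc] .
  have D1: "\<Delta> \<otimes>\<^bsub>T\<^esub> \<one>\<^bsub>T\<^esub> = \<Delta>" by simp
  \<comment> \<open>The elements z x_j \<otimes> 1 and the sum of the x_i \<otimes> b_i have equal
    images under \<open>pq\<close>, hence by the kernel inclusion under \<open>qq\<close>;
    uniqueness of coordinates in E then identifies the b_i.\<close>
  have co: "FE.co (f z \<otimes>\<^bsub>E\<^esub> f (x j)) i = coeff (?t j) \<one>\<^bsub>T\<^esub> i" if ij: "i \<in> {1..n}" "j \<in> {1..n}" for i j
  proof (rule FE.co_unique[OF _ _ ij(1)])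
    let ?b = "\<lambda>i. coeff (?t j) \<one>\<^bsub>T\<^esub> i"
    have bc: "?b i \<in> carrier B" for i using coeff_closed[OF tc[OF ij(2)] D_one] .
    then show "?b i \<in> carrier B" for i .
    let ?u = "RB.tens (?y j) \<one>\<^bsub>B\<^esub>" and ?v = "\<Oplus>\<^bsub>RB.TP\<^esub>i\<in>{1..n}. RB.tens (x i) (?b i)"
    have u: "?u \<in> carrier RB.TP" using yc[OF ij(2)] by simp
    have v: "?v \<in> carrier RB.TP" using bc by (intro RB.TP.finsum_closed Pi_I RB.tens_closed) simp_all
    have "pq ?u = P.tens (fraction TS' D (?t j) \<one>\<^bsub>T\<^esub>) \<one>\<^bsub>B\<^esub>"
      using pq_tens[OF yc[OF ij(2)] FE.R.one_closed] by (simp add: to_\<R>_def)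
    also have "\<dots> = pq (\<Oplus>\<^bsub>RB.TP\<^esub>i\<in>{1..n}. RB.tens (x i) (?b i \<otimes>\<^bsub>B\<^esub> \<one>\<^bsub>B\<^esub>))"
      by (rule tens_expansion[OF tc[OF ij(2)] D_one FE.R.one_closed])
    finally have "pq ?u = pq ?v" using bc by simp
    then have "?u \<ominus>\<^bsub>RB.TP\<^esub> ?v \<in> a_kernel RB.TP P.TP pq"
      unfolding a_kernel_def' using u v pq.hom_closed[OF v] by (simp add: RB.TP.minus_eq P.TP.r_neg)
    then have "qq (?u \<ominus>\<^bsub>RB.TP\<^esub> ?v) = \<zero>\<^bsub>E\<^esub>" using ker unfolding a_kernel_def' by blast
    then have "qq ?u \<ominus>\<^bsub>E\<^esub> qq ?v = \<zero>\<^bsub>E\<^esub>" using u v by (simp add: RB.TP.minus_eq FE.S.minus_eq)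
    then have "qq ?u = qq ?v" using qq.hom_closed[OF u] qq.hom_closed[OF v] by simp
    moreover have "qq ?u = f z \<otimes>\<^bsub>E\<^esub> f (x j)" using qq_tens[OF yc[OF ij(2)] FE.R.one_closed] z ij(2) by simp
    ultimately show "f z \<otimes>\<^bsub>E\<^esub> f (x j) = (\<Oplus>\<^bsub>E\<^esub>i\<in>{1..n}. g (?b i) \<otimes>\<^bsub>E\<^esub> f (x i))"
      using qq_expansion[OF bc] by simp
  qed
  have cc: "j \<in> {1..n} \<Longrightarrow> cramer_coeff x (?t j) j \<in> carrier TS" for j
    using cramer_coeff_TS[OF x_closed tc] .
  have "FE.tr (f z) = (\<Oplus>\<^bsub>B\<^esub>j\<in>{1..n}. h (fraction TS D (cramer_coeff x (?t j) j) \<Delta>))"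
    unfolding FE.tr_def using co coeff_closed[OF tc D_one]
    by (intro FE.R.finsum_cong_on) (simp_all only: D1)
  also have "\<dots> = h (\<Oplus>\<^bsub>\<A> x\<^esub>j\<in>{1..n}. fraction TS D (cramer_coeff x (?t j) j) \<Delta>)"
  proof -
    have "(\<lambda>j. fraction TS D (cramer_coeff x (?t j) j) \<Delta>) \<in> {1..n} \<rightarrow> carrier (\<A> x)"
      using fraction_closed(1)[OF cc D_Delta] by (intro Pi_I)
    then show ?thesis using P.B.hom_finsum by (simp add: o_def)
  qed
  also have "(\<Oplus>\<^bsub>\<A> x\<^esub>j\<in>{1..n}. fraction TS D (cramer_coeff x (?t j) j) \<Delta>)
      = fraction TS D (\<Oplus>\<^bsub>TS\<^esub>j\<in>{1..n}. cramer_coeff x (?t j) j) \<Delta>"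
    unfolding \<A>_def using cc D_Delta by (intro LS.frac_finsum[symmetric]) auto
  also have "(\<Oplus>\<^bsub>TS\<^esub>j\<in>{1..n}. cramer_coeff x (?t j) j) = (\<Oplus>\<^bsub>T\<^esub>j\<in>{1..n}. cramer_coeff x (?t j) j)"
    using cc by (intro finsum_TS) auto
  also have "\<dots> = (\<Oplus>\<^bsub>T\<^esub>j\<in>{1..n}. \<alpha> x \<otimes>\<^bsub>T\<^esub> \<alpha> (x(j := ?y j)))"
  proof (rule T.finsum_cong_on)
    fix j assume j: "j \<in> {1..n}"
    show "cramer_coeff x (?t j) j = \<alpha> x \<otimes>\<^bsub>T\<^esub> \<alpha> (x(j := ?y j))"
      by (rule cramer_coeff_phi[OF x_closed yc[OF j]])
    then show "\<alpha> x \<otimes>\<^bsub>T\<^esub> \<alpha> (x(j := ?y j)) \<in> carrier T" using TS_closed(1)[OF cc[OF j]] by simp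
  qed
  also have "\<dots> = \<Delta> \<otimes>\<^bsub>T\<^esub> \<pp> z" by (rule alpha_derivation[OF x_closed z])
  \<comment> \<open>Cancelling \<Delta> turns the sum of the diagonal coefficients into the power
    sum.\<close>
  also have "fraction TS D (\<Delta> \<otimes>\<^bsub>T\<^esub> \<pp> z) \<Delta> = to_\<A> x (\<pp> z)"
    unfolding to_\<A>_def
  proof (rule LS.frac_eqI1)
    show "\<Delta> \<otimes>\<^bsub>T\<^esub> \<pp> z \<in> carrier TS" using LS.S.m_closed[OF Delta_TS p_TS[OF z]] by (simp add: TS_ops)
    show "(\<Delta> \<otimes>\<^bsub>T\<^esub> \<pp> z) \<otimes>\<^bsub>TS\<^esub> \<one>\<^bsub>T\<^esub> = \<pp> z \<otimes>\<^bsub>TS\<^esub> \<Delta>"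
      using p_closed[OF z] by (simp add: TS_ops T.m_comm)
  qed (use D_Delta D_one p_TS[OF z] in auto)
  finally show ?thesis ..
qed

section \<open>The base change condition for the constructed homomorphism\<close>

context
  assumes h_c: "\<And>t. t \<in> carrier TS \<Longrightarrow> h (to_\<A> x t) = c t"
begin

lemma h_fraction:
  assumes "t \<in> carrier TS" "s \<in> D"
  shows "h (fraction TS D t s) = inv\<^bsub>B\<^esub> (c s) \<otimes>\<^bsub>B\<^esub> c t"
proof (rule hom_fraction_unique[OF h_hom assms])
  note u = c_D_unit[OF assms(2)]
  have t: "c t \<in> carrier B" using TS_closed(1)[OF assms(1)] by simp
  show "inv\<^bsub>B\<^esub> (c s) \<otimes>\<^bsub>B\<^esub> c t \<in> carrier B" using FE.R.Units_inv_closed[OF u] t by simp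
  have "(inv\<^bsub>B\<^esub> (c s) \<otimes>\<^bsub>B\<^esub> c t) \<otimes>\<^bsub>B\<^esub> c s = (inv\<^bsub>B\<^esub> (c s) \<otimes>\<^bsub>B\<^esub> c s) \<otimes>\<^bsub>B\<^esub> c t"
    using FE.R.Units_inv_closed[OF u] FE.R.Units_closed[OF u] t by (simp add: FE.R.m_ac)
  also have "\<dots> = c t" using FE.R.Units_l_inv[OF u] t by simp
  finally show "(inv\<^bsub>B\<^esub> (c s) \<otimes>\<^bsub>B\<^esub> c t) \<otimes>\<^bsub>B\<^esub> h (to_\<A> x s) = h (to_\<A> x t)"
    using h_c[OF assms(1)] h_c[OF D_TS[OF assms(2)]] by simp
qed

text \<open>For \<phi>_n(z) the Cramer numerator is the alternating tensor with x_i replaced by z,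
  on which \<open>c\<close> is \<Delta>'s value times the i-th coordinate of f(z).\<close>

lemma coeff_phi:
  assumes "z \<in> carrier R" "i \<in> {1..n}"
  shows "coeff (\<phi> n z) \<one>\<^bsub>T\<^esub> i = FE.co (f z) i"
proof -
  note u = c_D_unit[OF D_Delta]
  have k: "FE.co (f z) i \<in> carrier B" using assms by (intro FE.co_closed) simp_all
  have "coeff (\<phi> n z) \<one>\<^bsub>T\<^esub> i = inv\<^bsub>B\<^esub> (c \<Delta>) \<otimes>\<^bsub>B\<^esub> c (cramer_coeff x (\<phi> n z) i)"
    using h_fraction[OF cramer_coeff_TS[OF x_closed phi_n_TS'[OF assms(1)]] D_Delta] by simp
  also have "\<dots> = inv\<^bsub>B\<^esub> (c \<Delta>) \<otimes>\<^bsub>B\<^esub> (c \<Delta> \<otimes>\<^bsub>B\<^esub> FE.co (f z) i)"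
    unfolding cramer_coeff_phi[OF x_closed assms(1)] c_alpha_upd[OF assms] ..
  also have "\<dots> = FE.co (f z) i"
    using FE.R.m_assoc[OF FE.R.Units_inv_closed[OF u] FE.R.Units_closed[OF u] k] FE.R.Units_l_inv[OF u] k by simp
  finally show ?thesis .
qed

text \<open>On z \<otimes> b the Cramer coefficients become the coordinates of f(z), so the value of
  \<open>pq\<close> depends only on that of \<open>qq\<close>; this gives one kernel
  inclusion.\<close>

lemma pq_eq:
  assumes "u \<in> carrier RB.TP"
  shows "pq u = pq (\<Oplus>\<^bsub>RB.TP\<^esub>i\<in>{1..n}. RB.tens (x i) (FE.co (qq u) i))"
  using assms
proof (induction u rule: RB.TP_induct)
  case (tens z b)
  have "pq (RB.tens z b) = P.tens (fraction TS' D (\<phi> n z) \<one>\<^bsub>T\<^esub>) b"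
    using pq_tens[OF tens] by (simp add: to_\<R>_def)
  also have "\<dots> = pq (\<Oplus>\<^bsub>RB.TP\<^esub>i\<in>{1..n}. RB.tens (x i) (coeff (\<phi> n z) \<one>\<^bsub>T\<^esub> i \<otimes>\<^bsub>B\<^esub> b))"
    by (rule tens_expansion[OF phi_n_TS'[OF tens(1)] D_one tens(2)])
  also have "(\<Oplus>\<^bsub>RB.TP\<^esub>i\<in>{1..n}. RB.tens (x i) (coeff (\<phi> n z) \<one>\<^bsub>T\<^esub> i \<otimes>\<^bsub>B\<^esub> b))
      = (\<Oplus>\<^bsub>RB.TP\<^esub>i\<in>{1..n}. RB.tens (x i) (FE.co (qq (RB.tens z b)) i))"
  proof (rule RB.TP.finsum_cong_on)
    fix i assume i: "i \<in> {1..n}"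
    have fz: "f z \<in> carrier E" using tens by simp
    have "FE.co (qq (RB.tens z b)) i = FE.co (g b \<otimes>\<^bsub>E\<^esub> f z) i"
      using qq_tens[OF tens] tens fz by (simp add: FE.S.m_comm)
    also have "\<dots> = b \<otimes>\<^bsub>B\<^esub> FE.co (f z) i" by (rule FE.co_smult[OF tens(2) fz i])
    also have "\<dots> = coeff (\<phi> n z) \<one>\<^bsub>T\<^esub> i \<otimes>\<^bsub>B\<^esub> b"
      unfolding coeff_phi[OF tens(1) i] using tens(2) FE.co_closed[OF fz i] by (rule FE.R.m_comm)
    finally show "RB.tens (x i) (coeff (\<phi> n z) \<one>\<^bsub>T\<^esub> i \<otimes>\<^bsub>B\<^esub> b) = RB.tens (x i) (FE.co (qq (RB.tens z b)) i)"
      by (simp only:)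
    show "RB.tens (x i) (FE.co (qq (RB.tens z b)) i) \<in> carrier RB.TP"
      using i tens by (intro RB.tens_closed FE.co_closed qq.hom_closed) simp_all
  qed
  finally show ?case .
next
  case (add u v)
  let ?e = "\<lambda>u i. RB.tens (x i) (FE.co (qq u) i)"
  have ec: "?e w \<in> {1..n} \<rightarrow> carrier RB.TP" if "w \<in> carrier RB.TP" for w
    using that by (intro Pi_I RB.tens_closed FE.co_closed qq.hom_closed) simp_all
  have "(\<Oplus>\<^bsub>RB.TP\<^esub>i\<in>{1..n}. ?e (u \<oplus>\<^bsub>RB.TP\<^esub> v) i) = (\<Oplus>\<^bsub>RB.TP\<^esub>i\<in>{1..n}. ?e u i \<oplus>\<^bsub>RB.TP\<^esub> ?e v i)"
  proof (rule RB.TP.finsum_cong_on)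
    fix i assume i: "i \<in> {1..n}"
    show "?e (u \<oplus>\<^bsub>RB.TP\<^esub> v) i = ?e u i \<oplus>\<^bsub>RB.TP\<^esub> ?e v i"
      using i add(1,2) FE.co_add[OF qq.hom_closed qq.hom_closed i]
        RB.tens_add_right[OF x_mem[OF i] FE.co_closed[OF qq.hom_closed i] FE.co_closed[OF qq.hom_closed i]] by simp
    show "?e u i \<oplus>\<^bsub>RB.TP\<^esub> ?e v i \<in> carrier RB.TP"
      using funcset_mem[OF ec[OF add(1)] i] funcset_mem[OF ec[OF add(2)] i] by simp
  qed
  also have "\<dots> = (\<Oplus>\<^bsub>RB.TP\<^esub>i\<in>{1..n}. ?e u i) \<oplus>\<^bsub>RB.TP\<^esub> (\<Oplus>\<^bsub>RB.TP\<^esub>i\<in>{1..n}. ?e v i)"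
    using ec add(1,2) by (intro RB.TP.finsum_addf) blast+
  finally have e: "(\<Oplus>\<^bsub>RB.TP\<^esub>i\<in>{1..n}. ?e (u \<oplus>\<^bsub>RB.TP\<^esub> v) i) = \<dots>" .
  show ?case
    unfolding e pq.hom_add[OF add(1,2)]
      pq.hom_add[OF RB.TP.finsum_closed[OF ec[OF add(1)]] RB.TP.finsum_closed[OF ec[OF add(2)]]]
    using add(3,4) by (simp only:)
qed

lemma ker_qq_pq: "a_kernel RB.TP E qq \<subseteq> a_kernel RB.TP P.TP pq"
proof
  fix u assume "u \<in> a_kernel RB.TP E qq"
  then have u: "u \<in> carrier RB.TP" "qq u = \<zero>\<^bsub>E\<^esub>" unfolding a_kernel_def' by auto
  interpret r: ring_hom_cring R RB.TP "\<lambda>m. RB.tens m \<one>\<^bsub>B\<^esub>" by (rule RB.left_hom)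
  have z: "RB.tens (x i) \<zero>\<^bsub>B\<^esub> = \<zero>\<^bsub>RB.TP\<^esub>" if i: "i \<in> {1..n}" for i
  proof -
    have "RB.tens (x i) \<zero>\<^bsub>B\<^esub> \<oplus>\<^bsub>RB.TP\<^esub> RB.tens (x i) \<zero>\<^bsub>B\<^esub> = RB.tens (x i) \<zero>\<^bsub>B\<^esub> \<oplus>\<^bsub>RB.TP\<^esub> \<zero>\<^bsub>RB.TP\<^esub>"
      using RB.tens_add_right[OF x_mem[OF i] FE.R.zero_closed FE.R.zero_closed]
        RB.tens_closed[OF x_mem[OF i] FE.R.zero_closed] by simp
    then show ?thesis
      using RB.TP.add.l_cancel[OF _ RB.tens_closed[OF x_mem[OF i] FE.R.zero_closed] RB.TP.zero_closed]
        RB.tens_closed[OF x_mem[OF i] FE.R.zero_closed] by blast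
  qed
  have "(\<Oplus>\<^bsub>RB.TP\<^esub>i\<in>{1..n}. RB.tens (x i) (FE.co (qq u) i)) = (\<Oplus>\<^bsub>RB.TP\<^esub>i\<in>{1..n}. \<zero>\<^bsub>RB.TP\<^esub>)"
    using z FE.co_zero by (intro RB.TP.finsum_cong_on) (simp_all add: u(2))
  also have "\<dots> = \<zero>\<^bsub>RB.TP\<^esub>" by (rule RB.TP.finsum_zero)
  finally have "pq u = \<zero>\<^bsub>P.TP\<^esub>" using pq_eq[OF u(1)] pq.hom_zero by simp
  then show "u \<in> a_kernel RB.TP P.TP pq" using u(1) unfolding a_kernel_def' by blast
qed

text \<open>On fractions h is \<open>c\<close> of the numerator divided by \<open>c\<close> of the
  denominator, so semilinearity of \<open>l\<close> passes to the localization. It is the balancing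
  condition needed to define a functional on \<R> \<otimes> B.\<close>

lemma Lambda_smult:
  assumes "w \<in> carrier (\<A> x)" "r \<in> carrier (\<R> x)"
  shows "\<Lambda> (\<A>_to_\<R> x w \<otimes>\<^bsub>\<R> x\<^esub> r) = h w \<otimes>\<^bsub>B\<^esub> \<Lambda> r"
proof -
  interpret LS': multiplicative_set TS' D by (rule TS'_denominators)
  obtain a s where a: "a \<in> carrier TS" "s \<in> D" "w = fraction TS D a s" using assms(1) by (rule A_carrierE)
  obtain t d where t: "t \<in> carrier TS'" "d \<in> D" "r = fraction TS' D t d" using assms(2) by (rule R_carrierE)
  have a': "a \<in> carrier TS'" using a TS_subset_TS' by auto
  have at: "a \<otimes>\<^bsub>T\<^esub> t \<in> carrier TS'" using LS'.S.m_closed[OF a' t(1)] by (simp add: TS_ops)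
  have tT: "t \<in> carrier T" "a \<in> carrier T" using t(1) a(1) TS_closed by auto
  note us = c_D_unit[OF a(2)] and ud = c_D_unit[OF t(2)]
  have B: "c a \<in> carrier B" "l t \<in> carrier B" "c s \<in> carrier B" "c d \<in> carrier B"
    "inv\<^bsub>B\<^esub> (c s) \<in> carrier B" "inv\<^bsub>B\<^esub> (c d) \<in> carrier B"
    using tT l_closed us ud FE.R.Units_closed FE.R.Units_inv_closed by auto
  have "\<A>_to_\<R> x w \<otimes>\<^bsub>\<R> x\<^esub> r = fraction TS' D (a \<otimes>\<^bsub>T\<^esub> t) (s \<otimes>\<^bsub>T\<^esub> d)"
    unfolding a(3) t(3) A_to_R_frac[OF a(1,2)] \<R>_def using LS'.frac_mult[OF a' a(2) t(1,2)] by (simp add: TS_ops)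
  then have "\<Lambda> (\<A>_to_\<R> x w \<otimes>\<^bsub>\<R> x\<^esub> r) = inv\<^bsub>B\<^esub> (c (s \<otimes>\<^bsub>T\<^esub> d)) \<otimes>\<^bsub>B\<^esub> l (a \<otimes>\<^bsub>T\<^esub> t)"
    using Lambda_frac[OF at D_mult[OF a(2) t(2)]] by simp
  also have "c (s \<otimes>\<^bsub>T\<^esub> d) = c s \<otimes>\<^bsub>B\<^esub> c d"
    using c_mult[OF TS_closed(1)[OF D_TS[OF a(2)]] D_TS[OF t(2)]] .
  also have "l (a \<otimes>\<^bsub>T\<^esub> t) = c a \<otimes>\<^bsub>B\<^esub> l t" using l_mult[OF a(1) tT(1)] .
  also have "inv\<^bsub>B\<^esub> (c s \<otimes>\<^bsub>B\<^esub> c d) = inv\<^bsub>B\<^esub> (c s) \<otimes>\<^bsub>B\<^esub> inv\<^bsub>B\<^esub> (c d)"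
  proof (rule FE.R.comm_inv_char)
    have "(c s \<otimes>\<^bsub>B\<^esub> c d) \<otimes>\<^bsub>B\<^esub> (inv\<^bsub>B\<^esub> (c s) \<otimes>\<^bsub>B\<^esub> inv\<^bsub>B\<^esub> (c d)) = (c s \<otimes>\<^bsub>B\<^esub> inv\<^bsub>B\<^esub> (c s)) \<otimes>\<^bsub>B\<^esub> (c d \<otimes>\<^bsub>B\<^esub> inv\<^bsub>B\<^esub> (c d))"
      using B by (simp add: FE.R.m_ac)
    then show "(c s \<otimes>\<^bsub>B\<^esub> c d) \<otimes>\<^bsub>B\<^esub> (inv\<^bsub>B\<^esub> (c s) \<otimes>\<^bsub>B\<^esub> inv\<^bsub>B\<^esub> (c d)) = \<one>\<^bsub>B\<^esub>"
      using FE.R.Units_r_inv[OF us] FE.R.Units_r_inv[OF ud] by simp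
  qed (use B in auto)
  finally show ?thesis
    unfolding a(3) t(3) h_fraction[OF a(1,2)] Lambda_frac[OF t(1,2)] using B by (simp add: FE.R.m_ac)
qed

text \<open>An element of the kernel, and hence each of its multiples by x_j \<otimes> 1, has trace
  zero after applying \<open>qq\<close>. Its image in E is therefore orthogonal to the basis for the
  trace form, whose discriminant is a unit.\<close>

lemma ker_pq_qq: "a_kernel RB.TP P.TP pq \<subseteq> a_kernel RB.TP E qq"
proof
  fix u assume "u \<in> a_kernel RB.TP P.TP pq"
  then have u: "u \<in> carrier RB.TP" "pq u = \<zero>\<^bsub>P.TP\<^esub>" unfolding a_kernel_def' by auto
  \<comment> \<open>The B-linear extension of the trace functional to the base change.\<close>
  have "\<exists>H \<in> carrier P.TP \<rightarrow> carrier B. (\<forall>s\<in>carrier P.TP. \<forall>t\<in>carrier P.TP. H (s \<oplus>\<^bsub>P.TP\<^esub> t) = H s \<oplus>\<^bsub>B\<^esub> H t)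
    \<and> (\<forall>r\<in>carrier (\<R> x). \<forall>b\<in>carrier B. H (P.tens r b) = \<Lambda> r \<otimes>\<^bsub>B\<^esub> b)"
  proof (rule P.bilinear_lift[OF FE.R.is_cring])
    fix w r b assume a: "w \<in> carrier (\<A> x)" "r \<in> carrier (\<R> x)" "b \<in> carrier B"
    show "\<Lambda> (\<A>_to_\<R> x w \<otimes>\<^bsub>\<R> x\<^esub> r) \<otimes>\<^bsub>B\<^esub> b = \<Lambda> r \<otimes>\<^bsub>B\<^esub> (h w \<otimes>\<^bsub>B\<^esub> b)"
      unfolding Lambda_smult[OF a(1,2)] using Lambda_closed[OF a(2)] P.B.hom_closed[OF a(1)] a(3)
      by (simp add: FE.R.m_ac)
  qed (simp_all add: Lambda_closed Lambda_add FE.R.l_distr FE.R.r_distr)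
  then obtain H where H: "\<forall>s\<in>carrier P.TP. \<forall>t\<in>carrier P.TP. H (s \<oplus>\<^bsub>P.TP\<^esub> t) = H s \<oplus>\<^bsub>B\<^esub> H t"
    "\<forall>r\<in>carrier (\<R> x). \<forall>b\<in>carrier B. H (P.tens r b) = \<Lambda> r \<otimes>\<^bsub>B\<^esub> b"
    "H \<in> carrier P.TP \<rightarrow> carrier B" by blast
  have H0: "H \<zero>\<^bsub>P.TP\<^esub> = \<zero>\<^bsub>B\<^esub>"
  proof -
    have "H \<zero>\<^bsub>P.TP\<^esub> \<in> carrier B" using H(3) by auto
    moreover have "H \<zero>\<^bsub>P.TP\<^esub> \<oplus>\<^bsub>B\<^esub> H \<zero>\<^bsub>P.TP\<^esub> = H \<zero>\<^bsub>P.TP\<^esub> \<oplus>\<^bsub>B\<^esub> \<zero>\<^bsub>B\<^esub>"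
      using bspec[OF bspec[OF H(1)], of "\<zero>\<^bsub>P.TP\<^esub>" "\<zero>\<^bsub>P.TP\<^esub>"] calculation by simp
    ultimately show ?thesis using FE.R.add.l_cancel by simp
  qed
  \<comment> \<open>Through H the multiplication on R \<otimes> B becomes the trace pairing on
    E.\<close>
  have Hp: "H (pq (v \<otimes>\<^bsub>RB.TP\<^esub> RB.tens y \<one>\<^bsub>B\<^esub>)) = FE.tr (qq v \<otimes>\<^bsub>E\<^esub> f y)"
    if y: "y \<in> carrier R" and "v \<in> carrier RB.TP" for v y
    using that(2)
  proof (induction v rule: RB.TP_induct)
    case (tens z b)
    have zy: "z \<otimes>\<^bsub>R\<^esub> y \<in> carrier R" using tens y by simp
    have fc: "f z \<in> carrier E" "f y \<in> carrier E" "g b \<in> carrier E" using tens y by simp_all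
    have "RB.tens z b \<otimes>\<^bsub>RB.TP\<^esub> RB.tens y \<one>\<^bsub>B\<^esub> = RB.tens (z \<otimes>\<^bsub>R\<^esub> y) b"
      using RB.tens_mult[OF tens y FE.R.one_closed] tens(2) by simp
    then have "H (pq (RB.tens z b \<otimes>\<^bsub>RB.TP\<^esub> RB.tens y \<one>\<^bsub>B\<^esub>)) = \<Lambda> (to_\<R> x (\<phi> n (z \<otimes>\<^bsub>R\<^esub> y))) \<otimes>\<^bsub>B\<^esub> b"
      using pq_tens[OF zy tens(2)] H(2) to_R_phi_closed[OF zy] tens(2) by simp
    also have "\<Lambda> (to_\<R> x (\<phi> n (z \<otimes>\<^bsub>R\<^esub> y))) = FE.tr (f (z \<otimes>\<^bsub>R\<^esub> y))"
      unfolding to_\<R>_def Lambda_frac[OF phi_n_TS'[OF zy] D_one] l_phi[OF zy] c_one using zy by simp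
    also have "FE.tr (f (z \<otimes>\<^bsub>R\<^esub> y)) \<otimes>\<^bsub>B\<^esub> b = FE.tr (g b \<otimes>\<^bsub>E\<^esub> f (z \<otimes>\<^bsub>R\<^esub> y))"
    proof -
      have "FE.tr (g b \<otimes>\<^bsub>E\<^esub> f (z \<otimes>\<^bsub>R\<^esub> y)) = (\<Oplus>\<^bsub>B\<^esub>i\<in>{1..n}. FE.co (f (z \<otimes>\<^bsub>R\<^esub> y) \<otimes>\<^bsub>E\<^esub> f (x i)) i \<otimes>\<^bsub>B\<^esub> b)"
        unfolding FE.tr_def using zy tens(2) FE.S.m_assoc
        by (intro FE.R.finsum_cong_on) (simp_all add: FE.co_smult FE.co_closed FE.R.m_comm del: f_simps(2))
      also have "\<dots> = FE.tr (f (z \<otimes>\<^bsub>R\<^esub> y)) \<otimes>\<^bsub>B\<^esub> b"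
        unfolding FE.tr_def using zy tens(2) by (intro FE.R.finsum_rmult[symmetric]) (simp_all add: FE.co_closed)
      finally show ?thesis ..
    qed
    also have "g b \<otimes>\<^bsub>E\<^esub> f (z \<otimes>\<^bsub>R\<^esub> y) = qq (RB.tens z b) \<otimes>\<^bsub>E\<^esub> f y"
      using qq_tens[OF tens] tens y fc by (simp add: FE.S.m_ac)
    finally show ?case .
  next
    case (add v w)
    have yc: "RB.tens y \<one>\<^bsub>B\<^esub> \<in> carrier RB.TP" using y by simp
    have fy: "f y \<in> carrier E" using y by simp
    have "H (pq ((v \<oplus>\<^bsub>RB.TP\<^esub> w) \<otimes>\<^bsub>RB.TP\<^esub> RB.tens y \<one>\<^bsub>B\<^esub>)) = FE.tr (qq v \<otimes>\<^bsub>E\<^esub> f y) \<oplus>\<^bsub>B\<^esub> FE.tr (qq w \<otimes>\<^bsub>E\<^esub> f y)"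
      using add yc H(1) pq.hom_closed[OF RB.TP.m_closed[OF add(1) yc]] pq.hom_closed[OF RB.TP.m_closed[OF add(2) yc]]
        pq.hom_add[OF RB.TP.m_closed[OF add(1) yc] RB.TP.m_closed[OF add(2) yc]]
      by (simp only: RB.TP.l_distr)
    also have "\<dots> = FE.tr (qq (v \<oplus>\<^bsub>RB.TP\<^esub> w) \<otimes>\<^bsub>E\<^esub> f y)"
    proof -
      have q: "qq v \<otimes>\<^bsub>E\<^esub> f y \<in> carrier E" "qq w \<otimes>\<^bsub>E\<^esub> f y \<in> carrier E" using add(1,2) fy by simp_all
      have "FE.tr (qq v \<otimes>\<^bsub>E\<^esub> f y \<oplus>\<^bsub>E\<^esub> qq w \<otimes>\<^bsub>E\<^esub> f y)
          = (\<Oplus>\<^bsub>B\<^esub>i\<in>{1..n}. FE.co (qq v \<otimes>\<^bsub>E\<^esub> f y \<otimes>\<^bsub>E\<^esub> f (x i)) i \<oplus>\<^bsub>B\<^esub> FE.co (qq w \<otimes>\<^bsub>E\<^esub> f y \<otimes>\<^bsub>E\<^esub> f (x i)) i)"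
        unfolding FE.tr_def using q
        by (intro FE.R.finsum_cong_on) (simp_all add: FE.S.l_distr FE.co_add FE.co_closed)
      also have "\<dots> = FE.tr (qq v \<otimes>\<^bsub>E\<^esub> f y) \<oplus>\<^bsub>B\<^esub> FE.tr (qq w \<otimes>\<^bsub>E\<^esub> f y)"
        unfolding FE.tr_def using q by (intro FE.R.finsum_addf) (simp_all add: FE.co_closed Pi_iff)
      finally show ?thesis using add(1,2) fy by (simp add: FE.S.l_distr)
    qed
    finally show ?case .
  qed
  have qc: "qq u \<in> carrier E" using u(1) by simp
  have zero: "FE.tr (qq u \<otimes>\<^bsub>E\<^esub> f (x j)) = \<zero>\<^bsub>B\<^esub>" if j: "j \<in> {1..n}" for j
  proof -
    have "pq (u \<otimes>\<^bsub>RB.TP\<^esub> RB.tens (x j) \<one>\<^bsub>B\<^esub>) = \<zero>\<^bsub>P.TP\<^esub>"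
      using pq.hom_mult[OF u(1) RB.tens_closed[OF x_mem[OF j] FE.R.one_closed]] u(2)
        pq.hom_closed[OF RB.tens_closed[OF x_mem[OF j] FE.R.one_closed]] by simp
    then show ?thesis using Hp[OF x_mem[OF j] u(1)] H0 by simp
  qed
  \<comment> \<open>Orthogonality to f(x_j), rewritten as row j of the trace matrix applied to the
    coordinate vector.\<close>
  have ker: "(\<Oplus>\<^bsub>B\<^esub>i\<in>{1..n}. FE.tr (f (x j) \<otimes>\<^bsub>E\<^esub> f (x i)) \<otimes>\<^bsub>B\<^esub> FE.co (qq u) i) = \<zero>\<^bsub>B\<^esub>" if j: "j \<in> {1..n}" for j
  proof -
    have fj: "f (x j) \<in> carrier E" using j by simp
    have "FE.tr (qq u \<otimes>\<^bsub>E\<^esub> f (x j)) = (\<Oplus>\<^bsub>B\<^esub>k\<in>{1..n}. \<Oplus>\<^bsub>B\<^esub>i\<in>{1..n}. FE.co (f (x j) \<otimes>\<^bsub>E\<^esub> f (x i) \<otimes>\<^bsub>E\<^esub> f (x k)) k \<otimes>\<^bsub>B\<^esub> FE.co (qq u) i)"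
      unfolding FE.tr_def
    proof (rule FE.R.finsum_cong_on)
      fix k assume k: "k \<in> {1..n}"
      have "FE.co (qq u \<otimes>\<^bsub>E\<^esub> f (x j) \<otimes>\<^bsub>E\<^esub> f (x k)) k = FE.co ((f (x j) \<otimes>\<^bsub>E\<^esub> f (x k)) \<otimes>\<^bsub>E\<^esub> qq u) k"
        using qc fj k by (simp add: FE.S.m_ac)
      also have "\<dots> = (\<Oplus>\<^bsub>B\<^esub>i\<in>{1..n}. FE.co (qq u) i \<otimes>\<^bsub>B\<^esub> FE.co (f (x j) \<otimes>\<^bsub>E\<^esub> f (x k) \<otimes>\<^bsub>E\<^esub> f (x i)) k)"
        using qc fj k by (intro FE.co_mult) simp_all
      also have "\<dots> = (\<Oplus>\<^bsub>B\<^esub>i\<in>{1..n}. FE.co (f (x j) \<otimes>\<^bsub>E\<^esub> f (x i) \<otimes>\<^bsub>E\<^esub> f (x k)) k \<otimes>\<^bsub>B\<^esub> FE.co (qq u) i)"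
      proof (rule FE.R.finsum_cong_on)
        fix i assume i: "i \<in> {1..n}"
        have "f (x j) \<otimes>\<^bsub>E\<^esub> f (x k) \<otimes>\<^bsub>E\<^esub> f (x i) = f (x j) \<otimes>\<^bsub>E\<^esub> f (x i) \<otimes>\<^bsub>E\<^esub> f (x k)"
          using i j k by (simp add: FE.S.m_ac)
        then show "FE.co (qq u) i \<otimes>\<^bsub>B\<^esub> FE.co (f (x j) \<otimes>\<^bsub>E\<^esub> f (x k) \<otimes>\<^bsub>E\<^esub> f (x i)) k
            = FE.co (f (x j) \<otimes>\<^bsub>E\<^esub> f (x i) \<otimes>\<^bsub>E\<^esub> f (x k)) k \<otimes>\<^bsub>B\<^esub> FE.co (qq u) i"
          using i j k qc by (simp add: FE.R.m_comm FE.co_closed)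
        show "FE.co (f (x j) \<otimes>\<^bsub>E\<^esub> f (x i) \<otimes>\<^bsub>E\<^esub> f (x k)) k \<otimes>\<^bsub>B\<^esub> FE.co (qq u) i \<in> carrier B"
          using i j k qc by (simp add: FE.co_closed)
      qed
      finally show "FE.co (qq u \<otimes>\<^bsub>E\<^esub> f (x j) \<otimes>\<^bsub>E\<^esub> f (x k)) k
          = (\<Oplus>\<^bsub>B\<^esub>i\<in>{1..n}. FE.co (f (x j) \<otimes>\<^bsub>E\<^esub> f (x i) \<otimes>\<^bsub>E\<^esub> f (x k)) k \<otimes>\<^bsub>B\<^esub> FE.co (qq u) i)" .
      show "(\<Oplus>\<^bsub>B\<^esub>i\<in>{1..n}. FE.co (f (x j) \<otimes>\<^bsub>E\<^esub> f (x i) \<otimes>\<^bsub>E\<^esub> f (x k)) k \<otimes>\<^bsub>B\<^esub> FE.co (qq u) i) \<in> carrier B"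
        using j k qc by (intro FE.R.finsum_closed Pi_I) (simp add: FE.co_closed)
    qed
    also have "\<dots> = (\<Oplus>\<^bsub>B\<^esub>i\<in>{1..n}. \<Oplus>\<^bsub>B\<^esub>k\<in>{1..n}. FE.co (f (x j) \<otimes>\<^bsub>E\<^esub> f (x i) \<otimes>\<^bsub>E\<^esub> f (x k)) k \<otimes>\<^bsub>B\<^esub> FE.co (qq u) i)"
      using j qc by (intro FE.R.finsum_fubini) (simp_all add: FE.co_closed)
    also have "\<dots> = (\<Oplus>\<^bsub>B\<^esub>i\<in>{1..n}. FE.tr (f (x j) \<otimes>\<^bsub>E\<^esub> f (x i)) \<otimes>\<^bsub>B\<^esub> FE.co (qq u) i)"
    proof (rule FE.R.finsum_cong_on)
      fix i assume i: "i \<in> {1..n}"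
      show "(\<Oplus>\<^bsub>B\<^esub>k\<in>{1..n}. FE.co (f (x j) \<otimes>\<^bsub>E\<^esub> f (x i) \<otimes>\<^bsub>E\<^esub> f (x k)) k \<otimes>\<^bsub>B\<^esub> FE.co (qq u) i)
          = FE.tr (f (x j) \<otimes>\<^bsub>E\<^esub> f (x i)) \<otimes>\<^bsub>B\<^esub> FE.co (qq u) i"
        unfolding FE.tr_def using i j qc by (intro FE.R.finsum_rmult[symmetric]) (simp_all add: FE.co_closed)
      show "FE.tr (f (x j) \<otimes>\<^bsub>E\<^esub> f (x i)) \<otimes>\<^bsub>B\<^esub> FE.co (qq u) i \<in> carrier B"
        using i j qc by (simp add: FE.co_closed)
    qed
    finally show ?thesis using zero[OF j] by simp
  qed
  have "FE.co (qq u) i = \<zero>\<^bsub>B\<^esub>" if i: "i \<in> {1..n}" for i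
  proof -
    have k: "FE.co (qq u) i \<in> carrier B" using FE.co_closed[OF qc i] .
    \<comment> \<open>The determinant of the trace matrix annihilates each coordinate, and it is a
      unit.\<close>
    have "FE.trace_form \<otimes>\<^bsub>B\<^esub> FE.co (qq u) i = \<zero>\<^bsub>B\<^esub>"
      unfolding FE.trace_form_def using ker qc i
      by (intro FE.R.det_annihilates_kernel) (simp_all add: FE.co_closed)
    also have "\<zero>\<^bsub>B\<^esub> = FE.trace_form \<otimes>\<^bsub>B\<^esub> \<zero>\<^bsub>B\<^esub>" using FE.R.Units_closed[OF trace_unit] by simp
    finally show ?thesis using FE.R.Units_l_cancel[OF trace_unit k FE.R.zero_closed] by simp
  qed
  then have "qq u = \<zero>\<^bsub>E\<^esub>" using qc FE.co_zero by (intro FE.co_eqI) simp_all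
  then show "u \<in> a_kernel RB.TP E qq" using u(1) unfolding a_kernel_def' by blast
qed

lemma base_change: "base_change_is x B iB E g f h"
  unfolding base_change_iff equal_quotients_def
  using pq.homh pq_surj qq.homh qq_surj ker_pq_qq ker_qq_pq by blast

end

lemma base_change_power_sum:
  assumes "base_change_is x B iB E g f h" "z \<in> carrier R"
  shows "h (to_\<A> x (\<pp> z)) = FE.tr (f z)"
  using assms(1) unfolding base_change_iff equal_quotients_def by (intro hom_power_sum assms(2)) blast

end

theorem theorem3p11:
  fixes A :: "'a ring" and R :: "'r ring" and B :: "'b ring" and E :: "'e ring"
    and iR :: "'a \<Rightarrow> 'r" and iB :: "'a \<Rightarrow> 'b" and iE :: "'a \<Rightarrow> 'e"
    and n :: nat and x :: "nat \<Rightarrow> 'r" and g :: "'b \<Rightarrow> 'e" and f :: "'r \<Rightarrow> 'e"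
  assumes "ring_hom_cring A R iR"
    and "ring_hom_cring A B iB"
    and "ring_hom_cring A E iE"
    and "n \<ge> 1"
    and "x \<in> {1..n} \<rightarrow> carrier R"
    and "g \<in> alg_hom A B iB E iE"
    and "etale B E g"
    and "f \<in> alg_hom A R iR E iE"
    and "module_basis B (alg_module E g) n (\<lambda>i. f (x i))"
  shows
    "let \<A> = tensor_power.\<A> A R iR n x;
         \<pp> = (\<lambda>z. tensor_power.to_\<A> A R iR n x (tensor_power.\<pp> A R iR n z));
         Homs = alg_hom A \<A> (tensor_power.\<A>_map A R iR n x) B iB \<inter> extensional (carrier \<A>);
         same_quotient = tensor_power.base_change_is A R iR n x B iB E g f;
         Tr = (\<lambda>z. module_trace B (alg_module E g) (\<lambda>e. f z \<otimes>\<^bsub>E\<^esub> e))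
     in (\<exists>!h. h \<in> Homs \<and> same_quotient h) \<and>
        (\<forall>h \<in> Homs. same_quotient h \<longrightarrow>
           (\<forall>z \<in> carrier R. h (\<pp> z) = Tr z) \<and>
           (\<forall>h' \<in> Homs. (\<forall>z \<in> carrier R. h' (\<pp> z) = Tr z) \<longrightarrow> h' = h))"
proof -
  have g: "ring_hom_cring B E g" using assms(7) by (simp add: etale_def)
  have f: "ring_hom_cring R E f"
  proof -
    interpret r: ring_hom_cring A R iR by fact
    interpret e: ring_hom_cring A E iE by fact
    show ?thesis
      using assms(8) unfolding alg_hom_def
      by (intro ring_hom_cringI[OF r.S.is_cring e.S.is_cring] ring_hom_ringI2 r.S.ring_axioms e.S.ring_axioms) blast
  qed
  have "unramified_free_algebra B E g n (\<lambda>i. f (x i))"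
    using assms(7,9) g unfolding etale_def
    by (intro unramified_free_algebra.intro finite_free_algebra.intro finite_free_algebra_axioms.intro
        unramified_free_algebra_axioms.intro) blast+
  \<comment> \<open>Invertibility of the discriminant is the form in which etaleness is passed on to
    the norm construction.\<close>
  then have unit: "finite_free_algebra.trace_form B E g n (\<lambda>i. f (x i)) \<in> Units B"
    by (rule unramified_free_algebra.trace_form_unit)
  interpret N: norm_setting A R iR n B E g f x iB
  proof (intro norm_setting.intro norm_setting_axioms.intro)
    show "algebra_power A R iR n"
      using assms(1,4) by (intro algebra_power.intro algebra_power_axioms.intro)
    show "finite_free_algebra B E g n (\<lambda>i. f (x i))"
      using assms(9) g by (intro finite_free_algebra.intro finite_free_algebra_axioms.intro)
    show "g (iB a) = f (iR a)" if "a \<in> carrier A" for a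
      using assms(6,8) that unfolding alg_hom_def by simp
  qed (fact assms(2) f assms(5) unit)+
  let ?A = "N.\<A> x" and ?p = "\<lambda>z. N.to_\<A> x (N.\<pp> z)"
  let ?Homs = "alg_hom A ?A (N.\<A>_map x) B iB \<inter> extensional (carrier ?A)"
  let ?Tr = "\<lambda>z. module_trace B (alg_module E g) (\<lambda>e. f z \<otimes>\<^bsub>E\<^esub> e)"
  have Tr: "?Tr z = N.FE.tr (f z)" if "z \<in> carrier R" for z
    using that by (intro N.FE.module_trace_eq) simp
  have norm_hom: "norm_hom A R iR n B E g f x iB h" if "h \<in> ?Homs" for h
  proof -
    interpret AA: cring ?A by (rule N.A_cring)
    have "ring_hom_cring ?A B h"
      using that unfolding alg_hom_def
      by (intro ring_hom_cringI[OF N.A_cring N.FE.R.is_cring] ring_hom_ringI2 AA.ring_axioms N.FE.R.ring_axioms) blast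
    then show ?thesis
      using that unfolding alg_hom_def
      by (intro norm_hom.intro norm_hom_axioms.intro N.norm_setting_axioms) simp_all
  qed
  have trace: "h (?p z) = ?Tr z" if "h \<in> ?Homs" "N.base_change_is x B iB E g f h" "z \<in> carrier R" for h z
    using norm_hom.base_change_power_sum[OF norm_hom[OF that(1)] that(2,3)] Tr[OF that(3)] by simp
  \<comment> \<open>Both maps are extensional, so agreement on the carrier of \<A> is equality of
    functions.\<close>
  have determined: "h = h'" if h: "h \<in> ?Homs" and h': "h' \<in> ?Homs"
    and e: "\<And>z. z \<in> carrier R \<Longrightarrow> h (?p z) = ?Tr z" "\<And>z. z \<in> carrier R \<Longrightarrow> h' (?p z) = ?Tr z" for h h'
  proof (rule extensionalityI[of _ "carrier ?A"])
    show "h \<in> extensional (carrier ?A)" "h' \<in> extensional (carrier ?A)" using h h' by auto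
    show "h z = h' z" if "z \<in> carrier ?A" for z
    proof (rule N.hom_determined_by_power_sums[OF norm_hom.h_hom[OF norm_hom[OF h]]
          norm_hom.h_hom[OF norm_hom[OF h']] _ that])
      show "h (?p y) = h' (?p y)" if "y \<in> carrier R" for y
        by (rule trans[OF e(1)[OF that] e(2)[OF that, symmetric]])
    qed
  qed
  obtain H where H: "ring_hom_cring ?A B H" "\<And>t. t \<in> carrier N.TS \<Longrightarrow> H (N.to_\<A> x t) = N.c t"
    using N.norm_hom_exists by blast
  \<comment> \<open>Restriction makes the homomorphism extensional, as the set of candidates
    demands; its values on \<A> are unchanged.\<close>
  define h where "h = restrict H (carrier ?A)"
  interpret AA: cring ?A by (rule N.A_cring)
  have to: "N.to_\<A> x t \<in> carrier ?A" if "t \<in> carrier N.TS" for t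
    unfolding N.to_\<A>_def using that N.D_one by (rule N.fraction_closed(1))
  have hc: "h (N.to_\<A> x t) = N.c t" if "t \<in> carrier N.TS" for t
    using H(2)[OF that] to[OF that] by (simp add: h_def)
  have "h \<in> ring_hom ?A B"
    using AA.ring_hom_restrict[OF ring_hom_cring.homh[OF H(1)], of h] by (simp add: h_def)
  moreover have "h (N.\<A>_map x a) = iB a" if "a \<in> carrier A" for a
    using hc[OF N.T_map_TS[OF that]] N.c_T_map[OF that] by (simp add: N.\<A>_map_def)
  ultimately have hH: "h \<in> ?Homs" by (simp add: alg_hom_def h_def)
  have hq: "N.base_change_is x B iB E g f h"
    by (rule norm_hom.base_change[OF norm_hom[OF hH] hc])
  have "\<exists>!h. h \<in> ?Homs \<and> N.base_change_is x B iB E g f h"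
  proof (rule ex1I[of _ h])
    show "h \<in> ?Homs \<and> N.base_change_is x B iB E g f h" using hH hq by blast
    show "h' = h" if h': "h' \<in> ?Homs \<and> N.base_change_is x B iB E g f h'" for h'
      \<comment> \<open>Any solution has the prescribed traces at the power sums, as does the
        constructed one, so uniqueness reduces to determination by power sums.\<close>
      by (rule determined[OF conjunct1[OF h'] hH trace[OF conjunct1[OF h'] conjunct2[OF h']] trace[OF hH hq]])
  qed
  moreover have "\<forall>h \<in> ?Homs. N.base_change_is x B iB E g f h \<longrightarrow>
      (\<forall>z \<in> carrier R. h (?p z) = ?Tr z) \<and> (\<forall>h' \<in> ?Homs. (\<forall>z \<in> carrier R. h' (?p z) = ?Tr z) \<longrightarrow> h' = h)"
  proof (intro ballI impI conjI)
    fix h z assume "h \<in> ?Homs" "N.base_change_is x B iB E g f h" "z \<in> carrier R"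
    then show "h (?p z) = ?Tr z" by (rule trace)
  next
    fix h h' assume h: "h \<in> ?Homs" "N.base_change_is x B iB E g f h"
      and h': "h' \<in> ?Homs" "\<forall>z \<in> carrier R. h' (?p z) = ?Tr z"
    show "h' = h" by (rule determined[OF h'(1) h(1) bspec[OF h'(2)] trace[OF h]])
  qed
  ultimately show ?thesis unfolding Let_def by (rule conjI)
qed

end
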